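(* Let $G$ be a compact connected semisimple Lie group and let $\eta\in\mathfrak g^*$ be such that $G_\eta$ is a maximal torus, the coadjoint orbit $\mathcal O_\eta$ is quantizable, and $-2\pi i\eta$ is a dominant weight for the maximal torus $G_\eta$. Let $\{A_t\}_{t\in[0,1]}$ be a curve in $\mathfrak g$ such that the Hamiltonian isotopy $\{\psi_t\}_{t\in[0,1]}$ of $\mathcal O_\eta$ generated by the vector fields $X_{A_t}$ is closed, i.e. $\frac{d\psi_t(q)}{dt}=X_{A_t}(\psi_t(q))$ and $\psi_0=\psi_1=\mathrm{id}$. Then $$\kappa(\psi)=\frac{\chi(\pi^* )(h_1)}{\dim\pi},$$ where $h_t\in G$ is the solution to $\dot h_th_t^{-1}=A_t$, $h_0=e$, $\pi$ is the irreducible representation of $G$ whose highest weight is $-2\pi i\eta$, $\pi^*$ is its dual (contragredient) representation, and $\chi(\pi^* )$ is the character of $\pi^*$.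
   Context: Curves are smooth. **Coadjoint orbit.** $G$ acts on $\mathfrak g^*$ by $(g\cdot\nu)(A)=\nu(g^{-1}\cdot A)$, where $g\cdot A=\mathrm{Ad}_gA$. For $A\in\mathfrak g$, $X_A(\nu)=\frac{d}{du}\big|_{u=0}e^{uA}\cdot\nu$. $G_\eta$ is the isotropy subgroup of $\eta$, with Lie algebra $\mathfrak g_\eta$, and $\mathcal O=\mathcal O_\eta=G\cdot\eta\cong G/G_\eta$. The symplectic form is $\omega_\nu(X_A(\nu),X_B(\nu))=\nu([A,B])$. Put $h_A(\nu)=\nu(A)$, so $\iota_{X_A}\omega=dh_A$; the Hamiltonian of $X_A$ is $f_A=-h_A$. **Quantizability and weights.** Quantizable means that there is a character $\Lambda:G_\eta\to U(1)$ whose derivative is $\lambda:C\in\mathfrak g_\eta\mapsto 2\pi i\,\eta(C)$. Write $T=G_\eta$, $\mathfrak h=\mathfrak t\otimes\mathbb C$, let $\mathfrak g_{\mathbb C}=\mathfrak h\oplus\sum\mathfrak g_\alpha$ be the root decomposition, $P$ a fixed set of positive roots, and $\alpha^\vee\in[\mathfrak g_\alpha,\mathfrak g_{-\alpha}]$ the coroot with $\alpha(\alpha^\vee)=2$. The functional $\eta$ is extended complex-linearly to $\mathfrak g_{\mathbb C}$. That $-2\pi i\eta=-\lambda$ is a dominant weight means $\lambda(\alpha^\vee)\le 0$ for every $\alpha\in P$; highest weights are taken with respect to $P$. **Prequantum bundle.** $L=G\times_\Lambda\mathbb C=(G\times\mathbb C)/\simeq$ with $(g,z)\simeq(gb^{-1},\Lambda(b)z)$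 for $b\in G_\eta$, and projection $p:L\to\mathcal O$. Let $L^\times=L\setminus\{\text{zero section}\}$. A tangent vector of $L^\times$ at $[g,z]$ is written $[Y,x]$ if it is the velocity at $u=0$ of a curve $[g_u,ze^{ux}]$ with $g_0=g$, $\dot g_0=Y\in T_gG$, $x\in\mathbb C$. The connection form on $L^\times$ is $\Omega([Y,x])=\theta(Y)+(2\pi i)^{-1}x$, where $\theta$ is the left-invariant $1$-form on $G$ with $\theta_e=\eta$. For a section $\sigma$ of $L$ let $\sigma^\sharp:L^\times\to\mathbb C$ be given by $\sigma(p(y))=\sigma^\sharp(y)\,y$. The covariant derivative $D$ is defined by $(D_Y\sigma)^\sharp=Y^\sharp(\sigma^\sharp)$, where $Y^\sharp$ is the lift of $Y$ with $\Omega(Y^\sharp)=0$; its curvature is $-2\pi i\omega$. **The invariant $\kappa(\psi)$.** For $A\in\mathfrak g$ let $\mathcal P_A=-D_{X_A}+2\pi i h_A$, acting on $C^\infty(L)$. For $\sigma\in C^\infty(L)$ let $\sigma_t$ solve $\frac{d\sigma_t}{dt}=\mathcal P_{A_t}(\sigma_t)$, $\sigma_0=\sigma$. It is known that, $\psi$ being closed, there is a constant $\kappa(\psi)\in U(1)$ with $\sigma_1=\kappa(\psi)\sigma$ for every $\sigma\in C^\infty(L)$, and that $\kappa(\psi)=\exp(2\pi i\,\mathfrak A_\psi(q))$ for any $q\in\mathcal O$, where $$\mathfrak A_\psi(q)=\int_S\omega-\int_0^1 f_{A_t}(\psi_t(q))\,dt+\mathbb Z\in\mathbb R/\mathbb Z$$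 is the action integral along $\psi$, $S$ being any $2$-surface whose boundary is the closed curve $\{\psi_t(q)\}_{t\in[0,1]}$. *)

theory Defs
  imports "HOL-Analysis.Analysis" "HOL-Algebra.Product_Groups"
begin

section \<open>Smooth maps and manifolds\<close>

text \<open>Only used for open \<^term>\<open>S\<close>.\<close>

primrec higher_differentiable_on ::
    "nat \<Rightarrow> 'a::real_normed_vector set \<Rightarrow> ('a \<Rightarrow> 'b::real_normed_vector) \<Rightarrow> bool" where
  "higher_differentiable_on 0 S f \<longleftrightarrow> continuous_on S f"
| "higher_differentiable_on (Suc n) S f \<longleftrightarrow> (\<forall>x\<in>S. f differentiable (at x)) \<and>
     (\<forall>v. higher_differentiable_on n S (\<lambda>x. frechet_derivative f (at x) v))"

definition smooth_on :: "'a::real_normed_vector set \<Rightarrow> ('a \<Rightarrow> 'b::real_normed_vector) \<Rightarrow> bool" where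
  "smooth_on S f \<longleftrightarrow> (\<forall>n. higher_differentiable_on n S f)"

text \<open>A chart is a pair of its domain and its coordinate map; the values of the coordinate map
  outside the domain are irrelevant.\<close>

type_synonym ('m, 'v) atlas = "('m set \<times> ('m \<Rightarrow> 'v)) set"

definition smooth_atlas :: "'m set \<Rightarrow> ('m, 'v::real_normed_vector) atlas \<Rightarrow> bool" where
  "smooth_atlas M \<A> \<longleftrightarrow> \<Union>(fst ` \<A>) = M \<and>
     (\<forall>(U, \<phi>)\<in>\<A>. inj_on \<phi> U \<and> open (\<phi> ` U)) \<and>
     (\<forall>(U, \<phi>)\<in>\<A>. \<forall>(V, \<psi>)\<in>\<A>.
        open (\<phi> ` (U \<inter> V)) \<and> smooth_on (\<phi> ` (U \<inter> V)) (\<lambda>x. \<psi> (inv_into U \<phi> x)))"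

definition manifold_topology :: "('m, 'v::real_normed_vector) atlas \<Rightarrow> 'm topology" where
  "manifold_topology \<A> =
     topology (\<lambda>W. W \<subseteq> \<Union>(fst ` \<A>) \<and> (\<forall>(U, \<phi>)\<in>\<A>. open (\<phi> ` (U \<inter> W))))"

lemma openin_manifold_topology:
  assumes "smooth_atlas M \<A>"
  shows "openin (manifold_topology \<A>) W \<longleftrightarrow> W \<subseteq> M \<and> (\<forall>(U, \<phi>)\<in>\<A>. open (\<phi> ` (U \<inter> W)))"
proof -
  let ?P = "\<lambda>W. W \<subseteq> \<Union>(fst ` \<A>) \<and> (\<forall>(U, \<phi>)\<in>\<A>. open (\<phi> ` (U \<inter> W)))"
  have "istopology ?P"
    unfolding istopology_def
  proof (intro conjI allI impI)
    fix S T assume S: "?P S" and T: "?P T"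
    have "open (\<phi> ` (U \<inter> (S \<inter> T)))" if "(U, \<phi>) \<in> \<A>" for U \<phi>
    proof -
      have inj: "inj_on \<phi> U"
        using that assms by (auto simp: smooth_atlas_def)
      have "\<phi> ` (U \<inter> (S \<inter> T)) = \<phi> ` (U \<inter> S) \<inter> \<phi> ` (U \<inter> T)"
        using inj by (auto simp: inj_on_def)
      then show ?thesis using S T that by auto
    qed
    moreover have "S \<inter> T \<subseteq> \<Union>(fst ` \<A>)" using S by auto
    ultimately show "S \<inter> T \<subseteq> \<Union>(fst ` \<A>)" "\<forall>(U, \<phi>)\<in>\<A>. open (\<phi> ` (U \<inter> (S \<inter> T)))"
      by auto
  next
    fix K assume K: "\<forall>S\<in>K. ?P S"
    show "\<Union>K \<subseteq> \<Union>(fst ` \<A>)" using K by blast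
    have "open (\<phi> ` (U \<inter> \<Union>K))" if "(U, \<phi>) \<in> \<A>" for U \<phi>
    proof -
      have "\<phi> ` (U \<inter> \<Union>K) = (\<Union>S\<in>K. \<phi> ` (U \<inter> S))" by auto
      moreover have "open (\<phi> ` (U \<inter> S))" if "S \<in> K" for S
        using K that \<open>(U, \<phi>) \<in> \<A>\<close> by blast
      ultimately show ?thesis by auto
    qed
    then show "\<forall>(U, \<phi>)\<in>\<A>. open (\<phi> ` (U \<inter> \<Union>K))" by auto
  qed
  moreover have "\<Union>(fst ` \<A>) = M" using assms by (simp add: smooth_atlas_def)
  ultimately show ?thesis by (simp add: manifold_topology_def)
qed

definition prod_atlas :: "('m, 'v) atlas \<Rightarrow> ('n, 'w) atlas \<Rightarrow> ('m \<times> 'n, 'v \<times> 'w) atlas" where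
  "prod_atlas \<A> \<B> = {(U \<times> V, map_prod \<phi> \<psi>) |U \<phi> V \<psi>. (U, \<phi>) \<in> \<A> \<and> (V, \<psi>) \<in> \<B>}"

definition vec_atlas :: "('v, 'v) atlas" where
  "vec_atlas = {(UNIV, id)}"

text \<open>Smoothness of a map on an arbitrary subset \<^term>\<open>S\<close> of a manifold: near each point
  of \<^term>\<open>S\<close> the map is, in charts, the restriction of a smooth map \<^term>\<open>F\<close> defined on an
  open set \<^term>\<open>N\<close>.\<close>

definition manifold_smooth_on ::
    "('m, 'v::real_normed_vector) atlas \<Rightarrow> ('n, 'w::real_normed_vector) atlas
      \<Rightarrow> 'm set \<Rightarrow> ('m \<Rightarrow> 'n) \<Rightarrow> bool" where
  "manifold_smooth_on \<A> \<B> S f \<longleftrightarrow>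
     (\<forall>x\<in>S. \<exists>(U, \<phi>)\<in>\<A>. \<exists>(V, \<psi>)\<in>\<B>. \<exists>N F. x \<in> U \<and> open N \<and> \<phi> x \<in> N \<and> smooth_on N F \<and>
        (\<forall>y\<in>U \<inter> S. \<phi> y \<in> N \<longrightarrow> f y \<in> V \<and> \<psi> (f y) = F (\<phi> y)))"


section \<open>Lie groups\<close>

record ('g, 'e) lie_group_data = "'g monoid" +
  charts :: "('g set \<times> ('g \<Rightarrow> 'e)) set"

abbreviation lie_topology :: "('g, 'e::real_normed_vector) lie_group_data \<Rightarrow> 'g topology" where
  "lie_topology G \<equiv> manifold_topology (charts G)"

text \<open>The model space is a finite-dimensional normed space rather than a Euclidean space, so that
  zero-dimensional groups are included.\<close>

definition lie_group :: "('g, 'e::real_normed_vector) lie_group_data \<Rightarrow> bool" where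
  "lie_group G \<longleftrightarrow> group G \<and> (\<exists>B::'e set. finite B \<and> span B = UNIV) \<and>
     smooth_atlas (carrier G) (charts G) \<and> Hausdorff_space (lie_topology G) \<and>
     second_countable (lie_topology G) \<and>
     manifold_smooth_on (prod_atlas (charts G) (charts G)) (charts G)
       (carrier G \<times> carrier G) (\<lambda>(x, y). x \<otimes>\<^bsub>G\<^esub> y) \<and>
     manifold_smooth_on (charts G) (charts G) (carrier G) (\<lambda>x. inv\<^bsub>G\<^esub> x)"

text \<open>The Lie algebra is the tangent space at the identity, identified with the model space
  \<^typ>\<open>'e\<close> by means of the coordinates of a chart around the identity: the velocity of
  a curve \<open>c\<close> with \<open>c 0 = \<one>\<close> is the derivative of \<open>\<lambda>u. id_coord G (c u)\<close>. Tangent vectors at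
  \<open>g\<close> are written \<open>Y = g B\<close>, the left translate of a Lie algebra element \<open>B\<close>.\<close>

definition id_chart :: "('g, 'e) lie_group_data \<Rightarrow> 'g set \<times> ('g \<Rightarrow> 'e)" where
  "id_chart G = (SOME c. c \<in> charts G \<and> \<one>\<^bsub>G\<^esub> \<in> fst c)"

definition id_coord :: "('g, 'e) lie_group_data \<Rightarrow> 'g \<Rightarrow> 'e" where
  "id_coord G = snd (id_chart G)"

definition id_point :: "('g, 'e) lie_group_data \<Rightarrow> 'e \<Rightarrow> 'g" where
  "id_point G = inv_into (fst (id_chart G)) (id_coord G)"

definition one_param :: "('g, 'e::real_normed_vector) lie_group_data \<Rightarrow> 'e \<Rightarrow> (real \<Rightarrow> 'g) \<Rightarrow> bool" where
  "one_param G A c \<longleftrightarrow> manifold_smooth_on vec_atlas (charts G) UNIV c \<and>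
     (\<forall>s t. c (s + t) = c s \<otimes>\<^bsub>G\<^esub> c t) \<and>
     ((\<lambda>u. id_coord G (c u)) has_vector_derivative A) (at 0)"

definition lexp :: "('g, 'e::real_normed_vector) lie_group_data \<Rightarrow> 'e \<Rightarrow> 'g" where
  "lexp G A = (THE c. one_param G A c) 1"

definition Ad :: "('g, 'e::real_normed_vector) lie_group_data \<Rightarrow> 'g \<Rightarrow> 'e \<Rightarrow> 'e" where
  "Ad G g = frechet_derivative (\<lambda>x. id_coord G (g \<otimes>\<^bsub>G\<^esub> id_point G x \<otimes>\<^bsub>G\<^esub> inv\<^bsub>G\<^esub> g))
     (at (id_coord G \<one>\<^bsub>G\<^esub>))"

text \<open>\<open>[A, B] = ad A B\<close>, where \<open>ad\<close> is the derivative of \<open>Ad\<close> at the identity.\<close>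

definition bracket :: "('g, 'e::real_normed_vector) lie_group_data \<Rightarrow> 'e \<Rightarrow> 'e \<Rightarrow> 'e" where
  "bracket G A B =
     frechet_derivative (\<lambda>x. Ad G (id_point G x) B) (at (id_coord G \<one>\<^bsub>G\<^esub>)) A"

definition lie_ideal :: "('g, 'e::real_normed_vector) lie_group_data \<Rightarrow> 'e set \<Rightarrow> bool" where
  "lie_ideal G I \<longleftrightarrow> subspace I \<and> (\<forall>A. \<forall>B\<in>I. bracket G A B \<in> I)"

primrec derived_series :: "('g, 'e::real_normed_vector) lie_group_data \<Rightarrow> 'e set \<Rightarrow> nat \<Rightarrow> 'e set" where
  "derived_series G I 0 = I"
| "derived_series G I (Suc k) =
     span {bracket G A B |A B. A \<in> derived_series G I k \<and> B \<in> derived_series G I k}"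

definition semisimple :: "('g, 'e::real_normed_vector) lie_group_data \<Rightarrow> bool" where
  "semisimple G \<longleftrightarrow>
     (\<forall>I. lie_ideal G I \<and> (\<exists>k. derived_series G I k = {0}) \<longrightarrow> I = {0})"

definition circle_group :: "complex monoid" where
  "circle_group = \<lparr>carrier = sphere 0 1, monoid.mult = (*), one = 1\<rparr>"

definition torus :: "('g, 'e::real_normed_vector) lie_group_data \<Rightarrow> 'g set \<Rightarrow> bool" where
  "torus G T \<longleftrightarrow> subgroup T G \<and>
     (\<exists>(k::nat) f. f \<in> iso (product_group {..<k} (\<lambda>_. circle_group)) (G\<lparr>carrier := T\<rparr>) \<and>
        homeomorphic_map (product_topology (\<lambda>_. top_of_set (sphere 0 1)) {..<k})
          (subtopology (lie_topology G) T) f)"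

definition maximal_torus :: "('g, 'e::real_normed_vector) lie_group_data \<Rightarrow> 'g set \<Rightarrow> bool" where
  "maximal_torus G T \<longleftrightarrow> torus G T \<and> (\<forall>T'. torus G T' \<and> T \<subseteq> T' \<longrightarrow> T' = T)"

text \<open>The Lie algebra of a closed subgroup.\<close>

definition lie_subalgebra :: "('g, 'e::real_normed_vector) lie_group_data \<Rightarrow> 'g set \<Rightarrow> 'e set" where
  "lie_subalgebra G H = {A. \<forall>u::real. lexp G (u *\<^sub>R A) \<in> H}"


section \<open>Coadjoint orbits\<close>

definition coad ::
    "('g, 'e::real_normed_vector) lie_group_data \<Rightarrow> 'g \<Rightarrow> ('e \<Rightarrow>\<^sub>L real) \<Rightarrow> ('e \<Rightarrow>\<^sub>L real)" where
  "coad G g \<nu> = Blinfun (\<lambda>A. blinfun_apply \<nu> (Ad G (inv\<^bsub>G\<^esub> g) A))"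

definition orbit :: "('g, 'e::real_normed_vector) lie_group_data \<Rightarrow> ('e \<Rightarrow>\<^sub>L real) \<Rightarrow> ('e \<Rightarrow>\<^sub>L real) set" where
  "orbit G \<eta> = {coad G g \<eta> |g. g \<in> carrier G}"

definition isotropy :: "('g, 'e::real_normed_vector) lie_group_data \<Rightarrow> ('e \<Rightarrow>\<^sub>L real) \<Rightarrow> 'g set" where
  "isotropy G \<eta> = {g \<in> carrier G. coad G g \<eta> = \<eta>}"

definition fund_field ::
    "('g, 'e::real_normed_vector) lie_group_data \<Rightarrow> 'e \<Rightarrow> ('e \<Rightarrow>\<^sub>L real) \<Rightarrow> ('e \<Rightarrow>\<^sub>L real)" where
  "fund_field G A \<nu> = vector_derivative (\<lambda>u. coad G (lexp G (u *\<^sub>R A)) \<nu>) (at 0)"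

text \<open>\<open>\<psi>\<close> is the isotopy of the orbit generated by the fields \<open>X\<^bsub>A t\<^esub>\<close>, and it is closed.\<close>

definition closed_isotopy ::
    "('g, 'e::real_normed_vector) lie_group_data \<Rightarrow> ('e \<Rightarrow>\<^sub>L real) \<Rightarrow> (real \<Rightarrow> 'e)
      \<Rightarrow> (real \<Rightarrow> ('e \<Rightarrow>\<^sub>L real) \<Rightarrow> ('e \<Rightarrow>\<^sub>L real)) \<Rightarrow> bool" where
  "closed_isotopy G \<eta> A \<psi> \<longleftrightarrow> (\<forall>q\<in>orbit G \<eta>.
     (\<forall>t\<in>{0..1}. \<psi> t q \<in> orbit G \<eta> \<and>
        ((\<lambda>s. \<psi> s q) has_vector_derivative fund_field G (A t) (\<psi> t q)) (at t within {0..1})) \<and>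
     \<psi> 0 q = q \<and> \<psi> 1 q = q)"

definition quantizing_character ::
    "('g, 'e::real_normed_vector) lie_group_data \<Rightarrow> ('e \<Rightarrow>\<^sub>L real) \<Rightarrow> ('g \<Rightarrow> complex) \<Rightarrow> bool" where
  "quantizing_character G \<eta> \<Lambda> \<longleftrightarrow>
     \<Lambda> \<in> hom (G\<lparr>carrier := isotropy G \<eta>\<rparr>) circle_group \<and>
     continuous_map (subtopology (lie_topology G) (isotropy G \<eta>)) euclidean \<Lambda> \<and>
     (\<forall>C\<in>lie_subalgebra G (isotropy G \<eta>).
        ((\<lambda>u. \<Lambda> (lexp G (u *\<^sub>R C))) has_vector_derivative
           2 * of_real pi * \<i> * of_real (blinfun_apply \<eta> C)) (at 0))"


section \<open>Roots and weights\<close>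

text \<open>The complexified Lie algebra is \<^typ>\<open>'e \<times> 'e\<close>, the pair \<open>(x, y)\<close> standing for \<open>x + \<i> y\<close>.\<close>

definition cscale :: "complex \<Rightarrow> 'e::real_vector \<times> 'e \<Rightarrow> 'e \<times> 'e" where
  "cscale c = (\<lambda>(x, y). (Re c *\<^sub>R x - Im c *\<^sub>R y, Re c *\<^sub>R y + Im c *\<^sub>R x))"

definition cbracket ::
    "('g, 'e::real_normed_vector) lie_group_data \<Rightarrow> 'e \<times> 'e \<Rightarrow> 'e \<times> 'e \<Rightarrow> 'e \<times> 'e" where
  "cbracket G = (\<lambda>(x, y) (x', y').
     (bracket G x x' - bracket G y y', bracket G x y' + bracket G y x'))"

definition cartan :: "('g, 'e::real_normed_vector) lie_group_data \<Rightarrow> 'g set \<Rightarrow> ('e \<times> 'e) set" where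
  "cartan G T = lie_subalgebra G T \<times> lie_subalgebra G T"

definition root_space ::
    "('g, 'e::real_normed_vector) lie_group_data \<Rightarrow> 'g set \<Rightarrow> ('e \<times> 'e \<Rightarrow> complex) \<Rightarrow> ('e \<times> 'e) set" where
  "root_space G T \<alpha> = {X. \<forall>H\<in>cartan G T. cbracket G H X = cscale (\<alpha> H) X}"

text \<open>Roots are functionals on the Cartan subalgebra; as HOL functions they are normalised to
  vanish outside of it.\<close>

definition roots ::
    "('g, 'e::real_normed_vector) lie_group_data \<Rightarrow> 'g set \<Rightarrow> ('e \<times> 'e \<Rightarrow> complex) set" where
  "roots G T = {\<alpha>.
     (\<forall>H\<in>cartan G T. \<forall>K\<in>cartan G T. \<alpha> (H + K) = \<alpha> H + \<alpha> K) \<and>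
     (\<forall>c. \<forall>H\<in>cartan G T. \<alpha> (cscale c H) = c * \<alpha> H) \<and>
     (\<forall>H. H \<notin> cartan G T \<longrightarrow> \<alpha> H = 0) \<and>
     \<alpha> \<noteq> (\<lambda>_. 0) \<and> root_space G T \<alpha> \<noteq> {0}}"

definition positive_system ::
    "('g, 'e::real_normed_vector) lie_group_data \<Rightarrow> 'g set \<Rightarrow> ('e \<times> 'e \<Rightarrow> complex) set \<Rightarrow> bool" where
  "positive_system G T P \<longleftrightarrow> P \<subseteq> roots G T \<and>
     (\<forall>\<alpha>\<in>roots G T. (\<alpha> \<in> P) \<noteq> ((\<lambda>H. - \<alpha> H) \<in> P)) \<and>
     (\<forall>\<alpha>\<in>P. \<forall>\<beta>\<in>P. (\<lambda>H. \<alpha> H + \<beta> H) \<in> roots G T \<longrightarrow> (\<lambda>H. \<alpha> H + \<beta> H) \<in> P)"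

text \<open>Root spaces are complex subspaces, so the real span below is already the complex span.\<close>

definition coroot ::
    "('g, 'e::real_normed_vector) lie_group_data \<Rightarrow> 'g set \<Rightarrow> ('e \<times> 'e \<Rightarrow> complex) \<Rightarrow> 'e \<times> 'e" where
  "coroot G T \<alpha> = (THE H.
     H \<in> span {cbracket G X Y |X Y. X \<in> root_space G T \<alpha> \<and> Y \<in> root_space G T (\<lambda>H. - \<alpha> H)} \<and>
     \<alpha> H = 2)"

text \<open>The complex-linear extension of \<open>\<lambda> = 2 \<pi> \<i> \<eta>\<close>.\<close>

definition lambda_ext :: "('e::real_normed_vector \<Rightarrow>\<^sub>L real) \<Rightarrow> 'e \<times> 'e \<Rightarrow> complex" where
  "lambda_ext \<eta> = (\<lambda>(x, y). 2 * of_real pi * \<i> *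
     (of_real (blinfun_apply \<eta> x) + \<i> * of_real (blinfun_apply \<eta> y)))"

definition dominant ::
    "('g, 'e::real_normed_vector) lie_group_data \<Rightarrow> 'g set \<Rightarrow> ('e \<times> 'e \<Rightarrow> complex) set
      \<Rightarrow> ('e \<times> 'e \<Rightarrow> complex) \<Rightarrow> bool" where
  "dominant G T P \<mu> \<longleftrightarrow> (\<forall>\<alpha>\<in>P. Im (\<mu> (coroot G T \<alpha>)) = 0 \<and> Re (\<mu> (coroot G T \<alpha>)) \<ge> 0)"


section \<open>Representations\<close>

definition representation ::
    "('g, 'e::real_normed_vector) lie_group_data \<Rightarrow> ('g \<Rightarrow> complex^'n^'n) \<Rightarrow> bool" where
  "representation G \<pi> \<longleftrightarrow> continuous_map (lie_topology G) euclidean \<pi> \<and>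
     \<pi> \<one>\<^bsub>G\<^esub> = mat 1 \<and>
     (\<forall>g\<in>carrier G. \<forall>h\<in>carrier G. \<pi> (g \<otimes>\<^bsub>G\<^esub> h) = \<pi> g ** \<pi> h)"

definition irreducible_rep ::
    "('g, 'e::real_normed_vector) lie_group_data \<Rightarrow> ('g \<Rightarrow> complex^'n^'n) \<Rightarrow> bool" where
  "irreducible_rep G \<pi> \<longleftrightarrow> representation G \<pi> \<and>
     (\<forall>W. vec.subspace W \<and> (\<forall>g\<in>carrier G. \<forall>v\<in>W. \<pi> g *v v \<in> W) \<longrightarrow> W = {0} \<or> W = UNIV)"

definition dual_rep ::
    "('g, 'e) lie_group_data \<Rightarrow> ('g \<Rightarrow> complex^'n^'n) \<Rightarrow> 'g \<Rightarrow> complex^'n^'n" where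
  "dual_rep G \<pi> g = transpose (\<pi> (inv\<^bsub>G\<^esub> g))"

definition rep_character :: "('g \<Rightarrow> complex^'n^'n) \<Rightarrow> 'g \<Rightarrow> complex" where
  "rep_character \<pi> g = trace (\<pi> g)"

definition rep_deriv ::
    "('g, 'e::real_normed_vector) lie_group_data \<Rightarrow> ('g \<Rightarrow> complex^'n^'n) \<Rightarrow> 'e \<Rightarrow> complex^'n^'n" where
  "rep_deriv G \<pi> A = vector_derivative (\<lambda>u. \<pi> (lexp G (u *\<^sub>R A))) (at 0)"

definition rep_action ::
    "('g, 'e::real_normed_vector) lie_group_data \<Rightarrow> ('g \<Rightarrow> complex^'n^'n)
      \<Rightarrow> 'e \<times> 'e \<Rightarrow> complex^'n \<Rightarrow> complex^'n" where
  "rep_action G \<pi> = (\<lambda>(x, y) v. rep_deriv G \<pi> x *v v + \<i> *s (rep_deriv G \<pi> y *v v))"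

definition rep_weight ::
    "('g, 'e::real_normed_vector) lie_group_data \<Rightarrow> 'g set \<Rightarrow> ('g \<Rightarrow> complex^'n^'n)
      \<Rightarrow> ('e \<times> 'e \<Rightarrow> complex) \<Rightarrow> bool" where
  "rep_weight G T \<pi> \<mu> \<longleftrightarrow> (\<exists>v. v \<noteq> 0 \<and> (\<forall>H\<in>cartan G T. rep_action G \<pi> H v = \<mu> H *s v))"

text \<open>The highest weight is the largest one for the partial order in which \<open>\<nu>\<close> is below \<open>\<mu>\<close> if
  \<open>\<mu> - \<nu>\<close> is a combination of positive roots with nonnegative coefficients.\<close>

definition highest_weight ::
    "('g, 'e::real_normed_vector) lie_group_data \<Rightarrow> 'g set \<Rightarrow> ('e \<times> 'e \<Rightarrow> complex) set
      \<Rightarrow> ('g \<Rightarrow> complex^'n^'n) \<Rightarrow> ('e \<times> 'e \<Rightarrow> complex) \<Rightarrow> bool" where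
  "highest_weight G T P \<pi> \<mu> \<longleftrightarrow> rep_weight G T \<pi> \<mu> \<and>
     (\<forall>\<nu>. rep_weight G T \<pi> \<nu> \<longrightarrow> (\<exists>c. (\<forall>\<alpha>\<in>P. c \<alpha> \<ge> (0::real)) \<and>
        (\<forall>H\<in>cartan G T. \<mu> H - \<nu> H = (\<Sum>\<alpha>\<in>P. of_real (c \<alpha>) * \<alpha> H))))"


section \<open>The prequantum bundle\<close>

text \<open>Points of \<open>L = G \<times>\<^bsub>\<Lambda>\<^esub> \<complex>\<close> are the equivalence classes \<open>[g, z] = cls G \<eta> \<Lambda> g z\<close>.\<close>

definition bundle_rel ::
    "('g, 'e::real_normed_vector) lie_group_data \<Rightarrow> ('e \<Rightarrow>\<^sub>L real) \<Rightarrow> ('g \<Rightarrow> complex)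
      \<Rightarrow> (('g \<times> complex) \<times> ('g \<times> complex)) set" where
  "bundle_rel G \<eta> \<Lambda> =
     {((g, z), (g \<otimes>\<^bsub>G\<^esub> inv\<^bsub>G\<^esub> b, \<Lambda> b * z)) |g z b. g \<in> carrier G \<and> b \<in> isotropy G \<eta>}"

definition cls ::
    "('g, 'e::real_normed_vector) lie_group_data \<Rightarrow> ('e \<Rightarrow>\<^sub>L real) \<Rightarrow> ('g \<Rightarrow> complex)
      \<Rightarrow> 'g \<Rightarrow> complex \<Rightarrow> ('g \<times> complex) set" where
  "cls G \<eta> \<Lambda> g z = bundle_rel G \<eta> \<Lambda> `` {(g, z)}"

definition line_bundle ::
    "('g, 'e::real_normed_vector) lie_group_data \<Rightarrow> ('e \<Rightarrow>\<^sub>L real) \<Rightarrow> ('g \<Rightarrow> complex)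
      \<Rightarrow> ('g \<times> complex) set set" where
  "line_bundle G \<eta> \<Lambda> = (carrier G \<times> UNIV) // bundle_rel G \<eta> \<Lambda>"

definition line_bundle_nz ::
    "('g, 'e::real_normed_vector) lie_group_data \<Rightarrow> ('e \<Rightarrow>\<^sub>L real) \<Rightarrow> ('g \<Rightarrow> complex)
      \<Rightarrow> ('g \<times> complex) set set" where
  "line_bundle_nz G \<eta> \<Lambda> = {cls G \<eta> \<Lambda> g z |g z. g \<in> carrier G \<and> z \<noteq> 0}"

definition bproj ::
    "('g, 'e::real_normed_vector) lie_group_data \<Rightarrow> ('e \<Rightarrow>\<^sub>L real) \<Rightarrow> ('g \<times> complex) set \<Rightarrow> ('e \<Rightarrow>\<^sub>L real)" where
  "bproj G \<eta> l = (THE \<nu>. \<exists>g z. (g, z) \<in> l \<and> \<nu> = coad G g \<eta>)"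

text \<open>The vector space operations of the fibres, \<open>c [g, z] = [g, c z]\<close> and
  \<open>[g, z] + [g, w] = [g, z + w]\<close>, written directly on equivalence classes.\<close>

definition fscale :: "complex \<Rightarrow> ('g \<times> complex) set \<Rightarrow> ('g \<times> complex) set" where
  "fscale c l = (\<lambda>(g, z). (g, c * z)) ` l"

definition fadd :: "('g \<times> complex) set \<Rightarrow> ('g \<times> complex) set \<Rightarrow> ('g \<times> complex) set" where
  "fadd l m = {(g, z + w) |g z w. (g, z) \<in> l \<and> (g, w) \<in> m}"

definition bsection ::
    "('g, 'e::real_normed_vector) lie_group_data \<Rightarrow> ('e \<Rightarrow>\<^sub>L real) \<Rightarrow> ('g \<Rightarrow> complex)
      \<Rightarrow> (('e \<Rightarrow>\<^sub>L real) \<Rightarrow> ('g \<times> complex) set) \<Rightarrow> bool" where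
  "bsection G \<eta> \<Lambda> \<sigma> \<longleftrightarrow>
     \<sigma> \<in> (\<Pi>\<^sub>E \<nu>\<in>orbit G \<eta>. {l \<in> line_bundle G \<eta> \<Lambda>. bproj G \<eta> l = \<nu>})"

text \<open>The orbit and the bundle carry the quotient smooth structures for which
  \<open>g \<mapsto> g \<cdot> \<eta>\<close> and \<open>(g, z) \<mapsto> [g, z]\<close> are surjective submersions. Hence a map into the bundle
  is smooth iff it locally lifts to a smooth map into \<open>G \<times> \<complex>\<close>, and a map out of the
  orbit is smooth iff its composition with \<open>g \<mapsto> g \<cdot> \<eta>\<close> is.\<close>

definition smooth_into_bundle ::
    "('g, 'e::real_normed_vector) lie_group_data \<Rightarrow> ('e \<Rightarrow>\<^sub>L real) \<Rightarrow> ('g \<Rightarrow> complex)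
      \<Rightarrow> ('m, 'v::real_normed_vector) atlas \<Rightarrow> 'm set \<Rightarrow> ('m \<Rightarrow> ('g \<times> complex) set) \<Rightarrow> bool" where
  "smooth_into_bundle G \<eta> \<Lambda> \<A> S s \<longleftrightarrow>
     (\<forall>x\<in>S. \<exists>W F. openin (manifold_topology \<A>) W \<and> x \<in> W \<and>
        manifold_smooth_on \<A> (prod_atlas (charts G) vec_atlas) (W \<inter> S) F \<and>
        (\<forall>y\<in>W \<inter> S. s y = cls G \<eta> \<Lambda> (fst (F y)) (snd (F y))))"

definition smooth_section ::
    "('g, 'e::real_normed_vector) lie_group_data \<Rightarrow> ('e \<Rightarrow>\<^sub>L real) \<Rightarrow> ('g \<Rightarrow> complex)
      \<Rightarrow> (('e \<Rightarrow>\<^sub>L real) \<Rightarrow> ('g \<times> complex) set) \<Rightarrow> bool" where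
  "smooth_section G \<eta> \<Lambda> \<sigma> \<longleftrightarrow> bsection G \<eta> \<Lambda> \<sigma> \<and>
     smooth_into_bundle G \<eta> \<Lambda> (charts G) (carrier G) (\<lambda>g. \<sigma> (coad G g \<eta>))"

definition smooth_section_curve ::
    "('g, 'e::real_normed_vector) lie_group_data \<Rightarrow> ('e \<Rightarrow>\<^sub>L real) \<Rightarrow> ('g \<Rightarrow> complex)
      \<Rightarrow> (real \<Rightarrow> ('e \<Rightarrow>\<^sub>L real) \<Rightarrow> ('g \<times> complex) set) \<Rightarrow> bool" where
  "smooth_section_curve G \<eta> \<Lambda> \<sigma> \<longleftrightarrow> (\<forall>t\<in>{0..1}. bsection G \<eta> \<Lambda> (\<sigma> t)) \<and>
     smooth_into_bundle G \<eta> \<Lambda> (prod_atlas (charts G) vec_atlas) (carrier G \<times> {0..1})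
       (\<lambda>(g, t). \<sigma> t (coad G g \<eta>))"

definition sharp ::
    "('g, 'e::real_normed_vector) lie_group_data \<Rightarrow> ('e \<Rightarrow>\<^sub>L real)
      \<Rightarrow> (('e \<Rightarrow>\<^sub>L real) \<Rightarrow> ('g \<times> complex) set) \<Rightarrow> ('g \<times> complex) set \<Rightarrow> complex" where
  "sharp G \<eta> \<sigma> y = (THE c. \<sigma> (bproj G \<eta> y) = fscale c y)"

text \<open>A tangent vector \<open>[Y, x]\<close> at \<open>[g, z]\<close> with \<open>Y = g B\<close> is represented by \<open>(g, z, B, x)\<close>: it
  is the velocity of the curve \<open>[g exp(u B), z exp(u x)]\<close>, and \<open>\<theta>(Y) = \<eta>(B)\<close>.\<close>

definition tangent_deriv ::
    "('g, 'e::real_normed_vector) lie_group_data \<Rightarrow> ('e \<Rightarrow>\<^sub>L real) \<Rightarrow> ('g \<Rightarrow> complex)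
      \<Rightarrow> (('g \<times> complex) set \<Rightarrow> complex) \<Rightarrow> 'g \<Rightarrow> complex \<Rightarrow> 'e \<Rightarrow> complex \<Rightarrow> complex" where
  "tangent_deriv G \<eta> \<Lambda> f g z B x =
     vector_derivative (\<lambda>u. f (cls G \<eta> \<Lambda> (g \<otimes>\<^bsub>G\<^esub> lexp G (u *\<^sub>R B)) (z * exp (of_real u * x)))) (at 0)"

definition conn_form :: "('e::real_normed_vector \<Rightarrow>\<^sub>L real) \<Rightarrow> 'e \<Rightarrow> complex \<Rightarrow> complex" where
  "conn_form \<eta> B x = of_real (blinfun_apply \<eta> B) + inverse (2 * of_real pi * \<i>) * x"

definition orbit_velocity ::
    "('g, 'e::real_normed_vector) lie_group_data \<Rightarrow> ('e \<Rightarrow>\<^sub>L real) \<Rightarrow> 'g \<Rightarrow> 'e \<Rightarrow> ('e \<Rightarrow>\<^sub>L real)" where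
  "orbit_velocity G \<eta> g B =
     vector_derivative (\<lambda>u. coad G (g \<otimes>\<^bsub>G\<^esub> lexp G (u *\<^sub>R B)) \<eta>) (at 0)"

text \<open>\<open>Y\<^sup>\<sharp>(f)\<close> at a point \<open>y\<close>, computed from any representative of the
  horizontal lift of \<open>Y\<close> at \<open>y\<close>.\<close>

definition lift_deriv ::
    "('g, 'e::real_normed_vector) lie_group_data \<Rightarrow> ('e \<Rightarrow>\<^sub>L real) \<Rightarrow> ('g \<Rightarrow> complex)
      \<Rightarrow> (('e \<Rightarrow>\<^sub>L real) \<Rightarrow> ('e \<Rightarrow>\<^sub>L real)) \<Rightarrow> (('g \<times> complex) set \<Rightarrow> complex)
      \<Rightarrow> ('g \<times> complex) set \<Rightarrow> complex" where
  "lift_deriv G \<eta> \<Lambda> Y f y = (THE d. \<forall>g z B x.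
     g \<in> carrier G \<and> y = cls G \<eta> \<Lambda> g z \<and> conn_form \<eta> B x = 0 \<and>
     orbit_velocity G \<eta> g B = Y (coad G g \<eta>) \<longrightarrow> d = tangent_deriv G \<eta> \<Lambda> f g z B x)"

definition cov_deriv ::
    "('g, 'e::real_normed_vector) lie_group_data \<Rightarrow> ('e \<Rightarrow>\<^sub>L real) \<Rightarrow> ('g \<Rightarrow> complex)
      \<Rightarrow> (('e \<Rightarrow>\<^sub>L real) \<Rightarrow> ('e \<Rightarrow>\<^sub>L real))
      \<Rightarrow> (('e \<Rightarrow>\<^sub>L real) \<Rightarrow> ('g \<times> complex) set) \<Rightarrow> ('e \<Rightarrow>\<^sub>L real) \<Rightarrow> ('g \<times> complex) set" where
  "cov_deriv G \<eta> \<Lambda> Y \<sigma> = (THE \<tau>. bsection G \<eta> \<Lambda> \<tau> \<and>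
     (\<forall>y\<in>line_bundle_nz G \<eta> \<Lambda>. sharp G \<eta> \<tau> y = lift_deriv G \<eta> \<Lambda> Y (sharp G \<eta> \<sigma>) y))"


section \<open>The invariant\<close>

definition quantum_op ::
    "('g, 'e::real_normed_vector) lie_group_data \<Rightarrow> ('e \<Rightarrow>\<^sub>L real) \<Rightarrow> ('g \<Rightarrow> complex) \<Rightarrow> 'e
      \<Rightarrow> (('e \<Rightarrow>\<^sub>L real) \<Rightarrow> ('g \<times> complex) set) \<Rightarrow> ('e \<Rightarrow>\<^sub>L real) \<Rightarrow> ('g \<times> complex) set" where
  "quantum_op G \<eta> \<Lambda> A \<sigma> = (\<lambda>\<nu>\<in>orbit G \<eta>.
     fadd (fscale (- 1) (cov_deriv G \<eta> \<Lambda> (fund_field G A) \<sigma> \<nu>))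
          (fscale (2 * of_real pi * \<i> * of_real (blinfun_apply \<nu> A)) (\<sigma> \<nu>)))"

text \<open>The linear coordinate on the fibre over \<open>g \<cdot> \<eta>\<close> given by \<open>z \<mapsto> [g, z]\<close>.\<close>

definition fibre_coord :: "'g \<Rightarrow> ('g \<times> complex) set \<Rightarrow> complex" where
  "fibre_coord g l = (THE z. (g, z) \<in> l)"

definition quantum_evolution ::
    "('g, 'e::real_normed_vector) lie_group_data \<Rightarrow> ('e \<Rightarrow>\<^sub>L real) \<Rightarrow> ('g \<Rightarrow> complex) \<Rightarrow> (real \<Rightarrow> 'e)
      \<Rightarrow> (real \<Rightarrow> ('e \<Rightarrow>\<^sub>L real) \<Rightarrow> ('g \<times> complex) set) \<Rightarrow> bool" where
  "quantum_evolution G \<eta> \<Lambda> A \<sigma> \<longleftrightarrow> smooth_section_curve G \<eta> \<Lambda> \<sigma> \<and>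
     (\<forall>t\<in>{0..1}. \<forall>g\<in>carrier G.
        ((\<lambda>s. fibre_coord g (\<sigma> s (coad G g \<eta>))) has_vector_derivative
           fibre_coord g (quantum_op G \<eta> \<Lambda> (A t) (\<sigma> t) (coad G g \<eta>))) (at t within {0..1}))"

text \<open>\<open>\<kappa>(\<psi>)\<close>, where the isotopy \<open>\<psi>\<close> is given by the curve \<open>A\<close> whose fields \<open>X\<^bsub>A t\<^esub>\<close> generate it.
  For a closed isotopy exactly one such constant exists.\<close>

definition kappa ::
    "('g, 'e::real_normed_vector) lie_group_data \<Rightarrow> ('e \<Rightarrow>\<^sub>L real) \<Rightarrow> ('g \<Rightarrow> complex)
      \<Rightarrow> (real \<Rightarrow> 'e) \<Rightarrow> complex" where
  "kappa G \<eta> \<Lambda> A = (THE k. cmod k = 1 \<and>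
     (\<forall>\<sigma> \<sigma>t. smooth_section G \<eta> \<Lambda> \<sigma> \<and> quantum_evolution G \<eta> \<Lambda> A \<sigma>t \<and> \<sigma>t 0 = \<sigma> \<longrightarrow>
        (\<forall>\<nu>\<in>orbit G \<eta>. \<sigma>t 1 \<nu> = fscale k (\<sigma> \<nu>))))"

text \<open>The solution of \<open>h' h\<^sup>-\<^sup>1 = A\<close> with \<open>h 0 = \<one>\<close>; the velocity of
  \<open>h\<close> at \<open>t\<close> is right-translated to the identity.\<close>

definition group_evolution ::
    "('g, 'e::real_normed_vector) lie_group_data \<Rightarrow> (real \<Rightarrow> 'e) \<Rightarrow> (real \<Rightarrow> 'g) \<Rightarrow> bool" where
  "group_evolution G A h \<longleftrightarrow> manifold_smooth_on vec_atlas (charts G) {0..1} h \<and>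
     (\<forall>t\<in>{0..1}. ((\<lambda>s. id_coord G (h s \<otimes>\<^bsub>G\<^esub> inv\<^bsub>G\<^esub> (h t))) has_vector_derivative A t)
        (at t within {0..1})) \<and>
     h 0 = \<one>\<^bsub>G\<^esub>"

end

theory Submission
  imports Defs
begin

text \<open>
  A section of \<open>L\<close> is an equivariant function \<open>f\<close> on \<open>G\<close>, \<open>f (g b\<^sup>-\<^sup>1) = \<Lambda> b \<cdot> f g\<close> for \<open>b \<in> G\<^sub>\<eta>\<close>, and in these terms
  \<open>\<P>\<^sub>A f\<close> is minus the derivative of \<open>u \<mapsto> f (exp (u A) g)\<close>. Hence \<open>f\<^sub>t (h\<^sub>t g)\<close> is constant along every
  evolution, that is \<open>f\<^sub>1 (g) = f\<^sub>0 (h\<^sub>1\<^sup>-\<^sup>1 g)\<close>. Since \<open>\<psi>\<^sub>t\<close> is the action of \<open>h\<^sub>t\<close>, the element \<open>h\<^sub>1\<close> fixes the orbit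
  pointwise, so \<open>Ad h\<^sub>1 B - B\<close> lies in \<open>K = {B. \<forall>g. \<eta> (Ad g B) = 0}\<close>. This is an ideal contained in the Lie
  algebra of the torus \<open>G\<^sub>\<eta>\<close>, thus abelian, thus zero, and \<open>h\<^sub>1\<close> is central. It follows that
  \<open>f\<^sub>1 = \<Lambda> (h\<^sub>1) \<cdot> f\<^sub>0\<close>, i.e. \<open>\<kappa>(\<psi>) = \<Lambda> (h\<^sub>1)\<close>. On a highest weight vector \<open>v\<close> the torus acts by
  \<open>\<pi> b v = \<Lambda> (b)\<^sup>-\<^sup>1 v\<close>, so by irreducibility \<open>\<pi> (h\<^sub>1)\<close> is the scalar \<open>\<Lambda> (h\<^sub>1)\<^sup>-\<^sup>1\<close> and the character of \<open>\<pi>\<^sup>*\<close> at \<open>h\<^sub>1\<close>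
  is \<open>\<Lambda> (h\<^sub>1) \<cdot> dim \<pi>\<close>.
\<close>

section \<open>Smooth maps between finite-dimensional spaces\<close>

text \<open>The obstacle is regularity. \<open>lexp\<close>, \<open>cov_deriv\<close> and
  \<open>kappa\<close> are descriptions that must be shown to denote something, tori are given up to
  homeomorphism, and representations are merely continuous. Smoothness has two sources. A continuous
  one-parameter family whose multiplication is close to a translation is differentiable; this turns
  torus elements into exponentials, so that the infinitesimal data of \<open>\<Lambda>\<close> and
  of the highest weight integrate to the torus, and it differentiates \<open>\<pi>\<close> along
  exponentials. Derivatives expressible through the function itself then bootstrap to smoothness.
  All velocities are translated back to the one chart at the identity (\<open>lvel\<close>,
  \<open>gderiv\<close>). An evolution is a curve of sections with smooth local lifts
  \<open>[k, z]\<close>, and comparing lifts involves \<open>\<Lambda>\<close>, which lives on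
  \<open>G\<^sub>\<eta>\<close>. The matrix coefficient \<open>g \<mapsto> (\<pi>
  (g\<^sup>-\<^sup>1) v)\<^sub>i / v\<^sub>i\<close> extends it smoothly to \<open>G\<close>; this
  gives the joint differentiability in time and space on which the transport argument rests.\<close>

definition findim :: "'a::real_normed_vector itself \<Rightarrow> bool" where
  "findim _ \<longleftrightarrow> (\<exists>B::'a set. finite B \<and> span B = UNIV)"

text \<open>On the compact set of coefficient functions with l1-norm 1 the norm of the combination
  attains a minimum, positive by independence; homogeneity carries the bound to all coefficients.
  This makes coordinates continuous on a normed space that is merely spanned by a finite
  set.\<close>

lemma coordinates_bounded_below:
  fixes B :: "'a::real_normed_vector set"
  assumes "finite B" "independent B"
  shows "\<exists>c>0. \<forall>a. c * (\<Sum>b\<in>B. \<bar>a b\<bar>) \<le> norm (\<Sum>b\<in>B. a b *\<^sub>R b)"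
proof (cases "B = {}")
  case True
  then show ?thesis by (auto intro: exI[of _ 1])
next
  case False
  then obtain b0 where b0: "b0 \<in> B" by auto
  \<comment> \<open>Coefficients off \<open>B\<close> are pinned to 0, so that \<open>Q\<close> is a
    product of compact sets over the whole type and Tychonoff's theorem applies.\<close>
  define Q where "Q = PiE UNIV (\<lambda>b. if b \<in> B then {-1..1} else {0::real})"
  define Z where "Z = {a. (\<Sum>b\<in>B. \<bar>a b\<bar>) = (1::real)}"
  let ?f = "\<lambda>a. norm (\<Sum>b\<in>B. a b *\<^sub>R b)"
  have "compactin (product_topology (\<lambda>_. euclidean) UNIV) Q"
    unfolding Q_def by (subst compactin_PiE) auto
  then have "compact Q"
    by (simp add: euclidean_product_topology)
  moreover have "closed Z"
    unfolding Z_def by (intro closed_Collect_eq continuous_intros continuous_on_product_coordinates)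
  ultimately have "compact (Q \<inter> Z)" by (rule compact_Int_closed)
  moreover have "(\<lambda>b. if b = b0 then 1 else 0) \<in> Q \<inter> Z"
    using b0 assms(1) by (auto simp: Q_def Z_def if_distrib[of abs] sum.delta cong: if_cong)
  then have "Q \<inter> Z \<noteq> {}" by blast
  moreover have "continuous_on (Q \<inter> Z) ?f"
    by (intro continuous_intros continuous_on_subset[OF continuous_on_product_coordinates]) auto
  ultimately obtain m where m: "m \<in> Q \<inter> Z" "\<And>a. a \<in> Q \<inter> Z \<Longrightarrow> ?f m \<le> ?f a"
    using continuous_attains_inf[of "Q \<inter> Z" ?f] by blast
  have "?f m \<noteq> 0"
  proof
    assume "?f m = 0"
    then have "\<forall>b\<in>B. m b = 0"
      using assms real_vector.independentD[of B B m] by auto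
    then have "(\<Sum>b\<in>B. \<bar>m b\<bar>) = 0" by simp
    then show False using m(1) by (simp add: Z_def)
  qed
  then have pos: "?f m > 0" by simp
  have "?f m * (\<Sum>b\<in>B. \<bar>a b\<bar>) \<le> ?f a" for a
  proof (cases "(\<Sum>b\<in>B. \<bar>a b\<bar>) = 0")
    case True
    then show ?thesis by simp
  next
    case False
    define s where "s = (\<Sum>b\<in>B. \<bar>a b\<bar>)"
    have s: "s > 0" using False by (simp add: s_def sum_nonneg order_le_neq_trans)
    define a' where "a' = (\<lambda>b. if b \<in> B then a b / s else 0)"
    have le: "\<bar>a b\<bar> \<le> s" if "b \<in> B" for b
      unfolding s_def using that assms(1) by (intro member_le_sum) auto
    have "(\<Sum>b\<in>B. \<bar>a' b\<bar>) = (\<Sum>b\<in>B. \<bar>a b\<bar> / s)"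
      using s by (intro sum.cong) (auto simp: a'_def)
    also have "\<dots> = 1" using s by (simp add: sum_divide_distrib[symmetric] s_def)
    finally have "a' \<in> Z" by (simp add: Z_def)
    have "\<bar>a' b\<bar> \<le> 1" if "b \<in> B" for b
      using le[OF that] s that by (simp add: a'_def)
    then have "- 1 \<le> a' b \<and> a' b \<le> 1" if "b \<in> B" for b
      using that by (metis abs_le_D1 abs_le_D2 minus_le_iff)
    moreover have "a' b = 0" if "b \<notin> B" for b
      using that by (simp add: a'_def)
    ultimately have "a' \<in> Q"
      by (simp add: Q_def PiE_iff)
    with \<open>a' \<in> Z\<close> have "?f m \<le> ?f a'" using m(2) by blast
    also have "(\<Sum>b\<in>B. a' b *\<^sub>R b) = (1 / s) *\<^sub>R (\<Sum>b\<in>B. a b *\<^sub>R b)"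
      unfolding scaleR_sum_right by (intro sum.cong) (auto simp: a'_def)
    finally show ?thesis
      using s by (simp add: s_def[symmetric] pos_le_divide_eq)
  qed
  with pos show ?thesis by blast
qed

text \<open>The lower bound \<open>c\<close> on combinations bounds each coordinate functional by
  \<open>1 / c\<close>. Setting \<open>r b\<close> to 0 off \<open>B\<close> makes every
  \<open>r b\<close> bounded linear, without a side condition on \<open>b\<close>.\<close>

lemma findim_coordinates:
  assumes "findim TYPE('a::real_normed_vector)"
  obtains B and r :: "'a::real_normed_vector \<Rightarrow> 'a \<Rightarrow> real" where "finite B" "\<And>b. bounded_linear (r b)"
    "\<And>x. (\<Sum>b\<in>B. r b x *\<^sub>R b) = x"
    "\<And>b b'. b \<in> B \<Longrightarrow> b' \<in> B \<Longrightarrow> r b b' = (if b = b' then 1 else 0)"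
proof -
  obtain B0 :: "'a set" where B0: "finite B0" "span B0 = UNIV"
    using assms by (auto simp: findim_def)
  obtain B where B: "B \<subseteq> B0" "independent B" "B0 \<subseteq> span B"
    using real_vector.maximal_independent_subset[of B0] by blast
  have fin: "finite B" using B(1) B0(1) finite_subset by blast
  have sp: "span B = UNIV"
    using real_vector.span_mono[OF B(3)] B0(2) by (simp add: real_vector.span_span top_unique)
  define r where "r b x = (if b \<in> B then real_vector.representation B x b else 0)" for b x
  obtain c where c: "c > 0" "\<And>a. c * (\<Sum>b\<in>B. \<bar>a b\<bar>) \<le> norm (\<Sum>b\<in>B. a b *\<^sub>R b)"
    using coordinates_bounded_below[OF fin B(2)] by blast
  have sum: "(\<Sum>b\<in>B. r b x *\<^sub>R b) = x" for x
    unfolding r_def using real_vector.sum_representation_eq[OF B(2) _ fin subset_refl] sp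
    by auto
  have "bounded_linear (r b)" for b
  proof (rule bounded_linear_intro[where K = "1 / c"])
    show "r b (x + y) = r b x + r b y" for x y
      unfolding r_def using real_vector.representation_add[OF B(2)] sp by simp
    show "r b (k *\<^sub>R x) = k *\<^sub>R r b x" for k x
      unfolding r_def using real_vector.representation_scale[OF B(2)] sp by simp
    show "norm (r b x) \<le> norm x * (1 / c)" for x
    proof (cases "b \<in> B")
      case True
      have "c * \<bar>r b x\<bar> \<le> c * (\<Sum>b\<in>B. \<bar>r b x\<bar>)"
        using True fin c(1) by (intro mult_left_mono member_le_sum) auto
      also have "\<dots> \<le> norm x" using c(2)[of "\<lambda>b. r b x"] by (simp add: sum)
      finally show ?thesis using c(1) by (simp add: field_simps)
    next
      case False
      then show ?thesis using c(1) by (simp add: r_def)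
    qed
  qed
  moreover have "r b b' = (if b = b' then 1 else 0)" if "b \<in> B" "b' \<in> B" for b b'
    unfolding r_def using that real_vector.representation_basis[OF B(2) that(2)] by auto
  ultimately show ?thesis using that fin sum by blast
qed

lemma findim_euclidean: "findim TYPE('a::euclidean_space)"
  unfolding findim_def by (rule exI[of _ Basis]) simp

lemma findim_prod:
  assumes "findim TYPE('a::real_normed_vector)" "findim TYPE('b::real_normed_vector)"
  shows "findim TYPE('a \<times> 'b)"
proof -
  obtain B :: "'a set" and C :: "'b set" where B: "finite B" "span B = UNIV" and C: "finite C" "span C = UNIV"
    using assms by (auto simp: findim_def)
  let ?D = "(\<lambda>x. (x, 0)) ` B \<union> (\<lambda>y. (0, y)) ` C :: ('a \<times> 'b) set"
  have "(x, y) \<in> span ?D" for x y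
  proof -
    have 1: "linear (\<lambda>x::'a. (x, 0::'b))" and 2: "linear (\<lambda>y::'b. (0::'a, y))"
      by (auto intro!: linearI)
    have "(x, 0) \<in> span ((\<lambda>x. (x, 0::'b)) ` B)"
      using real_vector.linear_span_image[OF 1, of B] B(2) by auto
    moreover have "(0, y) \<in> span ((\<lambda>y. (0::'a, y)) ` C)"
      using real_vector.linear_span_image[OF 2, of C] C(2) by auto
    ultimately have "(x, 0) + (0, y) \<in> span ?D"
      by (intro real_vector.span_add;
          elim subsetD[OF real_vector.span_mono, rotated]; simp)
    then show ?thesis by simp
  qed
  then have "span ?D = UNIV" by auto
  moreover have "finite ?D" using B(1) C(1) by simp
  ultimately show ?thesis unfolding findim_def by (intro exI[of _ ?D] conjI)
qed

section \<open>Calculus of \<open>higher_differentiable_on\<close>\<close>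

lemma frechet_derivative_eqI: "(f has_derivative f') (at x) \<Longrightarrow> frechet_derivative f (at x) = f'"
  using frechet_derivative_at by blast

text \<open>Openness of \<open>S\<close> makes the two functions agree near each point, so their
  full derivatives on \<open>S\<close> coincide and the induction can pass to them.\<close>

lemma higher_differentiable_on_cong:
  assumes "open S" "\<And>x. x \<in> S \<Longrightarrow> f x = g x"
  shows "higher_differentiable_on n S f \<longleftrightarrow> higher_differentiable_on n S g"
  using assms
proof (induction n arbitrary: f g)
  case 0
  then show ?case by (simp cong: continuous_on_cong)
next
  case (Suc n)
  have tr: "(f has_derivative D) (at x) \<longleftrightarrow> (g has_derivative D) (at x)" if "x \<in> S" for x D
    using has_derivative_transform_within_open[of f D x UNIV S g]
      has_derivative_transform_within_open[of g D x UNIV S f] Suc.prems that by auto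
  then have "f differentiable (at x) \<longleftrightarrow> g differentiable (at x)" if "x \<in> S" for x
    using that by (auto simp: differentiable_def)
  moreover have "frechet_derivative f (at x) = frechet_derivative g (at x)" if "x \<in> S" for x
    unfolding frechet_derivative_def using tr[OF that] by simp
  ultimately show ?case
    using Suc.IH[OF Suc.prems(1), of "\<lambda>x. frechet_derivative f (at x) v"
        "\<lambda>x. frechet_derivative g (at x) v" for v] by auto
qed

lemma higher_differentiable_on_subset:
  "higher_differentiable_on n S f \<Longrightarrow> T \<subseteq> S \<Longrightarrow> higher_differentiable_on n T f"
  by (induction n arbitrary: f) (auto intro: continuous_on_subset)

lemma higher_differentiable_on_local:
  assumes "\<And>x. x \<in> S \<Longrightarrow> \<exists>T. open T \<and> x \<in> T \<and> higher_differentiable_on n T f"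
  shows "higher_differentiable_on n S f"
  using assms
proof (induction n arbitrary: f)
  case 0
  then have "continuous (at x within S) f" if "x \<in> S" for x
    using that by (metis higher_differentiable_on.simps(1) continuous_on_eq_continuous_at
        continuous_at_imp_continuous_at_within)
  then show ?case by (simp add: continuous_on_eq_continuous_within)
next
  case (Suc n)
  show ?case
    unfolding higher_differentiable_on.simps
  proof (intro conjI ballI allI)
    show "f differentiable (at x)" if "x \<in> S" for x
      using Suc.prems[OF that] by auto
    show "higher_differentiable_on n S (\<lambda>x. frechet_derivative f (at x) v)" for v
    proof (rule Suc.IH)
      fix x assume "x \<in> S"
      from Suc.prems[OF this] obtain T where "open T" "x \<in> T" "higher_differentiable_on (Suc n) T f"
        by auto
      then show "\<exists>T. open T \<and> x \<in> T \<and> higher_differentiable_on n T (\<lambda>x. frechet_derivative f (at x) v)"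
        by auto
    qed
  qed
qed

lemma higher_differentiable_on_continuous:
  "higher_differentiable_on n S f \<Longrightarrow> continuous_on S f"
  by (cases n) (auto intro!: continuous_at_imp_continuous_on differentiable_imp_continuous_within)

lemma higher_differentiable_on_SucD:
  "higher_differentiable_on (Suc n) S f \<Longrightarrow> higher_differentiable_on n S f"
proof (induction n arbitrary: f)
  case 0
  then show ?case using higher_differentiable_on_continuous[of "Suc 0"] by auto
next
  case (Suc n)
  have "higher_differentiable_on n S (\<lambda>x. frechet_derivative f (at x) v)" for v
    using Suc.prems by (intro Suc.IH) (simp only: higher_differentiable_on.simps(2)[of "Suc n"])
  then show ?case
    using Suc.prems by (simp only: higher_differentiable_on.simps(2)) blast
qed

text \<open>For derivatives known by a formula: on an open set the formula may stand for
  \<open>frechet_derivative\<close>.\<close>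

lemma higher_differentiable_on_SucI:
  assumes "open S" "\<And>x. x \<in> S \<Longrightarrow> (f has_derivative f' x) (at x)"
    "\<And>v. higher_differentiable_on n S (\<lambda>x. f' x v)"
  shows "higher_differentiable_on (Suc n) S f"
  unfolding higher_differentiable_on.simps
proof (intro conjI ballI allI)
  show "f differentiable (at x)" if "x \<in> S" for x
    using assms(2)[OF that] by (auto simp: differentiable_def)
  show "higher_differentiable_on n S (\<lambda>x. frechet_derivative f (at x) v)" for v
    using assms(3) by (rule higher_differentiable_on_cong[THEN iffD1, OF assms(1), rotated])
      (simp add: frechet_derivative_eqI[OF assms(2)])
qed

lemma higher_differentiable_on_has_derivative:
  "higher_differentiable_on (Suc n) S f \<Longrightarrow> x \<in> S \<Longrightarrow>
    (f has_derivative frechet_derivative f (at x)) (at x)"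
  using frechet_derivative_works by auto

lemma higher_differentiable_on_const: "higher_differentiable_on n S (\<lambda>_. c)"
  by (induction n arbitrary: c) auto

lemma higher_differentiable_on_linear:
  assumes "open S" "bounded_linear f"
  shows "higher_differentiable_on n S f"
proof (cases n)
  case 0
  then show ?thesis using assms by (simp add: linear_continuous_on)
next
  case (Suc m)
  show ?thesis unfolding Suc
    by (rule higher_differentiable_on_SucI[OF assms(1) bounded_linear_imp_has_derivative[OF assms(2)]])
      (rule higher_differentiable_on_const)
qed

lemma higher_differentiable_on_add:
  assumes "open S" "higher_differentiable_on n S f" "higher_differentiable_on n S g"
  shows "higher_differentiable_on n S (\<lambda>x. f x + g x)"
  using assms(2,3)
proof (induction n arbitrary: f g)
  case 0
  then show ?case by (auto intro: continuous_intros)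
next
  case (Suc n)
  show ?case
    by (rule higher_differentiable_on_SucI[OF assms(1)
      has_derivative_add[OF higher_differentiable_on_has_derivative[OF Suc.prems(1)]
        higher_differentiable_on_has_derivative[OF Suc.prems(2)]]])
     (assumption+, rule Suc.IH, use Suc.prems in auto)
qed

lemma higher_differentiable_on_sum:
  assumes "open S" "\<And>i. i \<in> I \<Longrightarrow> higher_differentiable_on n S (f i)"
  shows "higher_differentiable_on n S (\<lambda>x. \<Sum>i\<in>I. f i x)"
  using assms(2)
  by (induction I rule: infinite_finite_induct)
    (auto intro: higher_differentiable_on_const higher_differentiable_on_add[OF assms(1)])

lemma higher_differentiable_on_bilinear:
  assumes "open S" "bounded_bilinear h"
    "higher_differentiable_on n S f" "higher_differentiable_on n S g"
  shows "higher_differentiable_on n S (\<lambda>x. h (f x) (g x))"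
  using assms(3,4)
proof (induction n arbitrary: f g)
  case 0
  then show ?case by (auto intro: bounded_bilinear.continuous_on[OF assms(2)])
next
  case (Suc n)
  show ?case
    by (rule higher_differentiable_on_SucI[OF assms(1)
      bounded_bilinear.FDERIV[OF assms(2) higher_differentiable_on_has_derivative[OF Suc.prems(1)]
        higher_differentiable_on_has_derivative[OF Suc.prems(2)]]])
     (assumption+, intro higher_differentiable_on_add[OF assms(1)] Suc.IH higher_differentiable_on_SucD[OF Suc.prems(1)]
        higher_differentiable_on_SucD[OF Suc.prems(2)], use Suc.prems in auto)
qed

lemma higher_differentiable_on_linear_compose:
  assumes "open S" "bounded_linear h" "higher_differentiable_on n S f"
  shows "higher_differentiable_on n S (\<lambda>x. h (f x))"
  using assms(3)
proof (induction n arbitrary: f)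
  case 0
  then show ?case by (auto intro: bounded_linear.continuous_on[OF assms(2)])
next
  case (Suc n)
  show ?case
    by (rule higher_differentiable_on_SucI[OF assms(1)
      bounded_linear.has_derivative[OF assms(2) higher_differentiable_on_has_derivative[OF Suc.prems(1)]]])
     (assumption+, rule Suc.IH, use Suc.prems in auto)
qed

lemma higher_differentiable_on_Pair:
  assumes "open S" "higher_differentiable_on n S f" "higher_differentiable_on n S g"
  shows "higher_differentiable_on n S (\<lambda>x. (f x, g x))"
proof -
  have "higher_differentiable_on n S (\<lambda>x. (f x, 0) + (0, g x))"
    by (intro higher_differentiable_on_add assms
        higher_differentiable_on_linear_compose[where h = "\<lambda>x. (x, 0)"]
        higher_differentiable_on_linear_compose[where h = "\<lambda>x. (0, x)"]
        bounded_linear_Pair bounded_linear_ident bounded_linear_zero)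
  then show ?thesis by simp
qed

text \<open>Finite-dimensionality is needed because \<^const>\<open>higher_differentiable_on\<close> only sees directional
  derivatives: the derivative of the outer function is expanded in a basis.\<close>

lemma higher_differentiable_on_compose:
  fixes f :: "'b::real_normed_vector \<Rightarrow> 'c::real_normed_vector"
    and g :: "'a::real_normed_vector \<Rightarrow> 'b"
  assumes fd: "findim TYPE('b)" and "open S"
    and "higher_differentiable_on n T f" "higher_differentiable_on n S g" "g ` S \<subseteq> T"
  shows "higher_differentiable_on n S (\<lambda>x. f (g x))"
  using assms(3-5)
proof (induction n arbitrary: f)
  case 0
  then show ?case using continuous_on_compose2[of T f S g] by auto
next
  case (Suc n)
  obtain B r where B: "finite B" "\<And>b. bounded_linear (r b)" "\<And>x::'b. (\<Sum>b\<in>B. r b x *\<^sub>R b) = x"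
    using findim_coordinates[OF fd] by metis
  let ?f' = "\<lambda>y. frechet_derivative f (at y)" and ?g' = "\<lambda>x. frechet_derivative g (at x)"
  have df: "(f has_derivative ?f' (g x)) (at (g x))" if "x \<in> S" for x
    using higher_differentiable_on_has_derivative[OF Suc.prems(1)] that Suc.prems(3) by auto
  have dg: "(g has_derivative ?g' x) (at x)" if "x \<in> S" for x
    using higher_differentiable_on_has_derivative[OF Suc.prems(2) that] .
  show ?case
  proof (rule higher_differentiable_on_SucI[OF \<open>open S\<close>])
    show "((\<lambda>x. f (g x)) has_derivative (\<lambda>v. \<Sum>b\<in>B. r b (?g' x v) *\<^sub>R ?f' (g x) b)) (at x)"
      if "x \<in> S" for x
    proof -
      interpret bounded_linear "?f' (g x)"
        using df[OF that] by (rule has_derivative_bounded_linear)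
      have "(\<Sum>b\<in>B. r b (?g' x v) *\<^sub>R ?f' (g x) b) = ?f' (g x) (?g' x v)" for v
        by (subst (2) B(3)[of "?g' x v", symmetric]) (simp only: sum scaleR)
      then show ?thesis
        using has_derivative_compose[OF dg[OF that] df[OF that]] by simp
    qed
    show "higher_differentiable_on n S (\<lambda>x. \<Sum>b\<in>B. r b (?g' x v) *\<^sub>R ?f' (g x) b)" for v
    proof (intro higher_differentiable_on_sum \<open>open S\<close>
        higher_differentiable_on_bilinear[OF _ bounded_bilinear_scaleR])
      show "higher_differentiable_on n S (\<lambda>x. r b (?g' x v))" for b
        by (rule higher_differentiable_on_linear_compose[OF \<open>open S\<close> B(2)]) (use Suc.prems(2) in simp)
      show "higher_differentiable_on n S (\<lambda>x. ?f' (g x) b)" for b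
        by (rule Suc.IH[OF _ higher_differentiable_on_SucD[OF Suc.prems(2)] Suc.prems(3)]) (use Suc.prems(1) in simp)
    qed
  qed
qed

section \<open>Calculus of \<open>smooth_on\<close>\<close>

lemma smooth_on_cong: "open S \<Longrightarrow> (\<And>x. x \<in> S \<Longrightarrow> f x = g x) \<Longrightarrow> smooth_on S f \<longleftrightarrow> smooth_on S g"
  unfolding smooth_on_def using higher_differentiable_on_cong by blast

lemma smooth_on_subset: "smooth_on S f \<Longrightarrow> T \<subseteq> S \<Longrightarrow> smooth_on T f"
  unfolding smooth_on_def using higher_differentiable_on_subset by blast

lemma smooth_on_local:
  "(\<And>x. x \<in> S \<Longrightarrow> \<exists>T. open T \<and> x \<in> T \<and> smooth_on T f) \<Longrightarrow> smooth_on S f"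
  unfolding smooth_on_def using higher_differentiable_on_local by metis

lemma smooth_on_continuous: "smooth_on S f \<Longrightarrow> continuous_on S f"
  unfolding smooth_on_def using higher_differentiable_on_continuous by blast

lemma smooth_on_has_derivative:
  "smooth_on S f \<Longrightarrow> x \<in> S \<Longrightarrow> (f has_derivative frechet_derivative f (at x)) (at x)"
  unfolding smooth_on_def using higher_differentiable_on_has_derivative by blast

lemma smooth_on_derivative: "smooth_on S f \<Longrightarrow> smooth_on S (\<lambda>x. frechet_derivative f (at x) v)"
  unfolding smooth_on_def using higher_differentiable_on.simps(2)[THEN iffD1] by blast

lemma smooth_on_const: "smooth_on S (\<lambda>_. c)"
  unfolding smooth_on_def using higher_differentiable_on_const by blast

lemma smooth_on_linear: "open S \<Longrightarrow> bounded_linear f \<Longrightarrow> smooth_on S f"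
  unfolding smooth_on_def using higher_differentiable_on_linear by blast

lemma smooth_on_linear_compose:
  "open S \<Longrightarrow> bounded_linear h \<Longrightarrow> smooth_on S f \<Longrightarrow> smooth_on S (\<lambda>x. h (f x))"
  unfolding smooth_on_def using higher_differentiable_on_linear_compose by blast

lemma smooth_on_bilinear:
  "open S \<Longrightarrow> bounded_bilinear h \<Longrightarrow> smooth_on S f \<Longrightarrow> smooth_on S g \<Longrightarrow> smooth_on S (\<lambda>x. h (f x) (g x))"
  unfolding smooth_on_def using higher_differentiable_on_bilinear by blast

lemma smooth_on_Pair:
  "open S \<Longrightarrow> smooth_on S f \<Longrightarrow> smooth_on S g \<Longrightarrow> smooth_on S (\<lambda>x. (f x, g x))"
  unfolding smooth_on_def using higher_differentiable_on_Pair by blast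

lemma smooth_on_compose:
  fixes f :: "'b::real_normed_vector \<Rightarrow> 'c::real_normed_vector"
    and g :: "'a::real_normed_vector \<Rightarrow> 'b"
  assumes "findim TYPE('b)" "open S" "smooth_on T f" "smooth_on S g" "g ` S \<subseteq> T"
  shows "smooth_on S (\<lambda>x. f (g x))"
  using assms unfolding smooth_on_def by (blast intro: higher_differentiable_on_compose)

text \<open>Regularity bootstrap: when the derivative is a smooth expression in \<open>f\<close>
  itself, each order of differentiability of \<open>f\<close> yields the next. It serves solutions
  of differential equations and representations.\<close>

lemma smooth_onI_bootstrap:
  assumes "open S" "\<And>x. x \<in> S \<Longrightarrow> (f has_derivative f' x) (at x)"
    and "\<And>n v. higher_differentiable_on n S f \<Longrightarrow> higher_differentiable_on n S (\<lambda>x. f' x v)"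
  shows "smooth_on S f"
proof -
  have "higher_differentiable_on n S f" for n
  proof (induction n)
    case 0
    show ?case
      using assms(2) by (auto intro!: continuous_at_imp_continuous_on has_derivative_continuous)
  next
    case (Suc n)
    then show ?case using higher_differentiable_on_SucI[OF assms(1,2)] assms(3) by blast
  qed
  then show ?thesis by (simp add: smooth_on_def)
qed

text \<open>The derivative is determined by its finitely many values on a basis, each continuous in
  the point, so it is uniformly close to \<open>D\<close> on a small ball; the mean value inequality
  for \<open>f - D\<close> does the rest. The two free points \<open>x\<close> and \<open>y\<close>
  make this strict differentiability, as contraction arguments require.\<close>

lemma smooth_on_strict_derivative:
  fixes f :: "'a::real_normed_vector \<Rightarrow> 'b::real_normed_vector"
  assumes fd: "findim TYPE('a)" and "open S" "smooth_on S f" "x0 \<in> S"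
    and D: "(f has_derivative D) (at x0)" and "\<delta> > 0"
  shows "\<exists>r>0. ball x0 r \<subseteq> S \<and>
    (\<forall>x\<in>ball x0 r. \<forall>y\<in>ball x0 r. norm (f x - f y - D (x - y)) \<le> \<delta> * norm (x - y))"
proof -
  obtain B r where B: "finite B" "\<And>b. bounded_linear (r b)" "\<And>x::'a. (\<Sum>b\<in>B. r b x *\<^sub>R b) = x"
    using findim_coordinates[OF fd] by metis
  let ?f' = "\<lambda>x. frechet_derivative f (at x)"
  have D': "D = ?f' x0" using D by (rule frechet_derivative_at)
  \<comment> \<open>Passing from basis vectors to an arbitrary \<open>v\<close> costs the factor
    \<open>\<Sum>b\<in>B. onorm (r b)\<close>; the added 1 keeps \<open>C\<close> positive.\<close>
  define C where "C = (\<Sum>b\<in>B. onorm (r b)) + 1"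
  have C: "C > 0" unfolding C_def
    by (intro add_nonneg_pos sum_nonneg onorm_pos_le B(2)) simp
  have "\<forall>\<^sub>F x in at x0. \<forall>b\<in>B. norm (?f' x b - ?f' x0 b) < \<delta> / C"
  proof (rule eventually_ball_finite[OF B(1)], rule ballI)
    fix b
    have "continuous_on S (\<lambda>x. ?f' x b)"
      using smooth_on_continuous[OF smooth_on_derivative[OF assms(3)]] .
    then have "isCont (\<lambda>x. ?f' x b) x0"
      using assms(2,4) continuous_on_eq_continuous_at by blast
    then have "((\<lambda>x. ?f' x b) \<longlongrightarrow> ?f' x0 b) (at x0)" by (simp add: isCont_def)
    then show "\<forall>\<^sub>F x in at x0. norm (?f' x b - ?f' x0 b) < \<delta> / C"
      using tendstoD[of "\<lambda>x. ?f' x b" "?f' x0 b" "at x0" "\<delta> / C"] \<open>\<delta> > 0\<close> C by (simp add: dist_norm)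
  qed
  moreover have "\<forall>\<^sub>F x in at x0. x \<in> S" using assms(2,4) by (rule eventually_at_in_open')
  ultimately have "\<forall>\<^sub>F x in at x0. x \<in> S \<and> (\<forall>b\<in>B. norm (?f' x b - ?f' x0 b) < \<delta> / C)"
    by eventually_elim auto
  then obtain d where d: "d > 0" "\<And>x. x \<noteq> x0 \<Longrightarrow> dist x x0 < d \<Longrightarrow>
      x \<in> S \<and> (\<forall>b\<in>B. norm (?f' x b - ?f' x0 b) < \<delta> / C)"
    unfolding eventually_at by blast
  have d': "x \<in> S" "\<And>b. b \<in> B \<Longrightarrow> norm (?f' x b - ?f' x0 b) \<le> \<delta> / C" if "x \<in> ball x0 d" for x
    using d(2)[of x] that assms(4) C \<open>\<delta> > 0\<close> by (cases "x = x0"; force simp: dist_commute)+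
  have bl: "bounded_linear (?f' x)" if "x \<in> S" for x
    using smooth_on_has_derivative[OF assms(3) that] by (rule has_derivative_bounded_linear)
  have bound: "norm (?f' x v - ?f' x0 v) \<le> \<delta> * norm v" if x: "x \<in> ball x0 d" for x v
  proof -
    interpret L: bounded_linear "\<lambda>v. ?f' x v - ?f' x0 v"
      using bl d'(1)[OF x] assms(4) by (intro bounded_linear_sub) auto
    have "?f' x v - ?f' x0 v = (\<Sum>b\<in>B. r b v *\<^sub>R (?f' x b - ?f' x0 b))"
      using L.sum[of "\<lambda>b. r b v *\<^sub>R b" B] B(3)[of v] by (simp add: L.scaleR)
    also have "norm \<dots> \<le> (\<Sum>b\<in>B. norm (r b v *\<^sub>R (?f' x b - ?f' x0 b)))"
      by (rule norm_sum)
    also have "\<dots> \<le> (\<Sum>b\<in>B. (onorm (r b) * norm v) * (\<delta> / C))"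
    proof (rule sum_mono)
      fix b assume b: "b \<in> B"
      have "norm (r b v *\<^sub>R (?f' x b - ?f' x0 b)) = norm (r b v) * norm (?f' x b - ?f' x0 b)"
        by simp
      also have "\<dots> \<le> (onorm (r b) * norm v) * (\<delta> / C)"
        by (intro mult_mono onorm B(2) d'(2)[OF x b]) (simp_all add: onorm_pos_le B(2))
      finally show "norm (r b v *\<^sub>R (?f' x b - ?f' x0 b)) \<le> (onorm (r b) * norm v) * (\<delta> / C)" .
    qed
    also have "\<dots> = (C - 1) * (norm v * \<delta> / C)"
      by (simp add: C_def sum_distrib_right sum_divide_distrib mult.assoc)
    also have "\<dots> \<le> C * (norm v * \<delta> / C)"
      using C \<open>\<delta> > 0\<close> by (intro mult_right_mono) auto
    also have "\<dots> = \<delta> * norm v" using C by simp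
    finally show ?thesis .
  qed
  have "norm (f x - f y - D (x - y)) \<le> \<delta> * norm (x - y)"
    if x: "x \<in> ball x0 d" and y: "y \<in> ball x0 d" for x y
  proof -
    interpret D: bounded_linear D using D by (rule has_derivative_bounded_linear)
    have "norm ((f x - D x) - (f y - D y)) \<le> \<delta> * norm (x - y)"
    proof (rule differentiable_bound[of "ball x0 d" "\<lambda>x. f x - D x" "\<lambda>x v. ?f' x v - D v"])
      show "((\<lambda>x. f x - D x) has_derivative (\<lambda>v. ?f' z v - D v)) (at z within ball x0 d)"
        if "z \<in> ball x0 d" for z
        using smooth_on_has_derivative[OF assms(3) d'(1)[OF that]]
        by (intro has_derivative_diff bounded_linear_imp_has_derivative D.bounded_linear_axioms)
          (rule has_derivative_at_withinI)
      show "onorm (\<lambda>v. ?f' z v - D v) \<le> \<delta>" if "z \<in> ball x0 d" for z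
        using bound[OF that] \<open>\<delta> > 0\<close> by (intro onorm_bound) (auto simp: D')
    qed (use x y in auto)
    then show ?thesis by (simp add: D.diff algebra_simps)
  qed
  then show ?thesis using d(1) d'(1) by blast
qed

text \<open>Strict differentiability with error 1. The Lipschitz bound feeds
  \<open>picard_local\<close>.\<close>

lemma smooth_on_locally_lipschitz:
  fixes f :: "'a::real_normed_vector \<Rightarrow> 'b::real_normed_vector"
  assumes fd: "findim TYPE('a)" and "open S" "smooth_on S f" "x0 \<in> S"
  shows "\<exists>r>0. \<exists>L\<ge>0. ball x0 r \<subseteq> S \<and>
    (\<forall>x\<in>ball x0 r. \<forall>y\<in>ball x0 r. norm (f x - f y) \<le> L * norm (x - y))"
proof -
  let ?D = "frechet_derivative f (at x0)"
  have D: "(f has_derivative ?D) (at x0)" using smooth_on_has_derivative[OF assms(3,4)] .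
  interpret D: bounded_linear ?D using D by (rule has_derivative_bounded_linear)
  obtain r where r: "r > 0" "ball x0 r \<subseteq> S"
    "\<And>x y. x \<in> ball x0 r \<Longrightarrow> y \<in> ball x0 r \<Longrightarrow> norm (f x - f y - ?D (x - y)) \<le> 1 * norm (x - y)"
    using smooth_on_strict_derivative[OF assms D, of 1] by auto
  have "norm (f x - f y) \<le> (onorm ?D + 1) * norm (x - y)" if "x \<in> ball x0 r" "y \<in> ball x0 r" for x y
  proof -
    have "norm (f x - f y) \<le> norm (?D (x - y)) + norm (f x - f y - ?D (x - y))"
      by (rule norm_triangle_sub)
    also have "\<dots> \<le> onorm ?D * norm (x - y) + 1 * norm (x - y)"
      by (intro add_mono r(3) that onorm D.bounded_linear_axioms)
    finally show ?thesis by (simp add: algebra_simps)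
  qed
  then show ?thesis
    using r onorm_pos_le[OF D.bounded_linear_axioms] by (intro exI[of _ r] conjI exI[of _ "onorm ?D + 1"]) auto
qed

section \<open>Smooth maps between manifolds\<close>

lemma smooth_atlasD:
  assumes "smooth_atlas M \<A>" "(U, \<phi>) \<in> \<A>"
  shows "inj_on \<phi> U" "open (\<phi> ` U)" "U \<subseteq> M"
proof -
  have 1: "\<Union>(fst ` \<A>) = M" and 2: "\<forall>(U, \<phi>)\<in>\<A>. inj_on \<phi> U \<and> open (\<phi> ` U)"
    using assms(1) unfolding smooth_atlas_def by blast+
  show "inj_on \<phi> U" "open (\<phi> ` U)" using bspec[OF 2 assms(2)] by auto
  show "U \<subseteq> M" using assms(2) unfolding 1[symmetric] by force
qed

lemma smooth_atlas_transition:
  assumes "smooth_atlas M \<A>" "(U, \<phi>) \<in> \<A>" "(V, \<psi>) \<in> \<A>"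
  shows "open (\<phi> ` (U \<inter> V))" "smooth_on (\<phi> ` (U \<inter> V)) (\<lambda>x. \<psi> (inv_into U \<phi> x))"
proof -
  have "\<forall>(U, \<phi>)\<in>\<A>. \<forall>(V, \<psi>)\<in>\<A>.
        open (\<phi> ` (U \<inter> V)) \<and> smooth_on (\<phi> ` (U \<inter> V)) (\<lambda>x. \<psi> (inv_into U \<phi> x))"
    using assms(1) unfolding smooth_atlas_def by (elim conjE)
  from bspec[OF bspec[OF this assms(2), unfolded prod.case] assms(3)]
  show "open (\<phi> ` (U \<inter> V))" "smooth_on (\<phi> ` (U \<inter> V)) (\<lambda>x. \<psi> (inv_into U \<phi> x))"
    by simp_all
qed

lemma smooth_atlas_cover:
  assumes "smooth_atlas M \<A>" "x \<in> M"
  obtains U \<phi> where "(U, \<phi>) \<in> \<A>" "x \<in> U"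
proof -
  have "x \<in> \<Union>(fst ` \<A>)" using assms by (simp add: smooth_atlas_def)
  then show thesis using that by auto
qed

lemma smooth_atlas_vec: "smooth_atlas UNIV (vec_atlas :: ('v::real_normed_vector, 'v) atlas)"
proof -
  have "smooth_on UNIV (id :: 'v \<Rightarrow> 'v)"
    using smooth_on_linear[OF open_UNIV bounded_linear_ident] by (simp add: id_def)
  moreover have "inv_into UNIV id = (id :: 'v \<Rightarrow> 'v)"
    by (auto simp: inv_id)
  ultimately show ?thesis by (simp add: smooth_atlas_def vec_atlas_def)
qed

lemma prod_atlas_vec: "prod_atlas vec_atlas vec_atlas = vec_atlas"
  by (auto simp: prod_atlas_def vec_atlas_def map_prod_def id_def)

lemma inv_into_map_prod:
  assumes "inj_on \<phi> U" "inj_on \<psi> V" "z \<in> map_prod \<phi> \<psi> ` (U \<times> V)"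
  shows "inv_into (U \<times> V) (map_prod \<phi> \<psi>) z = (inv_into U \<phi> (fst z), inv_into V \<psi> (snd z))"
proof -
  obtain u v where "u \<in> U" "v \<in> V" "z = (\<phi> u, \<psi> v)" using assms(3) by auto
  moreover have "inj_on (map_prod \<phi> \<psi>) (U \<times> V)" using assms by (auto simp: inj_on_def)
  ultimately show ?thesis using assms inv_into_f_f[of "map_prod \<phi> \<psi>" "U \<times> V" "(u, v)"] by simp
qed

lemma smooth_atlas_prod:
  fixes \<A> :: "('m, 'v::real_normed_vector) atlas" and \<B> :: "('n, 'w::real_normed_vector) atlas"
  assumes A: "smooth_atlas M \<A>" and B: "smooth_atlas N \<B>"
    and fd: "findim TYPE('v)" "findim TYPE('w)"
  shows "smooth_atlas (M \<times> N) (prod_atlas \<A> \<B>)"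
proof -
  have cov: "\<Union>(fst ` prod_atlas \<A> \<B>) = M \<times> N"
  proof
    show "\<Union>(fst ` prod_atlas \<A> \<B>) \<subseteq> M \<times> N"
      using smooth_atlasD(3)[OF A] smooth_atlasD(3)[OF B] by (fastforce simp: prod_atlas_def)
    show "M \<times> N \<subseteq> \<Union>(fst ` prod_atlas \<A> \<B>)"
    proof
      fix z assume z: "z \<in> M \<times> N"
      then have zM: "fst z \<in> M" "snd z \<in> N" by auto
      obtain U \<phi> where U: "(U, \<phi>) \<in> \<A>" "fst z \<in> U" using smooth_atlas_cover[OF A zM(1)] by blast
      obtain V \<psi> where V: "(V, \<psi>) \<in> \<B>" "snd z \<in> V" using smooth_atlas_cover[OF B zM(2)] by blast
      have "(U \<times> V, map_prod \<phi> \<psi>) \<in> prod_atlas \<A> \<B>" using U V by (auto simp: prod_atlas_def)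
      moreover have "z \<in> U \<times> V" using U V by (cases z) auto
      ultimately show "z \<in> \<Union>(fst ` prod_atlas \<A> \<B>)" by force
    qed
  qed
  have im: "map_prod f g ` (X \<times> Y) = f ` X \<times> g ` Y" for f :: "'m \<Rightarrow> 'v" and g :: "'n \<Rightarrow> 'w" and X Y
    by auto
  have 1: "inj_on \<phi> U \<and> open (\<phi> ` U)" if P: "(U, \<phi>) \<in> prod_atlas \<A> \<B>" for U \<phi>
  proof -
    obtain U1 f1 V1 g1 where c: "(U1, f1) \<in> \<A>" "(V1, g1) \<in> \<B>" "U = U1 \<times> V1" "\<phi> = map_prod f1 g1"
      using P by (auto simp: prod_atlas_def)
    show ?thesis
      using smooth_atlasD[OF A c(1)] smooth_atlasD[OF B c(2)]
      by (auto simp: c(3,4) im open_Times inj_on_def)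
  qed
  have 2: "open (\<phi> ` (U \<inter> V)) \<and> smooth_on (\<phi> ` (U \<inter> V)) (\<lambda>x. \<psi> (inv_into U \<phi> x))"
    if P: "(U, \<phi>) \<in> prod_atlas \<A> \<B>" "(V, \<psi>) \<in> prod_atlas \<A> \<B>" for U \<phi> V \<psi>
  proof -
    obtain U1 f1 V1 g1 where c: "(U1, f1) \<in> \<A>" "(V1, g1) \<in> \<B>" "U = U1 \<times> V1" "\<phi> = map_prod f1 g1"
      using P(1) by (auto simp: prod_atlas_def)
    obtain U2 f2 V2 g2 where d: "(U2, f2) \<in> \<A>" "(V2, g2) \<in> \<B>" "V = U2 \<times> V2" "\<psi> = map_prod f2 g2"
      using P(2) by (auto simp: prod_atlas_def)
    have im': "\<phi> ` (U \<inter> V) = f1 ` (U1 \<inter> U2) \<times> g1 ` (V1 \<inter> V2)"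
      using im[of f1 g1 "U1 \<inter> U2" "V1 \<inter> V2"] by (simp add: c d Times_Int_Times)
    have o: "open (\<phi> ` (U \<inter> V))"
      unfolding im' using smooth_atlas_transition(1)[OF A c(1) d(1)] smooth_atlas_transition(1)[OF B c(2) d(2)]
      by (rule open_Times)
    have "smooth_on (\<phi> ` (U \<inter> V)) (\<lambda>z. (f2 (inv_into U1 f1 (fst z)), g2 (inv_into V1 g1 (snd z))))"
    proof (rule smooth_on_Pair[OF o])
      show "smooth_on (\<phi> ` (U \<inter> V)) (\<lambda>z. f2 (inv_into U1 f1 (fst z)))"
        by (rule smooth_on_compose[OF fd(1) o smooth_atlas_transition(2)[OF A c(1) d(1)]
              smooth_on_linear[OF o bounded_linear_fst]]) (auto simp: im')
      show "smooth_on (\<phi> ` (U \<inter> V)) (\<lambda>z. g2 (inv_into V1 g1 (snd z)))"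
        by (rule smooth_on_compose[OF fd(2) o smooth_atlas_transition(2)[OF B c(2) d(2)]
              smooth_on_linear[OF o bounded_linear_snd]]) (auto simp: im')
    qed
    also have "?this \<longleftrightarrow> smooth_on (\<phi> ` (U \<inter> V)) (\<lambda>x. \<psi> (inv_into U \<phi> x))"
    proof (rule smooth_on_cong[OF o])
      fix z assume "z \<in> \<phi> ` (U \<inter> V)"
      then have "z \<in> map_prod f1 g1 ` (U1 \<times> V1)" by (auto simp: c)
      then show "(f2 (inv_into U1 f1 (fst z)), g2 (inv_into V1 g1 (snd z))) = \<psi> (inv_into U \<phi> z)"
        by (simp add: c(3,4) d(4) inv_into_map_prod[OF smooth_atlasD(1)[OF A c(1)] smooth_atlasD(1)[OF B c(2)]])
    qed
    finally show ?thesis using o by blast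
  qed
  show ?thesis
    unfolding smooth_atlas_def
    using cov 1 2 by (intro conjI) auto
qed

section \<open>Change of charts and composition of smooth maps\<close>

lemma manifold_smooth_onI:
  assumes "\<And>x. x \<in> S \<Longrightarrow> \<exists>U \<phi> V \<psi> N F. (U, \<phi>) \<in> \<A> \<and> (V, \<psi>) \<in> \<B> \<and> x \<in> U \<and> open N \<and> \<phi> x \<in> N \<and>
    smooth_on N F \<and> (\<forall>y\<in>U \<inter> S. \<phi> y \<in> N \<longrightarrow> f y \<in> V \<and> \<psi> (f y) = F (\<phi> y))"
  shows "manifold_smooth_on \<A> \<B> S f"
  unfolding manifold_smooth_on_def
proof
  fix x assume "x \<in> S"
  from assms[OF this] obtain U \<phi> V \<psi> N F where "(U, \<phi>) \<in> \<A>" "(V, \<psi>) \<in> \<B>" and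
    "x \<in> U \<and> open N \<and> \<phi> x \<in> N \<and>
    smooth_on N F \<and> (\<forall>y\<in>U \<inter> S. \<phi> y \<in> N \<longrightarrow> f y \<in> V \<and> \<psi> (f y) = F (\<phi> y))"
    by blast
  then show "\<exists>(U, \<phi>)\<in>\<A>. \<exists>(V, \<psi>)\<in>\<B>. \<exists>N F. x \<in> U \<and> open N \<and> \<phi> x \<in> N \<and> smooth_on N F \<and>
        (\<forall>y\<in>U \<inter> S. \<phi> y \<in> N \<longrightarrow> f y \<in> V \<and> \<psi> (f y) = F (\<phi> y))"
    by (intro bexI[of _ "(U, \<phi>)"] bexI[of _ "(V, \<psi>)"]) auto
qed

lemma manifold_smooth_onE_some:
  assumes "manifold_smooth_on \<A> \<B> S f" "x \<in> S"
  obtains U \<phi> V \<psi> N F where "(U, \<phi>) \<in> \<A>" "(V, \<psi>) \<in> \<B>" "x \<in> U" "open N" "\<phi> x \<in> N"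
    "smooth_on N F" "\<And>y. y \<in> U \<Longrightarrow> y \<in> S \<Longrightarrow> \<phi> y \<in> N \<Longrightarrow> f y \<in> V \<and> \<psi> (f y) = F (\<phi> y)"
proof -
  from bspec[OF assms(1)[unfolded manifold_smooth_on_def] assms(2)]
  obtain c d N F where c: "c \<in> \<A>" and d: "d \<in> \<B>" and *: "x \<in> fst c" "open N" "snd c x \<in> N" "smooth_on N F"
    "\<forall>y\<in>fst c \<inter> S. snd c y \<in> N \<longrightarrow> f y \<in> fst d \<and> snd d (f y) = F (snd c y)"
    by (auto simp: case_prod_unfold)
  show thesis
    by (rule that[of "fst c" "snd c" "fst d" "snd d" N F]) (use c d * in auto)
qed

text \<open>The definition provides one pair of charts; composing with the transition maps on both
  sides carries the local representative to any prescribed pair. Since \<open>S\<close> is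
  arbitrary, \<open>F\<close> is tied to \<open>f\<close> only at points of
  \<open>S\<close>.\<close>

lemma manifold_smooth_onE:
  fixes \<A> :: "('m, 'v::real_normed_vector) atlas" and \<B> :: "('n, 'w::real_normed_vector) atlas"
  assumes f: "manifold_smooth_on \<A> \<B> S f" and A: "smooth_atlas M \<A>" and B: "smooth_atlas M' \<B>"
    and fd: "findim TYPE('v)" "findim TYPE('w)"
    and x: "x \<in> S" and U: "(U, \<phi>) \<in> \<A>" "x \<in> U" and V: "(V, \<psi>) \<in> \<B>" "f x \<in> V"
  obtains N F where "open N" "\<phi> x \<in> N" "N \<subseteq> \<phi> ` U" "smooth_on N F"
    "\<And>y. y \<in> U \<Longrightarrow> y \<in> S \<Longrightarrow> \<phi> y \<in> N \<Longrightarrow> f y \<in> V \<and> \<psi> (f y) = F (\<phi> y)"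
proof -
  obtain U' \<phi>' V' \<psi>' N' F' where c: "(U', \<phi>') \<in> \<A>" "(V', \<psi>') \<in> \<B>" "x \<in> U'" "open N'" "\<phi>' x \<in> N'"
    "smooth_on N' F'" and F': "\<And>y. y \<in> U' \<Longrightarrow> y \<in> S \<Longrightarrow> \<phi>' y \<in> N' \<Longrightarrow> f y \<in> V' \<and> \<psi>' (f y) = F' (\<phi>' y)"
    by (rule manifold_smooth_onE_some[OF f x]) (rule that)
  define \<tau> where "\<tau> = (\<lambda>z. \<phi>' (inv_into U \<phi> z))"
  define \<sigma> where "\<sigma> = (\<lambda>z. \<psi> (inv_into V' \<psi>' z))"
  have \<tau>: "open (\<phi> ` (U \<inter> U'))" "smooth_on (\<phi> ` (U \<inter> U')) \<tau>"
    using smooth_atlas_transition[OF A U(1) c(1)] by (auto simp: \<tau>_def)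
  have \<sigma>: "open (\<psi>' ` (V' \<inter> V))" "smooth_on (\<psi>' ` (V' \<inter> V)) \<sigma>"
    using smooth_atlas_transition[OF B c(2) V(1)] by (auto simp: \<sigma>_def)
  have \<tau>': "\<tau> (\<phi> y) = \<phi>' y" if "y \<in> U" for y
    using smooth_atlasD(1)[OF A U(1)] that by (simp add: \<tau>_def)
  have \<sigma>': "\<sigma> (\<psi>' y) = \<psi> y" if "y \<in> V'" for y
    using smooth_atlasD(1)[OF B c(2)] that by (simp add: \<sigma>_def)
  \<comment> \<open>\<open>N1\<close> keeps the values of \<open>F'\<close> inside the overlap of
    the two target charts; \<open>N\<close> below keeps the points inside the overlap of the two
    source charts.\<close>
  define N1 where "N1 = N' \<inter> F' -` (\<psi>' ` (V' \<inter> V))"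
  define N where "N = \<phi> ` (U \<inter> U') \<inter> \<tau> -` N1"
  have N1: "open N1"
    unfolding N1_def using continuous_open_preimage[OF smooth_on_continuous[OF c(6)] c(4) \<sigma>(1)]
    by (simp add: Int_commute)
  have N: "open N"
    unfolding N_def using continuous_open_preimage[OF smooth_on_continuous[OF \<tau>(2)] \<tau>(1) N1]
    by (simp add: Int_commute)
  show thesis
  proof (rule that[of N "\<lambda>z. \<sigma> (F' (\<tau> z))"])
    show "open N" by fact
    have "f x \<in> V'" "\<psi>' (f x) = F' (\<phi>' x)" using F'[OF c(3) x c(5)] by auto
    then have "F' (\<phi>' x) \<in> \<psi>' ` (V' \<inter> V)" using V(2) by (metis IntI imageI)
    then show "\<phi> x \<in> N" using c(3,5) U(2) by (auto simp: N_def N1_def \<tau>')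
    show "N \<subseteq> \<phi> ` U" by (auto simp: N_def)
    have "smooth_on N (\<lambda>z. F' (\<tau> z))"
      by (rule smooth_on_compose[OF fd(1) N c(6) smooth_on_subset[OF \<tau>(2)]]) (auto simp: N_def N1_def)
    then show "smooth_on N (\<lambda>z. \<sigma> (F' (\<tau> z)))"
      by (rule smooth_on_compose[OF fd(2) N \<sigma>(2)]) (auto simp: N_def N1_def)
    fix y assume y: "y \<in> U" "y \<in> S" "\<phi> y \<in> N"
    then obtain y' where "y' \<in> U" "y' \<in> U'" "\<phi> y = \<phi> y'" by (auto simp: N_def)
    then have yU': "y \<in> U'" using inj_onD[OF smooth_atlasD(1)[OF A U(1)] \<open>\<phi> y = \<phi> y'\<close> y(1)] by simp
    have "\<phi>' y \<in> N1" using y(3) \<tau>'[OF y(1)] by (simp add: N_def)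
    then have "\<phi>' y \<in> N'" "F' (\<phi>' y) \<in> \<psi>' ` (V' \<inter> V)" by (auto simp: N1_def)
    with F'[OF yU' y(2)] have fy: "f y \<in> V'" "\<psi>' (f y) = F' (\<phi>' y)" "\<psi>' (f y) \<in> \<psi>' ` (V' \<inter> V)"
      by auto
    then obtain v where "v \<in> V'" "v \<in> V" "\<psi>' (f y) = \<psi>' v" by auto
    then have "f y \<in> V" using inj_onD[OF smooth_atlasD(1)[OF B c(2)] \<open>\<psi>' (f y) = \<psi>' v\<close> fy(1)] by simp
    then show "f y \<in> V \<and> \<psi> (f y) = \<sigma> (F' (\<tau> (\<phi> y)))"
      using \<tau>'[OF y(1)] \<sigma>'[OF fy(1)] fy(2) by simp
  qed
qed

lemma manifold_smooth_on_mem: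
  assumes "manifold_smooth_on \<A> \<B> S f" "smooth_atlas M \<B>" "x \<in> S"
  shows "f x \<in> M"
proof -
  obtain U \<phi> V \<psi> N F where "(U, \<phi>) \<in> \<A>" "(V, \<psi>) \<in> \<B>" "x \<in> U" "open N" "\<phi> x \<in> N"
    "smooth_on N F" "\<And>y. y \<in> U \<Longrightarrow> y \<in> S \<Longrightarrow> \<phi> y \<in> N \<Longrightarrow> f y \<in> V \<and> \<psi> (f y) = F (\<phi> y)"
    by (rule manifold_smooth_onE_some[OF assms(1,3)]) (rule that)
  then show ?thesis using smooth_atlasD(3)[OF assms(2)] assms(3) by blast
qed

lemma manifold_smooth_on_cong:
  assumes "manifold_smooth_on \<A> \<B> S f" "T \<subseteq> S" "\<And>x. x \<in> T \<Longrightarrow> g x = f x"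
  shows "manifold_smooth_on \<A> \<B> T g"
proof (rule manifold_smooth_onI)
  fix x assume "x \<in> T"
  then have "x \<in> S" using assms(2) by auto
  then obtain U \<phi> V \<psi> N F where
   "(U, \<phi>) \<in> \<A>" "(V, \<psi>) \<in> \<B>" "x \<in> U" "open N" "\<phi> x \<in> N"
    "smooth_on N F" and "\<And>y. y \<in> U \<Longrightarrow> y \<in> S \<Longrightarrow> \<phi> y \<in> N \<Longrightarrow> f y \<in> V \<and> \<psi> (f y) = F (\<phi> y)"
    by (rule manifold_smooth_onE_some[OF assms(1)]) (rule that)
  then show "\<exists>U \<phi> V \<psi> N F. (U, \<phi>) \<in> \<A> \<and> (V, \<psi>) \<in> \<B> \<and> x \<in> U \<and> open N \<and> \<phi> x \<in> N \<and>
    smooth_on N F \<and> (\<forall>y\<in>U \<inter> T. \<phi> y \<in> N \<longrightarrow> g y \<in> V \<and> \<psi> (g y) = F (\<phi> y))"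
    using assms(2,3)
    by (intro exI[of _ U] exI[of _ \<phi>] exI[of _ V] exI[of _ \<psi>] exI[of _ N] exI[of _ F]) auto
qed

lemma manifold_smooth_on_subset:
  "manifold_smooth_on \<A> \<B> S f \<Longrightarrow> T \<subseteq> S \<Longrightarrow> manifold_smooth_on \<A> \<B> T f"
  by (erule manifold_smooth_on_cong) auto

lemma manifold_smooth_on_compose:
  fixes \<A> :: "('m, 'v::real_normed_vector) atlas" and \<B> :: "('n, 'w::real_normed_vector) atlas"
    and \<C> :: "('k, 'u::real_normed_vector) atlas"
  assumes f: "manifold_smooth_on \<A> \<B> S f" and g: "manifold_smooth_on \<B> \<C> R g" and "f ` S \<subseteq> R"
    and A: "smooth_atlas M \<A>" and B: "smooth_atlas M' \<B>" and fd: "findim TYPE('v)" "findim TYPE('w)"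
  shows "manifold_smooth_on \<A> \<C> S (\<lambda>x. g (f x))"
proof (rule manifold_smooth_onI)
  fix x assume x: "x \<in> S"
  then have fx: "f x \<in> R" using assms(3) by auto
  obtain V \<psi> W \<zeta> N2 F2 where 2: "(V, \<psi>) \<in> \<B>" "(W, \<zeta>) \<in> \<C>" "f x \<in> V" "open N2" "\<psi> (f x) \<in> N2"
    "smooth_on N2 F2" "\<And>y. y \<in> V \<Longrightarrow> y \<in> R \<Longrightarrow> \<psi> y \<in> N2 \<Longrightarrow> g y \<in> W \<and> \<zeta> (g y) = F2 (\<psi> y)"
    by (rule manifold_smooth_onE_some[OF g fx]) (rule that)
  obtain U \<phi> where U: "(U, \<phi>) \<in> \<A>" "x \<in> U"
    by (rule manifold_smooth_onE_some[OF f x]) (rule that)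
  obtain N1 F1 where 1: "open N1" "\<phi> x \<in> N1" "smooth_on N1 F1"
    "\<And>y. y \<in> U \<Longrightarrow> y \<in> S \<Longrightarrow> \<phi> y \<in> N1 \<Longrightarrow> f y \<in> V \<and> \<psi> (f y) = F1 (\<phi> y)"
    by (rule manifold_smooth_onE[OF f A B fd x U 2(1,3)]) (rule that)
  define N where "N = N1 \<inter> F1 -` N2"
  have N: "open N"
    unfolding N_def using continuous_open_preimage[OF smooth_on_continuous[OF 1(3)] 1(1) 2(4)]
    by (simp add: Int_commute)
  have "smooth_on N (\<lambda>z. F2 (F1 z))"
    by (rule smooth_on_compose[OF fd(2) N 2(6) smooth_on_subset[OF 1(3)]]) (auto simp: N_def)
  moreover have "\<phi> x \<in> N" using 1(4)[OF U(2) x 1(2)] 2(5) 1(2) by (auto simp: N_def)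
  moreover have "g (f y) \<in> W \<and> \<zeta> (g (f y)) = F2 (F1 (\<phi> y))" if "y \<in> U \<inter> S" "\<phi> y \<in> N" for y
  proof -
    have "f y \<in> V \<and> \<psi> (f y) = F1 (\<phi> y)" using that 1(4)[of y] by (auto simp: N_def)
    then show ?thesis using 2(7)[of "f y"] that assms(3) by (auto simp: N_def)
  qed
  ultimately show "\<exists>U \<phi> V \<psi> N F. (U, \<phi>) \<in> \<A> \<and> (V, \<psi>) \<in> \<C> \<and> x \<in> U \<and> open N \<and> \<phi> x \<in> N \<and>
    smooth_on N F \<and> (\<forall>y\<in>U \<inter> S. \<phi> y \<in> N \<longrightarrow> g (f y) \<in> V \<and> \<psi> (g (f y)) = F (\<phi> y))"
    using U 2(2) N
    by (intro exI[of _ U] exI[of _ \<phi>] exI[of _ W] exI[of _ \<zeta>] exI[of _ N] exI[of _ "\<lambda>z. F2 (F1 z)"]) auto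
qed

lemma manifold_smooth_on_Pair:
  fixes \<A> :: "('m, 'v::real_normed_vector) atlas" and \<B> :: "('n, 'w::real_normed_vector) atlas"
    and \<C> :: "('k, 'u::real_normed_vector) atlas"
  assumes f: "manifold_smooth_on \<A> \<B> S f" and g: "manifold_smooth_on \<A> \<C> S g"
    and A: "smooth_atlas M \<A>" and C: "smooth_atlas M' \<C>" and fd: "findim TYPE('v)" "findim TYPE('u)"
  shows "manifold_smooth_on \<A> (prod_atlas \<B> \<C>) S (\<lambda>x. (f x, g x))"
proof (rule manifold_smooth_onI)
  fix x assume x: "x \<in> S"
  obtain U \<phi> V \<psi> N1 F1 where 1: "(U, \<phi>) \<in> \<A>" "(V, \<psi>) \<in> \<B>" "x \<in> U" "open N1" "\<phi> x \<in> N1"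
    "smooth_on N1 F1" "\<And>y. y \<in> U \<Longrightarrow> y \<in> S \<Longrightarrow> \<phi> y \<in> N1 \<Longrightarrow> f y \<in> V \<and> \<psi> (f y) = F1 (\<phi> y)"
    by (rule manifold_smooth_onE_some[OF f x]) (rule that)
  obtain W \<zeta> where W: "(W, \<zeta>) \<in> \<C>" "g x \<in> W"
    by (rule manifold_smooth_onE_some[OF g x]) (rule that, assumption, use x in simp)
  obtain N2 F2 where 2: "open N2" "\<phi> x \<in> N2" "smooth_on N2 F2"
    "\<And>y. y \<in> U \<Longrightarrow> y \<in> S \<Longrightarrow> \<phi> y \<in> N2 \<Longrightarrow> g y \<in> W \<and> \<zeta> (g y) = F2 (\<phi> y)"
    by (rule manifold_smooth_onE[OF g A C fd x 1(1,3) W]) (rule that)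
  have N: "open (N1 \<inter> N2)" using 1(4) 2(1) by auto
  have "smooth_on (N1 \<inter> N2) (\<lambda>z. (F1 z, F2 z))"
    by (intro smooth_on_Pair[OF N] smooth_on_subset[OF 1(6)] smooth_on_subset[OF 2(3)]) auto
  moreover have "(V \<times> W, map_prod \<psi> \<zeta>) \<in> prod_atlas \<B> \<C>"
    using 1(2) W(1) by (auto simp: prod_atlas_def)
  ultimately show "\<exists>U \<phi> V \<psi> N F. (U, \<phi>) \<in> \<A> \<and> (V, \<psi>) \<in> prod_atlas \<B> \<C> \<and> x \<in> U \<and> open N \<and> \<phi> x \<in> N \<and>
    smooth_on N F \<and> (\<forall>y\<in>U \<inter> S. \<phi> y \<in> N \<longrightarrow> (f y, g y) \<in> V \<and> \<psi> (f y, g y) = F (\<phi> y))"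
    using 1 2 N by (intro exI[of _ U] exI[of _ \<phi>] exI[of _ "V \<times> W"] exI[of _ "map_prod \<psi> \<zeta>"]
      exI[of _ "N1 \<inter> N2"] exI[of _ "\<lambda>z. (F1 z, F2 z)"]) auto
qed

lemma manifold_smooth_on_ident:
  assumes "smooth_atlas M \<A>" "S \<subseteq> M"
  shows "manifold_smooth_on \<A> \<A> S (\<lambda>x. x)"
proof (rule manifold_smooth_onI)
  fix x assume "x \<in> S"
  then obtain U \<phi> where "(U, \<phi>) \<in> \<A>" "x \<in> U" using smooth_atlas_cover[OF assms(1)] assms(2) by blast
  then show "\<exists>U \<phi> V \<psi> N F. (U, \<phi>) \<in> \<A> \<and> (V, \<psi>) \<in> \<A> \<and> x \<in> U \<and> open N \<and> \<phi> x \<in> N \<and>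
    smooth_on N F \<and> (\<forall>y\<in>U \<inter> S. \<phi> y \<in> N \<longrightarrow> y \<in> V \<and> \<psi> y = F (\<phi> y))"
    using smooth_on_linear[OF open_UNIV bounded_linear_ident]
    by (intro exI[of _ U] exI[of _ \<phi>] exI[of _ UNIV] exI[of _ "\<lambda>x. x"]) auto
qed

lemma manifold_smooth_on_const:
  assumes "smooth_atlas M \<A>" "S \<subseteq> M" "smooth_atlas M' \<B>" "c \<in> M'"
  shows "manifold_smooth_on \<A> \<B> S (\<lambda>_. c)"
proof (rule manifold_smooth_onI)
  fix x assume "x \<in> S"
  then obtain U \<phi> where U: "(U, \<phi>) \<in> \<A>" "x \<in> U" using smooth_atlas_cover[OF assms(1)] assms(2) by blast
  obtain V \<psi> where V: "(V, \<psi>) \<in> \<B>" "c \<in> V" using smooth_atlas_cover[OF assms(3,4)] by blast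
  show "\<exists>U \<phi> V \<psi> N F. (U, \<phi>) \<in> \<A> \<and> (V, \<psi>) \<in> \<B> \<and> x \<in> U \<and> open N \<and> \<phi> x \<in> N \<and>
    smooth_on N F \<and> (\<forall>y\<in>U \<inter> S. \<phi> y \<in> N \<longrightarrow> c \<in> V \<and> \<psi> c = F (\<phi> y))"
    using U V smooth_on_const[of UNIV "\<psi> c"]
    by (intro exI[of _ U] exI[of _ \<phi>] exI[of _ V] exI[of _ \<psi>] exI[of _ UNIV] exI[of _ "\<lambda>_. \<psi> c"]) auto
qed

lemma manifold_smooth_on_fst:
  assumes "smooth_atlas M \<A>" "smooth_atlas M' \<B>" "S \<subseteq> M \<times> M'"
  shows "manifold_smooth_on (prod_atlas \<A> \<B>) \<A> S fst"
proof (rule manifold_smooth_onI)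
  fix x assume "x \<in> S"
  then have x: "fst x \<in> M" "snd x \<in> M'" using assms(3) by auto
  obtain U \<phi> where U: "(U, \<phi>) \<in> \<A>" "fst x \<in> U" using smooth_atlas_cover[OF assms(1) x(1)] by blast
  obtain V \<psi> where V: "(V, \<psi>) \<in> \<B>" "snd x \<in> V" using smooth_atlas_cover[OF assms(2) x(2)] by blast
  have "(U \<times> V, map_prod \<phi> \<psi>) \<in> prod_atlas \<A> \<B>" using U V by (auto simp: prod_atlas_def)
  then show "\<exists>U \<phi> V \<psi> N F. (U, \<phi>) \<in> prod_atlas \<A> \<B> \<and> (V, \<psi>) \<in> \<A> \<and> x \<in> U \<and> open N \<and> \<phi> x \<in> N \<and>
    smooth_on N F \<and> (\<forall>y\<in>U \<inter> S. \<phi> y \<in> N \<longrightarrow> fst y \<in> V \<and> \<psi> (fst y) = F (\<phi> y))"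
    using U V smooth_on_linear[OF open_UNIV bounded_linear_fst]
    by (intro exI[of _ "U \<times> V"] exI[of _ "map_prod \<phi> \<psi>"] exI[of _ U] exI[of _ \<phi>] exI[of _ UNIV] exI[of _ fst])
      (auto simp: mem_Times_iff)
qed

lemma manifold_smooth_on_snd:
  assumes "smooth_atlas M \<A>" "smooth_atlas M' \<B>" "S \<subseteq> M \<times> M'"
  shows "manifold_smooth_on (prod_atlas \<A> \<B>) \<B> S snd"
proof (rule manifold_smooth_onI)
  fix x assume "x \<in> S"
  then have x: "fst x \<in> M" "snd x \<in> M'" using assms(3) by auto
  obtain U \<phi> where U: "(U, \<phi>) \<in> \<A>" "fst x \<in> U" using smooth_atlas_cover[OF assms(1) x(1)] by blast
  obtain V \<psi> where V: "(V, \<psi>) \<in> \<B>" "snd x \<in> V" using smooth_atlas_cover[OF assms(2) x(2)] by blast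
  have "(U \<times> V, map_prod \<phi> \<psi>) \<in> prod_atlas \<A> \<B>" using U V by (auto simp: prod_atlas_def)
  then show "\<exists>U \<phi> V \<psi> N F. (U, \<phi>) \<in> prod_atlas \<A> \<B> \<and> (V, \<psi>) \<in> \<B> \<and> x \<in> U \<and> open N \<and> \<phi> x \<in> N \<and>
    smooth_on N F \<and> (\<forall>y\<in>U \<inter> S. \<phi> y \<in> N \<longrightarrow> snd y \<in> V \<and> \<psi> (snd y) = F (\<phi> y))"
    using U V smooth_on_linear[OF open_UNIV bounded_linear_snd]
    by (intro exI[of _ "U \<times> V"] exI[of _ "map_prod \<phi> \<psi>"] exI[of _ V] exI[of _ \<psi>] exI[of _ UNIV] exI[of _ snd])
      (auto simp: mem_Times_iff)
qed

lemma manifold_smooth_on_chart: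
  assumes "(U, \<phi>) \<in> \<A>"
  shows "manifold_smooth_on \<A> vec_atlas U \<phi>"
proof (rule manifold_smooth_onI)
  fix x assume "x \<in> U"
  then show "\<exists>U' \<phi>' V \<psi> N F. (U', \<phi>') \<in> \<A> \<and> (V, \<psi>) \<in> vec_atlas \<and> x \<in> U' \<and> open N \<and> \<phi>' x \<in> N \<and>
    smooth_on N F \<and> (\<forall>y\<in>U' \<inter> U. \<phi>' y \<in> N \<longrightarrow> \<phi> y \<in> V \<and> \<psi> (\<phi> y) = F (\<phi>' y))"
    using assms smooth_on_linear[OF open_UNIV bounded_linear_ident]
    by (intro exI[of _ U] exI[of _ \<phi>] exI[of _ UNIV] exI[of _ id] exI[of _ "\<lambda>x. x"]) (auto simp: vec_atlas_def)
qed

lemma manifold_smooth_on_chart_inv: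
  assumes "smooth_atlas M \<A>" "(U, \<phi>) \<in> \<A>"
  shows "manifold_smooth_on vec_atlas \<A> (\<phi> ` U) (inv_into U \<phi>)"
proof (rule manifold_smooth_onI)
  fix x assume x: "x \<in> \<phi> ` U"
  have o: "open (\<phi> ` U)" using smooth_atlasD[OF assms] by auto
  show "\<exists>U' \<phi>' V \<psi> N F. (U', \<phi>') \<in> vec_atlas \<and> (V, \<psi>) \<in> \<A> \<and> x \<in> U' \<and> open N \<and> \<phi>' x \<in> N \<and>
    smooth_on N F \<and> (\<forall>y\<in>U' \<inter> \<phi> ` U. \<phi>' y \<in> N \<longrightarrow> inv_into U \<phi> y \<in> V \<and> \<psi> (inv_into U \<phi> y) = F (\<phi>' y))"
    using assms x o smooth_on_linear[OF o bounded_linear_ident] smooth_atlasD(1)[OF assms]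
    by (intro exI[of _ UNIV] exI[of _ id] exI[of _ U] exI[of _ \<phi>] exI[of _ "\<phi> ` U"] exI[of _ "\<lambda>x. x"])
     (auto simp: vec_atlas_def)
qed

lemma manifold_smooth_on_vecI:
  assumes "open S" "smooth_on S f"
  shows "manifold_smooth_on vec_atlas vec_atlas S f"
proof (rule manifold_smooth_onI)
  fix x assume "x \<in> S"
  then show "\<exists>U \<phi> V \<psi> N F. (U, \<phi>) \<in> vec_atlas \<and> (V, \<psi>) \<in> vec_atlas \<and> x \<in> U \<and> open N \<and> \<phi> x \<in> N \<and>
    smooth_on N F \<and> (\<forall>y\<in>U \<inter> S. \<phi> y \<in> N \<longrightarrow> f y \<in> V \<and> \<psi> (f y) = F (\<phi> y))"
    using assms by (intro exI[of _ UNIV] exI[of _ id] exI[of _ S] exI[of _ f]) (auto simp: vec_atlas_def)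
qed

lemma manifold_smooth_on_vec_domainE:
  fixes \<B> :: "('n, 'w::real_normed_vector) atlas" and f :: "'v::real_normed_vector \<Rightarrow> 'n"
  assumes "manifold_smooth_on vec_atlas \<B> S f" "smooth_atlas M \<B>"
    "findim TYPE('v)" "findim TYPE('w)"
    "x \<in> S" "(V, \<psi>) \<in> \<B>" "f x \<in> V"
  obtains N F where "open N" "x \<in> N" "smooth_on N F"
    "\<And>y. y \<in> S \<Longrightarrow> y \<in> N \<Longrightarrow> f y \<in> V \<and> \<psi> (f y) = F y"
  using manifold_smooth_onE[OF assms(1) smooth_atlas_vec assms(2-5), of UNIV id V \<psi> thesis] assms(6,7)
  by (auto simp: vec_atlas_def)

text \<open>On an open domain the local representative agrees with the map in a full neighbourhood,
  so the coordinate expression itself is smooth.\<close>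

lemma manifold_smooth_on_open_domainE:
  fixes \<B> :: "('n, 'w::real_normed_vector) atlas" and f :: "'v::real_normed_vector \<Rightarrow> 'n"
  assumes "manifold_smooth_on vec_atlas \<B> S f" "smooth_atlas M \<B>"
    "findim TYPE('v)" "findim TYPE('w)" "open S"
    "x \<in> S" "(V, \<psi>) \<in> \<B>" "f x \<in> V"
  obtains N where "open N" "x \<in> N" "N \<subseteq> S" "\<And>y. y \<in> N \<Longrightarrow> f y \<in> V" "smooth_on N (\<lambda>y. \<psi> (f y))"
proof -
  obtain N F where N: "open N" "x \<in> N" "smooth_on N F"
    "\<And>y. y \<in> S \<Longrightarrow> y \<in> N \<Longrightarrow> f y \<in> V \<and> \<psi> (f y) = F y"
    by (rule manifold_smooth_on_vec_domainE[OF assms(1-4,6-8)]) (rule that)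
  have o: "open (N \<inter> S)" using N(1) assms(5) by auto
  have "smooth_on (N \<inter> S) (\<lambda>y. \<psi> (f y)) \<longleftrightarrow> smooth_on (N \<inter> S) F"
    using N(4) by (intro smooth_on_cong[OF o]) auto
  then have "smooth_on (N \<inter> S) (\<lambda>y. \<psi> (f y))" using smooth_on_subset[OF N(3)] by auto
  then show thesis using that[of "N \<inter> S"] N assms(6) o by auto
qed

lemma manifold_smooth_on_vecD:
  fixes f :: "'v::real_normed_vector \<Rightarrow> 'w::real_normed_vector"
  assumes "manifold_smooth_on vec_atlas vec_atlas S f" "findim TYPE('v)" "findim TYPE('w)" "open S"
  shows "smooth_on S f"
proof (rule smooth_on_local)
  fix x assume x: "x \<in> S"
  have "(UNIV, id) \<in> vec_atlas" "f x \<in> UNIV" by (auto simp: vec_atlas_def)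
  then obtain N where "open N" "x \<in> N" "smooth_on N (\<lambda>y. id (f y))"
    by (rule manifold_smooth_on_open_domainE[OF assms(1) smooth_atlas_vec assms(2-4) x]) (rule that)
  then show "\<exists>T. open T \<and> x \<in> T \<and> smooth_on T f" by auto
qed

section \<open>The topology of an atlas\<close>

lemma openin_chart_preimage:
  assumes A: "smooth_atlas M \<A>" and "(U, \<phi>) \<in> \<A>" "open N"
  shows "openin (manifold_topology \<A>) (U \<inter> \<phi> -` N)"
  unfolding openin_manifold_topology[OF A]
proof (intro conjI ballI, safe)
  show "x \<in> M" if "x \<in> U" for x using smooth_atlasD(3)[OF A assms(2)] that by auto
  fix U' \<phi>' assume c: "(U', \<phi>') \<in> \<A>"
  let ?\<tau> = "\<lambda>z. \<phi> (inv_into U' \<phi>' z)"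
  note tr = smooth_atlas_transition[OF A c assms(2)]
  have inj: "inj_on \<phi>' U'" using smooth_atlasD(1)[OF A c] .
  have "\<phi>' ` (U' \<inter> (U \<inter> \<phi> -` N)) = \<phi>' ` (U' \<inter> U) \<inter> ?\<tau> -` N"
    using inj by (auto simp: inv_into_f_f)
  also have "open \<dots>"
    using continuous_open_preimage[OF smooth_on_continuous[OF tr(2)] tr(1) assms(3)]
    by (simp add: Int_commute)
  finally show "open (\<phi>' ` (U' \<inter> (U \<inter> \<phi> -` N)))" .
qed

lemma topspace_manifold_topology:
  assumes "smooth_atlas M \<A>"
  shows "topspace (manifold_topology \<A>) = M"
proof
  show "topspace (manifold_topology \<A>) \<subseteq> M"
    using openin_topspace[of "manifold_topology \<A>"] openin_manifold_topology[OF assms] by auto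
  have "openin (manifold_topology \<A>) M"
    using smooth_atlasD[OF assms] by (auto simp: openin_manifold_topology[OF assms] Int_absorb2)
  then show "M \<subseteq> topspace (manifold_topology \<A>)" by (rule openin_subset)
qed

lemma manifold_topology_vec: "manifold_topology (vec_atlas :: ('v::real_normed_vector, 'v) atlas) = euclidean"
  unfolding topology_eq openin_manifold_topology[OF smooth_atlas_vec] by (auto simp: vec_atlas_def)

text \<open>Continuity of a smooth map relative to \<open>S\<close>, phrased with a neighbourhood of
  a single point so that no subspace topology enters.\<close>

lemma manifold_smooth_on_preimage:
  fixes \<A> :: "('m, 'v::real_normed_vector) atlas" and \<B> :: "('n, 'w::real_normed_vector) atlas"
  assumes f: "manifold_smooth_on \<A> \<B> S f" and A: "smooth_atlas M \<A>" and B: "smooth_atlas M' \<B>"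
    and W: "openin (manifold_topology \<B>) W" and x: "x \<in> S" "f x \<in> W"
  obtains T where "openin (manifold_topology \<A>) T" "x \<in> T" "\<And>y. y \<in> T \<Longrightarrow> y \<in> S \<Longrightarrow> f y \<in> W"
proof -
  obtain U \<phi> V \<psi> N F where c: "(U, \<phi>) \<in> \<A>" "(V, \<psi>) \<in> \<B>" "x \<in> U" "open N" "\<phi> x \<in> N"
    "smooth_on N F" "\<And>y. y \<in> U \<Longrightarrow> y \<in> S \<Longrightarrow> \<phi> y \<in> N \<Longrightarrow> f y \<in> V \<and> \<psi> (f y) = F (\<phi> y)"
    by (rule manifold_smooth_onE_some[OF f x(1)]) (rule that)
  have o: "open (\<psi> ` (V \<inter> W))" using W c(2) unfolding openin_manifold_topology[OF B] by auto
  define N' where "N' = N \<inter> F -` (\<psi> ` (V \<inter> W))"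
  have N': "open N'"
    unfolding N'_def using continuous_open_preimage[OF smooth_on_continuous[OF c(6)] c(4) o]
    by (simp add: Int_commute)
  show thesis
  proof (rule that[of "U \<inter> \<phi> -` N'"])
    show "openin (manifold_topology \<A>) (U \<inter> \<phi> -` N')" by (rule openin_chart_preimage[OF A c(1) N'])
    have fx: "f x \<in> V" "\<psi> (f x) = F (\<phi> x)" using c(7)[OF c(3) x(1) c(5)] by auto
    then have "F (\<phi> x) \<in> \<psi> ` (V \<inter> W)" using x(2) by (metis IntI imageI)
    then show "x \<in> U \<inter> \<phi> -` N'" using c(3,5) by (auto simp: N'_def)
    fix y assume y: "y \<in> U \<inter> \<phi> -` N'" "y \<in> S"
    then have "f y \<in> V" "\<psi> (f y) = F (\<phi> y)" "F (\<phi> y) \<in> \<psi> ` (V \<inter> W)"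
      using c(7)[of y] by (auto simp: N'_def)
    then obtain v where v: "v \<in> V" "v \<in> W" "\<psi> (f y) = \<psi> v" by auto
    show "f y \<in> W" using inj_onD[OF smooth_atlasD(1)[OF B c(2)] v(3) \<open>f y \<in> V\<close> v(1)] v(2) by simp
  qed
qed

lemma manifold_smooth_on_local:
  fixes \<A> :: "('m, 'v::real_normed_vector) atlas" and \<B> :: "('n, 'w::real_normed_vector) atlas"
  assumes A: "smooth_atlas M \<A>"
    and loc: "\<And>x. x \<in> S \<Longrightarrow> \<exists>T. openin (manifold_topology \<A>) T \<and> x \<in> T \<and> manifold_smooth_on \<A> \<B> (S \<inter> T) f"
  shows "manifold_smooth_on \<A> \<B> S f"
proof (rule manifold_smooth_onI)
  fix x assume x: "x \<in> S"
  obtain T where T: "openin (manifold_topology \<A>) T" "x \<in> T" "manifold_smooth_on \<A> \<B> (S \<inter> T) f"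
    using loc[OF x] by blast
  obtain U \<phi> V \<psi> N F where c: "(U, \<phi>) \<in> \<A>" "(V, \<psi>) \<in> \<B>" "x \<in> U" "open N" "\<phi> x \<in> N"
    "smooth_on N F" "\<And>y. y \<in> U \<Longrightarrow> y \<in> S \<inter> T \<Longrightarrow> \<phi> y \<in> N \<Longrightarrow> f y \<in> V \<and> \<psi> (f y) = F (\<phi> y)"
    by (rule manifold_smooth_onE_some[OF T(3) IntI[OF x T(2)]]) (rule that)
  define N' where "N' = N \<inter> \<phi> ` (U \<inter> T)"
  have N': "open N'"
    unfolding N'_def using T(1) c(1,4) unfolding openin_manifold_topology[OF A] by auto
  have "f y \<in> V \<and> \<psi> (f y) = F (\<phi> y)" if "y \<in> U \<inter> S" "\<phi> y \<in> N'" for y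
  proof -
    have "y \<in> T" using that smooth_atlasD(1)[OF A c(1)] by (auto simp: N'_def dest: inj_onD)
    then show ?thesis using c(7) that by (auto simp: N'_def)
  qed
  then show "\<exists>U \<phi> V \<psi> N F. (U, \<phi>) \<in> \<A> \<and> (V, \<psi>) \<in> \<B> \<and> x \<in> U \<and> open N \<and> \<phi> x \<in> N \<and>
    smooth_on N F \<and> (\<forall>y\<in>U \<inter> S. \<phi> y \<in> N \<longrightarrow> f y \<in> V \<and> \<psi> (f y) = F (\<phi> y))"
    using c N' T(2) smooth_on_subset[OF c(6), of N']
    by (intro exI[of _ U] exI[of _ \<phi>] exI[of _ V] exI[of _ \<psi>] exI[of _ N'] exI[of _ F]) (auto simp: N'_def)
qed

section \<open>Derivatives along curves\<close>

lemma has_vector_derivative_transform_eventually: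
  assumes "(f has_vector_derivative D) (at x within S)" "\<forall>\<^sub>F u in at x within S. f u = g u"
    "f x = g x" "x \<in> S"
  shows "(g has_vector_derivative D) (at x within S)"
  using has_derivative_transform_eventually[OF assms(1)[unfolded has_vector_derivative_def] assms(2-4)]
  by (simp add: has_vector_derivative_def)

lemma has_vector_derivative_compose_derivative:
  assumes "(y has_vector_derivative A) (at t within S)" "(f has_derivative L) (at (y t))"
  shows "((\<lambda>u. f (y u)) has_vector_derivative L A) (at t within S)"
proof -
  interpret L: bounded_linear L using assms(2) by (rule has_derivative_bounded_linear)
  show ?thesis
    using has_derivative_compose[OF assms(1)[unfolded has_vector_derivative_def] assms(2)]
    by (simp add: has_vector_derivative_def L.scaleR)
qed

lemma has_vector_derivative_eventually_mem:
  assumes "(y has_vector_derivative A) (at t within S)" "open N" "y t \<in> N"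
  shows "\<forall>\<^sub>F u in at t within S. y u \<in> N"
proof -
  have "continuous (at t within S) y"
    using assms(1) by (rule has_vector_derivative_continuous)
  then show ?thesis using assms(2,3) by (auto simp: continuous_within intro: topological_tendstoD)
qed

section \<open>Velocities of curves in a Lie group\<close>

locale lie_grp = group G for G :: "('g, 'e::banach) lie_group_data" (structure) +
  assumes lie: "lie_group G"
begin

section \<open>The chart at the identity\<close>

abbreviation U where "U \<equiv> fst (id_chart G)"
abbreviation \<phi> where "\<phi> \<equiv> id_coord G"
abbreviation \<iota> where "\<iota> \<equiv> id_point G"
abbreviation e0 where "e0 \<equiv> id_coord G \<one>"
abbreviation \<Omega> where "\<Omega> \<equiv> id_coord G ` fst (id_chart G)"

lemma fd: "findim TYPE('e)" and atl: "smooth_atlas (carrier G) (charts G)"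
  and smooth_mult: "manifold_smooth_on (prod_atlas (charts G) (charts G)) (charts G)
       (carrier G \<times> carrier G) (\<lambda>(x, y). x \<otimes> y)"
  and smooth_inv: "manifold_smooth_on (charts G) (charts G) (carrier G) (\<lambda>x. inv x)"
  using lie by (auto simp: lie_group_def findim_def)

lemma fd2: "findim TYPE('e \<times> 'e)" using findim_prod[OF fd fd] .

lemma id_chart_props: "id_chart G \<in> charts G \<and> \<one> \<in> U"
proof -
  obtain V \<psi> where "(V, \<psi>) \<in> charts G" "\<one> \<in> V" using smooth_atlas_cover[OF atl one_closed] .
  then have "\<exists>c. c \<in> charts G \<and> \<one> \<in> fst c" by force
  then show ?thesis unfolding id_chart_def by (rule someI_ex)
qed

lemma id_chart_mem: "(U, \<phi>) \<in> charts G" and one_U: "\<one> \<in> U"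
  using id_chart_props by (auto simp: id_coord_def)

lemma U_carrier: "g \<in> U \<Longrightarrow> g \<in> carrier G" and open_\<Omega>: "open \<Omega>" and inj_\<phi>: "inj_on \<phi> U"
  using smooth_atlasD[OF atl id_chart_mem] by auto

lemma pt_coord: "g \<in> U \<Longrightarrow> \<iota> (\<phi> g) = g"
  unfolding id_point_def using inj_\<phi> by (rule inv_into_f_f)

lemma coord_pt: "x \<in> \<Omega> \<Longrightarrow> \<phi> (\<iota> x) = x" and pt_U: "x \<in> \<Omega> \<Longrightarrow> \<iota> x \<in> U"
  unfolding id_point_def by (rule f_inv_into_f, assumption) (rule inv_into_into)

lemma pt_carrier: "x \<in> \<Omega> \<Longrightarrow> \<iota> x \<in> carrier G" using pt_U U_carrier by blast

lemma e0_\<Omega>: "e0 \<in> \<Omega>" and pt_e0: "\<iota> e0 = \<one>"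
  using one_U pt_coord by auto

lemma smooth_pt: "manifold_smooth_on vec_atlas (charts G) \<Omega> \<iota>"
  unfolding id_point_def by (rule manifold_smooth_on_chart_inv[OF atl id_chart_mem])

lemma smooth_coord: "manifold_smooth_on (charts G) vec_atlas U \<phi>"
  by (rule manifold_smooth_on_chart[OF id_chart_mem])

lemma smooth_on_carrier:
  "manifold_smooth_on \<A> (charts G) S a \<Longrightarrow> x \<in> S \<Longrightarrow> a x \<in> carrier G"
  using manifold_smooth_on_mem[OF _ atl] .

lemma smooth_mult':
  fixes \<A> :: "('m, 'v::real_normed_vector) atlas"
  assumes A: "smooth_atlas M \<A>" "findim TYPE('v)"
    and a: "manifold_smooth_on \<A> (charts G) S a" and b: "manifold_smooth_on \<A> (charts G) S b"
  shows "manifold_smooth_on \<A> (charts G) S (\<lambda>x. a x \<otimes> b x)"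
proof -
  have "manifold_smooth_on \<A> (charts G) S (\<lambda>x. (\<lambda>(x, y). x \<otimes> y) (a x, b x))"
    by (rule manifold_smooth_on_compose[OF manifold_smooth_on_Pair[OF a b A(1) atl A(2) fd] smooth_mult _ A(1)
        smooth_atlas_prod[OF atl atl fd fd] A(2) fd2])
      (use smooth_on_carrier a b in auto)
  then show ?thesis by simp
qed

lemma smooth_inv':
  fixes \<A> :: "('m, 'v::real_normed_vector) atlas"
  assumes A: "smooth_atlas M \<A>" "findim TYPE('v)" and a: "manifold_smooth_on \<A> (charts G) S a"
  shows "manifold_smooth_on \<A> (charts G) S (\<lambda>x. inv (a x))"
  by (rule manifold_smooth_on_compose[OF a smooth_inv _ A(1) atl A(2) fd]) (use smooth_on_carrier a in auto)

lemma smooth_const':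
  assumes "smooth_atlas M \<A>" "S \<subseteq> M" "g \<in> carrier G"
  shows "manifold_smooth_on \<A> (charts G) S (\<lambda>_. g)"
  using manifold_smooth_on_const[OF assms(1,2) atl assms(3)] .

lemmas smooth_mult_vec = smooth_mult'[OF smooth_atlas_vec]
lemmas smooth_inv_vec = smooth_inv'[OF smooth_atlas_vec]
lemmas smooth_const_vec = smooth_const'[OF smooth_atlas_vec subset_UNIV]

lemma coord_smooth:
  fixes f :: "'v::real_normed_vector \<Rightarrow> 'g"
  assumes "manifold_smooth_on vec_atlas (charts G) S f" "findim TYPE('v)" "open S" "x \<in> S" "f x \<in> U"
  obtains N where "open N" "x \<in> N" "N \<subseteq> S" "\<And>y. y \<in> N \<Longrightarrow> f y \<in> U" "smooth_on N (\<lambda>y. \<phi> (f y))"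
  by (rule manifold_smooth_on_open_domainE[OF assms(1) atl assms(2) fd assms(3,4) id_chart_mem assms(5)]) (rule that)

text \<open>Conjugation is smooth near the identity, hence the \<open>frechet_derivative\<close> in
  the definition of \<open>Ad\<close> is a genuine derivative.\<close>

lemma Ad_has_derivative:
  assumes g: "g \<in> carrier G"
  shows "((\<lambda>x. \<phi> (g \<otimes> \<iota> x \<otimes> inv g)) has_derivative Ad G g) (at e0)"
proof -
  have sm: "manifold_smooth_on vec_atlas (charts G) \<Omega> (\<lambda>x. g \<otimes> \<iota> x \<otimes> inv g)"
    by (intro smooth_mult_vec fd smooth_const_vec smooth_pt g inv_closed)
  have 1: "g \<otimes> \<iota> e0 \<otimes> inv g \<in> U" using g one_U by (simp add: pt_e0)
  obtain N where N: "open N" "e0 \<in> N" "N \<subseteq> \<Omega>" "\<And>y. y \<in> N \<Longrightarrow> g \<otimes> \<iota> y \<otimes> inv g \<in> U"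
    "smooth_on N (\<lambda>y. \<phi> (g \<otimes> \<iota> y \<otimes> inv g))"
    by (rule coord_smooth[OF sm fd open_\<Omega> e0_\<Omega> 1]) (rule that)
  show ?thesis unfolding Ad_def by (rule smooth_on_has_derivative[OF N(5,2)])
qed

lemma Ad_bounded_linear: "g \<in> carrier G \<Longrightarrow> bounded_linear (Ad G g)"
  using Ad_has_derivative by (rule has_derivative_bounded_linear)

lemma Ad_one: "Ad G \<one> = (\<lambda>x. x)"
proof -
  have "((\<lambda>x. x) has_derivative (\<lambda>x. x)) (at e0)" by simp
  then have "((\<lambda>x. \<phi> (\<one> \<otimes> \<iota> x \<otimes> inv \<one>)) has_derivative (\<lambda>x. x)) (at e0)"
    by (rule has_derivative_transform_within_open[OF _ open_\<Omega> e0_\<Omega>]) (simp add: pt_carrier coord_pt)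
  then show ?thesis using has_derivative_unique Ad_has_derivative[OF one_closed] by blast
qed

text \<open>The condition on \<open>U\<close> is needed because \<^const>\<open>id_coord\<close> is arbitrary outside of its chart.\<close>

definition lvel :: "(real \<Rightarrow> 'g) \<Rightarrow> 'e \<Rightarrow> real \<Rightarrow> real set \<Rightarrow> bool" where
  "lvel c A t S \<longleftrightarrow> c t \<in> carrier G \<and>
     (\<forall>\<^sub>F u in at t within S. c u \<in> carrier G \<and> inv (c t) \<otimes> c u \<in> U) \<and>
     ((\<lambda>u. \<phi> (inv (c t) \<otimes> c u)) has_vector_derivative A) (at t within S)"

text \<open>The left-trivialised differential of \<open>f\<close> at \<open>g\<close>. A full
  Frechet derivative in the translated chart is demanded, not just directional ones, so that every
  curve with a velocity can be fed into it.\<close>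

definition gderiv :: "('g \<Rightarrow> 'v::real_normed_vector) \<Rightarrow> 'g \<Rightarrow> ('e \<Rightarrow> 'v) \<Rightarrow> bool" where
  "gderiv f g L \<longleftrightarrow> ((\<lambda>x. f (g \<otimes> \<iota> x)) has_derivative L) (at e0)"

lemma lvel_carrier: "lvel c A t S \<Longrightarrow> c t \<in> carrier G"
  and lvel_eventually: "lvel c A t S \<Longrightarrow> \<forall>\<^sub>F u in at t within S. c u \<in> carrier G \<and> inv (c t) \<otimes> c u \<in> U"
  and lvel_deriv: "lvel c A t S \<Longrightarrow> ((\<lambda>u. \<phi> (inv (c t) \<otimes> c u)) has_vector_derivative A) (at t within S)"
  by (auto simp: lvel_def)

lemma gderiv_linear: "gderiv f g L \<Longrightarrow> bounded_linear L"
  unfolding gderiv_def by (rule has_derivative_bounded_linear)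

lemma inv_mult_cancel: "a \<in> carrier G \<Longrightarrow> b \<in> carrier G \<Longrightarrow> a \<otimes> (inv a \<otimes> b) = b"
  and inv_mult_cancel': "a \<in> carrier G \<Longrightarrow> b \<in> carrier G \<Longrightarrow> inv a \<otimes> (a \<otimes> b) = b"
  by (simp_all add: m_assoc[symmetric])

text \<open>Near \<open>t\<close> one has \<open>c u = c t \<otimes> \<iota> (\<phi> (inv (c t)
  \<otimes> c u))\<close>, so this is the chain rule in the chart translated to
  \<open>c t\<close>.\<close>

lemma lvel_gderiv:
  assumes "lvel c A t S" "gderiv f (c t) L" "t \<in> S"
  shows "((\<lambda>u. f (c u)) has_vector_derivative L A) (at t within S)"
proof (rule has_vector_derivative_transform_eventually)
  have ct: "c t \<in> carrier G" using lvel_carrier[OF assms(1)] .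
  show "((\<lambda>u. f (c t \<otimes> \<iota> (\<phi> (inv (c t) \<otimes> c u)))) has_vector_derivative L A) (at t within S)"
    using has_vector_derivative_compose_derivative[OF lvel_deriv[OF assms(1)], of "\<lambda>x. f (c t \<otimes> \<iota> x)" L]
      assms(2) ct by (simp add: gderiv_def)
  show "\<forall>\<^sub>F u in at t within S. f (c t \<otimes> \<iota> (\<phi> (inv (c t) \<otimes> c u))) = f (c u)"
    using lvel_eventually[OF assms(1)]
    by eventually_elim (simp add: pt_coord ct inv_mult_cancel)
  show "f (c t \<otimes> \<iota> (\<phi> (inv (c t) \<otimes> c t))) = f (c t)"
    using ct by (simp add: pt_e0)
qed (fact assms(3))

text \<open>The curve is smooth only relative to \<open>S\<close>, for instance
  \<open>{0..1}\<close>. Near \<open>t\<close> its displacement from \<open>c t\<close> is the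
  restriction of a smooth \<open>F\<close> on an open set, which supplies one-sided velocities at
  endpoints as well.\<close>

lemma smooth_curve_local:
  fixes c :: "real \<Rightarrow> 'g"
  assumes c: "manifold_smooth_on vec_atlas (charts G) S c" and t: "t \<in> S"
  obtains N F where "open N" "t \<in> N" "smooth_on N F"
    "\<And>u. u \<in> S \<Longrightarrow> u \<in> N \<Longrightarrow> inv (c t) \<otimes> c u \<in> U \<and> \<phi> (inv (c t) \<otimes> c u) = F u"
proof -
  have ct: "c t \<in> carrier G" using smooth_on_carrier[OF c t] .
  have sm: "manifold_smooth_on vec_atlas (charts G) S (\<lambda>u. inv (c t) \<otimes> c u)"
    using ct by (intro smooth_mult_vec findim_euclidean smooth_const_vec c) simp
  have 1: "inv (c t) \<otimes> c t \<in> U" using ct one_U by simp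
  show thesis
    by (rule manifold_smooth_on_vec_domainE[OF sm atl findim_euclidean fd t id_chart_mem 1]) (rule that)
qed

lemma lvelI:
  assumes c: "manifold_smooth_on vec_atlas (charts G) S c" and t: "t \<in> S"
    and D: "((\<lambda>u. \<phi> (inv (c t) \<otimes> c u)) has_vector_derivative A) (at t within S)"
  shows "lvel c A t S"
proof -
  obtain N F where N: "open N" "t \<in> N" "smooth_on N F"
    "\<And>u. u \<in> S \<Longrightarrow> u \<in> N \<Longrightarrow> inv (c t) \<otimes> c u \<in> U \<and> \<phi> (inv (c t) \<otimes> c u) = F u"
    by (rule smooth_curve_local[OF c t]) (rule that)
  have "\<forall>\<^sub>F u in at t within S. u \<in> S \<and> u \<in> N"
    using N(1,2) by (auto simp: eventually_at_topological)
  then have "\<forall>\<^sub>F u in at t within S. c u \<in> carrier G \<and> inv (c t) \<otimes> c u \<in> U"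
    by eventually_elim (use N(4) smooth_on_carrier[OF c] in auto)
  then show ?thesis using D smooth_on_carrier[OF c t] by (simp add: lvel_def)
qed

lemma lvel_exists:
  assumes c: "manifold_smooth_on vec_atlas (charts G) S c" and t: "t \<in> S"
  obtains A where "lvel c A t S"
proof -
  obtain N F where N: "open N" "t \<in> N" "smooth_on N F"
    "\<And>u. u \<in> S \<Longrightarrow> u \<in> N \<Longrightarrow> inv (c t) \<otimes> c u \<in> U \<and> \<phi> (inv (c t) \<otimes> c u) = F u"
    by (rule smooth_curve_local[OF c t]) (rule that)
  have "(F has_vector_derivative frechet_derivative F (at t) 1) (at t within S)"
    using has_vector_derivative_compose_derivative[OF has_vector_derivative_id
        smooth_on_has_derivative[OF N(3,2)]] .
  moreover have "\<forall>\<^sub>F u in at t within S. u \<in> S \<and> u \<in> N"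
    using N(1,2) by (auto simp: eventually_at_topological)
  then have "\<forall>\<^sub>F u in at t within S. F u = \<phi> (inv (c t) \<otimes> c u)"
    by eventually_elim (use N(4) in auto)
  moreover have "F t = \<phi> (inv (c t) \<otimes> c t)" using N(2,4) t by auto
  ultimately have "((\<lambda>u. \<phi> (inv (c t) \<otimes> c u)) has_vector_derivative frechet_derivative F (at t) 1) (at t within S)"
    using t by (rule has_vector_derivative_transform_eventually)
  then show thesis using that lvelI[OF c t] by blast
qed

lemma smooth_pt_fst: "manifold_smooth_on vec_atlas (charts G) (\<Omega> \<times> \<Omega>) (\<lambda>z. \<iota> (fst z))"
  and smooth_pt_snd: "manifold_smooth_on vec_atlas (charts G) (\<Omega> \<times> \<Omega>) (\<lambda>z. \<iota> (snd z))"
proof -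
  have o: "open (\<Omega> \<times> \<Omega>)" using open_\<Omega> open_Times by blast
  show "manifold_smooth_on vec_atlas (charts G) (\<Omega> \<times> \<Omega>) (\<lambda>z. \<iota> (fst z))"
    by (rule manifold_smooth_on_compose[OF manifold_smooth_on_vecI[OF o smooth_on_linear[OF o bounded_linear_fst]]
        smooth_pt _ smooth_atlas_vec smooth_atlas_vec fd2 fd]) auto
  show "manifold_smooth_on vec_atlas (charts G) (\<Omega> \<times> \<Omega>) (\<lambda>z. \<iota> (snd z))"
    by (rule manifold_smooth_on_compose[OF manifold_smooth_on_vecI[OF o smooth_on_linear[OF o bounded_linear_snd]]
        smooth_pt _ smooth_atlas_vec smooth_atlas_vec fd2 fd]) auto
qed

text \<open>For curves \<open>c\<close> and \<open>d\<close> the displacement of the product is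
  \<open>k x k^-1 y\<close> with \<open>k = (d t)^-1\<close> and \<open>x\<close>, \<open>y\<close>
  the displacements of the factors. Keeping \<open>k\<close> in the map lets a single derivative
  cover the product rule.\<close>

lemma twisted_mult_smooth:
  assumes k: "k \<in> carrier G"
  obtains N where "open N" "(e0, e0) \<in> N" "N \<subseteq> \<Omega> \<times> \<Omega>"
    "\<And>x y. (x, y) \<in> N \<Longrightarrow> k \<otimes> \<iota> x \<otimes> inv k \<otimes> \<iota> y \<in> U"
    "smooth_on N (\<lambda>(x, y). \<phi> (k \<otimes> \<iota> x \<otimes> inv k \<otimes> \<iota> y))"
proof -
  have o: "open (\<Omega> \<times> \<Omega>)" using open_\<Omega> open_Times by blast
  have sm: "manifold_smooth_on vec_atlas (charts G) (\<Omega> \<times> \<Omega>) (\<lambda>z. k \<otimes> \<iota> (fst z) \<otimes> inv k \<otimes> \<iota> (snd z))"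
    by (intro smooth_mult_vec fd2 smooth_const_vec smooth_pt_fst smooth_pt_snd k inv_closed)
  have 3: "k \<otimes> \<iota> (fst (e0, e0)) \<otimes> inv k \<otimes> \<iota> (snd (e0, e0)) \<in> U"
    using k one_U by (simp add: pt_e0)
  have 4: "(e0, e0) \<in> \<Omega> \<times> \<Omega>" using e0_\<Omega> by blast
  obtain N where N: "open N" "(e0, e0) \<in> N" "N \<subseteq> \<Omega> \<times> \<Omega>"
    "\<And>z. z \<in> N \<Longrightarrow> k \<otimes> \<iota> (fst z) \<otimes> inv k \<otimes> \<iota> (snd z) \<in> U"
    "smooth_on N (\<lambda>z. \<phi> (k \<otimes> \<iota> (fst z) \<otimes> inv k \<otimes> \<iota> (snd z)))"
    by (rule coord_smooth[OF sm fd2 o 4 3]) (rule that)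
  show thesis
    by (rule that[of N]) (use N in \<open>auto simp: case_prod_unfold\<close>)
qed

text \<open>By linearity the derivative is the sum of its partial derivatives: the identity in the
  second slot leaves conjugation by \<open>k\<close>, with derivative \<open>Ad G k\<close>, and the
  identity in the first slot leaves the identity map.\<close>

lemma twisted_mult_derivative:
  assumes k: "k \<in> carrier G"
  shows "((\<lambda>(x, y). \<phi> (k \<otimes> \<iota> x \<otimes> inv k \<otimes> \<iota> y)) has_derivative (\<lambda>(X, Y). Ad G k X + Y)) (at (e0, e0))"
proof -
  let ?Q = "\<lambda>(x, y). \<phi> (k \<otimes> \<iota> x \<otimes> inv k \<otimes> \<iota> y)"
  obtain N where N: "open N" "(e0, e0) \<in> N" "N \<subseteq> \<Omega> \<times> \<Omega>"
    "\<And>x y. (x, y) \<in> N \<Longrightarrow> k \<otimes> \<iota> x \<otimes> inv k \<otimes> \<iota> y \<in> U" "smooth_on N ?Q"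
    by (rule twisted_mult_smooth[OF k]) (rule that)
  let ?D = "frechet_derivative ?Q (at (e0, e0))"
  have D: "(?Q has_derivative ?D) (at (e0, e0))" by (rule smooth_on_has_derivative[OF N(5,2)])
  interpret D: bounded_linear ?D using D by (rule has_derivative_bounded_linear)
  have 1: "((\<lambda>x. ?Q (x, e0)) has_derivative (\<lambda>X. ?D (X, 0))) (at e0)"
    by (rule has_derivative_compose[where f = "\<lambda>x. (x, e0)", OF _ D]) (auto intro!: derivative_eq_intros)
  have "((\<lambda>x. ?Q (x, e0)) has_derivative Ad G k) (at e0)"
    by (rule has_derivative_transform_within_open[OF Ad_has_derivative[OF k] open_\<Omega> e0_\<Omega>])
      (simp add: pt_e0 pt_carrier k)
  from has_derivative_unique[OF 1 this] have a: "?D (X, 0) = Ad G k X" for X by (rule fun_cong)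
  have 2: "((\<lambda>y. ?Q (e0, y)) has_derivative (\<lambda>Y. ?D (0, Y))) (at e0)"
    by (rule has_derivative_compose[where f = "\<lambda>y. (e0, y)", OF _ D]) (auto intro!: derivative_eq_intros)
  have "((\<lambda>x. x) has_derivative (\<lambda>x. x)) (at e0)" by simp
  then have "((\<lambda>y. ?Q (e0, y)) has_derivative (\<lambda>x. x)) (at e0)"
    by (rule has_derivative_transform_within_open[OF _ open_\<Omega> e0_\<Omega>])
      (simp add: pt_e0 pt_carrier coord_pt k)
  from has_derivative_unique[OF 2 this] have b: "?D (0, Y) = Y" for Y by (rule fun_cong)
  have "?D (X, Y) = Ad G k X + Y" for X Y
    using D.add[of "(X, 0)" "(0, Y)"] unfolding a b by simp
  then have "?D = (\<lambda>(X, Y). Ad G k X + Y)" by (intro ext) (simp only: split_paired_all prod.case)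
  then show ?thesis using D by simp
qed

text \<open>Differentiate \<open>x x^-1 = 1\<close>, using that multiplication has derivative
  \<open>(X, Y) \<mapsto> X + Y\<close> at the identity.\<close>

lemma inv_derivative:
  "((\<lambda>x. \<phi> (inv (\<iota> x))) has_derivative uminus) (at e0)"
  and inv_near: "\<exists>N. open N \<and> e0 \<in> N \<and> N \<subseteq> \<Omega> \<and> (\<forall>x\<in>N. inv (\<iota> x) \<in> U) \<and> smooth_on N (\<lambda>x. \<phi> (inv (\<iota> x)))"
proof -
  have sm: "manifold_smooth_on vec_atlas (charts G) \<Omega> (\<lambda>x. inv (\<iota> x))"
    by (intro smooth_inv_vec fd smooth_pt)
  have 1: "inv (\<iota> e0) \<in> U" using one_U by (simp add: pt_e0)
  obtain N where N: "open N" "e0 \<in> N" "N \<subseteq> \<Omega>" "\<And>y. y \<in> N \<Longrightarrow> inv (\<iota> y) \<in> U"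
    "smooth_on N (\<lambda>y. \<phi> (inv (\<iota> y)))"
    by (rule coord_smooth[OF sm fd open_\<Omega> e0_\<Omega> 1]) (rule that)
  then show "\<exists>N. open N \<and> e0 \<in> N \<and> N \<subseteq> \<Omega> \<and> (\<forall>x\<in>N. inv (\<iota> x) \<in> U) \<and> smooth_on N (\<lambda>x. \<phi> (inv (\<iota> x)))"
    by blast
  let ?J = "\<lambda>x. \<phi> (inv (\<iota> x))"
  let ?D = "frechet_derivative ?J (at e0)"
  have D: "(?J has_derivative ?D) (at e0)" by (rule smooth_on_has_derivative[OF N(5,2)])
  have P: "((\<lambda>x. (x, ?J x)) has_derivative (\<lambda>X. (X, ?D X))) (at e0)"
    by (rule has_derivative_Pair[OF has_derivative_ident D])
  have Q: "((\<lambda>(x, y). \<phi> (\<one> \<otimes> \<iota> x \<otimes> inv \<one> \<otimes> \<iota> y)) has_derivative (\<lambda>(X, Y). Ad G \<one> X + Y)) (at (e0, ?J e0))"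
    using twisted_mult_derivative[OF one_closed] by (simp add: pt_e0)
  have C: "((\<lambda>x. \<phi> (\<one> \<otimes> \<iota> x \<otimes> inv \<one> \<otimes> \<iota> (?J x))) has_derivative (\<lambda>X. Ad G \<one> X + ?D X)) (at e0)"
    using has_derivative_compose[OF P Q] by simp
  have "((\<lambda>x. e0) has_derivative (\<lambda>X. 0)) (at e0)" by simp
  then have "((\<lambda>x. \<phi> (\<one> \<otimes> \<iota> x \<otimes> inv \<one> \<otimes> \<iota> (?J x))) has_derivative (\<lambda>X. 0)) (at e0)"
  proof (rule has_derivative_transform_within_open[OF _ N(1,2)])
    fix x assume "x \<in> N"
    then have "\<iota> x \<in> carrier G" "\<iota> (?J x) = inv (\<iota> x)" using N(3,4) pt_carrier pt_coord by auto
    then show "e0 = \<phi> (\<one> \<otimes> \<iota> x \<otimes> inv \<one> \<otimes> \<iota> (?J x))" by simp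
  qed
  from has_derivative_unique[OF C this] have "?D X = - X" for X
    by (auto simp: Ad_one fun_eq_iff add_eq_0_iff)
  then have "?D = uminus" by blast
  then show "(?J has_derivative uminus) (at e0)" using D by simp
qed

lemma Ad_mult:
  assumes g: "g \<in> carrier G" and h: "h \<in> carrier G"
  shows "Ad G (g \<otimes> h) X = Ad G g (Ad G h X)"
proof -
  let ?c = "\<lambda>g x. \<phi> (g \<otimes> \<iota> x \<otimes> inv g)"
  have sm: "manifold_smooth_on vec_atlas (charts G) \<Omega> (\<lambda>x. h \<otimes> \<iota> x \<otimes> inv h)"
    by (intro smooth_mult_vec fd smooth_const_vec smooth_pt h inv_closed)
  have 1: "h \<otimes> \<iota> e0 \<otimes> inv h \<in> U" using h one_U by (simp add: pt_e0)
  obtain N where N: "open N" "e0 \<in> N" "N \<subseteq> \<Omega>" "\<And>y. y \<in> N \<Longrightarrow> h \<otimes> \<iota> y \<otimes> inv h \<in> U"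
    "smooth_on N (\<lambda>y. \<phi> (h \<otimes> \<iota> y \<otimes> inv h))"
    by (rule coord_smooth[OF sm fd open_\<Omega> e0_\<Omega> 1]) (rule that)
  have "(?c g has_derivative Ad G g) (at (?c h e0))"
    using Ad_has_derivative[OF g] h by (simp add: pt_e0)
  from has_derivative_compose[OF Ad_has_derivative[OF h] this]
  have "((\<lambda>x. ?c g (?c h x)) has_derivative (\<lambda>x. Ad G g (Ad G h x))) (at e0)" .
  then have "(?c (g \<otimes> h) has_derivative (\<lambda>x. Ad G g (Ad G h x))) (at e0)"
  proof (rule has_derivative_transform_within_open[OF _ N(1,2)])
    fix x assume x: "x \<in> N"
    then have "\<iota> x \<in> carrier G" using N(3) pt_carrier by auto
    then show "?c g (?c h x) = ?c (g \<otimes> h) x"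
      using pt_coord[OF N(4)[OF x]] g h by (simp add: m_assoc inv_mult_group)
  qed
  then show ?thesis using has_derivative_unique Ad_has_derivative[of "g \<otimes> h"] g h by (metis m_closed)
qed

lemma Ad_inv: "g \<in> carrier G \<Longrightarrow> Ad G (inv g) (Ad G g X) = X" "g \<in> carrier G \<Longrightarrow> Ad G g (Ad G (inv g) X) = X"
  using Ad_mult[of "inv g" g X] Ad_mult[of g "inv g" X] by (simp_all add: Ad_one)

lemma Ad_linear:
  assumes "g \<in> carrier G"
  shows "Ad G g (X + Y) = Ad G g X + Ad G g Y" "Ad G g (X - Y) = Ad G g X - Ad G g Y"
    "Ad G g (- X) = - Ad G g X" "Ad G g (r *\<^sub>R X) = r *\<^sub>R Ad G g X" "Ad G g 0 = 0"
proof -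
  interpret bounded_linear "Ad G g" by (rule Ad_bounded_linear[OF assms])
  show "Ad G g (X + Y) = Ad G g X + Ad G g Y" "Ad G g (X - Y) = Ad G g X - Ad G g Y"
    "Ad G g (- X) = - Ad G g X" "Ad G g (r *\<^sub>R X) = r *\<^sub>R Ad G g X" "Ad G g 0 = 0"
    by (simp_all add: add diff neg scaleR zero)
qed

lemma lvel_const: "g \<in> carrier G \<Longrightarrow> lvel (\<lambda>_. g) 0 t S"
  unfolding lvel_def using one_U by auto

text \<open>The left velocity of \<open>c\<close> has to be moved past \<open>d t\<close>, which
  conjugates it by \<open>(d t)^-1\<close>.\<close>

lemma lvel_mult:
  assumes c: "lvel c A t S" and d: "lvel d B t S" and t: "t \<in> S"
  shows "lvel (\<lambda>u. c u \<otimes> d u) (Ad G (inv (d t)) A + B) t S"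
proof -
  let ?k = "inv (d t)"
  let ?Q = "\<lambda>(x, y). \<phi> (?k \<otimes> \<iota> x \<otimes> inv ?k \<otimes> \<iota> y)"
  let ?y = "\<lambda>u. (\<phi> (inv (c t) \<otimes> c u), \<phi> (inv (d t) \<otimes> d u))"
  have ct: "c t \<in> carrier G" and dt: "d t \<in> carrier G" using lvel_carrier[OF c] lvel_carrier[OF d] by auto
  obtain N where N: "open N" "(e0, e0) \<in> N" "N \<subseteq> \<Omega> \<times> \<Omega>"
    "\<And>x y. (x, y) \<in> N \<Longrightarrow> ?k \<otimes> \<iota> x \<otimes> inv ?k \<otimes> \<iota> y \<in> U" "smooth_on N ?Q"
    by (rule twisted_mult_smooth[OF inv_closed[OF dt]]) (rule that)
  have y: "(?y has_vector_derivative (A, B)) (at t within S)"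
    by (rule has_vector_derivative_Pair[OF lvel_deriv[OF c] lvel_deriv[OF d]])
  have y0: "?y t = (e0, e0)" using ct dt by simp
  have Q: "(?Q has_derivative (\<lambda>(X, Y). Ad G ?k X + Y)) (at (?y t))"
    unfolding y0 using twisted_mult_derivative[OF inv_closed[OF dt]] .
  have eq: "inv (c t \<otimes> d t) \<otimes> (c u \<otimes> d u) = ?k \<otimes> \<iota> (fst (?y u)) \<otimes> inv ?k \<otimes> \<iota> (snd (?y u))"
    if "c u \<in> carrier G \<and> inv (c t) \<otimes> c u \<in> U" "d u \<in> carrier G \<and> inv (d t) \<otimes> d u \<in> U" for u
    using that ct dt by (simp add: pt_coord inv_mult_group m_assoc inv_mult_cancel)
  have "\<forall>\<^sub>F u in at t within S. ?y u \<in> N"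
    using has_vector_derivative_eventually_mem[OF y N(1)] N(2) y0 by simp
  then have ev: "\<forall>\<^sub>F u in at t within S. c u \<in> carrier G \<and> d u \<in> carrier G \<and>
      inv (c t \<otimes> d t) \<otimes> (c u \<otimes> d u) = ?k \<otimes> \<iota> (fst (?y u)) \<otimes> inv ?k \<otimes> \<iota> (snd (?y u)) \<and> ?y u \<in> N"
    using lvel_eventually[OF c] lvel_eventually[OF d]
    by eventually_elim (use eq in blast)
  have "((\<lambda>u. ?Q (?y u)) has_vector_derivative Ad G ?k A + B) (at t within S)"
    using has_vector_derivative_compose_derivative[OF y Q] by simp
  then have "((\<lambda>u. \<phi> (inv (c t \<otimes> d t) \<otimes> (c u \<otimes> d u))) has_vector_derivative Ad G ?k A + B) (at t within S)"
  proof (rule has_vector_derivative_transform_eventually[OF _ _ _ t])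
    show "\<forall>\<^sub>F u in at t within S. ?Q (?y u) = \<phi> (inv (c t \<otimes> d t) \<otimes> (c u \<otimes> d u))"
      using ev by eventually_elim simp
    show "?Q (?y t) = \<phi> (inv (c t \<otimes> d t) \<otimes> (c t \<otimes> d t))"
      using ct dt by (simp add: pt_e0)
  qed
  moreover have "\<forall>\<^sub>F u in at t within S. c u \<otimes> d u \<in> carrier G \<and> inv (c t \<otimes> d t) \<otimes> (c u \<otimes> d u) \<in> U"
    using ev
  proof eventually_elim
    case (elim u)
    then show ?case using N(4)[of "fst (?y u)" "snd (?y u)"] by simp
  qed
  ultimately show ?thesis using ct dt by (simp add: lvel_def)
qed

text \<open>If \<open>x\<close> is the displacement of \<open>c\<close>, that of the inverse curve
  is \<open>(c t) x^-1 (c t)^-1\<close>; hence the sign and the \<open>Ad\<close>.\<close>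

lemma lvel_inv:
  assumes c: "lvel c A t S" and t: "t \<in> S"
  shows "lvel (\<lambda>u. inv (c u)) (- Ad G (c t) A) t S"
proof -
  let ?k = "c t"
  let ?y = "\<lambda>u. \<phi> (inv (c t) \<otimes> c u)"
  let ?J = "\<lambda>x. \<phi> (?k \<otimes> inv (\<iota> x) \<otimes> inv ?k)"
  have ct: "c t \<in> carrier G" using lvel_carrier[OF c] .
  have y0: "?y t = e0" using ct by simp
  have sm: "manifold_smooth_on vec_atlas (charts G) \<Omega> (\<lambda>x. ?k \<otimes> inv (\<iota> x) \<otimes> inv ?k)"
    by (intro smooth_mult_vec smooth_inv_vec fd smooth_const_vec smooth_pt ct inv_closed)
  have 1: "?k \<otimes> inv (\<iota> e0) \<otimes> inv ?k \<in> U" using ct one_U by (simp add: pt_e0)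
  obtain N where N: "open N" "e0 \<in> N" "N \<subseteq> \<Omega>" "\<And>y. y \<in> N \<Longrightarrow> ?k \<otimes> inv (\<iota> y) \<otimes> inv ?k \<in> U"
    "smooth_on N ?J"
    by (rule coord_smooth[OF sm fd open_\<Omega> e0_\<Omega> 1]) (rule that)
  obtain N' where N': "open N'" "e0 \<in> N'" "N' \<subseteq> \<Omega>" "\<And>x. x \<in> N' \<Longrightarrow> inv (\<iota> x) \<in> U"
    using inv_near by blast
  have "((\<lambda>x. \<phi> (?k \<otimes> \<iota> (\<phi> (inv (\<iota> x))) \<otimes> inv ?k)) has_derivative (\<lambda>X. Ad G ?k (- X))) (at e0)"
    by (rule has_derivative_compose[OF inv_derivative]) (use Ad_has_derivative[OF ct] in \<open>simp add: pt_e0\<close>)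
  then have "(?J has_derivative (\<lambda>X. Ad G ?k (- X))) (at e0)"
    by (rule has_derivative_transform_within_open[OF _ N'(1,2)]) (simp add: pt_coord N'(4))
  then have "((\<lambda>u. ?J (?y u)) has_vector_derivative - Ad G ?k A) (at t within S)"
    using has_vector_derivative_compose_derivative[OF lvel_deriv[OF c], of ?J "\<lambda>X. Ad G ?k (- X)"]
    by (simp add: y0 Ad_linear ct)
  moreover have ev: "\<forall>\<^sub>F u in at t within S. c u \<in> carrier G \<and> ?y u \<in> N \<and>
    ?k \<otimes> inv (\<iota> (?y u)) \<otimes> inv ?k = inv (inv (c t)) \<otimes> inv (c u)"
    using lvel_eventually[OF c] has_vector_derivative_eventually_mem[OF lvel_deriv[OF c] N(1), unfolded y0, OF N(2)]
    by eventually_elim (use ct in \<open>simp add: pt_coord inv_mult_group m_assoc\<close>)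
  then have "\<forall>\<^sub>F u in at t within S. ?J (?y u) = \<phi> (inv (inv (c t)) \<otimes> inv (c u))"
    by eventually_elim simp
  ultimately have "((\<lambda>u. \<phi> (inv (inv (c t)) \<otimes> inv (c u))) has_vector_derivative - Ad G ?k A) (at t within S)"
    by (rule has_vector_derivative_transform_eventually[OF _ _ _ t]) (use ct in \<open>simp add: pt_e0\<close>)
  moreover have "\<forall>\<^sub>F u in at t within S. inv (c u) \<in> carrier G \<and> inv (inv (c t)) \<otimes> inv (c u) \<in> U"
    using ev
  proof eventually_elim
    case (elim u)
    then show ?case using N(4)[of "?y u"] by simp
  qed
  ultimately show ?thesis using ct by (simp add: lvel_def)
qed

text \<open>In the chart centred at \<open>c t\<close> the displacement has derivative 0 at every
  nearby \<open>u\<close>, not only at \<open>t\<close>, so it is constant on the convex piece of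
  \<open>S\<close> around \<open>t\<close>. Injectivity of the chart and connectedness of
  \<open>S\<close> finish.\<close>

lemma lvel_zero_const:
  assumes S: "connected S" and c: "\<And>t. t \<in> S \<Longrightarrow> lvel c 0 t S" and "s \<in> S" "t \<in> S"
  shows "c s = c t"
proof (rule connected_local_const[OF S assms(3,4)], rule ballI)
  fix t assume t: "t \<in> S"
  have ct: "c t \<in> carrier G" using lvel_carrier[OF c[OF t]] .
  let ?y = "\<lambda>u. \<phi> (inv (c t) \<otimes> c u)"
  let ?Q = "\<lambda>(x, y). \<phi> (\<one> \<otimes> \<iota> x \<otimes> inv \<one> \<otimes> \<iota> y)"
  obtain N where N: "open N" "(e0, e0) \<in> N" "N \<subseteq> \<Omega> \<times> \<Omega>"
    "\<And>x y. (x, y) \<in> N \<Longrightarrow> \<one> \<otimes> \<iota> x \<otimes> inv \<one> \<otimes> \<iota> y \<in> U" "smooth_on N ?Q"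
    by (rule twisted_mult_smooth[OF one_closed]) (rule that)
  have "\<forall>\<^sub>F u in at t within S. (?y u, e0) \<in> N"
    by (rule has_vector_derivative_eventually_mem[OF has_vector_derivative_Pair[OF lvel_deriv[OF c[OF t]]
          has_vector_derivative_const] N(1)]) (use N(2) ct in simp)
  then have "\<forall>\<^sub>F u in at t within S. c u \<in> carrier G \<and> inv (c t) \<otimes> c u \<in> U \<and> (?y u, e0) \<in> N"
    using lvel_eventually[OF c[OF t]] by eventually_elim simp
  then obtain d where d: "d > 0" "\<And>u. u \<in> S \<Longrightarrow> u \<noteq> t \<Longrightarrow> dist u t < d \<Longrightarrow>
      c u \<in> carrier G \<and> inv (c t) \<otimes> c u \<in> U \<and> (?y u, e0) \<in> N"
    unfolding eventually_at by blast
  let ?B = "S \<inter> ball t d"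
  have B: "c u \<in> carrier G \<and> inv (c t) \<otimes> c u \<in> U \<and> (?y u, e0) \<in> N" if "u \<in> ?B" for u
    using d(2)[of u] that ct one_U N(2) by (cases "u = t") (auto simp: dist_commute)
  have cv: "convex ?B"
    using S is_interval_connected_1 is_interval_convex_1 by (intro convex_Int) auto
  have "(?y has_vector_derivative 0) (at u within ?B)" if u: "u \<in> ?B" for u
  proof -
    have uS: "u \<in> S" using u by auto
    have cu: "c u \<in> carrier G" using B[OF u] by auto
    let ?D = "frechet_derivative ?Q (at (?y u, e0))"
    have D: "(?Q has_derivative ?D) (at (?y u, e0))"
      by (rule smooth_on_has_derivative[OF N(5)]) (use B[OF u] in simp)
    interpret D: bounded_linear ?D using D by (rule has_derivative_bounded_linear)
    \<comment> \<open>The velocity at \<open>u\<close> is measured in the chart centred at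
      \<open>c u\<close>; the map \<open>y \<mapsto> ?Q (?y u, y)\<close> converts it to the chart
      centred at \<open>c t\<close>.\<close>
    have "gderiv (\<lambda>g. \<phi> (inv (c t) \<otimes> g)) (c u) (\<lambda>Y. ?D (0, Y))"
      unfolding gderiv_def
    proof (rule has_derivative_transform_within_open[OF _ open_\<Omega> e0_\<Omega>])
      show "((\<lambda>y. ?Q (?y u, y)) has_derivative (\<lambda>Y. ?D (0, Y))) (at e0)"
        by (rule has_derivative_compose[where f = "\<lambda>y. (?y u, y)", OF _ D]) (auto intro!: derivative_eq_intros)
      show "?Q (?y u, y) = \<phi> (inv (c t) \<otimes> (c u \<otimes> \<iota> y))" if "y \<in> \<Omega>" for y
        using that B[OF u] ct by (simp add: pt_coord pt_carrier m_assoc)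
    qed
    moreover have "?D (0, 0) = 0" using D.zero by (simp only: zero_prod_def)
    ultimately have "(?y has_vector_derivative 0) (at u within S)"
      using lvel_gderiv[OF c[OF uS] _ uS, of "\<lambda>g. \<phi> (inv (c t) \<otimes> g)" "\<lambda>Y. ?D (0, Y)"] by (simp only:)
    then show ?thesis by (rule has_vector_derivative_within_subset) auto
  qed
  then obtain k where k: "\<And>u. u \<in> ?B \<Longrightarrow> ?y u = k"
    using has_vector_derivative_zero_constant[OF cv] by blast
  have "c t = c u" if u: "u \<in> ?B" for u
  proof -
    have "?y u = ?y t" using k[OF u] k[of t] t d(1) by simp
    then have "inv (c t) \<otimes> c u = inv (c t) \<otimes> c t"
      using B[OF u] ct one_U inj_\<phi> by (auto dest: inj_onD)
    then show ?thesis using inv_mult_cancel[OF ct, of "c u"] B[OF u] ct by simp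
  qed
  then show "\<forall>\<^sub>F u in at t within S. c t = c u"
    unfolding eventually_at using d(1) by (intro exI[of _ d]) (auto simp: dist_commute)
qed

text \<open>The quotient \<open>c d^-1\<close> has velocity
  \<open>Ad (d t) (A t) - Ad (d t) (A t) = 0\<close>.\<close>

lemma lvel_unique:
  assumes S: "connected S" and c: "\<And>t. t \<in> S \<Longrightarrow> lvel c (A t) t S" and d: "\<And>t. t \<in> S \<Longrightarrow> lvel d (A t) t S"
    and "s \<in> S" "c s = d s" and t: "t \<in> S"
  shows "c t = d t"
proof -
  have "c t \<otimes> inv (d t) = c s \<otimes> inv (d s)"
  proof (rule lvel_zero_const[OF S _ t \<open>s \<in> S\<close>, of "\<lambda>u. c u \<otimes> inv (d u)"])
    fix u assume u: "u \<in> S"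
    have "d u \<in> carrier G" using lvel_carrier[OF d[OF u]] .
    then show "lvel (\<lambda>u. c u \<otimes> inv (d u)) 0 u S"
      using lvel_mult[OF c[OF u] lvel_inv[OF d[OF u] u] u] by simp
  qed
  moreover have "c t \<in> carrier G" "d t \<in> carrier G" "d s \<in> carrier G"
    using lvel_carrier[OF c[OF t]] lvel_carrier[OF d[OF t]] lvel_carrier[OF d[OF \<open>s \<in> S\<close>]] by auto
  moreover from this have "c t = (c t \<otimes> inv (d t)) \<otimes> d t" by (simp add: m_assoc)
  ultimately show ?thesis using assms(5) by simp
qed

lemma lvel_translate:
  assumes "lvel c A t S" "g \<in> carrier G" "t \<in> S"
  shows "lvel (\<lambda>u. g \<otimes> c u) A t S"
  using lvel_mult[OF lvel_const[OF assms(2)] assms(1,3)] lvel_carrier[OF assms(1)] by (simp add: Ad_linear)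

lemma smooth_gderiv:
  fixes f :: "'g \<Rightarrow> 'v::real_normed_vector"
  assumes f: "manifold_smooth_on (charts G) vec_atlas (carrier G) f" and g: "g \<in> carrier G"
    and v: "findim TYPE('v)"
  obtains L where "gderiv f g L"
proof -
  have 1: "manifold_smooth_on vec_atlas (charts G) \<Omega> (\<lambda>x. g \<otimes> \<iota> x)"
    by (intro smooth_mult_vec fd smooth_const_vec smooth_pt g)
  have "manifold_smooth_on vec_atlas vec_atlas \<Omega> (\<lambda>x. f (g \<otimes> \<iota> x))"
    by (rule manifold_smooth_on_compose[OF 1 f _ smooth_atlas_vec atl fd fd]) (use smooth_on_carrier[OF 1] in auto)
  then have "smooth_on \<Omega> (\<lambda>x. f (g \<otimes> \<iota> x))"
    by (rule manifold_smooth_on_vecD[OF _ fd v open_\<Omega>])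
  then show thesis using that smooth_on_has_derivative e0_\<Omega> unfolding gderiv_def by blast
qed

end

section \<open>One-parameter subgroups\<close>

lemma has_vector_derivative_interior_interval:
  assumes "(f has_vector_derivative D) (at t within {a..b})" "a < t" "t < b"
  shows "(f has_vector_derivative D) (at t)"
  using assms at_within_Icc_at[of a t b] by simp

lemma vector_derivative_bound:
  fixes f :: "real \<Rightarrow> 'a::real_normed_vector"
  assumes "\<And>x. x \<in> {a..b} \<Longrightarrow> (f has_vector_derivative f' x) (at x within {a..b})"
    "\<And>x. x \<in> {a..b} \<Longrightarrow> norm (f' x) \<le> B" "s \<in> {a..b}" "t \<in> {a..b}"
  shows "norm (f s - f t) \<le> B * \<bar>s - t\<bar>"
proof -
  have "norm (f s - f t) \<le> B * norm (s - t)"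
  proof (rule differentiable_bound[where S = "{a..b}" and f' = "\<lambda>x h. h *\<^sub>R f' x"])
    show "onorm (\<lambda>h. h *\<^sub>R f' x) \<le> B" if "x \<in> {a..b}" for x
    proof (rule onorm_le)
      show "norm (h *\<^sub>R f' x) \<le> B * norm h" for h
        using mult_right_mono[OF assms(2)[OF that], of "norm h"] by (simp add: mult.commute)
    qed
  qed (use assms in \<open>auto simp: has_vector_derivative_def\<close>)
  then show ?thesis by simp
qed

lemma has_vector_derivative_at_zero_iff:
  fixes f :: "real \<Rightarrow> 'a::real_normed_vector"
  shows "(f has_vector_derivative A) (at 0) \<longleftrightarrow> ((\<lambda>s. (1 / s) *\<^sub>R (f s - f 0)) \<longlongrightarrow> A) (at 0)"
proof -
  have "norm (f (0 + h) - f 0 - h *\<^sub>R A) / norm h = norm ((1 / h) *\<^sub>R (f h - f 0) - A)" if "h \<noteq> 0" for h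
  proof -
    have "(1 / h) *\<^sub>R (f h - f 0) - A = (1 / h) *\<^sub>R (f (0 + h) - f 0 - h *\<^sub>R A)"
      using that by (simp add: scaleR_diff_right)
    then show ?thesis by simp
  qed
  then have "(\<lambda>h. norm (f (0 + h) - f 0 - h *\<^sub>R A) / norm h) \<midarrow>0\<rightarrow> 0 \<longleftrightarrow>
      (\<lambda>h. norm ((1 / h) *\<^sub>R (f h - f 0) - A)) \<midarrow>0\<rightarrow> 0"
    by (intro filterlim_cong) (auto simp: eventually_at_filter)
  then show ?thesis
    by (simp add: has_vector_derivative_def has_derivative_at bounded_linear_scaleR_left tendsto_norm_zero_iff
        LIM_zero_iff)
qed

text \<open>Picard iteration, run as a contraction on the bounded continuous functions from the
  whole real line into a closed ball.\<close>

lemma picard_local: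
  fixes V :: "'a::banach \<Rightarrow> 'a"
  assumes r: "r > 0" and L: "L \<ge> 0"
    and lip: "\<And>x y. x \<in> ball e0 r \<Longrightarrow> y \<in> ball e0 r \<Longrightarrow> norm (V x - V y) \<le> L * norm (x - y)"
  obtains \<epsilon> y where "\<epsilon> > 0" "y 0 = e0" "\<And>t. \<bar>t\<bar> < \<epsilon> \<Longrightarrow> y t \<in> ball e0 r"
    "\<And>t. \<bar>t\<bar> < \<epsilon> \<Longrightarrow> (y has_vector_derivative V (y t)) (at t)"
proof -
  define K where "K = cball e0 (r / 2)"
  define M where "M = norm (V e0) + L * r"
  \<comment> \<open>The first bound keeps the iterates within \<open>r / 2\<close> of
    \<open>e0\<close>, the second makes the iteration contract by 1/2. The added 1s keep the
    denominators positive.\<close>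
  define \<epsilon> where "\<epsilon> = min (r / 2 / (M + 1)) (1 / (2 * (L + 1)))"
  have M: "M \<ge> 0" using L r by (simp add: M_def)
  have eps: "\<epsilon> > 0" using r M L by (simp add: \<epsilon>_def)
  have epsM: "M * \<epsilon> \<le> r / 2"
  proof -
    have "M * \<epsilon> \<le> M * (r / 2 / (M + 1))" using M by (intro mult_left_mono) (auto simp: \<epsilon>_def)
    also have "\<dots> \<le> r / 2" using M r by (simp add: field_simps)
    finally show ?thesis .
  qed
  have epsL: "L * \<epsilon> \<le> 1 / 2"
  proof -
    have "L * \<epsilon> \<le> L * (1 / (2 * (L + 1)))" using L by (intro mult_left_mono) (auto simp: \<epsilon>_def)
    also have "\<dots> \<le> 1 / 2" using L by (simp add: field_simps)
    finally show ?thesis .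
  qed
  have KB: "K \<subseteq> ball e0 r" using r by (auto simp: K_def)
  have VM: "norm (V x) \<le> M" if "x \<in> ball e0 r" for x
  proof -
    have "norm (V x) \<le> norm (V e0) + norm (V x - V e0)" by (rule norm_triangle_sub)
    also have "norm (V x - V e0) \<le> L * norm (x - e0)" using lip that r by simp
    also have "\<dots> \<le> L * r" using that L by (intro mult_left_mono) (auto simp: dist_norm norm_minus_commute)
    finally show ?thesis by (simp add: M_def)
  qed
  have Vc: "continuous_on (ball e0 r) V"
    using lip L by (intro lipschitz_on_continuous_on[of L] lipschitz_onI) (auto simp: dist_norm)
  define X where "X = PiC UNIV (\<lambda>_::real. K)"
  \<comment> \<open>Clamping time to \<open>{-\<epsilon>..\<epsilon>}\<close> turns a local solution
    into a bounded continuous function on the real line, the space in which the fixed point is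
    sought.\<close>
  define cl where "cl = (\<lambda>t::real. max (- \<epsilon>) (min \<epsilon> t))"
  \<comment> \<open>The integral from 0 to \<open>\<tau>\<close>, written as a difference because
    \<open>{0..\<tau>}\<close> is empty for negative \<open>\<tau>\<close>.\<close>
  define J where "J = (\<lambda>f \<tau>. integral {-\<epsilon>..\<tau>} (\<lambda>s. V (apply_bcontfun f s)) - integral {-\<epsilon>..0} (\<lambda>s. V (apply_bcontfun f s)))"
  define F where "F = (\<lambda>f. Bcontfun (\<lambda>t. e0 + J f (cl t)))"
  have cl: "cl t \<in> {-\<epsilon>..\<epsilon>}" "\<bar>cl t\<bar> \<le> \<epsilon>" for t using eps by (auto simp: cl_def)
  have clc: "continuous_on UNIV cl" unfolding cl_def by (intro continuous_intros)
  have fK: "apply_bcontfun f t \<in> K" if "f \<in> X" for f t using that by (auto simp: X_def mem_PiC_iff)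
  have fB: "apply_bcontfun f t \<in> ball e0 r" if "f \<in> X" for f t using fK[OF that] KB by blast
  have hc: "continuous_on T (\<lambda>s. V (apply_bcontfun f s))" if "f \<in> X" for f T
    by (rule continuous_on_compose2[OF Vc continuous_on_apply_bcontfun]) (use fB[OF that] in auto)
  have Jd: "(J f has_vector_derivative V (apply_bcontfun f t)) (at t within {-\<epsilon>..\<epsilon>})"
    if "f \<in> X" "t \<in> {-\<epsilon>..\<epsilon>}" for f t
    unfolding J_def
    using has_vector_derivative_diff[OF integral_has_vector_derivative[OF hc[OF that(1)] that(2)]
        has_vector_derivative_const] by simp
  have J0: "J f 0 = 0" for f by (simp add: J_def)
  have z: "0 \<in> {-\<epsilon>..\<epsilon>}" using eps by auto
  have JM: "norm (J f t) \<le> M * \<epsilon>" if "f \<in> X" "t \<in> {-\<epsilon>..\<epsilon>}" for f t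
  proof -
    have "norm (J f t - J f 0) \<le> M * \<bar>t - 0\<bar>"
      by (rule vector_derivative_bound[OF Jd[OF that(1)] _ that(2) z]) (assumption, rule VM[OF fB[OF that(1)]])
    also have "\<dots> \<le> M * \<epsilon>" using that(2) M by (intro mult_left_mono) auto
    finally show ?thesis by (simp add: J0)
  qed
  have bc: "(\<lambda>t. e0 + J f (cl t)) \<in> bcontfun" if f: "f \<in> X" for f
  proof (rule bcontfun_normI)
    have "continuous_on {-\<epsilon>..\<epsilon>} (J f)"
      by (rule continuous_on_vector_derivative[OF Jd[OF f]])
    then have "continuous_on UNIV (\<lambda>t. J f (cl t))"
      by (rule continuous_on_compose2[OF _ clc]) (use cl in auto)
    then show "continuous_on UNIV (\<lambda>t. e0 + J f (cl t))" by (intro continuous_intros)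
    show "norm (e0 + J f (cl t)) \<le> norm e0 + M * \<epsilon>" for t
      using JM[OF f cl(1)] norm_triangle_le[of e0 "J f (cl t)"] by simp
  qed
  have Fa: "apply_bcontfun (F f) t = e0 + J f (cl t)" if "f \<in> X" for f t
    unfolding F_def using Bcontfun_inverse[OF bc[OF that]] by simp
  have FX: "F ` X \<subseteq> X"
  proof safe
    fix f assume f: "f \<in> X"
    have "dist e0 (e0 + J f (cl t)) \<le> r / 2" for t
      using JM[OF f cl(1), of t] epsM by (simp add: dist_norm)
    then show "F f \<in> X" by (auto simp: X_def mem_PiC_iff Fa[OF f] K_def)
  qed
  have contr: "dist (F f) (F g) \<le> (1 / 2) * dist f g" if f: "f \<in> X" and g: "g \<in> X" for f g
  proof (rule dist_bound)
    fix t
    have d: "((\<lambda>t. J f t - J g t) has_vector_derivative V (apply_bcontfun f t) - V (apply_bcontfun g t)) (at t within {-\<epsilon>..\<epsilon>})"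
      if "t \<in> {-\<epsilon>..\<epsilon>}" for t
      by (rule has_vector_derivative_diff[OF Jd[OF f that] Jd[OF g that]])
    have b: "norm (V (apply_bcontfun f t) - V (apply_bcontfun g t)) \<le> L * dist f g" for t
    proof -
      have "norm (V (apply_bcontfun f t) - V (apply_bcontfun g t)) \<le> L * norm (apply_bcontfun f t - apply_bcontfun g t)"
        by (rule lip[OF fB[OF f] fB[OF g]])
      also have "\<dots> \<le> L * dist f g"
        using dist_bounded[of f t g] L by (intro mult_left_mono) (auto simp: dist_norm)
      finally show ?thesis .
    qed
    have "norm ((J f (cl t) - J g (cl t)) - (J f 0 - J g 0)) \<le> (L * dist f g) * \<bar>cl t - 0\<bar>"
      by (rule vector_derivative_bound[OF d b cl(1) z])
    also have "\<dots> \<le> (L * dist f g) * \<epsilon>" using cl(2)[of t] L by (intro mult_left_mono) auto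
    also have "\<dots> = (L * \<epsilon>) * dist f g" by simp
    also have "\<dots> \<le> 1 / 2 * dist f g" using epsL by (intro mult_right_mono) auto
    finally show "dist (apply_bcontfun (F f) t) (apply_bcontfun (F g) t) \<le> 1 / 2 * dist f g"
      by (simp add: Fa[OF f] Fa[OF g] J0 dist_norm)
  qed
  have "complete X"
    unfolding complete_eq_closed X_def K_def by (intro closed_PiC closed_cball)
  moreover have "const_bcontfun e0 \<in> X"
    using r by (auto simp: X_def mem_PiC_iff K_def const_bcontfun.rep_eq)
  then have "X \<noteq> {}" by auto
  ultimately obtain f where f: "f \<in> X" "F f = f"
    using Banach_fix[of X "1 / 2" F] FX contr by auto
  have fe: "apply_bcontfun f t = e0 + J f (cl t)" for t using Fa[OF f(1), of t] f(2) by simp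
  show thesis
  proof (rule that[of \<epsilon> "apply_bcontfun f"])
    show "\<epsilon> > 0" by fact
    show "apply_bcontfun f 0 = e0" using fe[of 0] eps by (simp add: cl_def J0)
    fix t assume t: "\<bar>t\<bar> < \<epsilon>"
    show "apply_bcontfun f t \<in> ball e0 r" by (rule fB[OF f(1)])
    have "(J f has_vector_derivative V (apply_bcontfun f t)) (at t)"
      by (rule has_vector_derivative_interior_interval[OF Jd[OF f(1)]]) (use t in auto)
    then have "((\<lambda>t. e0 + J f t) has_vector_derivative V (apply_bcontfun f t)) (at t)"
      using has_vector_derivative_add[OF has_vector_derivative_const] by fastforce
    then show "(apply_bcontfun f has_vector_derivative V (apply_bcontfun f t)) (at t)"
      unfolding has_vector_derivative_def
    proof (rule has_derivative_transform_within_open[of _ _ _ _ "{-\<epsilon><..<\<epsilon>}"])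
      show "e0 + J f s = apply_bcontfun f s" if "s \<in> {-\<epsilon><..<\<epsilon>}" for s
        using fe[of s] that by (simp add: cl_def)
    qed (use t in auto)
  qed
qed

text \<open>Cauchy criterion at 0: the limit is found along \<open>1 / (n + 1)\<close>.\<close>

lemma tendsto_at_zero_CauchyI:
  fixes q :: "real \<Rightarrow> 'a::banach"
  assumes C: "\<And>\<tau>. \<tau> > 0 \<Longrightarrow> \<exists>\<eta>>0. \<forall>s s'. s \<noteq> 0 \<and> \<bar>s\<bar> < \<eta> \<and> s' \<noteq> 0 \<and> \<bar>s'\<bar> < \<eta> \<longrightarrow> norm (q s - q s') \<le> \<tau>"
  shows "\<exists>A. (q \<longlongrightarrow> A) (at 0)"
proof -
  let ?x = "\<lambda>n. q (inverse (real (Suc n)))"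
  have small: "\<forall>\<^sub>F n in sequentially. inverse (real (Suc n)) \<noteq> 0 \<and> \<bar>inverse (real (Suc n))\<bar> < \<eta>" if "\<eta> > 0" for \<eta>
    using order_tendstoD(2)[OF LIMSEQ_inverse_real_of_nat that] by (auto elim: eventually_mono)
  have "Cauchy ?x"
  proof (rule CauchyI)
    fix e :: real assume e: "e > 0"
    then obtain \<eta> where \<eta>: "\<eta> > 0" "\<And>s s'. s \<noteq> 0 \<and> \<bar>s\<bar> < \<eta> \<and> s' \<noteq> 0 \<and> \<bar>s'\<bar> < \<eta> \<Longrightarrow> norm (q s - q s') \<le> e / 2"
      using C[of "e / 2"] by auto
    obtain N where N: "\<And>n. n \<ge> N \<Longrightarrow> inverse (real (Suc n)) \<noteq> 0 \<and> \<bar>inverse (real (Suc n))\<bar> < \<eta>"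
      using small[OF \<eta>(1)] unfolding eventually_sequentially by blast
    have "norm (?x m - ?x n) < e" if "m \<ge> N" "n \<ge> N" for m n
      using \<eta>(2)[of "inverse (real (Suc m))" "inverse (real (Suc n))"] N[OF that(1)] N[OF that(2)] e by linarith
    then show "\<exists>M. \<forall>m\<ge>M. \<forall>n\<ge>M. norm (?x m - ?x n) < e" by blast
  qed
  then obtain A where A: "?x \<longlonglongrightarrow> A" using Cauchy_convergent_iff convergent_def by blast
  have "(q \<longlongrightarrow> A) (at 0)"
  proof (rule tendstoI)
    fix e :: real assume e: "e > 0"
    then obtain \<eta> where \<eta>: "\<eta> > 0" "\<And>s s'. s \<noteq> 0 \<and> \<bar>s\<bar> < \<eta> \<and> s' \<noteq> 0 \<and> \<bar>s'\<bar> < \<eta> \<Longrightarrow> norm (q s - q s') \<le> e / 3"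
      using C[of "e / 3"] by auto
    have "\<forall>\<^sub>F n in sequentially. dist (?x n) A < e / 3" by (rule tendstoD[OF A]) (use e in simp)
    then obtain n where n: "dist (?x n) A < e / 3" "inverse (real (Suc n)) \<noteq> 0" "\<bar>inverse (real (Suc n))\<bar> < \<eta>"
      using eventually_happens[OF eventually_conj[OF _ small[OF \<eta>(1)]]] by auto
    have "dist (q s) A < e" if "s \<noteq> 0" "\<bar>s\<bar> < \<eta>" for s
      using \<eta>(2)[of s "inverse (real (Suc n))"] that n dist_triangle[of "q s" A "?x n"] e by (simp add: dist_norm)
    then show "\<forall>\<^sub>F s in at 0. dist (q s) A < e"
      unfolding eventually_at using \<eta>(1) by (intro exI[of _ \<eta>]) auto
  qed
  then show ?thesis ..
qed

text \<open>Comparing the integral of \<open>y\<close> over \<open>[s, \<epsilon> + s]\<close> with that over \<open>[0, \<epsilon>]\<close> pins down \<open>\<epsilon> (y s - p)\<close> up to a relative error that is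
  small when \<open>\<epsilon>\<close> is, because the multiplication is close to a translation near the identity.\<close>

lemma local_one_parameter_differentiable:
  fixes y :: "real \<Rightarrow> 'a::banach" and \<mu> :: "'a \<Rightarrow> 'a \<Rightarrow> 'a"
  assumes \<rho>: "\<rho> > 0" and cont: "continuous_on {-\<rho>..\<rho>} y" and y0: "y 0 = p"
    and hom: "\<And>s t. \<bar>s\<bar> \<le> \<rho> \<Longrightarrow> \<bar>t\<bar> \<le> \<rho> \<Longrightarrow> \<bar>s + t\<bar> \<le> \<rho> \<Longrightarrow> y (s + t) = \<mu> (y s) (y t)"
    and strict: "\<And>\<delta>. \<delta> > 0 \<Longrightarrow> \<exists>r>0. \<forall>x\<in>ball p r. \<forall>x'\<in>ball p r. \<forall>z\<in>ball p r.
      norm (\<mu> x z - \<mu> x' z - (x - x')) \<le> \<delta> * norm (x - x')"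
  shows "\<exists>A. (y has_vector_derivative A) (at 0)"
proof -
  obtain Y where Y: "\<And>x. x \<in> {-\<rho>..\<rho>} \<Longrightarrow> (Y has_vector_derivative y x) (at x within {-\<rho>..\<rho>})"
    using antiderivative_continuous[OF cont] by blast
  have Y': "(Y has_vector_derivative y x) (at x)" if "\<bar>x\<bar> < \<rho>" for x
    by (rule has_vector_derivative_interior_interval[OF Y]) (use that in auto)
  \<comment> \<open>The integral of \<open>y\<close> over \<open>{s..\<epsilon> + s}\<close> minus
    that over \<open>{0..\<epsilon>}\<close>, expressed by the antiderivative. It is differentiable
    in \<open>s\<close> although \<open>y\<close> is only known to be continuous.\<close>
  define W where "W = (\<lambda>\<epsilon> s. Y (\<epsilon> + s) - Y s - Y \<epsilon> + Y 0)"
  define q where "q = (\<lambda>s. (1 / s) *\<^sub>R (y s - p))"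
  define w where "w = (\<lambda>\<epsilon> s. (1 / s) *\<^sub>R W \<epsilon> s)"
  have key: "\<exists>\<epsilon>>0. \<epsilon> < \<rho> / 2 \<and> (\<forall>s. s \<noteq> 0 \<and> \<bar>s\<bar> < \<epsilon> \<longrightarrow> norm (w \<epsilon> s - \<epsilon> *\<^sub>R q s) \<le> \<epsilon> * (\<delta> * norm (q s)))"
    if \<delta>0: "\<delta> > 0" for \<delta>
  proof -
    obtain r where r: "r > 0" "\<And>x x' z. x \<in> ball p r \<Longrightarrow> x' \<in> ball p r \<Longrightarrow> z \<in> ball p r \<Longrightarrow>
      norm (\<mu> x z - \<mu> x' z - (x - x')) \<le> \<delta> * norm (x - x')"
      using strict[OF \<delta>0] by blast
    have "isCont y 0"
      using cont \<rho> by (simp add: continuous_on_interior)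
    then obtain d where d: "d > 0" "\<And>s. \<bar>s\<bar> < d \<Longrightarrow> y s \<in> ball p r"
      using r(1) y0 unfolding continuous_at_eps_delta by (auto simp: dist_commute)
    define \<epsilon> where "\<epsilon> = min (d / 2) (\<rho> / 4)"
    have e: "\<epsilon> > 0" "\<epsilon> < d" "\<epsilon> < \<rho> / 2" using d(1) \<rho> by (auto simp: \<epsilon>_def)
    have "norm (w \<epsilon> s - \<epsilon> *\<^sub>R q s) \<le> \<epsilon> * (\<delta> * norm (q s))" if s: "s \<noteq> 0" "\<bar>s\<bar> < \<epsilon>" for s
    proof -
      \<comment> \<open>Mean value inequality in \<open>u\<close>: since
        \<open>y u = \<mu> p (y u)\<close>, the derivative of \<open>H\<close> is
        \<open>\<mu> (y s) (y u) - \<mu> p (y u) - (y s - p)\<close>, which \<open>strict\<close>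
        bounds.\<close>
      define H where "H = (\<lambda>u. Y (u + s) - Y u - u *\<^sub>R (y s - p))"
      have "(H has_vector_derivative (y (u + s) - y u - (y s - p))) (at u within {0..\<epsilon>})" if "u \<in> {0..\<epsilon>}" for u
      proof -
        have sh: "((\<lambda>u. u + s) has_vector_derivative 1) (at u)" by (auto intro!: derivative_eq_intros)
        have "\<bar>u + s\<bar> < \<rho>" using that s e by auto
        from vector_diff_chain_at[OF sh Y'[OF this]]
        have "((\<lambda>u. Y (u + s)) has_vector_derivative y (u + s)) (at u)" by (simp add: o_def)
        moreover have "(Y has_vector_derivative y u) (at u)" using Y'[of u] that e by auto
        ultimately have "(H has_vector_derivative (y (u + s) - y u - (y s - p))) (at u)"
          unfolding H_def by (auto intro!: derivative_eq_intros)
        then show ?thesis by (rule has_vector_derivative_at_within)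
      qed
      moreover have "norm (y (u + s) - y u - (y s - p)) \<le> \<delta> * norm (y s - p)" if "u \<in> {0..\<epsilon>}" for u
      proof -
        have "\<bar>s\<bar> \<le> \<rho>" "\<bar>u\<bar> \<le> \<rho>" "\<bar>s + u\<bar> \<le> \<rho>" using that s e by auto
        then have "y (u + s) = \<mu> (y s) (y u)" using hom[of s u] by (simp add: add.commute)
        moreover have "y u = \<mu> p (y u)" using hom[of 0 u] that e y0 \<rho> by simp
        moreover have "norm (\<mu> (y s) (y u) - \<mu> p (y u) - (y s - p)) \<le> \<delta> * norm (y s - p)"
          using that s e r(1) by (intro r(2) d(2)) auto
        ultimately show ?thesis by simp
      qed
      ultimately have "norm (H \<epsilon> - H 0) \<le> (\<delta> * norm (y s - p)) * \<bar>\<epsilon> - 0\<bar>"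
        using e(1) by (intro vector_derivative_bound[of 0 \<epsilon> H "\<lambda>u. y (u + s) - y u - (y s - p)"]) auto
      also have "H \<epsilon> - H 0 = W \<epsilon> s - \<epsilon> *\<^sub>R (y s - p)" by (simp add: H_def W_def)
      finally have *: "norm (W \<epsilon> s - \<epsilon> *\<^sub>R (y s - p)) \<le> \<epsilon> * (\<delta> * norm (y s - p))" using e by (simp add: mult_ac)
      have "w \<epsilon> s - \<epsilon> *\<^sub>R q s = (1 / s) *\<^sub>R (W \<epsilon> s - \<epsilon> *\<^sub>R (y s - p))"
        by (simp add: w_def q_def scaleR_diff_right)
      then have "norm (w \<epsilon> s - \<epsilon> *\<^sub>R q s) = (1 / \<bar>s\<bar>) * norm (W \<epsilon> s - \<epsilon> *\<^sub>R (y s - p))" by simp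
      also have "\<dots> \<le> (1 / \<bar>s\<bar>) * (\<epsilon> * (\<delta> * norm (y s - p)))" using * by (intro mult_left_mono) auto
      also have "\<dots> = \<epsilon> * (\<delta> * norm (q s))" by (simp add: q_def)
      finally show ?thesis .
    qed
    then show ?thesis using e by blast
  qed
  have w: "(w \<epsilon> \<longlongrightarrow> y \<epsilon> - p) (at 0)" if "\<epsilon> > 0" "\<epsilon> < \<rho> / 2" for \<epsilon>
  proof -
    have sh: "((\<lambda>s. \<epsilon> + s) has_vector_derivative 1) (at 0)" by (auto intro!: derivative_eq_intros)
    have "\<bar>\<epsilon> + 0\<bar> < \<rho>" using that \<rho> by auto
    from vector_diff_chain_at[OF sh Y'[OF this]]
    have "((\<lambda>s. Y (\<epsilon> + s)) has_vector_derivative y (\<epsilon> + 0)) (at 0)" by (simp add: o_def)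
    moreover have "(Y has_vector_derivative y 0) (at 0)" using Y'[of 0] \<rho> by simp
    ultimately have "(W \<epsilon> has_vector_derivative (y \<epsilon> - p)) (at 0)"
      unfolding W_def by (auto intro!: derivative_eq_intros simp: y0)
    then show ?thesis by (simp add: has_vector_derivative_at_zero_iff w_def W_def)
  qed
  \<comment> \<open>With \<open>\<delta> = 1 / 2\<close> the error
    \<open>\<epsilon> * norm (q s) / 2\<close> is absorbed on the left, so the difference quotients
    stay bounded near 0.\<close>
  obtain C \<eta>0 where C: "C \<ge> 0" "\<eta>0 > 0" "\<And>s. s \<noteq> 0 \<Longrightarrow> \<bar>s\<bar> < \<eta>0 \<Longrightarrow> norm (q s) \<le> C"
  proof -
    obtain \<epsilon> where e: "\<epsilon> > 0" "\<epsilon> < \<rho> / 2" "\<And>s. s \<noteq> 0 \<Longrightarrow> \<bar>s\<bar> < \<epsilon> \<Longrightarrow> norm (w \<epsilon> s - \<epsilon> *\<^sub>R q s) \<le> \<epsilon> * (1 / 2 * norm (q s))"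
      using key[of "1 / 2"] by auto
    have "\<forall>\<^sub>F s in at 0. dist (w \<epsilon> s) (y \<epsilon> - p) < 1" using tendstoD[OF w[OF e(1,2)]] by simp
    then obtain d where d: "d > 0" "\<And>s. s \<noteq> 0 \<Longrightarrow> \<bar>s\<bar> < d \<Longrightarrow> dist (w \<epsilon> s) (y \<epsilon> - p) < 1"
      unfolding eventually_at by auto
    have "norm (q s) \<le> 2 * (norm (y \<epsilon> - p) + 1) / \<epsilon>" if s: "s \<noteq> 0" "\<bar>s\<bar> < min d \<epsilon>" for s
    proof -
      have "norm (w \<epsilon> s) \<le> norm (y \<epsilon> - p) + 1"
        using d(2)[of s] s norm_triangle_sub[of "w \<epsilon> s" "y \<epsilon> - p"] by (simp add: dist_norm)
      moreover have "\<epsilon> * norm (q s) \<le> norm (w \<epsilon> s) + \<epsilon> * (1 / 2 * norm (q s))"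
        using e(3)[of s] s norm_triangle_sub[of "\<epsilon> *\<^sub>R q s" "w \<epsilon> s"] e(1) by (simp add: norm_minus_commute)
      ultimately show ?thesis using e(1) by (simp add: field_simps)
    qed
    then show thesis using that[of "2 * (norm (y \<epsilon> - p) + 1) / \<epsilon>" "min d \<epsilon>"] e(1) d(1) by simp
  qed
  have "\<exists>A. (q \<longlongrightarrow> A) (at 0)"
  proof (rule tendsto_at_zero_CauchyI)
    fix \<tau> :: real assume \<tau>: "\<tau> > 0"
    define \<delta> where "\<delta> = \<tau> / (4 * (C + 1))"
    have \<delta>: "\<delta> > 0" "\<delta> * C \<le> \<tau> / 4" using \<tau> C(1) by (auto simp: \<delta>_def field_simps)
    obtain \<epsilon> where e: "\<epsilon> > 0" "\<epsilon> < \<rho> / 2" "\<And>s. s \<noteq> 0 \<Longrightarrow> \<bar>s\<bar> < \<epsilon> \<Longrightarrow> norm (w \<epsilon> s - \<epsilon> *\<^sub>R q s) \<le> \<epsilon> * (\<delta> * norm (q s))"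
      using key[OF \<delta>(1)] by auto
    have "\<forall>\<^sub>F s in at 0. dist (w \<epsilon> s) (y \<epsilon> - p) < \<epsilon> * \<tau> / 4"
      by (rule tendstoD[OF w[OF e(1,2)]]) (use e(1) \<tau> in simp)
    then obtain d where d: "d > 0" "\<And>s. s \<noteq> 0 \<Longrightarrow> \<bar>s\<bar> < d \<Longrightarrow> dist (w \<epsilon> s) (y \<epsilon> - p) < \<epsilon> * \<tau> / 4"
      unfolding eventually_at by auto
    \<comment> \<open>All difference quotients near 0 lie within \<open>\<tau> / 2\<close> of the
      fixed vector \<open>(y \<epsilon> - p) / \<epsilon>\<close>, hence within
      \<open>\<tau>\<close> of one another.\<close>
    have near: "norm (y \<epsilon> - p - \<epsilon> *\<^sub>R q s) \<le> \<epsilon> * (\<tau> / 2)" if s: "s \<noteq> 0" "\<bar>s\<bar> < min (min d \<epsilon>) \<eta>0" for s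
    proof -
      have "\<delta> * norm (q s) \<le> \<delta> * C" using C(3)[of s] s \<delta>(1) by (intro mult_left_mono) auto
      then have "norm (w \<epsilon> s - \<epsilon> *\<^sub>R q s) \<le> \<epsilon> * (\<tau> / 4)"
        using e(3)[of s] s \<delta>(2) e(1) by (intro order_trans[OF e(3) mult_left_mono]) auto
      moreover have "norm (y \<epsilon> - p - w \<epsilon> s) \<le> \<epsilon> * \<tau> / 4" using d(2)[of s] s by (simp add: dist_norm norm_minus_commute)
      ultimately show ?thesis
        using norm_triangle_ineq[of "y \<epsilon> - p - w \<epsilon> s" "w \<epsilon> s - \<epsilon> *\<^sub>R q s"] by simp
    qed
    have "norm (q s - q s') \<le> \<tau>" if "s \<noteq> 0" "\<bar>s\<bar> < min (min d \<epsilon>) \<eta>0" "s' \<noteq> 0" "\<bar>s'\<bar> < min (min d \<epsilon>) \<eta>0" for s s'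
    proof -
      have "\<epsilon> * norm (q s - q s') = norm (\<epsilon> *\<^sub>R (q s - q s'))" using e(1) by simp
      also have "\<epsilon> *\<^sub>R (q s - q s') = (y \<epsilon> - p - \<epsilon> *\<^sub>R q s') - (y \<epsilon> - p - \<epsilon> *\<^sub>R q s)"
        by (simp add: scaleR_diff_right)
      also have "norm \<dots> \<le> \<epsilon> * (\<tau> / 2) + \<epsilon> * (\<tau> / 2)"
        using near[OF that(1,2)] near[OF that(3,4)] norm_triangle_ineq4 by (meson add_mono order_trans)
      finally show ?thesis using e(1) by (simp add: field_simps)
    qed
    then show "\<exists>\<eta>>0. \<forall>s s'. s \<noteq> 0 \<and> \<bar>s\<bar> < \<eta> \<and> s' \<noteq> 0 \<and> \<bar>s'\<bar> < \<eta> \<longrightarrow> norm (q s - q s') \<le> \<tau>"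
      using d(1) e(1) C(2) by (intro exI[of _ "min (min d \<epsilon>) \<eta>0"]) auto
  qed
  then obtain A where A: "(q \<longlongrightarrow> A) (at 0)" ..
  then have "(y has_vector_derivative A) (at 0)"
    by (simp add: has_vector_derivative_at_zero_iff q_def y0)
  then show ?thesis ..
qed

context lie_grp
begin

section \<open>Existence and uniqueness of one-parameter subgroups\<close>

lemma mult_near:
  obtains N where "open N" "(e0, e0) \<in> N" "N \<subseteq> \<Omega> \<times> \<Omega>"
    "\<And>x y. (x, y) \<in> N \<Longrightarrow> \<iota> x \<otimes> \<iota> y \<in> U"
    "smooth_on N (\<lambda>(x, y). \<phi> (\<iota> x \<otimes> \<iota> y))"
    "((\<lambda>(x, y). \<phi> (\<iota> x \<otimes> \<iota> y)) has_derivative (\<lambda>(X, Y). X + Y)) (at (e0, e0))"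
proof -
  obtain N where N: "open N" "(e0, e0) \<in> N" "N \<subseteq> \<Omega> \<times> \<Omega>"
    "\<And>x y. (x, y) \<in> N \<Longrightarrow> \<one> \<otimes> \<iota> x \<otimes> inv \<one> \<otimes> \<iota> y \<in> U"
    "smooth_on N (\<lambda>(x, y). \<phi> (\<one> \<otimes> \<iota> x \<otimes> inv \<one> \<otimes> \<iota> y))"
    by (rule twisted_mult_smooth[OF one_closed]) (rule that)
  have eq: "\<one> \<otimes> \<iota> x \<otimes> inv \<one> \<otimes> \<iota> y = \<iota> x \<otimes> \<iota> y" if "(x, y) \<in> N" for x y
    using that N(3) pt_carrier by auto
  show thesis
  proof (rule that[OF N(1-3)])
    show "\<iota> x \<otimes> \<iota> y \<in> U" if "(x, y) \<in> N" for x y using N(4)[OF that] eq[OF that] by simp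
    show "smooth_on N (\<lambda>(x, y). \<phi> (\<iota> x \<otimes> \<iota> y))"
      using N(5) by (rule smooth_on_cong[OF N(1), THEN iffD1, rotated])
        (simp only: split_paired_all prod.case eq)
    show "((\<lambda>(x, y). \<phi> (\<iota> x \<otimes> \<iota> y)) has_derivative (\<lambda>(X, Y). X + Y)) (at (e0, e0))"
      using twisted_mult_derivative[OF one_closed, unfolded Ad_one]
      by (rule has_derivative_transform_within_open[OF _ N(1,2)]) (simp only: split_paired_all prod.case eq)
  qed
qed

lemma lvel_subset: "lvel c A t S \<Longrightarrow> T \<subseteq> S \<Longrightarrow> lvel c A t T"
  unfolding lvel_def using has_vector_derivative_within_subset
  by (auto elim: filter_leD[OF at_le])

lemma lvel_shift:
  assumes "lvel c A (s + t) UNIV"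
  shows "lvel (\<lambda>u. c (s + u)) A t UNIV"
  unfolding lvel_def
proof (intro conjI)
  show "c (s + t) \<in> carrier G" using lvel_carrier[OF assms] .
  obtain d where d: "d > 0" "\<And>u. u \<noteq> s + t \<Longrightarrow> dist u (s + t) < d \<Longrightarrow> c u \<in> carrier G \<and> inv (c (s + t)) \<otimes> c u \<in> U"
    using lvel_eventually[OF assms] unfolding eventually_at by auto
  show "\<forall>\<^sub>F u in at t. c (s + u) \<in> carrier G \<and> inv (c (s + t)) \<otimes> c (s + u) \<in> U"
    unfolding eventually_at using d by (intro exI[of _ d]) (auto simp: dist_norm)
  have "((\<lambda>u. s + u) has_vector_derivative 1) (at t)" by (auto intro!: derivative_eq_intros)
  from vector_diff_chain_at[OF this lvel_deriv[OF assms]]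
  show "((\<lambda>u. \<phi> (inv (c (s + t)) \<otimes> c (s + u))) has_vector_derivative A) (at t)" by (simp add: o_def)
qed

text \<open>\<open>c\<close> is the integral curve through the identity of the left-invariant field
  of \<open>A\<close>. The homomorphism law is uniqueness for \<open>t \<mapsto> c (s + t)\<close>
  and \<open>t \<mapsto> c s \<otimes> c t\<close>, which both have constant velocity
  \<open>A\<close>.\<close>

lemma local_one_parameter:
  obtains \<epsilon> c where "\<epsilon> > 0" "c 0 = \<one>" "\<And>t. \<bar>t\<bar> < \<epsilon> \<Longrightarrow> lvel c A t UNIV"
    "manifold_smooth_on vec_atlas (charts G) {-\<epsilon><..<\<epsilon>} c"
    "\<And>s t. \<bar>s\<bar> < \<epsilon> \<Longrightarrow> \<bar>t\<bar> < \<epsilon> \<Longrightarrow> c (s + t) = c s \<otimes> c t"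
proof -
  obtain N where N: "open N" "(e0, e0) \<in> N" "N \<subseteq> \<Omega> \<times> \<Omega>"
    "\<And>x y. (x, y) \<in> N \<Longrightarrow> \<iota> x \<otimes> \<iota> y \<in> U"
    "smooth_on N (\<lambda>(x, y). \<phi> (\<iota> x \<otimes> \<iota> y))"
    "((\<lambda>(x, y). \<phi> (\<iota> x \<otimes> \<iota> y)) has_derivative (\<lambda>(X, Y). X + Y)) (at (e0, e0))"
    by (rule mult_near) (rule that)
  let ?Q = "\<lambda>(x, y). \<phi> (\<iota> x \<otimes> \<iota> y)"
  define DQ where "DQ x = frechet_derivative ?Q (at (x, e0))" for x
  \<comment> \<open>The left-invariant field in coordinates: the derivative of
    \<open>z \<mapsto> \<iota> x \<otimes> \<iota> z\<close> at the identity in direction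
    \<open>A\<close>.\<close>
  define V where "V x = DQ x (0, A)" for x
  define N0 where "N0 = (\<lambda>x. (x, e0)) -` N"
  have N0: "open N0" "e0 \<in> N0"
    unfolding N0_def using N(1,2) by (auto intro!: open_vimage continuous_intros)
  have pr: "smooth_on N0 (\<lambda>x. (x, e0))"
    by (rule smooth_on_Pair[OF N0(1) smooth_on_linear[OF N0(1) bounded_linear_ident] smooth_on_const])
  have V: "smooth_on N0 V"
    unfolding V_def DQ_def
    by (rule smooth_on_compose[OF fd2 N0(1) smooth_on_derivative[OF N(5)] pr]) (auto simp: N0_def)
  obtain r L where r: "r > 0" "L \<ge> 0" "ball e0 r \<subseteq> N0"
    "\<And>x y. x \<in> ball e0 r \<Longrightarrow> y \<in> ball e0 r \<Longrightarrow> norm (V x - V y) \<le> L * norm (x - y)"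
    using smooth_on_locally_lipschitz[OF fd N0(1) V N0(2)] by blast
  obtain \<epsilon> y where y: "\<epsilon> > 0" "y 0 = e0" "\<And>t. \<bar>t\<bar> < \<epsilon> \<Longrightarrow> y t \<in> ball e0 r"
    "\<And>t. \<bar>t\<bar> < \<epsilon> \<Longrightarrow> (y has_vector_derivative V (y t)) (at t)"
    by (rule picard_local[of r L e0 V]) (use r in auto)
  have yN: "(y t, e0) \<in> N" if "\<bar>t\<bar> < \<epsilon>" for t using y(3)[OF that] r(3) by (auto simp: N0_def)
  have y\<Omega>: "y t \<in> \<Omega>" if "\<bar>t\<bar> < \<epsilon>" for t using yN[OF that] N(3) by auto
  define c where "c t = \<iota> (y t)" for t
  define S where "S = {-\<epsilon><..<\<epsilon>}"
  have S: "open S" "\<And>t. t \<in> S \<longleftrightarrow> \<bar>t\<bar> < \<epsilon>" by (auto simp: S_def)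
  have lv: "lvel c A t UNIV" if t: "\<bar>t\<bar> < \<epsilon>" for t
  proof -
    have g: "c t \<in> carrier G" using pt_carrier[OF y\<Omega>[OF t]] by (simp add: c_def)
    have sm: "manifold_smooth_on vec_atlas (charts G) \<Omega> (\<lambda>x. inv (c t) \<otimes> \<iota> x)"
      by (intro smooth_mult_vec fd smooth_const_vec smooth_pt g inv_closed)
    have 1: "inv (c t) \<otimes> \<iota> (y t) \<in> U" using g one_U by (simp flip: c_def)
    obtain M where M: "open M" "y t \<in> M" "M \<subseteq> \<Omega>" "\<And>x. x \<in> M \<Longrightarrow> inv (c t) \<otimes> \<iota> x \<in> U"
      "smooth_on M (\<lambda>x. \<phi> (inv (c t) \<otimes> \<iota> x))"
      by (rule coord_smooth[OF sm fd open_\<Omega> y\<Omega>[OF t] 1]) (rule that)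
    let ?R = "\<lambda>x. \<phi> (inv (c t) \<otimes> \<iota> x)"
    let ?DR = "frechet_derivative ?R (at (y t))"
    have R: "(?R has_derivative ?DR) (at (y t))" by (rule smooth_on_has_derivative[OF M(5,2)])
    have Q: "(?Q has_derivative DQ (y t)) (at (y t, e0))"
      unfolding DQ_def by (rule smooth_on_has_derivative[OF N(5) yN[OF t]])
    have Qz: "((\<lambda>z. ?Q (y t, z)) has_derivative (\<lambda>Z. DQ (y t) (0, Z))) (at e0)"
      by (rule has_derivative_compose[where f = "\<lambda>z. (y t, z)", OF _ Q]) (auto intro!: derivative_eq_intros)
    have Q0: "?Q (y t, e0) = y t" using y\<Omega>[OF t] by (simp add: pt_e0 pt_carrier coord_pt)
    \<comment> \<open>Multiplying by \<open>c t\<close> and translating back is the identity near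
      \<open>e0\<close>. So \<open>?DR\<close> undoes \<open>Z \<mapsto> DQ (y t) (0, Z)\<close>,
      and the velocity of \<open>c\<close> at \<open>t\<close> is \<open>A\<close> itself.\<close>
    have "((\<lambda>z. ?R (?Q (y t, z))) has_derivative (\<lambda>Z. ?DR (DQ (y t) (0, Z)))) (at e0)"
      by (rule has_derivative_compose[OF Qz]) (use R Q0 in simp)
    moreover have "((\<lambda>z. ?R (?Q (y t, z))) has_derivative (\<lambda>Z. Z)) (at e0)"
    proof (rule has_derivative_transform_within_open[OF has_derivative_ident])
      show "open ((\<lambda>z. (y t, z)) -` N)" using N(1) by (intro open_vimage continuous_intros)
      show "e0 \<in> (\<lambda>z. (y t, z)) -` N" using yN[OF t] by simp
      fix z assume "z \<in> (\<lambda>z. (y t, z)) -` N"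
      then have z: "(y t, z) \<in> N" by simp
      then have "\<iota> z \<in> carrier G" "z \<in> \<Omega>" using N(3) pt_carrier by auto
      then show "z = ?R (?Q (y t, z))"
        using pt_coord[OF N(4)[OF z]] g by (simp add: c_def[symmetric] inv_mult_cancel' coord_pt)
    qed
    ultimately have "?DR (DQ (y t) (0, Z)) = Z" for Z using has_derivative_unique by (metis (no_types, lifting))
    then have "((\<lambda>u. ?R (y u)) has_vector_derivative A) (at t)"
      using has_vector_derivative_compose_derivative[OF y(4)[OF t] R] by (simp add: V_def)
    moreover have "\<forall>\<^sub>F u in at t. y u \<in> M"
      by (rule has_vector_derivative_eventually_mem[OF y(4)[OF t] M(1,2)])
    then have "\<forall>\<^sub>F u in at t. c u \<in> carrier G \<and> inv (c t) \<otimes> c u \<in> U"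
      by eventually_elim (use M(3,4) pt_carrier in \<open>auto simp: c_def\<close>)
    ultimately show ?thesis using g by (simp add: lvel_def c_def)
  qed
  \<comment> \<open>The equation \<open>y' = V y\<close> bootstraps the solution to
    smoothness.\<close>
  have ysm: "smooth_on S y"
  proof (rule smooth_onI_bootstrap[OF S(1), where f' = "\<lambda>t h. h *\<^sub>R V (y t)"])
    show "(y has_derivative (\<lambda>h. h *\<^sub>R V (y t))) (at t)" if "t \<in> S" for t
      using y(4) that S(2) by (simp add: has_vector_derivative_def)
    show "higher_differentiable_on n S (\<lambda>t. h *\<^sub>R V (y t))" if "higher_differentiable_on n S y" for n h
    proof -
      have "y ` S \<subseteq> N0" using y(3) r(3) S(2) by blast
      then have "higher_differentiable_on n S (\<lambda>t. V (y t))"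
        using V that unfolding smooth_on_def by (blast intro: higher_differentiable_on_compose[OF fd S(1)])
      then show ?thesis
        by (rule higher_differentiable_on_linear_compose[OF S(1) bounded_linear_scaleR_right])
    qed
  qed
  have csm: "manifold_smooth_on vec_atlas (charts G) S c"
    unfolding c_def
    by (rule manifold_smooth_on_compose[OF manifold_smooth_on_vecI[OF S(1) ysm] smooth_pt _ smooth_atlas_vec
        smooth_atlas_vec findim_euclidean fd]) (use y\<Omega> S(2) in auto)
  have c0: "c 0 = \<one>" using y(2) by (simp add: c_def pt_e0)
  \<comment> \<open>Both arguments stay below \<open>\<epsilon> / 2\<close> so that
    \<open>s + t\<close> remains in the domain of the local curve.\<close>
  have hom: "c (s + t) = c s \<otimes> c t" if "\<bar>s\<bar> < \<epsilon> / 2" "\<bar>t\<bar> < \<epsilon> / 2" for s t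
  proof -
    let ?I = "{-\<epsilon>/2<..<\<epsilon>/2}"
    have s: "c s \<in> carrier G" using lvel_carrier[OF lv, of s] that y(1) by auto
    show ?thesis
    proof (rule lvel_unique[where S = ?I and A = "\<lambda>_. A" and c = "\<lambda>t. c (s + t)" and d = "\<lambda>t. c s \<otimes> c t" and s = 0])
      show "lvel (\<lambda>t. c (s + t)) A u ?I" if "u \<in> ?I" for u
        using that \<open>\<bar>s\<bar> < \<epsilon> / 2\<close> by (intro lvel_subset[OF lvel_shift[OF lv]]) auto
      show "lvel (\<lambda>t. c s \<otimes> c t) A u ?I" if "u \<in> ?I" for u
        using that y(1) by (intro lvel_translate s lvel_subset[OF lv]) auto
    qed (use that y(1) s c0 in auto)
  qed
  show thesis
    by (rule that[of "\<epsilon> / 2" c]) (use y(1) c0 lv hom in \<open>auto intro: manifold_smooth_on_subset[OF csm] simp: S_def\<close>)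
qed

text \<open>The local homomorphism is extended by taking the \<open>n\<close>-th power of
  \<open>c (t / n)\<close> for large \<open>n\<close>; passing to a common multiple shows
  independence of \<open>n\<close>.\<close>

lemma one_param_exists: "\<exists>c. one_param G A c"
proof -
  obtain \<delta> c where c: "\<delta> > 0" "c 0 = \<one>" "\<And>t. \<bar>t\<bar> < \<delta> \<Longrightarrow> lvel c A t UNIV"
    "manifold_smooth_on vec_atlas (charts G) {-\<delta><..<\<delta>} c"
    and hom: "\<And>s t. \<bar>s\<bar> < \<delta> \<Longrightarrow> \<bar>t\<bar> < \<delta> \<Longrightarrow> c (s + t) = c s \<otimes> c t"
    by (rule local_one_parameter[of A]) (rule that)
  have cc: "c t \<in> carrier G" if "\<bar>t\<bar> < \<delta>" for t using lvel_carrier[OF c(3)[OF that]] .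
  have small: "\<bar>t / real n\<bar> < \<delta>" if "n \<ge> m" "m > 0" "\<bar>t / real m\<bar> < \<delta>" for t n m
  proof -
    have "\<bar>t\<bar> / real n \<le> \<bar>t\<bar> / real m" using that(1,2) by (intro divide_left_mono) auto
    then have "\<bar>t / real n\<bar> \<le> \<bar>t / real m\<bar>" by (simp add: abs_divide)
    then show ?thesis using that(3) by simp
  qed
  have pow: "c (real k * r) = c r [^] k" if "\<bar>real k * r\<bar> < \<delta>" for k r
    using that
  proof (induction k)
    case 0
    then show ?case using c(2) by simp
  next
    case (Suc k)
    have "\<bar>real (Suc k) * r\<bar> = real (Suc k) * \<bar>r\<bar>" by (simp add: abs_mult)
    then have le: "real (Suc k) * \<bar>r\<bar> < \<delta>" using Suc.prems by simp
    have "real k * \<bar>r\<bar> \<le> real (Suc k) * \<bar>r\<bar>" by (rule mult_right_mono) simp_all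
    moreover have "1 * \<bar>r\<bar> \<le> real (Suc k) * \<bar>r\<bar>" by (rule mult_right_mono) simp_all
    ultimately have sm: "\<bar>real k * r\<bar> < \<delta>" "\<bar>r\<bar> < \<delta>"
      using le unfolding abs_mult by auto
    have "real (Suc k) * r = real k * r + r" by (simp add: distrib_right)
    then show ?case using hom[OF sm] Suc.IH[OF sm(1)] by (simp only: nat_pow_Suc)
  qed
  \<comment> \<open>The added 1 makes \<open>n t\<close> positive and the bound on
    \<open>\<bar>t / n t\<bar>\<close> strict.\<close>
  define n where "n t = nat \<lceil>\<bar>t\<bar> / \<delta>\<rceil> + 1" for t
  have n: "n t > 0" "\<bar>t / real (n t)\<bar> < \<delta>" for t
  proof -
    show "n t > 0" by (simp add: n_def)
    have "\<bar>t\<bar> / \<delta> \<le> of_int \<lceil>\<bar>t\<bar> / \<delta>\<rceil>" by (rule le_of_int_ceiling)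
    also have "\<dots> \<le> real (nat \<lceil>\<bar>t\<bar> / \<delta>\<rceil>)" by (simp add: of_nat_nat)
    finally have "\<bar>t\<bar> / \<delta> < real (n t)" by (simp add: n_def)
    then show "\<bar>t / real (n t)\<bar> < \<delta>"
      using c(1) \<open>n t > 0\<close> by (simp add: abs_divide divide_less_eq mult.commute)
  qed
  define d where "d t = c (t / real (n t)) [^] n t" for t
  have pp: "c (t / real k) [^] k = c (t / real m) [^] m"
    if "k > 0" "m > 0" "\<bar>t / real k\<bar> < \<delta>" "\<bar>t / real m\<bar> < \<delta>" for t k m
  proof -
    have km: "\<bar>t / real (k * m)\<bar> < \<delta>" by (rule small[OF _ that(1,3)]) (use that in simp)
    have "c (real m * (t / real (k * m))) = c (t / real (k * m)) [^] m"
      by (rule pow) (use that in simp)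
    then have 1: "c (t / real k) = c (t / real (k * m)) [^] m" using that by simp
    have "c (real k * (t / real (k * m))) = c (t / real (k * m)) [^] k"
      by (rule pow) (use that in simp)
    then have 2: "c (t / real m) = c (t / real (k * m)) [^] k" using that by simp
    show ?thesis unfolding 1 2 using cc[OF km] by (simp add: nat_pow_pow mult.commute)
  qed
  have dn: "d t = c (t / real k) [^] k" if "k > 0" "\<bar>t / real k\<bar> < \<delta>" for t k
    unfolding d_def using pp[OF n(1) that(1) n(2) that(2)] .
  have dc: "d t = c t" if "\<bar>t\<bar> < \<delta>" for t using dn[of 1 t] that cc[OF that] by simp
  have dcar: "d t \<in> carrier G" for t unfolding d_def using cc[OF n(2)] by simp
  have dhom: "d (s + t) = d s \<otimes> d t" for s t
  proof -
    \<comment> \<open>One denominator fine enough for \<open>s\<close>, \<open>t\<close> and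
      \<open>s + t\<close>. As \<open>c (s / k)\<close> and \<open>c (t / k)\<close> commute, the
      \<open>k\<close>-th power of their product splits.\<close>
    define k where "k = n s + n t + n (s + t)"
    have k: "k > 0" "\<bar>s / real k\<bar> < \<delta>" "\<bar>t / real k\<bar> < \<delta>" "\<bar>(s + t) / real k\<bar> < \<delta>"
      using small[OF _ n(1) n(2), of s k] small[OF _ n(1) n(2), of t k] small[OF _ n(1) n(2), of "s + t" k] n(1)[of s]
      by (auto simp: k_def)
    have "c (s / real k) \<otimes> c (t / real k) = c (t / real k) \<otimes> c (s / real k)"
      unfolding hom[OF k(2,3), symmetric] hom[OF k(3,2), symmetric] by (simp only: add.commute)
    from pow_mult_distrib[OF this cc[OF k(2)] cc[OF k(3)], of k]
    show ?thesis
      by (simp only: dn[OF k(1,2)] dn[OF k(1,3)] dn[OF k(1,4)] add_divide_distrib hom[OF k(2,3)])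
  qed
  \<comment> \<open>Near any \<open>t\<close> the curve \<open>d\<close> is the translate
    \<open>d t \<otimes> c (u - t)\<close> of the smooth local curve.\<close>
  have dsm: "manifold_smooth_on vec_atlas (charts G) UNIV d"
  proof (rule manifold_smooth_on_local[OF smooth_atlas_vec])
    fix t :: real
    define B where "B = {t - \<delta><..<t + \<delta>}"
    have o: "open B" by (simp add: B_def)
    have sh: "smooth_on B (\<lambda>u. u - t)"
      by (rule smooth_onI_bootstrap[OF o, where f' = "\<lambda>_ h. h"])
       (auto intro!: derivative_eq_intros higher_differentiable_on_const)
    have "manifold_smooth_on vec_atlas (charts G) B (\<lambda>u. c (u - t))"
      by (rule manifold_smooth_on_compose[OF manifold_smooth_on_vecI[OF o sh] c(4) _ smooth_atlas_vec
        smooth_atlas_vec findim_euclidean findim_euclidean]) (auto simp: B_def)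
    then have "manifold_smooth_on vec_atlas (charts G) B (\<lambda>u. d t \<otimes> c (u - t))"
      by (intro smooth_mult_vec findim_euclidean smooth_const_vec dcar)
    then have "manifold_smooth_on vec_atlas (charts G) (UNIV \<inter> B) d"
    proof (rule manifold_smooth_on_cong)
      show "d u = d t \<otimes> c (u - t)" if "u \<in> UNIV \<inter> B" for u
        using that dhom[of t "u - t"] dc[of "u - t"] by (auto simp: B_def)
    qed auto
    then show "\<exists>T. openin (manifold_topology vec_atlas) T \<and> t \<in> T \<and> manifold_smooth_on vec_atlas (charts G) (UNIV \<inter> T) d"
      using o c(1) by (intro exI[of _ B]) (auto simp: manifold_topology_vec B_def)
  qed
  have "((\<lambda>u. \<phi> (inv (c 0) \<otimes> c u)) has_vector_derivative A) (at 0)"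
    using lvel_deriv[OF c(3)[of 0]] c(1) by simp
  then have "((\<lambda>u. \<phi> (d u)) has_vector_derivative A) (at 0)"
    unfolding has_vector_derivative_def
    by (rule has_derivative_transform_within_open[of _ _ _ _ "{-\<delta><..<\<delta>}"])
      (use c(1,2) cc dc in \<open>auto simp: abs_less_iff\<close>)
  then have "one_param G A d" using dsm dhom by (simp add: one_param_def)
  then show ?thesis by (intro exI[of _ d])
qed

lemma hom_curve_zero:
  assumes "\<And>t. c t \<in> carrier G" "\<And>s t. c (s + t) = c s \<otimes> c (t::real)"
  shows "c 0 = \<one>" "inv (c t) \<otimes> c u = c (u - t)"
proof -
  have "c 0 \<otimes> c 0 = c 0" using assms(2)[of 0 0] by simp
  then show 0: "c 0 = \<one>" using assms(1)[of 0] by simp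
  have "c u = c t \<otimes> c (u - t)" using assms(2)[of t "u - t"] by simp
  then show "inv (c t) \<otimes> c u = c (u - t)" using assms(1) by (simp add: inv_mult_cancel')
qed

text \<open>By the homomorphism law the displacement \<open>inv (c t) \<otimes> c u\<close> is
  \<open>c (u - t)\<close>, so the velocity at every time is the one at 0.\<close>

lemma hom_curve_lvel:
  assumes car: "\<And>t. c t \<in> carrier G" and hom: "\<And>s t. c (s + t) = c s \<otimes> c (t::real)"
    and ev: "\<forall>\<^sub>F u in at 0. c u \<in> U" and d: "((\<lambda>u. \<phi> (c u)) has_vector_derivative A) (at 0)"
  shows "lvel c A t UNIV"
  unfolding lvel_def hom_curve_zero(2)[OF car hom]
proof (intro conjI)
  show "c t \<in> carrier G" by (rule car)
  obtain e where e: "e > 0" "\<And>u. u \<noteq> 0 \<Longrightarrow> dist u 0 < e \<Longrightarrow> c u \<in> U"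
    using ev unfolding eventually_at by auto
  show "\<forall>\<^sub>F u in at t. c u \<in> carrier G \<and> c (u - t) \<in> U"
    unfolding eventually_at using e car by (intro exI[of _ e]) (auto simp: dist_norm)
  have sh: "((\<lambda>u. u - t) has_vector_derivative 1) (at t)" by (auto intro!: derivative_eq_intros)
  have d': "((\<lambda>u. \<phi> (c u)) has_vector_derivative A) (at (t - t))" using d by simp
  from vector_diff_chain_at[OF sh d']
  show "((\<lambda>u. \<phi> (c (u - t))) has_vector_derivative A) (at t)" by (simp add: o_def)
qed

lemma one_param_carrier: "one_param G A c \<Longrightarrow> c t \<in> carrier G"
  unfolding one_param_def using smooth_on_carrier[of vec_atlas UNIV c] by blast

lemma one_param_lvel:
  assumes c: "one_param G A c"
  shows "lvel c A t UNIV"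
proof (rule hom_curve_lvel)
  have sm: "manifold_smooth_on vec_atlas (charts G) UNIV c"
    and hom: "\<And>s t. c (s + t) = c s \<otimes> c t" and d: "((\<lambda>u. \<phi> (c u)) has_vector_derivative A) (at 0)"
    using c by (auto simp: one_param_def)
  show car: "c t \<in> carrier G" for t using one_param_carrier[OF c] .
  show "c (s + t) = c s \<otimes> c t" for s t by (rule hom)
  show "((\<lambda>u. \<phi> (c u)) has_vector_derivative A) (at 0)" by (rule d)
  have "lvel c A 0 UNIV"
    by (rule lvelI[OF sm]) (use d car in \<open>simp_all add: hom_curve_zero(1)[OF car hom]\<close>)
  from lvel_eventually[OF this] show "\<forall>\<^sub>F u in at 0. c u \<in> U"
    by eventually_elim (simp add: hom_curve_zero[OF car hom] car)
qed

lemma hom_curve_unique: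
  assumes c: "\<And>t. lvel c A t UNIV" "c 0 = \<one>" and d: "one_param G A d"
  shows "c t = d t"
proof (rule lvel_unique[of UNIV c "\<lambda>_. A" d 0 t])
  have "d 0 = \<one>"
    using d by (intro hom_curve_zero(1) one_param_carrier[OF d]) (simp add: one_param_def)
  then show "c 0 = d 0" using c(2) by simp
qed (use c one_param_lvel[OF d] connected_UNIV in auto)

lemma one_param_zero: "one_param G A c \<Longrightarrow> c 0 = \<one>"
  by (rule hom_curve_zero(1)) (auto simp: one_param_carrier one_param_def)

lemma one_param_unique: "one_param G A c \<Longrightarrow> one_param G A d \<Longrightarrow> c = d"
  by (rule ext, rule hom_curve_unique[OF one_param_lvel one_param_zero])

text \<open>Uniqueness makes the \<open>THE\<close> in \<open>lexp\<close> denote the given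
  subgroup.\<close>

lemma lexp_eq: "one_param G A c \<Longrightarrow> lexp G A = c 1"
  unfolding lexp_def by (subst the_equality[of _ c]) (auto intro: one_param_unique)

lemma one_param_scale:
  assumes c: "one_param G A c"
  shows "one_param G (r *\<^sub>R A) (\<lambda>u. c (r * u))"
  unfolding one_param_def
proof (intro conjI allI)
  have "smooth_on UNIV (\<lambda>u. r * u)"
    by (rule smooth_on_linear[OF open_UNIV bounded_linear_mult_right])
  moreover have "manifold_smooth_on vec_atlas (charts G) UNIV c" using c by (simp add: one_param_def)
  ultimately show "manifold_smooth_on vec_atlas (charts G) UNIV (\<lambda>u. c (r * u))"
    by (rule manifold_smooth_on_compose[OF manifold_smooth_on_vecI[OF open_UNIV] _ _ smooth_atlas_vec
        smooth_atlas_vec findim_euclidean findim_euclidean]) auto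
  show "c (r * (s + t)) = c (r * s) \<otimes> c (r * t)" for s t
    using c by (simp add: one_param_def distrib_left)
  have sh: "((\<lambda>u. r * u) has_vector_derivative r) (at 0)" by (auto intro!: derivative_eq_intros)
  have "((\<lambda>u. \<phi> (c u)) has_vector_derivative A) (at (r * 0))" using c by (simp add: one_param_def)
  from vector_diff_chain_at[OF sh this]
  show "((\<lambda>u. \<phi> (c (r * u))) has_vector_derivative r *\<^sub>R A) (at 0)" by (simp add: o_def)
qed

lemma lexp_curve:
  assumes "one_param G A c"
  shows "lexp G (u *\<^sub>R A) = c u"
  using lexp_eq[OF one_param_scale[OF assms]] by simp

lemma one_param_lexp: "one_param G A (\<lambda>u. lexp G (u *\<^sub>R A))"
proof -
  obtain c where c: "one_param G A c" using one_param_exists by blast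
  have "(\<lambda>u. lexp G (u *\<^sub>R A)) = c" using lexp_curve[OF c] by blast
  then show ?thesis using c by simp
qed

lemma lexp_carrier: "lexp G A \<in> carrier G"
  using one_param_carrier[OF one_param_lexp[of A], of 1] by simp

lemma lexp_zero: "lexp G 0 = \<one>"
  using one_param_zero[OF one_param_lexp[of 0]] by simp

lemma lexp_add: "lexp G ((s + t) *\<^sub>R A) = lexp G (s *\<^sub>R A) \<otimes> lexp G (t *\<^sub>R A)"
  using one_param_lexp[of A] by (simp add: one_param_def)

lemma lexp_lvel: "lvel (\<lambda>u. lexp G (u *\<^sub>R A)) A t UNIV"
  by (rule one_param_lvel[OF one_param_lexp])

lemma lexp_smooth: "manifold_smooth_on vec_atlas (charts G) UNIV (\<lambda>u. lexp G (u *\<^sub>R A))"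
  using one_param_lexp[of A] by (simp add: one_param_def)

lemma lexp_inv: "inv (lexp G (t *\<^sub>R A)) = lexp G ((- t) *\<^sub>R A)"
proof -
  have "lexp G ((- t) *\<^sub>R A) \<otimes> lexp G (t *\<^sub>R A) = \<one>"
    using lexp_add[of "- t" t A] by (simp add: lexp_zero)
  then show ?thesis by (rule inv_equality) (rule lexp_carrier)+
qed

text \<open>In the chart at the identity multiplication has derivative
  \<open>(X, Y) \<mapsto> X + Y\<close>, hence is close to a translation, and
  \<open>local_one_parameter_differentiable\<close> applies. Tori are given up to homeomorphism, so
  their one-parameter subgroups arrive as continuous ones.\<close>

lemma continuous_one_parameter:
  assumes cont: "continuous_map euclideanreal (lie_topology G) c"
    and hom: "\<And>s t. c (s + t) = c s \<otimes> c (t::real)"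
  shows "\<exists>A. \<forall>t. c t = lexp G (t *\<^sub>R A)"
proof -
  have car: "c t \<in> carrier G" for t
    using continuous_map_image_subset_topspace[OF cont] topspace_manifold_topology[OF atl] by auto
  note zero = hom_curve_zero[OF car hom]
  have pre: "open {t. c t \<in> U \<inter> \<phi> -` N}" if "open N" for N
    using openin_continuous_map_preimage[OF cont openin_chart_preimage[OF atl id_chart_mem that]] by simp
  define T where "T = {t. c t \<in> U}"
  have T: "open T" "0 \<in> T" using pre[of UNIV] one_U zero(1) by (auto simp: T_def)
  have yc: "continuous_on T (\<lambda>t. \<phi> (c t))"
  proof (subst continuous_on_open_vimage[OF T(1)], intro allI impI)
    fix B :: "'e set" assume "open B"
    have "(\<lambda>t. \<phi> (c t)) -` B \<inter> T = {t. c t \<in> U \<inter> \<phi> -` B}" by (auto simp: T_def)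
    then show "open ((\<lambda>t. \<phi> (c t)) -` B \<inter> T)" using pre[OF \<open>open B\<close>] by simp
  qed
  obtain \<rho>0 where "\<rho>0 > 0" "ball 0 \<rho>0 \<subseteq> T" using T openE by blast
  then have \<rho>: "\<rho>0 / 2 > 0" "{-(\<rho>0/2)..\<rho>0/2} \<subseteq> T" by (auto simp: subset_iff dist_norm)
  have inU: "c t \<in> U" if "\<bar>t\<bar> \<le> \<rho>0 / 2" for t
  proof -
    have "t \<in> {-(\<rho>0/2)..\<rho>0/2}" using abs_le_D1[OF that] abs_le_D2[OF that] by simp
    then show ?thesis using \<rho>(2) unfolding T_def by blast
  qed
  obtain N where N: "open N" "(e0, e0) \<in> N" "N \<subseteq> \<Omega> \<times> \<Omega>"
    "\<And>x y. (x, y) \<in> N \<Longrightarrow> \<iota> x \<otimes> \<iota> y \<in> U"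
    "smooth_on N (\<lambda>(x, y). \<phi> (\<iota> x \<otimes> \<iota> y))"
    "((\<lambda>(x, y). \<phi> (\<iota> x \<otimes> \<iota> y)) has_derivative (\<lambda>(X, Y). X + Y)) (at (e0, e0))"
    by (rule mult_near) (rule that)
  have "\<exists>A. ((\<lambda>t. \<phi> (c t)) has_vector_derivative A) (at 0)"
  proof (rule local_one_parameter_differentiable[OF \<rho>(1), where p = e0 and \<mu> = "\<lambda>x y. \<phi> (\<iota> x \<otimes> \<iota> y)"])
    show "continuous_on {- (\<rho>0 / 2)..\<rho>0 / 2} (\<lambda>t. \<phi> (c t))" using yc \<rho>(2) by (rule continuous_on_subset)
    show "\<phi> (c 0) = e0" by (simp add: zero)
    show "\<phi> (c (s + t)) = \<phi> (\<iota> (\<phi> (c s)) \<otimes> \<iota> (\<phi> (c t)))"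
      if "\<bar>s\<bar> \<le> \<rho>0 / 2" "\<bar>t\<bar> \<le> \<rho>0 / 2" for s t
      by (simp only: pt_coord[OF inU[OF that(1)]] pt_coord[OF inU[OF that(2)]] hom)
    \<comment> \<open>For two points with the same second coordinate \<open>z\<close>, strictness at
      \<open>(e0, e0)\<close> compares the increment of the multiplication with
      \<open>x - x'\<close>.\<close>
    fix \<delta> :: real assume "\<delta> > 0"
    from smooth_on_strict_derivative[OF fd2 N(1,5,2,6) this]
    obtain r where r: "r > 0" "\<And>x y. x \<in> ball (e0, e0) r \<Longrightarrow> y \<in> ball (e0, e0) r \<Longrightarrow>
      norm ((\<lambda>(x, y). \<phi> (\<iota> x \<otimes> \<iota> y)) x - (\<lambda>(x, y). \<phi> (\<iota> x \<otimes> \<iota> y)) y - (\<lambda>(X, Y). X + Y) (x - y)) \<le> \<delta> * norm (x - y)"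
      by blast
    have b: "(x, z) \<in> ball (e0, e0) r" if "x \<in> ball e0 (r / 2)" "z \<in> ball e0 (r / 2)" for x z
    proof -
      have "dist (e0, e0) (x, z) \<le> dist e0 x + dist e0 z"
        unfolding dist_Pair_Pair by (rule sqrt_sum_squares_le_sum_abs[THEN order_trans]) simp
      then show ?thesis using that by simp
    qed
    have "norm (\<phi> (\<iota> x \<otimes> \<iota> z) - \<phi> (\<iota> x' \<otimes> \<iota> z) - (x - x')) \<le> \<delta> * norm (x - x')"
      if "x \<in> ball e0 (r / 2)" "x' \<in> ball e0 (r / 2)" "z \<in> ball e0 (r / 2)" for x x' z
      using r(2)[OF b[OF that(1,3)] b[OF that(2,3)]] by (simp add: norm_Pair)
    then show "\<exists>r>0. \<forall>x\<in>ball e0 r. \<forall>x'\<in>ball e0 r. \<forall>z\<in>ball e0 r.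
           norm (\<phi> (\<iota> x \<otimes> \<iota> z) - \<phi> (\<iota> x' \<otimes> \<iota> z) - (x - x')) \<le> \<delta> * norm (x - x')"
      using r(1) by (intro exI[of _ "r / 2"]) auto
  qed
  then obtain A where A: "((\<lambda>t. \<phi> (c t)) has_vector_derivative A) (at 0)" ..
  have "\<forall>\<^sub>F u in at 0. u \<in> T" using T by (rule eventually_at_in_open')
  then have "\<forall>\<^sub>F u in at 0. c u \<in> U" by (simp add: T_def)
  from hom_curve_unique[OF hom_curve_lvel[OF car hom this A] zero(1) one_param_lexp]
  show ?thesis by blast
qed

end

section \<open>The adjoint and coadjoint actions\<close>

lemma linear_findim_bounded:
  fixes f :: "'a::real_normed_vector \<Rightarrow> 'b::real_normed_vector"
  assumes fd: "findim TYPE('a)" and f: "linear f"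
  shows "bounded_linear f"
proof -
  obtain B r where B: "finite B" "\<And>b. bounded_linear (r b)" "\<And>x::'a. (\<Sum>b\<in>B. r b x *\<^sub>R b) = x"
    using findim_coordinates[OF fd] by metis
  have "f x = (\<Sum>b\<in>B. r b x *\<^sub>R f b)" for x
    by (subst (1) B(3)[of x, symmetric]) (simp only: linear_sum[OF f] linear_scale[OF f])
  then have "f = (\<lambda>x. \<Sum>b\<in>B. r b x *\<^sub>R f b)" by blast
  moreover have "bounded_linear (\<lambda>x. \<Sum>b\<in>B. r b x *\<^sub>R f b)"
    by (intro bounded_linear_sum bounded_linear_scaleR_const B(2))
  ultimately show ?thesis by simp
qed

text \<open>A finite basis and its dual functionals write \<open>\<beta> u\<close> as a finite sum
  with scalar coefficients \<open>\<beta> u b\<close>; it suffices to differentiate these.\<close>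

lemma blinfun_has_vector_derivativeI:
  fixes \<beta> :: "real \<Rightarrow> 'a::real_normed_vector \<Rightarrow>\<^sub>L real"
  assumes fd: "findim TYPE('a)"
    and d: "\<And>x. ((\<lambda>u. blinfun_apply (\<beta> u) x) has_vector_derivative blinfun_apply D x) F"
  shows "(\<beta> has_vector_derivative D) F"
proof -
  obtain B r where B: "finite B" "\<And>b. bounded_linear (r b)" "\<And>x::'a. (\<Sum>b\<in>B. r b x *\<^sub>R b) = x"
    using findim_coordinates[OF fd] by metis
  have exp: "\<gamma> = (\<Sum>b\<in>B. blinfun_apply \<gamma> b *\<^sub>R Blinfun (r b))" for \<gamma> :: "'a \<Rightarrow>\<^sub>L real"
  proof (rule blinfun_eqI)
    fix x
    have "blinfun_apply \<gamma> x = blinfun_apply \<gamma> (\<Sum>b\<in>B. r b x *\<^sub>R b)" by (simp only: B(3))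
    also have "\<dots> = (\<Sum>b\<in>B. r b x * blinfun_apply \<gamma> b)" by (simp add: blinfun.sum_right blinfun.scaleR_right)
    finally show "blinfun_apply \<gamma> x = blinfun_apply (\<Sum>b\<in>B. blinfun_apply \<gamma> b *\<^sub>R Blinfun (r b)) x"
      by (simp add: blinfun.sum_left blinfun.scaleR_left bounded_linear_Blinfun_apply[OF B(2)] mult.commute)
  qed
  have "((\<lambda>u. \<Sum>b\<in>B. blinfun_apply (\<beta> u) b *\<^sub>R Blinfun (r b)) has_vector_derivative
      (\<Sum>b\<in>B. blinfun_apply D b *\<^sub>R Blinfun (r b))) F"
    by (rule has_vector_derivative_sum)
      (rule bounded_linear.has_vector_derivative[OF bounded_linear_scaleR_left d])
  then show ?thesis by (simp only: exp[symmetric])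
qed

context lie_grp
begin

text \<open>\<open>Ad G (\<iota> x) B\<close> is the partial derivative at \<open>y = e0\<close> of
  the smooth map \<open>(x, y) \<mapsto> x y x^-1\<close>, so it is smooth in \<open>x\<close>. The
  \<open>frechet_derivative\<close> in \<open>bracket\<close> is therefore a genuine one.\<close>

lemma Ad_pt_has_derivative: "((\<lambda>x. Ad G (\<iota> x) B) has_derivative (\<lambda>A. bracket G A B)) (at e0)"
proof -
  have o: "open (\<Omega> \<times> \<Omega>)" using open_\<Omega> open_Times by blast
  have sm: "manifold_smooth_on vec_atlas (charts G) (\<Omega> \<times> \<Omega>) (\<lambda>z. \<iota> (fst z) \<otimes> \<iota> (snd z) \<otimes> inv (\<iota> (fst z)))"
    by (intro smooth_mult_vec smooth_inv_vec fd2 smooth_pt_fst smooth_pt_snd)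
  have 3: "\<iota> (fst (e0, e0)) \<otimes> \<iota> (snd (e0, e0)) \<otimes> inv (\<iota> (fst (e0, e0))) \<in> U"
    using one_U by (simp add: pt_e0)
  have 4: "(e0, e0) \<in> \<Omega> \<times> \<Omega>" using e0_\<Omega> by blast
  let ?Q = "\<lambda>z. \<phi> (\<iota> (fst z) \<otimes> \<iota> (snd z) \<otimes> inv (\<iota> (fst z)))"
  obtain N where N: "open N" "(e0, e0) \<in> N" "N \<subseteq> \<Omega> \<times> \<Omega>"
    "\<And>z. z \<in> N \<Longrightarrow> \<iota> (fst z) \<otimes> \<iota> (snd z) \<otimes> inv (\<iota> (fst z)) \<in> U" "smooth_on N ?Q"
    by (rule coord_smooth[OF sm fd2 o 4 3]) (rule that)
  define N0 where "N0 = (\<lambda>x. (x, e0)) -` N"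
  have N0: "open N0" "e0 \<in> N0"
    unfolding N0_def using N(1,2) by (auto intro!: open_vimage continuous_intros)
  have pr: "smooth_on N0 (\<lambda>x. (x, e0))"
    by (rule smooth_on_Pair[OF N0(1) smooth_on_linear[OF N0(1) bounded_linear_ident] smooth_on_const])
  have V: "smooth_on N0 (\<lambda>x. frechet_derivative ?Q (at (x, e0)) (0, B))"
    by (rule smooth_on_compose[OF fd2 N0(1) smooth_on_derivative[OF N(5)] pr]) (auto simp: N0_def)
  have eq: "frechet_derivative ?Q (at (x, e0)) (0, B) = Ad G (\<iota> x) B" if x: "x \<in> N0" for x
  proof -
    have xN: "(x, e0) \<in> N" using x by (simp add: N0_def)
    then have "\<iota> x \<in> carrier G" using N(3) pt_carrier by auto
    from Ad_has_derivative[OF this]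
    have a: "((\<lambda>y. ?Q (x, y)) has_derivative Ad G (\<iota> x)) (at e0)" by simp
    have "((\<lambda>y. ?Q (x, y)) has_derivative (\<lambda>Y. frechet_derivative ?Q (at (x, e0)) (0, Y))) (at e0)"
      by (rule has_derivative_compose[where f = "\<lambda>y. (x, y)", OF _ smooth_on_has_derivative[OF N(5) xN]])
        (auto intro!: derivative_eq_intros)
    from has_derivative_unique[OF this a] show ?thesis by (rule fun_cong)
  qed
  have "smooth_on N0 (\<lambda>x. Ad G (\<iota> x) B)"
    using V by (rule smooth_on_cong[OF N0(1), THEN iffD1, rotated]) (rule eq)
  from smooth_on_has_derivative[OF this N0(2)] show ?thesis by (simp only: bracket_def[abs_def])
qed

lemma Ad_gderiv:
  assumes g: "g \<in> carrier G"
  shows "gderiv (\<lambda>g. Ad G g B) g (\<lambda>A. Ad G g (bracket G A B))"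
  unfolding gderiv_def
  by (rule has_derivative_transform_within_open[OF bounded_linear.has_derivative[OF Ad_bounded_linear[OF g]
        Ad_pt_has_derivative] open_\<Omega> e0_\<Omega>]) (simp add: Ad_mult g pt_carrier)

lemma bracket_linear_left: "bounded_linear (\<lambda>A. bracket G A B)"
  using Ad_pt_has_derivative by (rule has_derivative_bounded_linear)

lemma bracket_linear_right: "linear (bracket G A)"
proof (rule linearI)
  show "bracket G A (B + C) = bracket G A B + bracket G A C" for B C
  proof -
    have "((\<lambda>x. Ad G (\<iota> x) (B + C)) has_derivative (\<lambda>A. bracket G A B + bracket G A C)) (at e0)"
      by (rule has_derivative_transform_within_open[OF has_derivative_add[OF Ad_pt_has_derivative Ad_pt_has_derivative]
            open_\<Omega> e0_\<Omega>]) (simp add: Ad_linear pt_carrier)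
    from has_derivative_unique[OF Ad_pt_has_derivative this] show ?thesis by (rule fun_cong)
  qed
  show "bracket G A (r *\<^sub>R B) = r *\<^sub>R bracket G A B" for r B
  proof -
    have "((\<lambda>x. Ad G (\<iota> x) (r *\<^sub>R B)) has_derivative (\<lambda>A. r *\<^sub>R bracket G A B)) (at e0)"
      by (rule has_derivative_transform_within_open[OF has_derivative_scaleR_right[OF Ad_pt_has_derivative]
            open_\<Omega> e0_\<Omega>]) (simp add: Ad_linear pt_carrier)
    from has_derivative_unique[OF Ad_pt_has_derivative this] show ?thesis by (rule fun_cong)
  qed
qed

lemma lexp_gderiv:
  assumes "gderiv f g L" "g \<in> carrier G"
  shows "((\<lambda>u. f (g \<otimes> lexp G (u *\<^sub>R A))) has_vector_derivative L A) (at 0)"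
proof -
  have "lvel (\<lambda>u. g \<otimes> lexp G (u *\<^sub>R A)) A 0 UNIV"
    by (rule lvel_translate[OF lexp_lvel assms(2)]) simp
  from lvel_gderiv[OF this] show ?thesis using assms by (simp add: lexp_zero)
qed

lemma one_paramI:
  assumes "manifold_smooth_on vec_atlas (charts G) UNIV c" "\<And>s t. c (s + t) = c s \<otimes> c t"
    and "lvel c A 0 UNIV"
  shows "one_param G A c"
proof -
  have car: "c t \<in> carrier G" for t using smooth_on_carrier[OF assms(1)] by simp
  show ?thesis
    using assms(1,2) lvel_deriv[OF assms(3)] car unfolding one_param_def
    by (simp add: hom_curve_zero(1)[OF car assms(2)])
qed

text \<open>Both sides are one-parameter subgroups with velocity \<open>Ad G g A\<close>.\<close>

lemma lexp_conj:
  assumes g: "g \<in> carrier G"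
  shows "g \<otimes> lexp G (u *\<^sub>R A) \<otimes> inv g = lexp G (u *\<^sub>R Ad G g A)"
proof -
  have "one_param G (Ad G g A) (\<lambda>u. g \<otimes> lexp G (u *\<^sub>R A) \<otimes> inv g)"
  proof (rule one_paramI)
    show "manifold_smooth_on vec_atlas (charts G) UNIV (\<lambda>u. g \<otimes> lexp G (u *\<^sub>R A) \<otimes> inv g)"
      by (intro smooth_mult_vec findim_euclidean smooth_const_vec lexp_smooth g inv_closed)
    show "g \<otimes> lexp G ((s + t) *\<^sub>R A) \<otimes> inv g =
      g \<otimes> lexp G (s *\<^sub>R A) \<otimes> inv g \<otimes> (g \<otimes> lexp G (t *\<^sub>R A) \<otimes> inv g)" for s t
      using g by (simp add: lexp_add m_assoc lexp_carrier inv_mult_cancel')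
    show "lvel (\<lambda>u. g \<otimes> lexp G (u *\<^sub>R A) \<otimes> inv g) (Ad G g A) 0 UNIV"
      using lvel_mult[OF lvel_translate[OF lexp_lvel[of A 0] g UNIV_I] lvel_const[OF inv_closed[OF g]] UNIV_I] g by simp
  qed
  from lexp_curve[OF this] show ?thesis by simp
qed

lemma lexp_mult_right:
  assumes g: "g \<in> carrier G"
  shows "lexp G (u *\<^sub>R A) \<otimes> g = g \<otimes> lexp G (u *\<^sub>R Ad G (inv g) A)"
  using lexp_conj[OF inv_closed[OF g], of u A, symmetric] g by (simp add: m_assoc[symmetric] lexp_carrier)

text \<open>Commuting with the whole curve gives \<open>exp (u Ad g A) = exp (u A)\<close>; compare
  velocities at 0.\<close>

lemma Ad_fixedI:
  assumes g: "g \<in> carrier G" and "\<And>u. g \<otimes> lexp G (u *\<^sub>R A) = lexp G (u *\<^sub>R A) \<otimes> g"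
  shows "Ad G g A = A"
proof -
  have "lexp G (u *\<^sub>R Ad G g A) = lexp G (u *\<^sub>R A)" for u
    using assms(2)[of u] g by (simp add: lexp_conj[OF g, symmetric] m_assoc lexp_carrier)
  then have "one_param G (Ad G g A) (\<lambda>u. lexp G (u *\<^sub>R A))"
    using one_param_lexp[of "Ad G g A"] by simp
  then show ?thesis
    using one_param_lexp[of A] vector_derivative_unique_at unfolding one_param_def by blast
qed

lemma lexp_commute: "lexp G (s *\<^sub>R A) \<otimes> lexp G (t *\<^sub>R A) = lexp G (t *\<^sub>R A) \<otimes> lexp G (s *\<^sub>R A)"
  by (simp only: lexp_add[symmetric] add.commute)

lemma Ad_lexp_self: "Ad G (lexp G (u *\<^sub>R A)) A = A"
  by (rule Ad_fixedI[OF lexp_carrier lexp_commute])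

lemma Ad_lexp_deriv:
  "((\<lambda>u. Ad G (lexp G (u *\<^sub>R A)) B) has_vector_derivative bracket G A B) (at 0)"
  using lexp_gderiv[OF Ad_gderiv[OF one_closed] one_closed, of A] by (simp add: lexp_carrier Ad_one)

lemma bracket_eq_zeroI:
  assumes "\<And>u. Ad G (lexp G (u *\<^sub>R A)) B = B"
  shows "bracket G A B = 0"
  using Ad_lexp_deriv[of A B] vector_derivative_unique_at[OF _ has_vector_derivative_const]
  unfolding assms by blast

text \<open>Polarisation of \<open>[C, C] = 0\<close>, which holds because
  \<open>Ad (exp (u C))\<close> fixes \<open>C\<close>.\<close>

lemma bracket_antisym: "bracket G A B = - bracket G B A"
proof -
  interpret L: bounded_linear "\<lambda>A. bracket G A C" for C by (rule bracket_linear_left)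
  have self: "bracket G C C = 0" for C by (rule bracket_eq_zeroI[OF Ad_lexp_self])
  have "bracket G (A + B) (A + B) = 0" by (rule self)
  moreover have "bracket G (A + B) (A + B) = (bracket G A A + bracket G B A) + (bracket G A B + bracket G B B)"
    by (simp only: linear_add[OF bracket_linear_right] L.add)
  ultimately have "bracket G B A + bracket G A B = 0" by (simp add: self)
  then show ?thesis by (simp add: eq_neg_iff_add_eq_0 add.commute)
qed

text \<open>Differentiate \<open>Ad g (Ad (exp (u A)) B) = Ad (exp (u Ad g A)) (Ad g B)\<close> at
  \<open>u = 0\<close>.\<close>

lemma Ad_bracket:
  assumes g: "g \<in> carrier G"
  shows "Ad G g (bracket G A B) = bracket G (Ad G g A) (Ad G g B)"
proof -
  have 1: "((\<lambda>u. Ad G g (Ad G (lexp G (u *\<^sub>R A)) B)) has_vector_derivative Ad G g (bracket G A B)) (at 0)"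
    by (rule bounded_linear.has_vector_derivative[OF Ad_bounded_linear[OF g] Ad_lexp_deriv])
  have "Ad G g (Ad G (lexp G (u *\<^sub>R A)) B) = Ad G (lexp G (u *\<^sub>R Ad G g A)) (Ad G g B)" for u
  proof -
    have "g \<otimes> lexp G (u *\<^sub>R A) = lexp G (u *\<^sub>R Ad G g A) \<otimes> g"
      using g by (simp add: lexp_conj[OF g, symmetric] m_assoc lexp_carrier)
    then show ?thesis using g by (simp add: Ad_mult[symmetric] lexp_carrier)
  qed
  then show ?thesis
    using vector_derivative_unique_at[OF 1] Ad_lexp_deriv[of "Ad G g A" "Ad G g B"] by simp
qed

section \<open>The coadjoint action and its vector fields\<close>

lemma coad_apply:
  assumes "g \<in> carrier G"
  shows "blinfun_apply (coad G g \<nu>) A = blinfun_apply \<nu> (Ad G (inv g) A)"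
proof -
  have "bounded_linear (\<lambda>A. blinfun_apply \<nu> (Ad G (inv g) A))"
    by (rule bounded_linear_compose[OF blinfun.bounded_linear_right Ad_bounded_linear]) (use assms in simp)
  then show ?thesis unfolding coad_def by (simp add: bounded_linear_Blinfun_apply)
qed

lemma coad_mult:
  "g \<in> carrier G \<Longrightarrow> h \<in> carrier G \<Longrightarrow> coad G (g \<otimes> h) \<nu> = coad G g (coad G h \<nu>)"
  by (rule blinfun_eqI) (simp add: coad_apply inv_mult_group Ad_mult)

lemma coad_one: "coad G \<one> \<nu> = \<nu>"
  by (rule blinfun_eqI) (simp add: coad_apply Ad_one)

text \<open>The infinitesimal coadjoint action, which \<open>fund_field_eq\<close> identifies with
  \<open>fund_field\<close>. The minus sign comes from the inverse in \<open>coad\<close>.\<close>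

definition coad_field :: "'e \<Rightarrow> ('e \<Rightarrow>\<^sub>L real) \<Rightarrow> ('e \<Rightarrow>\<^sub>L real)" where
  "coad_field A \<nu> = Blinfun (\<lambda>B. - blinfun_apply \<nu> (bracket G A B))"

lemma coad_field_apply: "blinfun_apply (coad_field A \<nu>) B = - blinfun_apply \<nu> (bracket G A B)"
proof -
  have "bounded_linear (\<lambda>B. - blinfun_apply \<nu> (bracket G A B))"
    by (intro bounded_linear_minus bounded_linear_compose[OF blinfun.bounded_linear_right]
        linear_findim_bounded[OF fd bracket_linear_right])
  then show ?thesis unfolding coad_field_def by (simp add: bounded_linear_Blinfun_apply)
qed

text \<open>A left velocity \<open>A\<close> of \<open>c\<close> is the right velocity
  \<open>Ad (c t) A\<close>, and it is the right velocity that acts on the moving point.\<close>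

lemma coad_curve:
  assumes c: "lvel c A t S" and t: "t \<in> S"
  shows "((\<lambda>u. coad G (c u) \<nu>) has_vector_derivative coad_field (Ad G (c t) A) (coad G (c t) \<nu>)) (at t within S)"
proof (rule blinfun_has_vector_derivativeI[OF fd])
  fix B
  have ct: "c t \<in> carrier G" by (rule lvel_carrier[OF c])
  have "((\<lambda>u. Ad G (inv (c u)) B) has_vector_derivative
      Ad G (inv (c t)) (bracket G (- Ad G (c t) A) B)) (at t within S)"
    using lvel_gderiv[OF lvel_inv[OF c t] Ad_gderiv t] ct by simp
  then have "((\<lambda>u. blinfun_apply \<nu> (Ad G (inv (c u)) B)) has_vector_derivative
      blinfun_apply \<nu> (Ad G (inv (c t)) (bracket G (- Ad G (c t) A) B))) (at t within S)"
    by (rule bounded_linear.has_vector_derivative[OF blinfun.bounded_linear_right])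
  moreover have "bracket G (- X) B = - bracket G X B" for X
    using linear_neg[OF bounded_linear.linear[OF bracket_linear_left]] .
  ultimately have "((\<lambda>u. blinfun_apply \<nu> (Ad G (inv (c u)) B)) has_vector_derivative
      blinfun_apply (coad_field (Ad G (c t) A) (coad G (c t) \<nu>)) B) (at t within S)"
    using ct by (simp add: coad_field_apply coad_apply Ad_linear blinfun.minus_right)
  then show "((\<lambda>u. blinfun_apply (coad G (c u) \<nu>) B) has_vector_derivative
      blinfun_apply (coad_field (Ad G (c t) A) (coad G (c t) \<nu>)) B) (at t within S)"
  proof (rule has_vector_derivative_transform_eventually[OF _ _ _ t])
    show "\<forall>\<^sub>F u in at t within S. blinfun_apply \<nu> (Ad G (inv (c u)) B) = blinfun_apply (coad G (c u) \<nu>) B"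
      using lvel_eventually[OF c] by eventually_elim (simp add: coad_apply)
  qed (simp add: coad_apply ct)
qed

lemma fund_field_eq: "fund_field G A \<nu> = coad_field A \<nu>"
  using coad_curve[OF lexp_lvel[of A 0], of \<nu>]
  by (simp add: fund_field_def vector_derivative_at lexp_zero Ad_one coad_one)

lemma orbit_velocity_eq:
  assumes g: "g \<in> carrier G"
  shows "orbit_velocity G \<eta> g B = coad_field (Ad G g B) (coad G g \<eta>)"
  using coad_curve[OF lvel_translate[OF lexp_lvel[of B 0] g], of \<eta>] g
  by (simp add: orbit_velocity_def vector_derivative_at lexp_zero)

lemma isotropyD: "b \<in> isotropy G \<eta> \<Longrightarrow> b \<in> carrier G" "b \<in> isotropy G \<eta> \<Longrightarrow> coad G b \<eta> = \<eta>"
  by (auto simp: isotropy_def)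

lemma isotropy_subgroup: "subgroup (isotropy G \<eta>) G"
proof (rule subgroupI)
  show "isotropy G \<eta> \<subseteq> carrier G" by (auto simp: isotropy_def)
  show "isotropy G \<eta> \<noteq> {}" using coad_one by (auto simp: isotropy_def)
  show "inv a \<in> isotropy G \<eta>" if "a \<in> isotropy G \<eta>" for a
    using that coad_mult[of "inv a" a \<eta>] by (simp add: isotropy_def coad_one)
  show "a \<otimes> b \<in> isotropy G \<eta>" if "a \<in> isotropy G \<eta>" "b \<in> isotropy G \<eta>" for a b
    using that by (simp add: isotropy_def coad_mult)
qed

text \<open>The derivative of \<open>coad (exp (t B)) \<eta>\<close> at any \<open>t\<close> is the
  one at 0 transported by \<open>exp (t B)\<close>, whose \<open>Ad\<close> fixes \<open>B\<close>.
  So it vanishes identically and the curve stays at \<open>\<eta>\<close>.\<close>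

lemma lie_subalgebra_isotropyI:
  assumes "\<And>C. blinfun_apply \<eta> (bracket G B C) = 0"
  shows "B \<in> lie_subalgebra G (isotropy G \<eta>)"
proof -
  have z: "((\<lambda>u. coad G (lexp G (u *\<^sub>R B)) \<eta>) has_vector_derivative 0) (at t within UNIV)" for t
  proof -
    let ?g = "lexp G (t *\<^sub>R B)"
    have "coad_field (Ad G ?g B) (coad G ?g \<eta>) = 0"
    proof (rule blinfun_eqI)
      fix C
      have "Ad G (inv ?g) (bracket G B C) = bracket G B (Ad G (inv ?g) C)"
        using Ad_lexp_self[of "- t" B] by (simp add: Ad_bracket lexp_carrier lexp_inv)
      then show "blinfun_apply (coad_field (Ad G ?g B) (coad G ?g \<eta>)) C = blinfun_apply 0 C"
        by (simp add: coad_field_apply Ad_lexp_self coad_apply lexp_carrier assms)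
    qed
    then show ?thesis using coad_curve[OF lexp_lvel[of B t], of \<eta>] by simp
  qed
  obtain k where k: "\<And>u. coad G (lexp G (u *\<^sub>R B)) \<eta> = k"
    by (rule has_vector_derivative_zero_constant[OF convex_UNIV z]) (auto intro: that)
  have "k = \<eta>" using k[of 0] by (simp add: lexp_zero coad_one)
  then show ?thesis using k lexp_carrier by (simp add: lie_subalgebra_def isotropy_def)
qed

text \<open>\<open>h' = A h = h (Ad h^-1 A)\<close>: the right velocity of the definition becomes a
  left one. Smoothness supplies some left velocity, and uniqueness of derivatives within
  \<open>{0..1}\<close> identifies it.\<close>

lemma group_evolution_lvel:
  assumes h: "group_evolution G A h" and t: "t \<in> {0..1}"
  shows "lvel h (Ad G (inv (h t)) (A t)) t {0..1}"
proof -
  have sm: "manifold_smooth_on vec_atlas (charts G) {0..1} h"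
    and d: "((\<lambda>s. \<phi> (h s \<otimes> inv (h t))) has_vector_derivative A t) (at t within {0..1})"
    using h t by (auto simp: group_evolution_def)
  obtain A' where A': "lvel h A' t {0..1}" by (rule lvel_exists[OF sm t])
  have ht: "h t \<in> carrier G" by (rule lvel_carrier[OF A'])
  have "lvel (\<lambda>s. h s \<otimes> inv (h t)) (Ad G (h t) A') t {0..1}"
    using lvel_mult[OF A' lvel_const[OF inv_closed[OF ht]] t] ht by simp
  from lvel_deriv[OF this] have "((\<lambda>s. \<phi> (inv (h t \<otimes> inv (h t)) \<otimes> (h s \<otimes> inv (h t)))) has_vector_derivative
    Ad G (h t) A') (at t within {0..1})" .
  then have "((\<lambda>s. \<phi> (h s \<otimes> inv (h t))) has_vector_derivative Ad G (h t) A') (at t within {0..1})"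
    unfolding has_vector_derivative_def
    by (rule has_derivative_transform[OF t, rotated]) (use smooth_on_carrier[OF sm] ht in simp)
  then have "A t = Ad G (h t) A'"
    using vector_derivative_unique_within_closed_interval[where f = "\<lambda>s. \<phi> (h s \<otimes> inv (h t))" and a = 0 and b = 1
        and x = t and f' = "A t"] d t by (simp add: cbox_interval)
  then show ?thesis using A' ht by (simp add: Ad_inv)
qed

text \<open>The pairing of \<open>\<psi> s q\<close> with \<open>Ad (h s) B\<close> is constant in
  \<open>s\<close>: one factor contributes \<open>- \<psi> ([A, Ad h B])\<close> to the derivative
  and the other contributes the same with a plus sign. At both ends \<open>\<psi>\<close> is at
  \<open>q\<close>.\<close>

lemma closed_isotopy_fixes_orbit:
  assumes h: "group_evolution G A h" and \<psi>: "closed_isotopy G \<eta> A \<psi>" and q: "q \<in> orbit G \<eta>"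
  shows "blinfun_apply q (Ad G (h 1) B) = blinfun_apply q B"
proof -
  have h0: "h 0 = \<one>" using h by (simp add: group_evolution_def)
  have d: "((\<lambda>s. blinfun_apply (\<psi> s q) (Ad G (h s) B)) has_vector_derivative 0) (at t within {0..1})"
    if t: "t \<in> {0..1}" for t
  proof -
    have ht: "h t \<in> carrier G" using lvel_carrier[OF group_evolution_lvel[OF h t]] .
    have 1: "((\<lambda>s. \<psi> s q) has_vector_derivative coad_field (A t) (\<psi> t q)) (at t within {0..1})"
      using \<psi> q t by (simp add: closed_isotopy_def fund_field_eq)
    have 2: "((\<lambda>s. Ad G (h s) B) has_vector_derivative Ad G (h t) (bracket G (Ad G (inv (h t)) (A t)) B)) (at t within {0..1})"
      by (rule lvel_gderiv[OF group_evolution_lvel[OF h t] Ad_gderiv[OF ht] t])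
    from bounded_bilinear.has_vector_derivative[OF bounded_bilinear_blinfun_apply 1 2]
    show ?thesis using ht by (simp add: coad_field_apply Ad_bracket Ad_inv)
  qed
  obtain k where k: "\<And>t. t \<in> {0..1} \<Longrightarrow> blinfun_apply (\<psi> t q) (Ad G (h t) B) = k"
    by (rule has_vector_derivative_zero_constant[OF _ d]) (auto intro: that)
  have "\<psi> 0 q = q" "\<psi> 1 q = q" using \<psi> q by (auto simp: closed_isotopy_def)
  then show ?thesis using k[of 0] k[of 1] h0 by (simp add: Ad_one)
qed

section \<open>Centrality of the endpoint \<open>h 1\<close>\<close>

lemma Ad_eq_ident_of_semisimple:
  assumes ss: "semisimple G" and comm: "\<And>a b. a \<in> isotropy G \<eta> \<Longrightarrow> b \<in> isotropy G \<eta> \<Longrightarrow> a \<otimes> b = b \<otimes> a"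
    and h: "h \<in> carrier G" and fix_orbit: "\<And>q B. q \<in> orbit G \<eta> \<Longrightarrow> blinfun_apply q (Ad G h B) = blinfun_apply q B"
  shows "Ad G h B = B"
proof -
  define K where "K = {B. \<forall>g\<in>carrier G. blinfun_apply \<eta> (Ad G g B) = 0}"
  have sub: "subspace K"
    by (auto simp: subspace_def K_def Ad_linear blinfun.add_right blinfun.scaleR_right)
  \<comment> \<open>\<open>K\<close> is stable under every \<open>Ad g\<close>; differentiating
    along \<open>exp (u A)\<close> turns this into stability under brackets.\<close>
  have ideal: "bracket G A B \<in> K" if B: "B \<in> K" for A B
    unfolding K_def
  proof (intro CollectI ballI)
    fix g assume g: "g \<in> carrier G"
    have "((\<lambda>u. blinfun_apply \<eta> (Ad G g (Ad G (lexp G (u *\<^sub>R A)) B))) has_vector_derivative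
        blinfun_apply \<eta> (Ad G g (bracket G A B))) (at 0)"
      by (rule bounded_linear.has_vector_derivative[OF bounded_linear_compose[OF blinfun.bounded_linear_right
            Ad_bounded_linear[OF g]] Ad_lexp_deriv])
    moreover have "blinfun_apply \<eta> (Ad G g (Ad G (lexp G (u *\<^sub>R A)) B)) = 0" for u
      using B g lexp_carrier by (simp add: K_def Ad_mult[symmetric])
    ultimately show "blinfun_apply \<eta> (Ad G g (bracket G A B)) = 0"
      using vector_derivative_unique_at[OF _ has_vector_derivative_const] by simp
  qed
  \<comment> \<open>\<open>\<eta>\<close> vanishes on \<open>K\<close>, hence on all brackets with
    \<open>B\<close>, so \<open>B\<close> generates a subgroup of the isotropy group.\<close>
  have KT: "lexp G (u *\<^sub>R B) \<in> isotropy G \<eta>" if B: "B \<in> K" for B u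
  proof -
    have "blinfun_apply \<eta> (bracket G B C) = 0" for C
    proof -
      have "bracket G B C \<in> K" using ideal[OF B, of C] bracket_antisym[of B C] subspace_neg[OF sub] by simp
      then have "blinfun_apply \<eta> (Ad G \<one> (bracket G B C)) = 0" by (simp add: K_def)
      then show ?thesis by (simp add: Ad_one)
    qed
    from lie_subalgebra_isotropyI[OF this] show ?thesis by (simp add: lie_subalgebra_def)
  qed
  have ab: "bracket G A B = 0" if "A \<in> K" "B \<in> K" for A B
  proof (rule bracket_eq_zeroI)
    show "Ad G (lexp G (u *\<^sub>R A)) B = B" for u
      by (rule Ad_fixedI[OF lexp_carrier comm[OF KT[OF that(1)] KT[OF that(2)]]])
  qed
  have "bracket G 0 0 = 0" "0 \<in> K" using ab subspace_0[OF sub] by auto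
  then have "0 \<in> {bracket G A B |A B. A \<in> K \<and> B \<in> K}" by force
  moreover have "{bracket G A B |A B. A \<in> K \<and> B \<in> K} \<subseteq> {0}" using ab by auto
  ultimately have "{bracket G A B |A B. A \<in> K \<and> B \<in> K} = {0}" by (simp only: subset_singleton_iff) blast
  then have "derived_series G K (Suc 0) = {0}" by simp
  moreover have "lie_ideal G K" using sub ideal by (simp add: lie_ideal_def)
  ultimately have "K = {0}" using ss unfolding semisimple_def by blast
  \<comment> \<open>\<open>\<eta> \<circ> Ad g\<close> is the orbit point of \<open>g^-1\<close>, on
    which \<open>B\<close> and \<open>Ad h B\<close> have the same value.\<close>
  moreover have "Ad G h B - B \<in> K"
    unfolding K_def
  proof (intro CollectI ballI)
    fix g assume g: "g \<in> carrier G"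
    then have "coad G (inv g) \<eta> \<in> orbit G \<eta>" unfolding orbit_def by blast
    from fix_orbit[OF this, of B] g h
    show "blinfun_apply \<eta> (Ad G g (Ad G h B - B)) = 0"
      by (simp add: coad_apply Ad_linear blinfun.diff_right)
  qed
  ultimately show ?thesis by simp
qed

text \<open>As \<open>Ad G h\<close> is the identity, \<open>g \<mapsto> g h g^-1\<close> has
  velocity 0 along straight lines in the chart at the identity. Translation makes it locally
  constant everywhere, and connectedness makes it constantly \<open>h\<close>.\<close>

lemma central_of_Ad_ident:
  assumes con: "connected_space (lie_topology G)" and h: "h \<in> carrier G" and Ad: "\<And>B. Ad G h B = B"
    and g: "g \<in> carrier G"
  shows "g \<otimes> h = h \<otimes> g"
proof -
  define \<kappa> where "\<kappa> g = g \<otimes> h \<otimes> inv g" for g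
  obtain r where r: "r > 0" "ball e0 r \<subseteq> \<Omega>" using open_\<Omega> e0_\<Omega> openE by blast
  have Adi: "Ad G (inv h) B = B" for B using Ad_inv(1)[OF h, of B] Ad by simp
  have near: "\<kappa> (\<iota> x) = h" if x: "x \<in> ball e0 r" for x
  proof -
    define S where "S = {0..1::real}"
    define l where "l t = e0 + t *\<^sub>R (x - e0)" for t
    have l: "l t \<in> ball e0 r" if "t \<in> S" for t
    proof -
      have "norm (t *\<^sub>R (x - e0)) \<le> 1 * norm (x - e0)"
        using that unfolding norm_scaleR by (intro mult_right_mono) (auto simp: S_def)
      then show ?thesis using x by (simp add: l_def dist_norm norm_minus_commute)
    qed
    have "smooth_on UNIV l"
      by (rule smooth_onI_bootstrap[OF open_UNIV, where f' = "\<lambda>_ s. s *\<^sub>R (x - e0)"])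
        (auto simp: l_def[abs_def] intro!: derivative_eq_intros higher_differentiable_on_const)
    then have "manifold_smooth_on vec_atlas vec_atlas S l"
      using manifold_smooth_on_subset[OF manifold_smooth_on_vecI[OF open_UNIV]] by blast
    then have c: "manifold_smooth_on vec_atlas (charts G) S (\<lambda>t. \<iota> (l t))"
      by (rule manifold_smooth_on_compose[OF _ smooth_pt _ smooth_atlas_vec smooth_atlas_vec findim_euclidean fd])
        (use l r(2) in auto)
    have "\<kappa> (\<iota> (l 1)) = \<kappa> (\<iota> (l 0))"
    proof (rule lvel_zero_const[of S])
      show "lvel (\<lambda>t. \<kappa> (\<iota> (l t))) 0 t S" if t: "t \<in> S" for t
      proof -
        obtain a where a: "lvel (\<lambda>t. \<iota> (l t)) a t S" by (rule lvel_exists[OF c t])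
        have "lvel (\<lambda>t. \<iota> (l t) \<otimes> h) a t S" using lvel_mult[OF a lvel_const[OF h] t] Adi by simp
        from lvel_mult[OF this lvel_inv[OF a t] t] show ?thesis
          using lvel_carrier[OF a] by (simp add: \<kappa>_def)
      qed
    qed (auto simp: S_def)
    then show ?thesis using h by (simp add: l_def \<kappa>_def pt_e0)
  qed
  have loc: "\<exists>T. openin (lie_topology G) T \<and> k \<in> T \<and> T \<subseteq> carrier G \<and> (\<forall>y\<in>T. \<kappa> y = \<kappa> k)" if k: "k \<in> carrier G" for k
  proof -
    have sm: "manifold_smooth_on (charts G) (charts G) (carrier G) (\<lambda>y. inv k \<otimes> y)"
      using k by (intro smooth_mult'[OF atl fd] smooth_const'[OF atl subset_refl] manifold_smooth_on_ident[OF atl subset_refl]) simp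
    have 1: "inv k \<otimes> k \<in> U \<inter> \<phi> -` ball e0 r" using k one_U r(1) by simp
    obtain T where T: "openin (lie_topology G) T" "k \<in> T" "\<And>y. y \<in> T \<Longrightarrow> y \<in> carrier G \<Longrightarrow> inv k \<otimes> y \<in> U \<inter> \<phi> -` ball e0 r"
      by (rule manifold_smooth_on_preimage[OF sm atl atl openin_chart_preimage[OF atl id_chart_mem open_ball] k 1]) (rule that)
    have TG: "T \<subseteq> carrier G" using openin_subset[OF T(1)] topspace_manifold_topology[OF atl] by simp
    have "\<kappa> y = \<kappa> k" if y: "y \<in> T" for y
    proof -
      have yG: "y \<in> carrier G" using y TG by auto
      have "\<kappa> (\<iota> (\<phi> (inv k \<otimes> y))) = h" using T(3)[OF y yG] by (intro near) simp
      then have kk: "\<kappa> (inv k \<otimes> y) = h" using T(3)[OF y yG] by (simp add: pt_coord)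
      \<comment> \<open>Local constancy at \<open>k\<close> comes from that at the identity through
        \<open>\<kappa> (k x) = k (\<kappa> x) k^-1\<close>.\<close>
      have "\<kappa> y = k \<otimes> \<kappa> (inv k \<otimes> y) \<otimes> inv k"
        using k yG h by (simp add: \<kappa>_def m_assoc inv_mult_group inv_mult_cancel)
      then show ?thesis unfolding kk by (simp add: \<kappa>_def)
    qed
    then show ?thesis using T(1,2) TG by blast
  qed
  let ?P = "{k \<in> carrier G. \<kappa> k = h}" and ?N = "{k \<in> carrier G. \<kappa> k \<noteq> h}"
  have "openin (lie_topology G) {k \<in> carrier G. Q (\<kappa> k)}" for Q
  proof (subst openin_subopen, intro ballI)
    fix k assume k: "k \<in> {k \<in> carrier G. Q (\<kappa> k)}"
    then obtain T where T: "openin (lie_topology G) T" "k \<in> T" "T \<subseteq> carrier G" "\<forall>y\<in>T. \<kappa> y = \<kappa> k"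
      using loc[of k] by auto
    moreover have "T \<subseteq> {k \<in> carrier G. Q (\<kappa> k)}" using T(3,4) k by auto
    ultimately show "\<exists>T. openin (lie_topology G) T \<and> k \<in> T \<and> T \<subseteq> {k \<in> carrier G. Q (\<kappa> k)}" by blast
  qed
  from this[of "\<lambda>k. k = h"] this[of "\<lambda>k. k \<noteq> h"]
  have "openin (lie_topology G) ?P" "openin (lie_topology G) ?N" by auto
  moreover have "topspace (lie_topology G) \<subseteq> ?P \<union> ?N" using topspace_manifold_topology[OF atl] by auto
  moreover have "\<one> \<in> ?P" using h by (simp add: \<kappa>_def)
  ultimately have "?N = {}" using con unfolding connected_space_def by blast
  then have "g \<otimes> h \<otimes> inv g = h" using g by (auto simp: \<kappa>_def)
  then have "g \<otimes> h \<otimes> inv g \<otimes> g = h \<otimes> g" by simp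
  then show ?thesis using g h by (simp add: m_assoc)
qed

end

section \<open>Smoothness of representations\<close>

text \<open>Strictness lets Banach's theorem solve \<open>\<Phi> x = y\<close> near
  \<open>\<Phi> 0\<close> with \<open>norm x \<le> 2 * norm (y - \<Phi> 0)\<close>, so the
  first-order expansion of \<open>P\<close> at 0 transfers to \<open>p\<close> at
  \<open>\<Phi> 0\<close>. It is applied to coordinates of the second kind.\<close>

lemma has_derivative_via_local_inverse:
  fixes \<Phi> :: "'a::banach \<Rightarrow> 'a" and P p :: "'a \<Rightarrow> 'b::real_normed_vector"
  assumes strict: "\<And>\<delta>. \<delta> > 0 \<Longrightarrow> \<exists>r>0. \<forall>x\<in>ball 0 r. \<forall>y\<in>ball 0 r. norm (\<Phi> x - \<Phi> y - (x - y)) \<le> \<delta> * norm (x - y)"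
    and P: "(P has_derivative P') (at 0)" and eq: "\<exists>r>0. \<forall>x\<in>ball 0 r. p (\<Phi> x) = P x"
  shows "(p has_derivative P') (at (\<Phi> 0))"
proof -
  obtain r0 where r0: "r0 > 0" "\<And>x. x \<in> ball 0 r0 \<Longrightarrow> p (\<Phi> x) = P x" using eq by blast
  obtain r1 where r1: "r1 > 0" "\<And>x y. x \<in> ball 0 r1 \<Longrightarrow> y \<in> ball 0 r1 \<Longrightarrow> norm (\<Phi> x - \<Phi> y - (x - y)) \<le> 1 / 2 * norm (x - y)"
    using strict[of "1 / 2"] by auto
  have solve: "\<exists>x. \<Phi> x = y \<and> norm x \<le> 2 * norm (y - \<Phi> 0) \<and> norm x < r1" if y: "norm (y - \<Phi> 0) < r1 / 4" for y
  proof -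
    let ?K = "cball (0::'a) (r1 / 2)"
    \<comment> \<open>Fixed points of \<open>T\<close> are the solutions of
      \<open>\<Phi> x = y\<close>. Strictness with 1/2 makes \<open>T\<close> a contraction, and
      \<open>r1 / 4 + r1 / 4\<close> keeps it inside the ball of radius
      \<open>r1 / 2\<close>.\<close>
    define T where "T x = x - (\<Phi> x - y)" for x
    have K: "?K \<subseteq> ball 0 r1" using r1(1) by auto
    have z: "(0::'a) \<in> ball 0 r1" using r1(1) by simp
    have "\<exists>!x\<in>?K. T x = x"
    proof (rule Banach_fix[of ?K "1 / 2" T])
      show "complete ?K" by (simp add: complete_eq_closed)
      show "?K \<noteq> {}" using r1(1) by simp
      show "T ` ?K \<subseteq> ?K"
      proof safe
        fix x assume x: "x \<in> ?K"
        have "norm (T x) = norm ((y - \<Phi> 0) - (\<Phi> x - \<Phi> 0 - (x - 0)))" by (simp add: T_def algebra_simps)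
        also have "\<dots> \<le> norm (y - \<Phi> 0) + norm (\<Phi> x - \<Phi> 0 - (x - 0))" by (rule norm_triangle_ineq4)
        also have "\<dots> \<le> r1 / 4 + 1 / 2 * norm (x - 0)" using y r1(2)[of x 0] x K z by (intro add_mono) auto
        also have "\<dots> \<le> r1 / 2" using x by simp
        finally show "T x \<in> ?K" by simp
      qed
      show "dist (T x) (T x') \<le> 1 / 2 * dist x x'" if "x \<in> ?K" "x' \<in> ?K" for x x'
      proof -
        have "dist (T x) (T x') = norm (\<Phi> x - \<Phi> x' - (x - x'))"
          by (simp add: T_def dist_norm norm_minus_commute algebra_simps)
        then show ?thesis using r1(2)[OF subsetD[OF K that(1)] subsetD[OF K that(2)]] by (simp add: dist_norm)
      qed
    qed auto
    then obtain x where x: "x \<in> ?K" "T x = x" by blast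
    then have \<Phi>: "\<Phi> x = y" by (simp add: T_def)
    have "norm x \<le> norm (\<Phi> x - \<Phi> 0) + norm (\<Phi> x - \<Phi> 0 - (x - 0))"
      using norm_triangle_ineq4[of "\<Phi> x - \<Phi> 0" "\<Phi> x - \<Phi> 0 - (x - 0)"] by simp
    also have "norm (\<Phi> x - \<Phi> 0 - (x - 0)) \<le> 1 / 2 * norm (x - 0)" using r1(2)[of x 0] x(1) K z by auto
    finally have "norm x \<le> 2 * norm (y - \<Phi> 0)" by (simp add: \<Phi>)
    then show ?thesis using \<Phi> x(1) r1(1) by (intro exI[of _ x]) auto
  qed
  interpret P': bounded_linear P' using P by (rule has_derivative_bounded_linear)
  obtain K where K: "K > 0" "\<And>v. norm (P' v) \<le> norm v * K" using P'.pos_bounded by blast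
  show ?thesis
    unfolding has_derivative_at_alt
  proof (intro conjI allI impI)
    show "bounded_linear P'" by (rule P'.bounded_linear_axioms)
    fix e :: real assume e: "e > 0"
    \<comment> \<open>The error splits into the remainder of \<open>P\<close> at \<open>x\<close>
      and \<open>P'\<close> of the difference between \<open>x\<close> and
      \<open>y - \<Phi> 0\<close>. Each is at most \<open>e / 4 * norm x\<close>, and
      \<open>norm x\<close> is at most twice \<open>norm (y - \<Phi> 0)\<close>.\<close>
    obtain r2 where r2: "r2 > 0" "\<And>x y. x \<in> ball 0 r2 \<Longrightarrow> y \<in> ball 0 r2 \<Longrightarrow> norm (\<Phi> x - \<Phi> y - (x - y)) \<le> e / (4 * K) * norm (x - y)"
      using strict[of "e / (4 * K)"] e K(1) by auto
    have "\<forall>e>0. \<exists>d>0. \<forall>y. norm (y - 0) < d \<longrightarrow> norm (P y - P 0 - P' (y - 0)) \<le> e * norm (y - 0)"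
      using P unfolding has_derivative_at_alt by blast
    then obtain r3 where r3: "r3 > 0" "\<And>x. norm x < r3 \<Longrightarrow> norm (P x - P 0 - P' x) \<le> e / 4 * norm x"
      using e by (metis diff_zero divide_pos_pos zero_less_numeral)
    define d where "d = min (r1 / 4) (min (r0 / 2) (min (r2 / 2) (r3 / 2)))"
    have "norm (p y - p (\<Phi> 0) - P' (y - \<Phi> 0)) \<le> e * norm (y - \<Phi> 0)" if y: "norm (y - \<Phi> 0) < d" for y
    proof -
      obtain x where x: "\<Phi> x = y" "norm x \<le> 2 * norm (y - \<Phi> 0)" using solve[of y] y by (auto simp: d_def)
      have small: "norm x < r0" "norm x < r2" "norm x < r3" using x(2) y by (auto simp: d_def)
      have "P' (x - (y - \<Phi> 0)) = P' x - P' (y - \<Phi> 0)" by (rule P'.diff)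
      moreover have "p y = P x" "p (\<Phi> 0) = P 0" using r0(2)[of x] r0(2)[of 0] small(1) r0(1) x(1) by auto
      ultimately have "p y - p (\<Phi> 0) - P' (y - \<Phi> 0) = (P x - P 0 - P' x) + P' (x - (y - \<Phi> 0))" by simp
      then have "norm (p y - p (\<Phi> 0) - P' (y - \<Phi> 0)) \<le> norm (P x - P 0 - P' x) + norm (P' (x - (y - \<Phi> 0)))"
        by (simp only: norm_triangle_ineq)
      also have "norm (P x - P 0 - P' x) \<le> e / 4 * norm x" by (rule r3(2)[OF small(3)])
      also have "norm (P' (x - (y - \<Phi> 0))) \<le> norm (x - (y - \<Phi> 0)) * K" by (rule K(2))
      also have "norm (x - (y - \<Phi> 0)) \<le> e / (4 * K) * norm x"
        using r2(2)[of x 0] small(2) r2(1) x(1) by (simp add: norm_minus_commute)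
      also have "e / (4 * K) * norm x * K = e / 4 * norm x" using K(1) by simp
      finally have "norm (p y - p (\<Phi> 0) - P' (y - \<Phi> 0)) \<le> e / 4 * norm x + e / 4 * norm x" using K(1) by simp
      also have "\<dots> = e / 2 * norm x" by simp
      also have "\<dots> \<le> e / 2 * (2 * norm (y - \<Phi> 0))" using x(2) e by (intro mult_left_mono) auto
      finally show ?thesis by simp
    qed
    then show "\<exists>d>0. \<forall>y. norm (y - \<Phi> 0) < d \<longrightarrow> norm (p y - p (\<Phi> 0) - P' (y - \<Phi> 0)) \<le> e * norm (y - \<Phi> 0)"
      using r0(1) r1(1) r2(1) r3(1) by (intro exI[of _ d]) (auto simp: d_def)
  qed
qed

lemma bounded_bilinear_matrix_mult: "bounded_bilinear ((**) :: complex^'n^'n \<Rightarrow> complex^'n^'n \<Rightarrow> complex^'n^'n)"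
proof -
  have "bilinear ((**) :: complex^'n^'n \<Rightarrow> complex^'n^'n \<Rightarrow> complex^'n^'n)"
    unfolding bilinear_def
    by (auto intro!: linearI simp: matrix_matrix_mult_def vec_eq_iff distrib_left distrib_right sum.distrib scaleR_sum_right)
  then show ?thesis by (simp add: bilinear_conv_bounded_bilinear)
qed

lemma bounded_bilinear_matrix_vector_mult: "bounded_bilinear ((*v) :: complex^'n^'n \<Rightarrow> complex^'n \<Rightarrow> complex^'n)"
proof -
  have "bilinear ((*v) :: complex^'n^'n \<Rightarrow> complex^'n \<Rightarrow> complex^'n)"
    unfolding bilinear_def
    by (auto intro!: linearI simp: matrix_vector_mult_def vec_eq_iff distrib_left distrib_right sum.distrib scaleR_sum_right)
  then show ?thesis by (simp add: bilinear_conv_bounded_bilinear)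
qed

context lie_grp
begin

text \<open>Representations are continuous for the manifold topology; along smooth curves this
  becomes ordinary continuity.\<close>

lemma smooth_curve_continuous:
  fixes f :: "'g \<Rightarrow> 'b::topological_space"
  assumes "manifold_smooth_on vec_atlas (charts G) UNIV c" and f: "continuous_map (lie_topology G) euclidean f"
  shows "continuous_on UNIV (\<lambda>u::real. f (c u))"
proof (subst continuous_on_open_vimage[OF open_UNIV], intro allI impI)
  fix B :: "'b set" assume "open B"
  then have W: "openin (lie_topology G) {g \<in> carrier G. f g \<in> B}"
    using openin_continuous_map_preimage[OF f] topspace_manifold_topology[OF atl] by simp
  have "\<forall>u\<in>(\<lambda>u. f (c u)) -` B. \<exists>T. open T \<and> u \<in> T \<and> T \<subseteq> (\<lambda>u. f (c u)) -` B"
  proof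
    fix u assume "u \<in> (\<lambda>u. f (c u)) -` B"
    then have u: "f (c u) \<in> B" by simp
    have "c u \<in> {g \<in> carrier G. f g \<in> B}" using u smooth_on_carrier[OF assms(1)] by simp
    then obtain T where "open T" "u \<in> T" "\<And>y. y \<in> T \<Longrightarrow> y \<in> UNIV \<Longrightarrow> c y \<in> {g \<in> carrier G. f g \<in> B}"
      by (rule manifold_smooth_on_preimage[OF assms(1) smooth_atlas_vec atl W UNIV_I, unfolded manifold_topology_vec open_openin[symmetric]])
       (rule that)
    then show "\<exists>T. open T \<and> u \<in> T \<and> T \<subseteq> (\<lambda>u. f (c u)) -` B" by (intro exI[of _ T]) auto
  qed
  then show "open ((\<lambda>u. f (c u)) -` B \<inter> UNIV)" unfolding Int_UNIV_right by (rule open_subopen[THEN iffD2])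
qed

context
  fixes \<pi> :: "'g \<Rightarrow> complex^'n^'n"
  assumes rep: "representation G \<pi>"
begin

lemma rep_continuous: "continuous_map (lie_topology G) euclidean \<pi>"
  and rep_one: "\<pi> \<one> = mat 1"
  and rep_mult: "g \<in> carrier G \<Longrightarrow> h \<in> carrier G \<Longrightarrow> \<pi> (g \<otimes> h) = \<pi> g ** \<pi> h"
  using rep by (auto simp: representation_def)

text \<open>Right multiplication by \<open>z\<close> near \<open>mat 1\<close> is close to the
  identity, since the difference of the increments of \<open>x z\<close> and of \<open>x\<close> is
  \<open>x - x'\<close> times \<open>z - mat 1\<close>. So the continuous curve
  \<open>u \<mapsto> \<pi> (exp (u A))\<close> is differentiable.\<close>

lemma rep_lexp_deriv: "((\<lambda>u. \<pi> (lexp G (u *\<^sub>R A))) has_vector_derivative rep_deriv G \<pi> A) (at 0)"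
proof -
  let ?E = "\<lambda>u. \<pi> (lexp G (u *\<^sub>R A))"
  interpret bounded_bilinear "(**) :: complex^'n^'n \<Rightarrow> complex^'n^'n \<Rightarrow> complex^'n^'n"
    by (rule bounded_bilinear_matrix_mult)
  obtain K where K: "K > 0" "\<And>(X :: complex^'n^'n) (Y :: complex^'n^'n). norm (X ** Y) \<le> norm X * norm Y * K"
    using pos_bounded by blast
  have "\<exists>D. (?E has_vector_derivative D) (at 0)"
  proof (rule local_one_parameter_differentiable[where \<rho> = 1 and p = "mat 1" and \<mu> = "(**)"])
    show "continuous_on {- 1..1} ?E"
      using smooth_curve_continuous[OF lexp_smooth rep_continuous] by (rule continuous_on_subset) simp
    show "?E 0 = mat 1" by (simp add: lexp_zero rep_one)
    show "?E (s + t) = ?E s ** ?E t" for s t by (simp add: lexp_add rep_mult lexp_carrier)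
    fix \<delta> :: real assume \<delta>: "\<delta> > 0"
    have "norm (x ** z - x' ** z - (x - x')) \<le> \<delta> * norm (x - x')"
      if "z \<in> ball (mat 1) (\<delta> / K)" for x x' z :: "complex^'n^'n"
    proof -
      have "norm (z - mat 1) * K \<le> \<delta>" using that K(1) by (simp add: dist_norm norm_minus_commute pos_less_divide_eq less_imp_le)
      have "x ** z - x' ** z - (x - x') = (x - x') ** (z - mat 1)"
        by (simp add: diff_left diff_right)
      then have "norm (x ** z - x' ** z - (x - x')) \<le> norm (x - x') * (norm (z - mat 1) * K)"
        using K(2)[of "x - x'" "z - mat 1"] by (simp add: mult.assoc)
      also have "\<dots> \<le> norm (x - x') * \<delta>" using \<open>norm (z - mat 1) * K \<le> \<delta>\<close> by (rule mult_left_mono) simp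
      finally show ?thesis by (simp add: mult.commute)
    qed
    then show "\<exists>r>0. \<forall>x\<in>ball (mat 1 :: complex^'n^'n) r. \<forall>x'\<in>ball (mat 1) r. \<forall>z\<in>ball (mat 1 :: complex^'n^'n) r.
       norm (x ** z - x' ** z - (x - x')) \<le> \<delta> * norm (x - x')"
      using \<delta> K(1) by (intro exI[of _ "\<delta> / K"]) auto
  qed simp
  then obtain D where D: "(?E has_vector_derivative D) (at 0)" ..
  then show ?thesis unfolding rep_deriv_def using vector_derivative_at[OF D] by simp
qed

lemma rep_lexp_deriv_at:
  "((\<lambda>u. \<pi> (lexp G (u *\<^sub>R A))) has_vector_derivative \<pi> (lexp G (t *\<^sub>R A)) ** rep_deriv G \<pi> A) (at t)"
proof -
  interpret bounded_bilinear "(**) :: complex^'n^'n \<Rightarrow> complex^'n^'n \<Rightarrow> complex^'n^'n"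
    by (rule bounded_bilinear_matrix_mult)
  have sh: "((\<lambda>u. u - t) has_vector_derivative 1) (at t)" by (auto intro!: derivative_eq_intros)
  have "((\<lambda>u. \<pi> (lexp G (u *\<^sub>R A))) has_vector_derivative rep_deriv G \<pi> A) (at (t - t))"
    using rep_lexp_deriv by simp
  from vector_diff_chain_at[OF sh this]
  have "((\<lambda>u. \<pi> (lexp G ((u - t) *\<^sub>R A))) has_vector_derivative rep_deriv G \<pi> A) (at t)" by (simp add: o_def)
  from bounded_linear.has_vector_derivative[OF bounded_linear_right this]
  have "((\<lambda>u. \<pi> (lexp G (t *\<^sub>R A)) ** \<pi> (lexp G ((u - t) *\<^sub>R A))) has_vector_derivative
    \<pi> (lexp G (t *\<^sub>R A)) ** rep_deriv G \<pi> A) (at t)" .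
  moreover have "\<pi> (lexp G (t *\<^sub>R A)) ** \<pi> (lexp G ((u - t) *\<^sub>R A)) = \<pi> (lexp G (u *\<^sub>R A))" for u
    using lexp_add[of t "u - t" A] by (simp add: rep_mult lexp_carrier)
  ultimately show ?thesis by simp
qed

text \<open>In the coordinates of the second kind, \<open>x \<mapsto> exp (x\<^sub>1 b\<^sub>1) \<cdots> exp (x\<^sub>n b\<^sub>n)\<close>, the representation is a
  product of differentiable functions of one variable.\<close>

lemma rep_gderiv_one: "\<exists>\<l>. gderiv \<pi> \<one> \<l>"
proof -
  obtain B and r :: "'e \<Rightarrow> 'e \<Rightarrow> real" where B: "finite B" "\<And>b. bounded_linear (r b)" "\<And>x. (\<Sum>b\<in>B. r b x *\<^sub>R b) = x"
    "\<And>b b'. b \<in> B \<Longrightarrow> b' \<in> B \<Longrightarrow> r b b' = (if b = b' then 1 else 0)"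
    by (rule findim_coordinates[OF fd]) (rule that)
  obtain bs where bs: "set bs = B" "distinct bs" using finite_distinct_list[OF B(1)] by blast
  define \<Psi> where "\<Psi> bs x = foldr (\<lambda>b g. lexp G (r b x *\<^sub>R b) \<otimes> g) bs \<one>" for bs x
  have \<Psi>_simps: "\<Psi> [] x = \<one>" "\<Psi> (b # bs) x = lexp G (r b x *\<^sub>R b) \<otimes> \<Psi> bs x" for b bs x
    by (simp_all add: \<Psi>_def)
  have sm: "manifold_smooth_on vec_atlas (charts G) UNIV (\<Psi> bs)" for bs
  proof (induction bs)
    case Nil
    then show ?case unfolding \<Psi>_simps[abs_def] by (rule smooth_const_vec[OF one_closed])
  next
    case (Cons b bs)
    have "manifold_smooth_on vec_atlas (charts G) UNIV (\<lambda>x. lexp G (r b x *\<^sub>R b))"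
      by (rule manifold_smooth_on_compose[OF manifold_smooth_on_vecI[OF open_UNIV smooth_on_linear[OF open_UNIV B(2)]]
          lexp_smooth _ smooth_atlas_vec smooth_atlas_vec fd findim_euclidean]) simp
    then show ?case unfolding \<Psi>_simps[abs_def] by (rule smooth_mult_vec[OF fd _ Cons.IH])
  qed
  have car: "\<Psi> bs x \<in> carrier G" for bs x using smooth_on_carrier[OF sm] by simp
  have zero: "\<Psi> bs 0 = \<one>" for bs
    by (induction bs) (simp_all add: \<Psi>_simps lexp_zero linear_0[OF bounded_linear.linear[OF B(2)]])
  \<comment> \<open>On the axis of \<open>b\<close> all other factors are trivial; this makes the
    derivative of the coordinate change at 0 the identity on the basis.\<close>
  have line: "\<Psi> bs (s *\<^sub>R b) = (if b \<in> set bs then lexp G (s *\<^sub>R b) else \<one>)"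
    if "b \<in> B" "set bs \<subseteq> B" "distinct bs" for bs b s
    using that(2,3)
  proof (induction bs)
    case (Cons a bs)
    have "r a (s *\<^sub>R b) = (if a = b then s else 0)"
      using Cons.prems that(1) B(4)[of a b] by (simp add: linear_scale[OF bounded_linear.linear[OF B(2)]])
    then show ?case using Cons by (auto simp: \<Psi>_simps lexp_zero lexp_carrier)
  qed (simp add: \<Psi>_simps)
  have P: "\<exists>L. ((\<lambda>x. \<pi> (\<Psi> bs x)) has_derivative L) (at 0)" for bs
  proof (induction bs)
    case Nil
    then show ?case unfolding \<Psi>_simps by (blast intro: has_derivative_const)
  next
    case (Cons b bs)
    then obtain L where L: "((\<lambda>x. \<pi> (\<Psi> bs x)) has_derivative L) (at 0)" by blast
    have r0: "r b 0 = 0" by (rule linear_0[OF bounded_linear.linear[OF B(2)]])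
    have "((\<lambda>u. \<pi> (lexp G (u *\<^sub>R b))) has_derivative (\<lambda>h. h *\<^sub>R rep_deriv G \<pi> b)) (at (r b 0))"
      using rep_lexp_deriv[of b] by (simp add: has_vector_derivative_def r0)
    from has_derivative_compose[OF bounded_linear_imp_has_derivative[OF B(2)] this]
    have "((\<lambda>x. \<pi> (lexp G (r b x *\<^sub>R b))) has_derivative (\<lambda>x. r b x *\<^sub>R rep_deriv G \<pi> b)) (at 0)" .
    from bounded_bilinear.FDERIV[OF bounded_bilinear_matrix_mult this L]
    show ?case unfolding \<Psi>_simps rep_mult[OF lexp_carrier car] by (intro exI)
  qed
  obtain L where L: "((\<lambda>x. \<pi> (\<Psi> bs x)) has_derivative L) (at 0)" using P by blast
  have 1: "\<Psi> bs 0 \<in> U" using one_U by (simp add: zero)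
  obtain N where N: "open N" "0 \<in> N" "\<And>y. y \<in> N \<Longrightarrow> \<Psi> bs y \<in> U" "smooth_on N (\<lambda>y. \<phi> (\<Psi> bs y))"
    by (rule coord_smooth[OF sm fd open_UNIV UNIV_I 1]) (rule that)
  let ?F = "\<lambda>y. \<phi> (\<Psi> bs y)"
  let ?D = "frechet_derivative ?F (at 0)"
  have D: "(?F has_derivative ?D) (at 0)" by (rule smooth_on_has_derivative[OF N(4,2)])
  interpret D: bounded_linear ?D using D by (rule has_derivative_bounded_linear)
  have Db: "?D b = b" if b: "b \<in> B" for b
  proof -
    have sc: "((\<lambda>s. s *\<^sub>R b) has_vector_derivative b) (at (0::real))"
      by (auto simp: has_vector_derivative_def intro!: derivative_eq_intros)
    have "((\<lambda>s. ?F (s *\<^sub>R b)) has_vector_derivative ?D b) (at 0)"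
      by (rule has_vector_derivative_compose_derivative[OF sc]) (use D in simp)
    moreover have "?F (s *\<^sub>R b) = \<phi> (lexp G (s *\<^sub>R b))" for s using line[OF b, of bs] bs b by simp
    ultimately have "((\<lambda>s. \<phi> (lexp G (s *\<^sub>R b))) has_vector_derivative ?D b) (at 0)" by simp
    then show ?thesis
      using one_param_lexp[of b] vector_derivative_unique_at unfolding one_param_def by blast
  qed
  have "?D X = X" for X
  proof -
    have "?D X = ?D (\<Sum>b\<in>B. r b X *\<^sub>R b)" by (simp only: B(3))
    also have "\<dots> = (\<Sum>b\<in>B. r b X *\<^sub>R ?D b)" by (simp only: D.sum D.scaleR)
    also have "\<dots> = (\<Sum>b\<in>B. r b X *\<^sub>R b)" by (rule sum.cong) (simp_all add: Db)
    finally show ?thesis by (simp only: B(3))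
  qed
  then have "?D = (\<lambda>X. X)" by (rule ext)
  then have D': "(?F has_derivative (\<lambda>X. X)) (at 0)" using D by simp
  \<comment> \<open>Here \<open>\<Phi> = \<phi> \<circ> \<Psi> bs\<close> and
    \<open>P = \<pi> \<circ> \<Psi> bs\<close>: differentiability in the new coordinates passes to
    the chart.\<close>
  have "((\<lambda>x. \<pi> (\<iota> x)) has_derivative L) (at (?F 0))"
  proof (rule has_derivative_via_local_inverse[OF _ L])
    show "\<exists>r>0. \<forall>x\<in>ball 0 r. \<forall>y\<in>ball 0 r. norm (?F x - ?F y - (x - y)) \<le> \<delta> * norm (x - y)" if "\<delta> > 0" for \<delta>
      using smooth_on_strict_derivative[OF fd N(1,4,2) D' that] by blast
    obtain r where "r > 0" "ball 0 r \<subseteq> N" using N(1,2) openE by blast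
    then show "\<exists>r>0. \<forall>x\<in>ball 0 r. \<pi> (\<iota> (\<phi> (\<Psi> bs x))) = \<pi> (\<Psi> bs x)"
      using N(3) pt_coord by (intro exI[of _ r]) auto
  qed
  then have "((\<lambda>x. \<pi> (\<iota> x)) has_derivative L) (at e0)" by (simp add: zero)
  then have "gderiv \<pi> \<one> L" unfolding gderiv_def
    by (rule has_derivative_transform_within_open[OF _ open_\<Omega> e0_\<Omega>]) (simp add: pt_carrier)
  then show ?thesis by blast
qed

text \<open>Left translation carries the derivative at the identity, identified along exponentials,
  to \<open>g\<close>.\<close>

lemma rep_gderiv:
  assumes g: "g \<in> carrier G"
  shows "gderiv \<pi> g (\<lambda>A. \<pi> g ** rep_deriv G \<pi> A)"
proof -
  interpret bounded_bilinear "(**) :: complex^'n^'n \<Rightarrow> complex^'n^'n \<Rightarrow> complex^'n^'n"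
    by (rule bounded_bilinear_matrix_mult)
  obtain \<l> where l: "gderiv \<pi> \<one> \<l>" using rep_gderiv_one by blast
  have "\<l> A = rep_deriv G \<pi> A" for A
    using lexp_gderiv[OF l one_closed, of A] vector_derivative_unique_at[OF _ rep_lexp_deriv]
    by (simp add: lexp_carrier)
  then have "gderiv \<pi> \<one> (rep_deriv G \<pi>)" using l by (metis ext)
  then have "((\<lambda>x. \<pi> (\<one> \<otimes> \<iota> x)) has_derivative rep_deriv G \<pi>) (at e0)" by (simp add: gderiv_def)
  from bounded_linear.has_derivative[OF bounded_linear_right this]
  have "((\<lambda>x. \<pi> g ** \<pi> (\<one> \<otimes> \<iota> x)) has_derivative (\<lambda>A. \<pi> g ** rep_deriv G \<pi> A)) (at e0)" .
  then show ?thesis unfolding gderiv_def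
    by (rule has_derivative_transform_within_open[OF _ open_\<Omega> e0_\<Omega>]) (simp add: pt_carrier rep_mult g)
qed

lemma rep_deriv_linear: "bounded_linear (rep_deriv G \<pi>)"
proof -
  have "mat 1 ** X = X" for X :: "complex^'n^'n" by simp
  then show ?thesis using gderiv_linear[OF rep_gderiv[OF one_closed]] by (simp add: rep_one)
qed

text \<open>The derivative of \<open>p = \<pi> \<circ> \<iota>\<close> at \<open>x\<close> is
  \<open>p x\<close> times \<open>rep_deriv\<close> of a smooth expression in \<open>x\<close>, so
  every order of differentiability of \<open>p\<close> yields the next.\<close>

lemma rep_smooth_near_one:
  obtains N where "open N" "e0 \<in> N" "N \<subseteq> \<Omega>" "smooth_on N (\<lambda>x. \<pi> (\<iota> x))"
proof -
  have o: "open (\<Omega> \<times> \<Omega>)" using open_\<Omega> open_Times by blast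
  have sm: "manifold_smooth_on vec_atlas (charts G) (\<Omega> \<times> \<Omega>) (\<lambda>z. inv (\<iota> (fst z)) \<otimes> \<iota> (snd z))"
    by (intro smooth_mult_vec smooth_inv_vec fd2 smooth_pt_fst smooth_pt_snd)
  have 3: "inv (\<iota> (fst (e0, e0))) \<otimes> \<iota> (snd (e0, e0)) \<in> U"
    using one_U by (simp add: pt_e0)
  have 4: "(e0, e0) \<in> \<Omega> \<times> \<Omega>" using e0_\<Omega> by blast
  let ?Q = "\<lambda>z. \<phi> (inv (\<iota> (fst z)) \<otimes> \<iota> (snd z))"
  obtain N where N: "open N" "(e0, e0) \<in> N" "N \<subseteq> \<Omega> \<times> \<Omega>"
    "\<And>z. z \<in> N \<Longrightarrow> inv (\<iota> (fst z)) \<otimes> \<iota> (snd z) \<in> U" "smooth_on N ?Q"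
    by (rule coord_smooth[OF sm fd2 o 4 3]) (rule that)
  define N0 where "N0 = (\<lambda>x. (x, x)) -` N"
  have N0: "open N0" "e0 \<in> N0" "N0 \<subseteq> \<Omega>"
    unfolding N0_def using N(1,2,3) by (auto intro!: open_vimage continuous_intros)
  have diag: "smooth_on N0 (\<lambda>x. (x, x))"
    by (intro smooth_on_Pair[OF N0(1)] smooth_on_linear[OF N0(1)] bounded_linear_ident)
  \<comment> \<open>The left Maurer-Cartan form in coordinates: the derivative of
    \<open>z \<mapsto> x^-1 z\<close> at \<open>z = x\<close>.\<close>
  define \<omega> where "\<omega> x v = frechet_derivative ?Q (at (x, x)) (0, v)" for x v
  have \<omega>: "smooth_on N0 (\<lambda>x. \<omega> x v)" for v
    unfolding \<omega>_def
    by (rule smooth_on_compose[OF fd2 N0(1) smooth_on_derivative[OF N(5)] diag]) (auto simp: N0_def)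
  let ?p = "\<lambda>x. \<pi> (\<iota> x)"
  interpret bounded_bilinear "(**) :: complex^'n^'n \<Rightarrow> complex^'n^'n \<Rightarrow> complex^'n^'n"
    by (rule bounded_bilinear_matrix_mult)
  have pe: "(?p has_derivative rep_deriv G \<pi>) (at e0)"
    using rep_gderiv[OF one_closed] unfolding gderiv_def rep_one matrix_mul_lid
    by (rule has_derivative_transform_within_open[OF _ open_\<Omega> e0_\<Omega>]) (simp add: pt_carrier)
  have "smooth_on N0 ?p"
  proof (rule smooth_onI_bootstrap[OF N0(1), where f' = "\<lambda>x v. ?p x ** rep_deriv G \<pi> (\<omega> x v)"])
    fix x assume x: "x \<in> N0"
    then have xN: "(x, x) \<in> N" and xc: "\<iota> x \<in> carrier G" using N0(3) pt_carrier by (auto simp: N0_def)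
    have Q: "((\<lambda>z. ?Q (x, z)) has_derivative \<omega> x) (at x)"
      unfolding \<omega>_def
      by (rule has_derivative_compose[where f = "\<lambda>z. (x, z)", OF _ smooth_on_has_derivative[OF N(5) xN]])
        (auto intro!: derivative_eq_intros)
    have "(?p has_derivative rep_deriv G \<pi>) (at (?Q (x, x)))" using pe xc by simp
    from bounded_linear.has_derivative[OF bounded_linear_right has_derivative_compose[OF Q this]]
    have d: "((\<lambda>z. ?p x ** ?p (?Q (x, z))) has_derivative (\<lambda>v. ?p x ** rep_deriv G \<pi> (\<omega> x v))) (at x)" .
    show "(?p has_derivative (\<lambda>v. ?p x ** rep_deriv G \<pi> (\<omega> x v))) (at x)"
    proof (rule has_derivative_transform_within_open[OF d])
      show "open ((\<lambda>z. (x, z)) -` N)" using N(1) by (intro open_vimage continuous_intros)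
      show "x \<in> (\<lambda>z. (x, z)) -` N" using xN by simp
      fix z assume "z \<in> (\<lambda>z. (x, z)) -` N"
      then have z: "(x, z) \<in> N" by simp
      then have "\<iota> z \<in> carrier G" using N(3) pt_carrier by auto
      then show "?p x ** ?p (?Q (x, z)) = ?p z"
        using pt_coord[OF N(4)[OF z]] xc by (simp add: rep_mult[symmetric] inv_mult_cancel)
    qed
  next
    fix n v assume n: "higher_differentiable_on n N0 ?p"
    have "higher_differentiable_on n N0 (\<lambda>x. \<omega> x v)" using \<omega> by (simp add: smooth_on_def)
    from higher_differentiable_on_linear_compose[OF N0(1) rep_deriv_linear this]
    show "higher_differentiable_on n N0 (\<lambda>x. ?p x ** rep_deriv G \<pi> (\<omega> x v))"
      by (rule higher_differentiable_on_bilinear[OF N0(1) bounded_bilinear_matrix_mult n])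
  qed
  then show thesis using that N0 by blast
qed

text \<open>Near \<open>k\<close> the matrix \<open>\<pi> y\<close> is \<open>\<pi> k\<close> times
  \<open>\<pi> (k^-1 y)\<close>, which reduces the claim to the identity.\<close>

lemma rep_smooth: "manifold_smooth_on (charts G) vec_atlas (carrier G) \<pi>"
proof (rule manifold_smooth_on_local[OF atl])
  fix k assume k: "k \<in> carrier G"
  obtain N where N: "open N" "e0 \<in> N" "N \<subseteq> \<Omega>" "smooth_on N (\<lambda>x. \<pi> (\<iota> x))"
    by (rule rep_smooth_near_one) (rule that)
  have sm: "manifold_smooth_on (charts G) (charts G) (carrier G) (\<lambda>y. inv k \<otimes> y)"
    using k by (intro smooth_mult'[OF atl fd] smooth_const'[OF atl subset_refl] manifold_smooth_on_ident[OF atl subset_refl]) simp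
  have 1: "inv k \<otimes> k \<in> U \<inter> \<phi> -` N" using k one_U N(2) by simp
  obtain T where T: "openin (lie_topology G) T" "k \<in> T" "\<And>y. y \<in> T \<Longrightarrow> y \<in> carrier G \<Longrightarrow> inv k \<otimes> y \<in> U \<inter> \<phi> -` N"
    by (rule manifold_smooth_on_preimage[OF sm atl atl openin_chart_preimage[OF atl id_chart_mem N(1)] k 1]) (rule that)
  let ?S = "carrier G \<inter> T"
  have a: "manifold_smooth_on (charts G) vec_atlas ?S (\<lambda>y. \<phi> (inv k \<otimes> y))"
    by (rule manifold_smooth_on_compose[OF manifold_smooth_on_subset[OF sm] smooth_coord _ atl atl fd fd]) (use T(3) in auto)
  have lin: "smooth_on N (\<lambda>x. \<pi> k ** \<pi> (\<iota> x))"
    by (rule smooth_on_linear_compose[OF N(1) bounded_bilinear.bounded_linear_right[OF bounded_bilinear_matrix_mult] N(4)])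
  have "manifold_smooth_on (charts G) vec_atlas ?S (\<lambda>y. \<pi> k ** \<pi> (\<iota> (\<phi> (inv k \<otimes> y))))"
    by (rule manifold_smooth_on_compose[OF a manifold_smooth_on_vecI[OF N(1) lin] _ atl smooth_atlas_vec fd fd]) (use T(3) in auto)
  then have "manifold_smooth_on (charts G) vec_atlas ?S \<pi>"
  proof (rule manifold_smooth_on_cong)
    fix y assume "y \<in> ?S"
    then show "\<pi> y = \<pi> k ** \<pi> (\<iota> (\<phi> (inv k \<otimes> y)))"
      using T(3)[of y] k by (simp add: pt_coord rep_mult[symmetric] inv_mult_cancel)
  qed simp
  then show "\<exists>T. openin (lie_topology G) T \<and> k \<in> T \<and> manifold_smooth_on (charts G) vec_atlas (carrier G \<inter> T) \<pi>"
    using T(1,2) by blast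
qed

end

end

lemma exp_has_vector_derivative_of_real:
  "((\<lambda>u. exp (of_real u * a)) has_vector_derivative exp (of_real t * a) * a) (at t)" for a :: complex
  using exp_scaleR_has_vector_derivative_right[of a t UNIV] by (simp add: scaleR_conv_of_real)

section \<open>Sections as equivariant functions\<close>

locale prequantum = lie_grp G for G :: "('g, 'e::banach) lie_group_data" (structure) +
  fixes \<eta> :: "'e \<Rightarrow>\<^sub>L real" and \<Lambda> :: "'g \<Rightarrow> complex"
  assumes qc: "quantizing_character G \<eta> \<Lambda>"
begin

abbreviation T where "T \<equiv> isotropy G \<eta>"

lemma \<Lambda>_mult: "a \<in> T \<Longrightarrow> b \<in> T \<Longrightarrow> \<Lambda> (a \<otimes> b) = \<Lambda> a * \<Lambda> b"
  and \<Lambda>_norm: "a \<in> T \<Longrightarrow> cmod (\<Lambda> a) = 1"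
  using qc by (auto simp: quantizing_character_def hom_def circle_group_def Pi_iff)

lemma \<Lambda>_nonzero: "a \<in> T \<Longrightarrow> \<Lambda> a \<noteq> 0"
  using \<Lambda>_norm by fastforce

lemma T_one: "\<one> \<in> T" and T_inv: "a \<in> T \<Longrightarrow> inv a \<in> T" and T_mult: "a \<in> T \<Longrightarrow> b \<in> T \<Longrightarrow> a \<otimes> b \<in> T"
  using isotropy_subgroup[of \<eta>] by (auto simp: subgroup.one_closed subgroup.m_inv_closed subgroup.m_closed)

lemmas T_carrier = isotropyD(1)

lemma \<Lambda>_one: "\<Lambda> \<one> = 1"
  using \<Lambda>_mult[OF T_one T_one] \<Lambda>_nonzero[OF T_one] by simp

lemma \<Lambda>_inv: "a \<in> T \<Longrightarrow> \<Lambda> (inv a) = inverse (\<Lambda> a)"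
proof -
  assume a: "a \<in> T"
  have "\<Lambda> a * \<Lambda> (inv a) = 1" using \<Lambda>_mult[OF a T_inv[OF a]] a by (simp add: T_carrier \<Lambda>_one)
  then show ?thesis by (rule inverse_unique[symmetric])
qed

lemma \<Lambda>_deriv: "C \<in> lie_subalgebra G T \<Longrightarrow> ((\<lambda>u. \<Lambda> (lexp G (u *\<^sub>R C))) has_vector_derivative
    2 * of_real pi * \<i> * of_real (blinfun_apply \<eta> C)) (at 0)"
  using qc by (simp add: quantizing_character_def)

section \<open>Computing with the equivalence classes of the bundle\<close>

lemma mem_cls: "g \<in> carrier G \<Longrightarrow> p \<in> cls G \<eta> \<Lambda> g z \<longleftrightarrow> (\<exists>b\<in>T. p = (g \<otimes> inv b, \<Lambda> b * z))"
  by (auto simp: cls_def bundle_rel_def)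

text \<open>The right action of \<open>T\<close> on \<open>G\<close> is free. This makes
  \<open>fibre_coord\<close> well defined.\<close>

lemma mem_cls_same: "g \<in> carrier G \<Longrightarrow> (g, w) \<in> cls G \<eta> \<Lambda> g z \<longleftrightarrow> w = z"
proof -
  assume g: "g \<in> carrier G"
  have "b = \<one>" if "g = g \<otimes> inv b" "b \<in> T" for b
  proof -
    have bc: "b \<in> carrier G" using that(2) by (rule T_carrier)
    have "inv b = inv g \<otimes> (g \<otimes> inv b)" using g bc by (simp add: inv_mult_cancel')
    also have "\<dots> = \<one>" using g by (simp flip: that(1))
    finally have "inv (inv b) = inv \<one>" by simp
    then show ?thesis using bc by simp
  qed
  then show ?thesis unfolding mem_cls[OF g] using g T_one \<Lambda>_one by (auto intro!: bexI[of _ \<one>])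
qed

lemma cls_shift:
  assumes g: "g \<in> carrier G" and b: "b \<in> T"
  shows "cls G \<eta> \<Lambda> (g \<otimes> inv b) (\<Lambda> b * z) = cls G \<eta> \<Lambda> g z"
proof -
  have bc: "b \<in> carrier G" using b T_carrier by blast
  have gb: "g \<otimes> inv b \<in> carrier G" using g bc by simp
  have 1: "(g \<otimes> inv b \<otimes> inv a, \<Lambda> a * (\<Lambda> b * z)) \<in> cls G \<eta> \<Lambda> g z" if "a \<in> T" for a
    unfolding mem_cls[OF g]
    using that b g bc T_carrier[OF that] T_mult[OF that b]
    by (intro bexI[of _ "a \<otimes> b"]) (simp_all add: \<Lambda>_mult inv_mult_group m_assoc)
  have 2: "(g \<otimes> inv a, \<Lambda> a * z) \<in> cls G \<eta> \<Lambda> (g \<otimes> inv b) (\<Lambda> b * z)" if "a \<in> T" for a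
    unfolding mem_cls[OF gb]
    using that b g bc T_carrier[OF that] T_mult[OF that T_inv[OF b]] \<Lambda>_nonzero[OF b]
    by (intro bexI[of _ "a \<otimes> inv b"]) (simp_all add: \<Lambda>_mult T_inv \<Lambda>_inv inv_mult_group m_assoc inv_mult_cancel')
  show ?thesis
  proof (intro equalityI subsetI)
    fix p assume "p \<in> cls G \<eta> \<Lambda> (g \<otimes> inv b) (\<Lambda> b * z)"
    then show "p \<in> cls G \<eta> \<Lambda> g z" unfolding mem_cls[OF gb] using 1 by auto
  next
    fix p assume "p \<in> cls G \<eta> \<Lambda> g z"
    then show "p \<in> cls G \<eta> \<Lambda> (g \<otimes> inv b) (\<Lambda> b * z)" unfolding mem_cls[OF g] using 2 by auto
  qed
qed

lemma cls_inject: "g \<in> carrier G \<Longrightarrow> cls G \<eta> \<Lambda> g z = cls G \<eta> \<Lambda> g w \<longleftrightarrow> z = w"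
  using mem_cls_same[of g z z] mem_cls_same[of g z w] by auto

lemma coad_shift: "g \<in> carrier G \<Longrightarrow> b \<in> T \<Longrightarrow> coad G (g \<otimes> inv b) \<eta> = coad G g \<eta>"
  using T_inv[of b] by (simp add: coad_mult isotropyD)

lemma coad_eqD:
  assumes "g \<in> carrier G" "g' \<in> carrier G" "coad G g' \<eta> = coad G g \<eta>"
  shows "\<exists>b\<in>T. g' = g \<otimes> inv b"
proof -
  have "coad G (inv g' \<otimes> g) \<eta> = coad G (inv g' \<otimes> g') \<eta>" using assms by (simp only: coad_mult inv_closed)
  also have "\<dots> = \<eta>" using assms by (simp add: coad_one)
  finally have "coad G (inv g' \<otimes> g) \<eta> = \<eta>" .
  then have "inv g' \<otimes> g \<in> T" using assms by (simp add: isotropy_def)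
  moreover have "g' = g \<otimes> inv (inv g' \<otimes> g)" using assms by (simp add: inv_mult_group inv_mult_cancel)
  ultimately show ?thesis by blast
qed

lemma bproj_cls:
  assumes g: "g \<in> carrier G"
  shows "bproj G \<eta> (cls G \<eta> \<Lambda> g z) = coad G g \<eta>"
  unfolding bproj_def
proof (rule the_equality)
  show "\<exists>g' z'. (g', z') \<in> cls G \<eta> \<Lambda> g z \<and> coad G g \<eta> = coad G g' \<eta>"
    using mem_cls_same[OF g] by blast
  show "\<nu> = coad G g \<eta>" if "\<exists>g' z'. (g', z') \<in> cls G \<eta> \<Lambda> g z \<and> \<nu> = coad G g' \<eta>" for \<nu>
    using that g by (auto simp: mem_cls coad_shift)
qed

lemma fscale_cls: "g \<in> carrier G \<Longrightarrow> fscale c (cls G \<eta> \<Lambda> g z) = cls G \<eta> \<Lambda> g (c * z)"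
proof -
  assume g: "g \<in> carrier G"
  have "cls G \<eta> \<Lambda> g z = (\<lambda>b. (g \<otimes> inv b, \<Lambda> b * z)) ` T" for z
    using mem_cls[OF g] by auto
  then show ?thesis by (simp add: fscale_def image_image mult_ac)
qed

lemma fadd_cls:
  assumes g: "g \<in> carrier G"
  shows "fadd (cls G \<eta> \<Lambda> g z) (cls G \<eta> \<Lambda> g w) = cls G \<eta> \<Lambda> g (z + w)"
proof (intro equalityI subsetI)
  fix p assume "p \<in> fadd (cls G \<eta> \<Lambda> g z) (cls G \<eta> \<Lambda> g w)"
  then obtain k x y where p: "p = (k, x + y)" "(k, x) \<in> cls G \<eta> \<Lambda> g z" "(k, y) \<in> cls G \<eta> \<Lambda> g w"
    by (auto simp: fadd_def)
  then obtain a b where a: "a \<in> T" "k = g \<otimes> inv a" "x = \<Lambda> a * z" and b: "b \<in> T" "k = g \<otimes> inv b" "y = \<Lambda> b * w"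
    using mem_cls[OF g] by auto
  have ab: "a \<in> carrier G" "b \<in> carrier G" using a(1) b(1) T_carrier by auto
  have "g \<otimes> inv a = g \<otimes> inv b" using a(2) b(2) by simp
  then have "inv a = inv b" using g ab by simp
  then have "inv (inv a) = inv (inv b)" by simp
  then have "a = b" using ab by simp
  then show "p \<in> cls G \<eta> \<Lambda> g (z + w)" using a b p(1) mem_cls[OF g] by (auto simp: distrib_left)
next
  fix p assume "p \<in> cls G \<eta> \<Lambda> g (z + w)"
  then obtain a where a: "a \<in> T" "p = (g \<otimes> inv a, \<Lambda> a * (z + w))" using mem_cls[OF g] by auto
  moreover have "(g \<otimes> inv a, \<Lambda> a * z) \<in> cls G \<eta> \<Lambda> g z" "(g \<otimes> inv a, \<Lambda> a * w) \<in> cls G \<eta> \<Lambda> g w"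
    using a(1) mem_cls[OF g] by auto
  ultimately show "p \<in> fadd (cls G \<eta> \<Lambda> g z) (cls G \<eta> \<Lambda> g w)"
    unfolding fadd_def by (auto simp: distrib_left intro!: exI)
qed

lemma fibre_coord_cls: "g \<in> carrier G \<Longrightarrow> fibre_coord g (cls G \<eta> \<Lambda> g z) = z"
  unfolding fibre_coord_def by (rule the_equality) (simp_all add: mem_cls_same)

lemma line_bundle_eq: "line_bundle G \<eta> \<Lambda> = {cls G \<eta> \<Lambda> g z |g z. g \<in> carrier G}"
  by (auto simp: line_bundle_def quotient_def cls_def)

definition equivariant :: "('g \<Rightarrow> complex) \<Rightarrow> bool" where
  "equivariant f \<longleftrightarrow> (\<forall>g\<in>carrier G. \<forall>b\<in>T. f (g \<otimes> inv b) = \<Lambda> b * f g)"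

text \<open>\<open>SOME\<close> picks a group element over the orbit point; \<open>sec_apply\<close>
  shows that for equivariant \<open>f\<close> the choice is immaterial. The restriction to the orbit
  matches the extensional functions in \<open>bsection\<close>.\<close>

definition sec :: "('g \<Rightarrow> complex) \<Rightarrow> ('e \<Rightarrow>\<^sub>L real) \<Rightarrow> ('g \<times> complex) set" where
  "sec f = (\<lambda>\<nu>\<in>orbit G \<eta>. let g = (SOME g. g \<in> carrier G \<and> coad G g \<eta> = \<nu>) in cls G \<eta> \<Lambda> g (f g))"

lemma orbitI: "g \<in> carrier G \<Longrightarrow> coad G g \<eta> \<in> orbit G \<eta>"
  by (auto simp: orbit_def)

lemma orbitE:
  assumes "\<nu> \<in> orbit G \<eta>" obtains g where "g \<in> carrier G" "\<nu> = coad G g \<eta>"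
  using assms by (auto simp: orbit_def)

lemma sec_apply:
  assumes f: "equivariant f" and g: "g \<in> carrier G"
  shows "sec f (coad G g \<eta>) = cls G \<eta> \<Lambda> g (f g)"
proof -
  define k where "k = (SOME k. k \<in> carrier G \<and> coad G k \<eta> = coad G g \<eta>)"
  have "k \<in> carrier G \<and> coad G k \<eta> = coad G g \<eta>"
    unfolding k_def by (rule someI[of _ g]) (simp add: g)
  then obtain b where b: "b \<in> T" "k = g \<otimes> inv b" using coad_eqD g by blast
  have "sec f (coad G g \<eta>) = cls G \<eta> \<Lambda> k (f k)"
    using orbitI[OF g] by (simp add: sec_def k_def[symmetric])
  also have "\<dots> = cls G \<eta> \<Lambda> g (f g)"
    using f g b cls_shift[OF g b(1)] by (simp add: equivariant_def)
  finally show ?thesis .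
qed

lemma sec_bsection:
  assumes "equivariant f"
  shows "bsection G \<eta> \<Lambda> (sec f)"
  unfolding bsection_def
proof (rule PiE_I)
  fix \<nu> assume "\<nu> \<in> orbit G \<eta>"
  then obtain g where g: "g \<in> carrier G" "\<nu> = coad G g \<eta>" by (rule orbitE)
  then show "sec f \<nu> \<in> {l \<in> line_bundle G \<eta> \<Lambda>. bproj G \<eta> l = \<nu>}"
    using assms by (auto simp: sec_apply bproj_cls line_bundle_eq)
qed (simp add: sec_def)

lemma bsection_ext:
  assumes "bsection G \<eta> \<Lambda> \<sigma>" "bsection G \<eta> \<Lambda> \<tau>" "\<And>g. g \<in> carrier G \<Longrightarrow> \<sigma> (coad G g \<eta>) = \<tau> (coad G g \<eta>)"
  shows "\<sigma> = \<tau>"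
proof (rule PiE_ext)
  show "\<sigma> \<in> (\<Pi>\<^sub>E \<nu>\<in>orbit G \<eta>. {l \<in> line_bundle G \<eta> \<Lambda>. bproj G \<eta> l = \<nu>})"
    and "\<tau> \<in> (\<Pi>\<^sub>E \<nu>\<in>orbit G \<eta>. {l \<in> line_bundle G \<eta> \<Lambda>. bproj G \<eta> l = \<nu>})"
    using assms by (simp_all add: bsection_def)
  show "\<sigma> \<nu> = \<tau> \<nu>" if "\<nu> \<in> orbit G \<eta>" for \<nu>
    using that assms(3) by (auto elim: orbitE)
qed

text \<open>Reading off the fibre coordinate inverts \<open>sec\<close>; equivariance is the
  relation \<open>[g b^-1, \<Lambda> b z] = [g, z]\<close> in these coordinates.\<close>

lemma bsection_sec:
  assumes \<sigma>: "bsection G \<eta> \<Lambda> \<sigma>"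
  defines "f \<equiv> \<lambda>g. fibre_coord g (\<sigma> (coad G g \<eta>))"
  shows "equivariant f" "\<sigma> = sec f"
proof -
  have val: "\<sigma> (coad G g \<eta>) = cls G \<eta> \<Lambda> g (f g)" if g: "g \<in> carrier G" for g
  proof -
    have "\<sigma> (coad G g \<eta>) \<in> {l \<in> line_bundle G \<eta> \<Lambda>. bproj G \<eta> l = coad G g \<eta>}"
      using \<sigma> orbitI[OF g] unfolding bsection_def by (rule PiE_mem)
    then obtain k z where k: "k \<in> carrier G" "\<sigma> (coad G g \<eta>) = cls G \<eta> \<Lambda> k z" "coad G k \<eta> = coad G g \<eta>"
      by (auto simp: line_bundle_eq bproj_cls)
    then obtain b where b: "b \<in> T" "g = k \<otimes> inv b" using coad_eqD[OF k(1) g] by auto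
    have "\<sigma> (coad G g \<eta>) = cls G \<eta> \<Lambda> g (\<Lambda> b * z)" using cls_shift[OF k(1) b(1)] b(2) k(2) by simp
    then show ?thesis using g by (simp add: f_def fibre_coord_cls)
  qed
  show e: "equivariant f"
    unfolding equivariant_def
  proof (intro ballI)
    fix g b assume g: "g \<in> carrier G" and b: "b \<in> T"
    have gb: "g \<otimes> inv b \<in> carrier G" using g T_carrier[OF b] by simp
    have "cls G \<eta> \<Lambda> (g \<otimes> inv b) (f (g \<otimes> inv b)) = cls G \<eta> \<Lambda> (g \<otimes> inv b) (\<Lambda> b * f g)"
      using val[OF gb] val[OF g] by (simp add: coad_shift g b cls_shift)
    then show "f (g \<otimes> inv b) = \<Lambda> b * f g" using cls_inject[OF gb] by blast
  qed
  show "\<sigma> = sec f"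
    by (rule bsection_ext[OF \<sigma> sec_bsection[OF e]]) (simp add: val sec_apply[OF e])
qed

lemma fibre_coord_sec:
  "equivariant f \<Longrightarrow> g \<in> carrier G \<Longrightarrow> fibre_coord g (sec f (coad G g \<eta>)) = f g"
  by (simp add: sec_apply fibre_coord_cls)

lemma sec_cong:
  assumes "equivariant f" "equivariant f'" "\<And>g. g \<in> carrier G \<Longrightarrow> f g = f' g"
  shows "sec f = sec f'"
  by (rule bsection_ext[OF sec_bsection[OF assms(1)] sec_bsection[OF assms(2)]])
    (simp add: sec_apply assms)

lemma sharp_sec:
  assumes "equivariant f" "g \<in> carrier G" "z \<noteq> 0"
  shows "sharp G \<eta> (sec f) (cls G \<eta> \<Lambda> g z) = f g / z"
  unfolding sharp_def bproj_cls[OF assms(2)] sec_apply[OF assms(1,2)] fscale_cls[OF assms(2)] cls_inject[OF assms(2)]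
  by (rule the_equality) (use assms(3) in auto)

section \<open>Covariant derivative and quantum operator on equivariant functions\<close>

definition gdiff :: "('g \<Rightarrow> complex) \<Rightarrow> bool" where
  "gdiff f \<longleftrightarrow> (\<forall>g\<in>carrier G. \<exists>L. gderiv f g L)"

text \<open>The derivative along the right-invariant vector field of \<open>A\<close>, which
  generates left translations and projects to \<open>X_A\<close> on the orbit.\<close>

definition rderiv :: "'e \<Rightarrow> ('g \<Rightarrow> complex) \<Rightarrow> 'g \<Rightarrow> complex" where
  "rderiv A f g = vector_derivative (\<lambda>u. f (lexp G (u *\<^sub>R A) \<otimes> g)) (at 0)"

lemma rderiv_gderiv:
  assumes "gderiv f g L" "g \<in> carrier G"
  shows "((\<lambda>u. f (lexp G (u *\<^sub>R A) \<otimes> g)) has_vector_derivative L (Ad G (inv g) A)) (at 0)"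
    "rderiv A f g = L (Ad G (inv g) A)"
proof -
  show *: "((\<lambda>u. f (lexp G (u *\<^sub>R A) \<otimes> g)) has_vector_derivative L (Ad G (inv g) A)) (at 0)"
    unfolding lexp_mult_right[OF assms(2)] by (rule lexp_gderiv[OF assms])
  then show "rderiv A f g = L (Ad G (inv g) A)" unfolding rderiv_def by (rule vector_derivative_at)
qed

text \<open>Left translations commute with the right action of \<open>T\<close>, so equivariance
  survives the differentiation.\<close>

lemma rderiv_shift:
  assumes f: "equivariant f" "gdiff f" and g: "g \<in> carrier G" and b: "b \<in> T"
  shows "rderiv A f (g \<otimes> inv b) = \<Lambda> b * rderiv A f g"
proof -
  obtain L where L: "gderiv f g L" using f(2) g by (auto simp: gdiff_def)
  have "f (lexp G (u *\<^sub>R A) \<otimes> (g \<otimes> inv b)) = \<Lambda> b * f (lexp G (u *\<^sub>R A) \<otimes> g)" for u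
    using f(1) g b lexp_carrier T_carrier[OF b] by (simp add: equivariant_def m_assoc[symmetric])
  moreover have "((\<lambda>u. \<Lambda> b * f (lexp G (u *\<^sub>R A) \<otimes> g)) has_vector_derivative \<Lambda> b * L (Ad G (inv g) A)) (at 0)"
    by (rule bounded_linear.has_vector_derivative[OF bounded_linear_mult_right rderiv_gderiv(1)[OF L g]])
  ultimately show ?thesis
    unfolding rderiv_def[of A f "g \<otimes> inv b"] rderiv_gderiv(2)[OF L g] by (simp add: vector_derivative_at)
qed

lemma lie_subalgebra_T_neg: "C \<in> lie_subalgebra G T \<Longrightarrow> - C \<in> lie_subalgebra G T"
proof -
  assume "C \<in> lie_subalgebra G T"
  then have "lexp G ((- u) *\<^sub>R C) \<in> T" for u by (simp add: lie_subalgebra_def del: scaleR_minus_left)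
  then show ?thesis by (simp add: lie_subalgebra_def)
qed

text \<open>Along the fibres of \<open>G\<close> over the orbit an equivariant function is governed
  by the character; the sign comes from \<open>f (g b) = \<Lambda> (b^-1) f g\<close>.\<close>

lemma gderiv_isotropy:
  assumes f: "equivariant f" and L: "gderiv f g L" and g: "g \<in> carrier G" and C: "C \<in> lie_subalgebra G T"
  shows "L C = - (2 * of_real pi * \<i> * of_real (blinfun_apply \<eta> C)) * f g"
proof -
  let ?c = "2 * of_real pi * \<i> * of_real (blinfun_apply \<eta> (- C))"
  have "f (g \<otimes> lexp G (u *\<^sub>R C)) = \<Lambda> (lexp G (u *\<^sub>R (- C))) * f g" for u
  proof -
    have "lexp G (u *\<^sub>R (- C)) \<in> T" using lie_subalgebra_T_neg[OF C] by (simp add: lie_subalgebra_def)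
    moreover have "lexp G (u *\<^sub>R C) = inv (lexp G (u *\<^sub>R (- C)))" using lexp_inv[of u "- C"] by simp
    ultimately show ?thesis using f g by (simp add: equivariant_def)
  qed
  moreover have "((\<lambda>u. \<Lambda> (lexp G (u *\<^sub>R (- C))) * f g) has_vector_derivative ?c * f g) (at 0)"
    by (rule bounded_linear.has_vector_derivative[OF bounded_linear_mult_left \<Lambda>_deriv[OF lie_subalgebra_T_neg[OF C]]])
  ultimately have "((\<lambda>u. f (g \<otimes> lexp G (u *\<^sub>R C))) has_vector_derivative ?c * f g) (at 0)" by simp
  from vector_derivative_unique_at[OF lexp_gderiv[OF L g] this] show ?thesis
    by (simp add: blinfun.minus_right)
qed

text \<open>Since \<open>sharp\<close> divides by the fibre coordinate, along the curve that
  represents the tangent vector it is \<open>f (g exp (u B)) exp (- u x) / z\<close>.\<close>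

lemma tangent_deriv_sec:
  assumes f: "equivariant f" and L: "gderiv f g L" and g: "g \<in> carrier G" and z: "z \<noteq> 0"
  shows "tangent_deriv G \<eta> \<Lambda> (sharp G \<eta> (sec f)) g z B x = (L B - x * f g) / z"
proof -
  have eq: "sharp G \<eta> (sec f) (cls G \<eta> \<Lambda> (g \<otimes> lexp G (u *\<^sub>R B)) (z * exp (of_real u * x))) =
      f (g \<otimes> lexp G (u *\<^sub>R B)) * exp (of_real u * (- x)) / z" for u
    using sharp_sec[OF f, of "g \<otimes> lexp G (u *\<^sub>R B)" "z * exp (of_real u * x)"] g z lexp_carrier
    by (simp add: exp_minus divide_inverse mult_ac)
  have "((\<lambda>u. exp (of_real u * (- x))) has_vector_derivative (- x)) (at 0)"
    using exp_has_vector_derivative_of_real[of "- x" 0] by simp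
  from has_vector_derivative_mult[OF lexp_gderiv[OF L g] this]
  have "((\<lambda>u. f (g \<otimes> lexp G (u *\<^sub>R B)) * exp (of_real u * (- x))) has_vector_derivative (L B - x * f g)) (at 0)"
    using g by (simp add: lexp_zero algebra_simps)
  from bounded_linear.has_vector_derivative[OF bounded_linear_divide this]
  show ?thesis unfolding tangent_deriv_def eq by (rule vector_derivative_at)
qed

lemma conn_form_zero_iff:
  "conn_form \<eta> B x = 0 \<longleftrightarrow> x = - (2 * of_real pi * \<i> * of_real (blinfun_apply \<eta> B))"
proof -
  have nz: "2 * of_real pi * \<i> \<noteq> (0::complex)" by simp
  have "conn_form \<eta> B x = 0 \<longleftrightarrow> (2 * of_real pi * \<i>) * conn_form \<eta> B x = 0" by simp
  also have "(2 * of_real pi * \<i>) * conn_form \<eta> B x = 2 * of_real pi * \<i> * of_real (blinfun_apply \<eta> B) + x"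
    using nz unfolding conn_form_def distrib_left by (simp only: mult.assoc[symmetric] right_inverse[OF nz] mult_1_left)
  finally show ?thesis by (simp add: eq_neg_iff_add_eq_0 add.commute)
qed

text \<open>A horizontal lift has many representatives \<open>(k, w, B, x)\<close>, and the
  \<open>THE\<close> demands that all give one value. Two choices of \<open>B\<close> over the same
  \<open>k\<close> differ by an element of the Lie algebra of \<open>T\<close>, whose contribution
  to \<open>L B\<close> cancels against the change of \<open>x\<close> forced by
  \<open>conn_form\<close>. Moving \<open>k\<close> along the fibre multiplies both the numerator
  and \<open>w\<close> by \<open>\<Lambda> b\<close>.\<close>

lemma lift_deriv_sec:
  assumes f: "equivariant f" "gdiff f" and g: "g \<in> carrier G" and z: "z \<noteq> 0"
  shows "lift_deriv G \<eta> \<Lambda> (fund_field G A) (sharp G \<eta> (sec f)) (cls G \<eta> \<Lambda> g z) =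
    (rderiv A f g + 2 * of_real pi * \<i> * of_real (blinfun_apply (coad G g \<eta>) A) * f g) / z"
    (is "_ = ?d")
  unfolding lift_deriv_def
proof (rule the_equality)
  have all: "tangent_deriv G \<eta> \<Lambda> (sharp G \<eta> (sec f)) k w B x = ?d"
    if k: "k \<in> carrier G" and eq: "cls G \<eta> \<Lambda> g z = cls G \<eta> \<Lambda> k w" and x: "conn_form \<eta> B x = 0"
      and B: "orbit_velocity G \<eta> k B = fund_field G A (coad G k \<eta>)" for k w B x
  proof -
    obtain L where L: "gderiv f k L" using f(2) k by (auto simp: gdiff_def)
    interpret L: bounded_linear L by (rule gderiv_linear[OF L])
    obtain b where b: "b \<in> T" "k = g \<otimes> inv b" "w = \<Lambda> b * z"
      using mem_cls_same[OF k, of w w] unfolding eq[symmetric] mem_cls[OF g] by auto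
    have w: "w \<noteq> 0" using b \<Lambda>_nonzero z by simp
    \<comment> \<open>\<open>Ad (k^-1) A\<close> is one solution of the velocity condition, so
      \<open>C\<close> measures the ambiguity. Equality of the velocities says that
      \<open>\<eta>\<close> vanishes on brackets with \<open>C\<close>.\<close>
    define C where "C = B - Ad G (inv k) A"
    have "blinfun_apply \<eta> (bracket G C X) = 0" for X
    proof -
      have "blinfun_apply (coad_field (Ad G k B) (coad G k \<eta>)) (Ad G k X) = blinfun_apply (coad_field A (coad G k \<eta>)) (Ad G k X)"
        using B by (simp only: orbit_velocity_eq[OF k] fund_field_eq)
      then have "blinfun_apply \<eta> (bracket G B X) = blinfun_apply \<eta> (bracket G (Ad G (inv k) A) X)"
        using k by (simp add: coad_field_apply coad_apply Ad_bracket Ad_inv)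
      then show ?thesis
        using linear_diff[OF bounded_linear.linear[OF bracket_linear_left]] by (simp add: C_def blinfun.diff_right)
    qed
    then have C: "C \<in> lie_subalgebra G T" by (rule lie_subalgebra_isotropyI)
    have "L B = L (Ad G (inv k) A) + L C" using L.add[of "Ad G (inv k) A" C] by (simp add: C_def)
    also have "\<dots> = rderiv A f k - 2 * of_real pi * \<i> * of_real (blinfun_apply \<eta> C) * f k"
      using gderiv_isotropy[OF f(1) L k C] rderiv_gderiv(2)[OF L k] by simp
    finally have "L B - x * f k = rderiv A f k + 2 * of_real pi * \<i> * of_real (blinfun_apply \<eta> (Ad G (inv k) A)) * f k"
      using x unfolding conn_form_zero_iff by (simp add: C_def blinfun.diff_right algebra_simps)
    moreover have "blinfun_apply \<eta> (Ad G (inv k) A) = blinfun_apply (coad G g \<eta>) A"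
      using coad_apply[OF k, of \<eta> A] coad_shift[OF g b(1)] b(2) by simp
    moreover have "rderiv A f k = \<Lambda> b * rderiv A f g" "f k = \<Lambda> b * f g"
      using rderiv_shift[OF f g b(1)] f(1) g b(1,2) by (auto simp: equivariant_def)
    ultimately have "L B - x * f k = \<Lambda> b * (rderiv A f g + 2 * of_real pi * \<i> * of_real (blinfun_apply (coad G g \<eta>) A) * f g)"
      by (simp add: algebra_simps)
    then show ?thesis
      unfolding tangent_deriv_sec[OF f(1) L k w] using \<Lambda>_nonzero[OF b(1)] by (simp add: b(3))
  qed
  then show "\<forall>k w B x. k \<in> carrier G \<and> cls G \<eta> \<Lambda> g z = cls G \<eta> \<Lambda> k w \<and> conn_form \<eta> B x = 0 \<and>
     orbit_velocity G \<eta> k B = fund_field G A (coad G k \<eta>) \<longrightarrow> ?d = tangent_deriv G \<eta> \<Lambda> (sharp G \<eta> (sec f)) k w B x"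
    by metis
  fix d assume d: "\<forall>k w B x. k \<in> carrier G \<and> cls G \<eta> \<Lambda> g z = cls G \<eta> \<Lambda> k w \<and> conn_form \<eta> B x = 0 \<and>
     orbit_velocity G \<eta> k B = fund_field G A (coad G k \<eta>) \<longrightarrow> d = tangent_deriv G \<eta> \<Lambda> (sharp G \<eta> (sec f)) k w B x"
  \<comment> \<open>Uniqueness of \<open>d\<close> needs at least one horizontal representative;
    this is it.\<close>
  define B where "B = Ad G (inv g) A"
  define x where "x = - (2 * of_real pi * \<i> * of_real (blinfun_apply \<eta> B))"
  have x: "conn_form \<eta> B x = 0" unfolding conn_form_zero_iff x_def ..
  have B: "orbit_velocity G \<eta> g B = fund_field G A (coad G g \<eta>)"
    using g by (simp add: orbit_velocity_eq fund_field_eq B_def Ad_inv)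
  from d g x B have "d = tangent_deriv G \<eta> \<Lambda> (sharp G \<eta> (sec f)) g z B x" by blast
  then show "d = ?d" using all[OF g refl x B] by simp
qed

text \<open>The \<open>THE\<close> in \<open>cov_deriv\<close> is resolved by evaluating
  \<open>sharp\<close> at \<open>[g, 1]\<close>, which recovers the equivariant function of a
  candidate section.\<close>

lemma cov_deriv_sec:
  fixes A :: 'e
  assumes f: "equivariant f" "gdiff f"
  defines "f' \<equiv> \<lambda>g. rderiv A f g + 2 * of_real pi * \<i> * of_real (blinfun_apply (coad G g \<eta>) A) * f g"
  shows "equivariant f'" "cov_deriv G \<eta> \<Lambda> (fund_field G A) (sec f) = sec f'"
proof -
  show e: "equivariant f'"
    unfolding equivariant_def f'_def
  proof (intro ballI)
    fix g b assume g: "g \<in> carrier G" and b: "b \<in> T"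
    have "f (g \<otimes> inv b) = \<Lambda> b * f g" using f(1) g b by (simp add: equivariant_def)
    then show "rderiv A f (g \<otimes> inv b) + 2 * of_real pi * \<i> * of_real (blinfun_apply (coad G (g \<otimes> inv b) \<eta>) A) * f (g \<otimes> inv b) =
      \<Lambda> b * (rderiv A f g + 2 * of_real pi * \<i> * of_real (blinfun_apply (coad G g \<eta>) A) * f g)"
      by (simp add: rderiv_shift[OF f g b] coad_shift[OF g b] algebra_simps)
  qed
  show "cov_deriv G \<eta> \<Lambda> (fund_field G A) (sec f) = sec f'"
    unfolding cov_deriv_def
  proof (rule the_equality)
    show "bsection G \<eta> \<Lambda> (sec f') \<and> (\<forall>y\<in>line_bundle_nz G \<eta> \<Lambda>.
        sharp G \<eta> (sec f') y = lift_deriv G \<eta> \<Lambda> (fund_field G A) (sharp G \<eta> (sec f)) y)"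
    proof (intro conjI ballI)
      show "bsection G \<eta> \<Lambda> (sec f')" by (rule sec_bsection[OF e])
      fix y assume "y \<in> line_bundle_nz G \<eta> \<Lambda>"
      then obtain g z where y: "g \<in> carrier G" "z \<noteq> 0" "y = cls G \<eta> \<Lambda> g z" by (auto simp: line_bundle_nz_def)
      show "sharp G \<eta> (sec f') y = lift_deriv G \<eta> \<Lambda> (fund_field G A) (sharp G \<eta> (sec f)) y"
        unfolding y(3) sharp_sec[OF e y(1,2)] lift_deriv_sec[OF f y(1,2)] by (simp only: f'_def)
    qed
    fix \<tau> assume \<tau>: "bsection G \<eta> \<Lambda> \<tau> \<and> (\<forall>y\<in>line_bundle_nz G \<eta> \<Lambda>.
        sharp G \<eta> \<tau> y = lift_deriv G \<eta> \<Lambda> (fund_field G A) (sharp G \<eta> (sec f)) y)"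
    obtain k where k: "equivariant k" "\<tau> = sec k" using bsection_sec \<tau> by blast
    have "k g = f' g" if g: "g \<in> carrier G" for g
    proof -
      have "cls G \<eta> \<Lambda> g 1 \<in> line_bundle_nz G \<eta> \<Lambda>" using g unfolding line_bundle_nz_def by force
      then have "sharp G \<eta> (sec k) (cls G \<eta> \<Lambda> g 1) = lift_deriv G \<eta> \<Lambda> (fund_field G A) (sharp G \<eta> (sec f)) (cls G \<eta> \<Lambda> g 1)"
        using \<tau> k(2) by blast
      then show ?thesis unfolding sharp_sec[OF k(1) g one_neq_zero] lift_deriv_sec[OF f g one_neq_zero] by (simp add: f'_def)
    qed
    then show "\<tau> = sec f'" unfolding k(2) by (rule sec_cong[OF k(1) e])
  qed
qed

text \<open>The horizontal lift of \<open>X\<^sub>A\<close> at \<open>[g, z]\<close> contributes the term \<open>2 \<pi> \<i> h\<^sub>A\<close>, which cancels the potential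
  term of \<open>\<P>\<^sub>A\<close>.\<close>

lemma quantum_op_sec:
  assumes f: "equivariant f" "gdiff f" and g: "g \<in> carrier G"
  shows "fibre_coord g (quantum_op G \<eta> \<Lambda> A (sec f) (coad G g \<eta>)) = - rderiv A f g"
  using orbitI[OF g] cov_deriv_sec[OF f, of A]
  by (simp add: quantum_op_def sec_apply f(1) g fscale_cls fadd_cls fibre_coord_cls)

end

context lie_grp
begin

section \<open>Tori: commutativity and exponentials\<close>

lemma torus_commute:
  assumes T: "torus G T" and "a \<in> T" "b \<in> T"
  shows "a \<otimes> b = b \<otimes> a"
proof -
  obtain k :: nat and f where f: "f \<in> iso (product_group {..<k} (\<lambda>_. circle_group)) (G\<lparr>carrier := T\<rparr>)"
    using T unfolding torus_def by blast
  let ?P = "product_group {..<k} (\<lambda>_. circle_group)"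
  have bij: "f ` carrier ?P = T" and hom: "f \<in> hom ?P (G\<lparr>carrier := T\<rparr>)"
    using f by (auto simp: iso_def bij_betw_def)
  obtain x y where x: "x \<in> carrier ?P" "a = f x" and y: "y \<in> carrier ?P" "b = f y"
    using assms(2,3) bij by blast
  have "x \<otimes>\<^bsub>?P\<^esub> y = y \<otimes>\<^bsub>?P\<^esub> x" by (simp add: circle_group_def mult.commute)
  then show ?thesis using hom_mult[OF hom x(1) y(1)] hom_mult[OF hom y(1) x(1)] x(2) y(2) by simp
qed

text \<open>A point of a product of circles lies on the one-parameter subgroup that scales its
  arguments. Pushed forward by the homeomorphic isomorphism this is a continuous one-parameter
  subgroup of \<open>G\<close>, hence an exponential.\<close>

lemma torus_lexp:
  assumes T: "torus G T" and b: "b \<in> T"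
  obtains C where "\<And>u. lexp G (u *\<^sub>R C) \<in> T" "lexp G C = b"
proof -
  obtain k :: nat and f where f: "f \<in> iso (product_group {..<k} (\<lambda>_. circle_group)) (G\<lparr>carrier := T\<rparr>)"
    and hm: "homeomorphic_map (product_topology (\<lambda>_. top_of_set (sphere 0 1)) {..<k}) (subtopology (lie_topology G) T) f"
    using T unfolding torus_def by blast
  let ?P = "product_group {..<k} (\<lambda>_. circle_group)"
  have bij: "f ` carrier ?P = T" and hom: "f \<in> hom ?P (G\<lparr>carrier := T\<rparr>)"
    using f by (auto simp: iso_def bij_betw_def)
  obtain x where x: "x \<in> carrier ?P" "b = f x" using b bij by blast
  \<comment> \<open>Each coordinate runs from 1 at \<open>s = 0\<close> to \<open>x j\<close> at
    \<open>s = 1\<close>; the restriction to \<open>{..<k}\<close> matches the extensional carrier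
    of the product.\<close>
  define w where "w s = (\<lambda>j\<in>{..<k}. cis (s * Arg (x j)))" for s :: real
  have wP: "w s \<in> carrier ?P" for s
    by (auto simp: w_def circle_group_def PiE_iff)
  have xs: "x \<in> PiE {..<k} (\<lambda>_. sphere 0 1)" using x(1) by (simp add: circle_group_def)
  have "w 1 = x"
  proof
    fix j
    show "w 1 j = x j"
    proof (cases "j < k")
      case True
      then have n: "norm (x j) = 1" using xs by (auto simp: PiE_iff)
      then have "x j \<noteq> 0" by auto
      then have "cis (Arg (x j)) = sgn (x j)" by (rule cis_Arg)
      then show ?thesis using True n by (simp add: w_def sgn_div_norm)
    next
      case False
      then show ?thesis using xs by (simp add: w_def PiE_iff extensional_def)
    qed
  qed
  have whom: "w (s + t) = w s \<otimes>\<^bsub>?P\<^esub> w t" for s t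
    by (auto simp: w_def circle_group_def fun_eq_iff cis_mult distrib_right)
  have "continuous_map euclideanreal (product_topology (\<lambda>_. top_of_set (sphere 0 1)) {..<k}) w"
    unfolding continuous_map_componentwise
  proof (intro conjI ballI)
    show "w ` topspace euclideanreal \<subseteq> extensional {..<k}" by (auto simp: w_def)
    fix j assume "j \<in> {..<k}"
    then show "continuous_map euclideanreal (top_of_set (sphere 0 1)) (\<lambda>s. w s j)"
      by (auto simp: w_def continuous_map_in_subtopology intro!: continuous_intros)
  qed
  from continuous_map_compose[OF this homeomorphic_imp_continuous_map[OF hm]]
  have cont: "continuous_map euclideanreal (lie_topology G) (\<lambda>s. f (w s))"
    by (simp add: continuous_map_in_subtopology o_def)
  have "f (w (s + t)) = f (w s) \<otimes> f (w t)" for s t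
    using hom_mult[OF hom wP wP] by (simp add: whom)
  from continuous_one_parameter[OF cont this] obtain C where C: "\<And>s. f (w s) = lexp G (s *\<^sub>R C)" by blast
  show thesis
  proof (rule that[of C])
    show "lexp G (u *\<^sub>R C) \<in> T" for u using bij wP[of u] by (auto simp: C[symmetric])
    show "lexp G C = b" using C[of 1] x(2) \<open>w 1 = x\<close> by simp
  qed
qed

end

section \<open>Evolution of sections\<close>

text \<open>\<open>v\<close> takes the part of the highest weight vector: the Lie algebra of the
  torus acts on it by the negative of the derivative of \<open>\<Lambda>\<close>. The index
  \<open>i\<close> marks a nonzero coordinate, so that the matrix coefficient \<open>wfun\<close>
  does not vanish at the identity.\<close>

locale weighted_rep = prequantum G \<eta> \<Lambda>
  for G :: "('g, 'e::banach) lie_group_data" (structure) and \<eta> :: "'e \<Rightarrow>\<^sub>L real" and \<Lambda> :: "'g \<Rightarrow> complex" +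
  fixes \<pi> :: "'g \<Rightarrow> complex^'n^'n" and v :: "complex^'n" and i :: 'n
  assumes rep: "representation G \<pi>" and vi: "v $ i \<noteq> 0" and T: "torus G (isotropy G \<eta>)"
    and weight: "\<And>C. C \<in> lie_subalgebra G (isotropy G \<eta>) \<Longrightarrow>
      rep_deriv G \<pi> C *v v = - (2 * of_real pi * \<i> * of_real (blinfun_apply \<eta> C)) *s v"
begin

text \<open>With \<open>a\<close> the derivative of the character at \<open>C\<close>, the function
  \<open>u \<mapsto> \<Lambda> (exp (u C)) exp (- u a)\<close> has derivative 0.\<close>

lemma \<Lambda>_lexp:
  assumes C: "C \<in> lie_subalgebra G T"
  shows "\<Lambda> (lexp G C) = exp (2 * of_real pi * \<i> * of_real (blinfun_apply \<eta> C))"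
proof -
  let ?a = "2 * of_real pi * \<i> * of_real (blinfun_apply \<eta> C)"
  have CT: "lexp G (u *\<^sub>R C) \<in> T" for u using C by (simp add: lie_subalgebra_def)
  have d: "((\<lambda>u. \<Lambda> (lexp G (u *\<^sub>R C))) has_vector_derivative \<Lambda> (lexp G (t *\<^sub>R C)) * ?a) (at t)" for t
  proof -
    have sh: "((\<lambda>u. u - t) has_vector_derivative 1) (at t)" by (auto intro!: derivative_eq_intros)
    have "((\<lambda>u. \<Lambda> (lexp G (u *\<^sub>R C))) has_vector_derivative ?a) (at (t - t))" using \<Lambda>_deriv[OF C] by simp
    from vector_diff_chain_at[OF sh this]
    have "((\<lambda>u. \<Lambda> (lexp G ((u - t) *\<^sub>R C))) has_vector_derivative ?a) (at t)" by (simp add: o_def)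
    from bounded_linear.has_vector_derivative[OF bounded_linear_mult_right this]
    have "((\<lambda>u. \<Lambda> (lexp G (t *\<^sub>R C)) * \<Lambda> (lexp G ((u - t) *\<^sub>R C))) has_vector_derivative \<Lambda> (lexp G (t *\<^sub>R C)) * ?a) (at t)" .
    moreover have "\<Lambda> (lexp G (t *\<^sub>R C)) * \<Lambda> (lexp G ((u - t) *\<^sub>R C)) = \<Lambda> (lexp G (u *\<^sub>R C))" for u
      using lexp_add[of t "u - t" C] \<Lambda>_mult[OF CT CT] by simp
    ultimately show ?thesis by simp
  qed
  have "((\<lambda>u. \<Lambda> (lexp G (u *\<^sub>R C)) * exp (of_real u * (- ?a))) has_vector_derivative 0) (at t within UNIV)" for t
    using has_vector_derivative_mult[OF d[of t] exp_has_vector_derivative_of_real[of "- ?a" t]] by simp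
  then obtain k where k: "\<And>u. \<Lambda> (lexp G (u *\<^sub>R C)) * exp (of_real u * (- ?a)) = k"
    by (rule has_vector_derivative_zero_constant[OF convex_UNIV]) (auto intro: that)
  have "k = 1" using k[of 0] by (simp add: lexp_zero \<Lambda>_one)
  then have "\<Lambda> (lexp G C) * exp (- ?a) = 1" using k[of 1] by simp
  then show ?thesis by (simp add: exp_minus field_simps)
qed

text \<open>The curve \<open>u \<mapsto> \<pi> (exp (u C)) v\<close> solves the linear equation
  \<open>w' = - a w\<close>, which is integrated in each coordinate.\<close>

lemma rep_lexp_weight:
  assumes C: "C \<in> lie_subalgebra G T"
  shows "\<pi> (lexp G C) *v v = exp (- (2 * of_real pi * \<i> * of_real (blinfun_apply \<eta> C))) *s v"
proof -
  let ?a = "2 * of_real pi * \<i> * of_real (blinfun_apply \<eta> C)"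
  let ?w = "\<lambda>u. \<pi> (lexp G (u *\<^sub>R C)) *v v"
  have "(?w has_vector_derivative (\<pi> (lexp G (t *\<^sub>R C)) ** rep_deriv G \<pi> C) *v v) (at t)" for t
    by (rule bounded_linear.has_vector_derivative[OF
        bounded_bilinear.bounded_linear_left[OF bounded_bilinear_matrix_vector_mult] rep_lexp_deriv_at[OF rep]])
  moreover have "(\<pi> (lexp G (t *\<^sub>R C)) ** rep_deriv G \<pi> C) *v v = (- ?a) *s ?w t" for t
    by (simp only: matrix_vector_mul_assoc[symmetric] weight[OF C] vector_scalar_commute)
  ultimately have d: "(?w has_vector_derivative (- ?a) *s ?w t) (at t)" for t by simp
  have dj: "((\<lambda>u. ?w u $ j) has_vector_derivative (- ?a) * ?w t $ j) (at t)" for t j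
    using bounded_linear.has_vector_derivative[OF bounded_linear_vec_nth d[of t], of j] by simp
  have "(\<pi> (lexp G C) *v v) $ j = (exp (- ?a) *s v) $ j" for j
  proof -
    have "((\<lambda>u. ?w u $ j * exp (of_real u * ?a)) has_vector_derivative 0) (at t within UNIV)" for t
      using has_vector_derivative_mult[OF dj[of j t] exp_has_vector_derivative_of_real[of ?a t]]
      by (simp add: algebra_simps)
    then obtain k where k: "\<And>u. ?w u $ j * exp (of_real u * ?a) = k"
      by (rule has_vector_derivative_zero_constant[OF convex_UNIV]) (auto intro: that)
    have "k = v $ j" using k[of 0] by (simp add: lexp_zero rep_one[OF rep])
    then have "?w 1 $ j * exp ?a = v $ j" using k[of 1] by simp
    then show ?thesis by (simp add: exp_minus field_simps)
  qed
  then show ?thesis by (simp add: vec_eq_iff)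
qed

text \<open>Every element of the torus is an exponential, so the two integrated formulas can be
  compared.\<close>

lemma rep_T:
  assumes b: "b \<in> T"
  shows "\<pi> b *v v = inverse (\<Lambda> b) *s v"
proof -
  obtain C where C: "\<And>u. lexp G (u *\<^sub>R C) \<in> T" "lexp G C = b" by (rule torus_lexp[OF T b]) (rule that)
  have "C \<in> lie_subalgebra G T" using C(1) by (simp add: lie_subalgebra_def)
  from \<Lambda>_lexp[OF this] rep_lexp_weight[OF this] show ?thesis by (simp add: C(2) exp_minus)
qed

text \<open>The section given by this matrix coefficient of the highest weight vector is nonzero, which makes the
  constant \<open>\<kappa>(\<psi>)\<close> unique.\<close>

definition wfun :: "'g \<Rightarrow> complex" where
  "wfun g = (\<pi> g *v v) $ i"

lemma wfun_equivariant: "equivariant wfun"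
  unfolding equivariant_def
proof (intro ballI)
  fix g b assume g: "g \<in> carrier G" and b: "b \<in> T"
  have "\<pi> (g \<otimes> inv b) *v v = \<pi> g *v (\<pi> (inv b) *v v)"
    using g T_carrier[OF b] by (simp add: rep_mult[OF rep] matrix_vector_mul_assoc)
  also have "\<dots> = \<Lambda> b *s (\<pi> g *v v)"
    by (simp add: rep_T[OF T_inv[OF b]] \<Lambda>_inv[OF b] vector_scalar_commute)
  finally show "wfun (g \<otimes> inv b) = \<Lambda> b * wfun g" by (simp add: wfun_def)
qed

lemma wfun_one: "wfun \<one> \<noteq> 0"
  using vi by (simp add: wfun_def rep_one[OF rep])

lemma wfun_smooth: "manifold_smooth_on (charts G) vec_atlas (carrier G) wfun"
proof -
  have "bounded_linear (\<lambda>M :: complex^'n^'n. (M *v v) $ i)"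
    by (rule bounded_linear_compose[OF bounded_linear_vec_nth
        bounded_bilinear.bounded_linear_left[OF bounded_bilinear_matrix_vector_mult]])
  from manifold_smooth_on_compose[OF rep_smooth[OF rep] manifold_smooth_on_vecI[OF open_UNIV smooth_on_linear[OF open_UNIV this]]
      subset_UNIV atl smooth_atlas_vec fd findim_euclidean]
  show ?thesis by (simp add: wfun_def[abs_def])
qed

lemma wfun_gderiv:
  assumes "g \<in> carrier G" obtains L where "gderiv wfun g L"
  by (rule smooth_gderiv[OF wfun_smooth assms findim_euclidean]) (rule that)

text \<open>\<open>g \<mapsto> (g, wfun g)\<close> is a global smooth lift of the section.\<close>

lemma sec_wfun_smooth: "smooth_section G \<eta> \<Lambda> (sec wfun)"
  unfolding smooth_section_def smooth_into_bundle_def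
proof (intro conjI ballI)
  show "bsection G \<eta> \<Lambda> (sec wfun)" by (rule sec_bsection[OF wfun_equivariant])
  fix x assume x: "x \<in> carrier G"
  have "openin (lie_topology G) (carrier G)"
    using openin_topspace[of "lie_topology G"] topspace_manifold_topology[OF atl] by simp
  moreover have "manifold_smooth_on (charts G) (prod_atlas (charts G) vec_atlas) (carrier G) (\<lambda>g. (g, wfun g))"
    by (rule manifold_smooth_on_Pair[OF manifold_smooth_on_ident[OF atl subset_refl] wfun_smooth atl smooth_atlas_vec
        fd findim_euclidean])
  ultimately show "\<exists>W F. openin (lie_topology G) W \<and> x \<in> W \<and>
        manifold_smooth_on (charts G) (prod_atlas (charts G) vec_atlas) (W \<inter> carrier G) F \<and>
        (\<forall>y\<in>W \<inter> carrier G. sec wfun (coad G y \<eta>) = cls G \<eta> \<Lambda> (fst (F y)) (snd (F y)))"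
    using x by (intro exI[of _ "carrier G"] exI[of _ "\<lambda>g. (g, wfun g)"]) (simp add: sec_apply[OF wfun_equivariant])
qed

section \<open>The evolution of the test section\<close>

context
  fixes A :: "real \<Rightarrow> 'e" and h :: "real \<Rightarrow> 'g"
  assumes h: "group_evolution G A h"
begin

lemma h_smooth: "manifold_smooth_on vec_atlas (charts G) {0..1} h" and h_zero: "h 0 = \<one>"
  using h by (auto simp: group_evolution_def)

lemma h_carrier: "t \<in> {0..1} \<Longrightarrow> h t \<in> carrier G"
  using smooth_on_carrier[OF h_smooth] .

text \<open>To be recognised as the evolution of \<open>sec wfun\<close>: \<open>kappa\<close>
  quantifies over evolutions, so one that starts at a nonzero section has to be exhibited.\<close>

definition wflow :: "real \<Rightarrow> 'g \<Rightarrow> complex" where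
  "wflow t g = wfun (inv (h t) \<otimes> g)"

lemma wflow_equivariant:
  assumes t: "t \<in> {0..1}" shows "equivariant (wflow t)"
  unfolding equivariant_def
proof (intro ballI)
  fix g b assume "g \<in> carrier G" "b \<in> T"
  then show "wflow t (g \<otimes> inv b) = \<Lambda> b * wflow t g"
    using wfun_equivariant h_carrier[OF t] T_carrier[of b]
    by (simp add: equivariant_def wflow_def m_assoc[symmetric])
qed

lemma wflow_gderiv:
  assumes t: "t \<in> {0..1}" and g: "g \<in> carrier G" and L: "gderiv wfun (inv (h t) \<otimes> g) L"
  shows "gderiv (wflow t) g L"
  using L unfolding gderiv_def
  by (rule has_derivative_transform_within_open[OF _ open_\<Omega> e0_\<Omega>])
    (simp add: wflow_def pt_carrier g h_carrier[OF t] m_assoc)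

text \<open>The velocity of \<open>s \<mapsto> inv (h s) \<otimes> g\<close> at \<open>t\<close> is
  \<open>- Ad (g^-1) (A t)\<close>, to which the differential of \<open>wfun\<close> assigns minus
  the right-invariant derivative of \<open>wflow t\<close>.\<close>

lemma sec_wflow_evolution: "quantum_evolution G \<eta> \<Lambda> A (\<lambda>t. sec (wflow t))"
  unfolding quantum_evolution_def smooth_section_curve_def
proof (intro conjI ballI)
  show "bsection G \<eta> \<Lambda> (sec (wflow t))" if "t \<in> {0..1}" for t
    by (rule sec_bsection[OF wflow_equivariant[OF that]])
  let ?A = "prod_atlas (charts G) vec_atlas :: ('g \<times> real, 'e \<times> real) atlas"
  let ?S = "carrier G \<times> {0..1::real}"
  have at: "smooth_atlas (carrier G \<times> UNIV) ?A" by (rule smooth_atlas_prod[OF atl smooth_atlas_vec fd findim_euclidean])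
  have fdp: "findim TYPE('e \<times> real)" by (rule findim_prod[OF fd findim_euclidean])
  have sub: "?S \<subseteq> carrier G \<times> UNIV" by auto
  have 1: "manifold_smooth_on ?A (charts G) ?S fst" by (rule manifold_smooth_on_fst[OF atl smooth_atlas_vec sub])
  have 2: "manifold_smooth_on ?A (charts G) ?S (\<lambda>z. h (snd z))"
    by (rule manifold_smooth_on_compose[OF manifold_smooth_on_snd[OF atl smooth_atlas_vec sub] h_smooth _ at
        smooth_atlas_vec fdp findim_euclidean]) auto
  have 3: "manifold_smooth_on ?A (charts G) ?S (\<lambda>z. inv (h (snd z)) \<otimes> fst z)"
    by (rule smooth_mult'[OF at fdp smooth_inv'[OF at fdp 2] 1])
  have 4: "manifold_smooth_on ?A vec_atlas ?S (\<lambda>z. wflow (snd z) (fst z))"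
    unfolding wflow_def
    by (rule manifold_smooth_on_compose[OF 3 wfun_smooth _ at atl fdp fd]) (use smooth_on_carrier[OF 3] in auto)
  have 5: "manifold_smooth_on ?A (prod_atlas (charts G) vec_atlas) ?S (\<lambda>z. (fst z, wflow (snd z) (fst z)))"
    by (rule manifold_smooth_on_Pair[OF 1 4 at smooth_atlas_vec fdp findim_euclidean])
  have 6: "openin (manifold_topology ?A) (carrier G \<times> UNIV)"
    using openin_topspace[of "manifold_topology ?A"] topspace_manifold_topology[OF at] by simp
  show "smooth_into_bundle G \<eta> \<Lambda> ?A ?S (\<lambda>(g, t). sec (wflow t) (coad G g \<eta>))"
    unfolding smooth_into_bundle_def
  proof
    fix x assume x: "x \<in> ?S"
    have eq: "(carrier G \<times> UNIV) \<inter> ?S = ?S" by auto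
    have "(\<lambda>(g, t). sec (wflow t) (coad G g \<eta>)) y = cls G \<eta> \<Lambda> (fst y) (wflow (snd y) (fst y))" if "y \<in> ?S" for y
      using that sec_apply[OF wflow_equivariant] by (auto simp: case_prod_unfold)
    then show "\<exists>W F. openin (manifold_topology ?A) W \<and> x \<in> W \<and>
        manifold_smooth_on ?A (prod_atlas (charts G) vec_atlas) (W \<inter> ?S) F \<and>
        (\<forall>y\<in>W \<inter> ?S. (\<lambda>(g, t). sec (wflow t) (coad G g \<eta>)) y = cls G \<eta> \<Lambda> (fst (F y)) (snd (F y)))"
      using x 5 6
      by (intro exI[of _ "carrier G \<times> UNIV"] exI[of _ "\<lambda>z. (fst z, wflow (snd z) (fst z))"]) (simp only: eq, auto)
  qed
  fix t g assume t: "t \<in> {0..1::real}" and g: "g \<in> carrier G"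
  have ht: "h t \<in> carrier G" by (rule h_carrier[OF t])
  have k: "inv (h t) \<otimes> g \<in> carrier G" using ht g by simp
  obtain L where L: "gderiv wfun (inv (h t) \<otimes> g) L" by (rule wfun_gderiv[OF k]) (rule that)
  note L' = wflow_gderiv[OF t g L]
  interpret L: bounded_linear L by (rule gderiv_linear[OF L])
  have gd: "gdiff (wflow t)"
    unfolding gdiff_def
  proof
    fix g assume g: "g \<in> carrier G"
    then have "inv (h t) \<otimes> g \<in> carrier G" using ht by simp
    from wfun_gderiv[OF this] wflow_gderiv[OF t g] show "\<exists>L. gderiv (wflow t) g L" by metis
  qed
  have "lvel (\<lambda>s. inv (h s)) (- A t) t {0..1}"
    using lvel_inv[OF group_evolution_lvel[OF h t] t] ht by (simp add: Ad_inv)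
  from lvel_mult[OF this lvel_const[OF g] t]
  have "lvel (\<lambda>s. inv (h s) \<otimes> g) (- Ad G (inv g) (A t)) t {0..1}" using g by (simp add: Ad_linear)
  from lvel_gderiv[OF this L t]
  have "((\<lambda>s. wflow s g) has_vector_derivative - rderiv (A t) (wflow t) g) (at t within {0..1})"
    using rderiv_gderiv(2)[OF L' g] by (simp add: wflow_def L.neg)
  then have "((\<lambda>s. fibre_coord g (sec (wflow s) (coad G g \<eta>))) has_vector_derivative - rderiv (A t) (wflow t) g) (at t within {0..1})"
    unfolding has_vector_derivative_def
    by (rule has_derivative_transform[OF t, rotated]) (simp add: fibre_coord_sec[OF wflow_equivariant g])
  then show "((\<lambda>s. fibre_coord g (sec (wflow s) (coad G g \<eta>))) has_vector_derivative
           fibre_coord g (quantum_op G \<eta> \<Lambda> (A t) (sec (wflow t)) (coad G g \<eta>))) (at t within {0..1})"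
    by (simp only: quantum_op_sec[OF wflow_equivariant[OF t] gd g])
qed

lemma sec_wflow_zero: "sec (wflow 0) = sec wfun"
  by (rule sec_cong[OF wflow_equivariant wfun_equivariant]) (simp_all add: wflow_def h_zero)

section \<open>Transport of an arbitrary evolution along \<open>h\<close>\<close>

context
  fixes \<sigma> :: "real \<Rightarrow> ('e \<Rightarrow>\<^sub>L real) \<Rightarrow> ('g \<times> complex) set"
  assumes ev: "quantum_evolution G \<eta> \<Lambda> A \<sigma>"
begin

definition coordf :: "real \<Rightarrow> 'g \<Rightarrow> complex" where
  "coordf t g = fibre_coord g (\<sigma> t (coad G g \<eta>))"

lemma coordf:
  assumes "t \<in> {0..1}"
  shows "equivariant (coordf t)" "\<sigma> t = sec (coordf t)"
proof -
  have b: "bsection G \<eta> \<Lambda> (\<sigma> t)" using ev assms by (auto simp: quantum_evolution_def smooth_section_curve_def)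
  show "equivariant (coordf t)" "\<sigma> t = sec (coordf t)"
    using bsection_sec[OF b] by (simp_all add: coordf_def[abs_def])
qed

text \<open>Locally \<open>\<sigma>\<^sub>t (g \<cdot> \<eta>) = [k, z]\<close> with \<open>k \<in> G\<close> and \<open>z\<close> depending smoothly on \<open>(g, t)\<close>; the fibre coordinate is
  \<open>\<Lambda> (g\<^sup>-\<^sup>1 k) z\<close>, and on \<open>G\<^sub>\<eta>\<close> the character is the restriction of a smooth function on \<open>G\<close>.\<close>

lemma coordf_differentiable:
  assumes g: "g \<in> carrier G" and t: "t \<in> {0..1}"
  obtains D where "((\<lambda>y. coordf (snd y) (g \<otimes> \<iota> (fst y))) has_derivative D) (at (e0, t) within UNIV \<times> {0..1})"
proof -
  let ?A = "prod_atlas (charts G) vec_atlas :: ('g \<times> real, 'e \<times> real) atlas"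
  let ?L = "prod_atlas (charts G) vec_atlas :: ('g \<times> complex, 'e \<times> complex) atlas"
  let ?S = "carrier G \<times> {0..1::real}"
  have at: "smooth_atlas (carrier G \<times> UNIV) ?A" by (rule smooth_atlas_prod[OF atl smooth_atlas_vec fd findim_euclidean])
  have atL: "smooth_atlas (carrier G \<times> UNIV) ?L" by (rule smooth_atlas_prod[OF atl smooth_atlas_vec fd findim_euclidean])
  have fdp: "findim TYPE('e \<times> real)" and fdL: "findim TYPE('e \<times> complex)"
    by (rule findim_prod[OF fd findim_euclidean])+
  have into_bundle: "smooth_into_bundle G \<eta> \<Lambda> ?A ?S (\<lambda>(g, t). \<sigma> t (coad G g \<eta>))"
    using ev by (simp add: quantum_evolution_def smooth_section_curve_def)
  have gt: "(g, t) \<in> ?S" using g t by simp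
  obtain W F where W: "openin (manifold_topology ?A) W" "(g, t) \<in> W"
    and F: "manifold_smooth_on ?A ?L (W \<inter> ?S) F"
    and eq0: "\<forall>y\<in>W \<inter> ?S. (\<lambda>(g, t). \<sigma> t (coad G g \<eta>)) y = cls G \<eta> \<Lambda> (fst (F y)) (snd (F y))"
    using bspec[OF into_bundle[unfolded smooth_into_bundle_def] gt] by (elim exE conjE) (rule that)
  have eq: "\<sigma> s (coad G k \<eta>) = cls G \<eta> \<Lambda> (fst (F (k, s))) (snd (F (k, s)))" if "(k, s) \<in> W \<inter> ?S" for k s
    using bspec[OF eq0 that] by simp
  have o: "open (\<Omega> \<times> (UNIV :: real set))" using open_\<Omega> open_Times by blast
  \<comment> \<open>The chart centred at \<open>g\<close>, with time as a further
    coordinate.\<close>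
  define j where "j y = (g \<otimes> \<iota> (fst y), snd y)" for y :: "'e \<times> real"
  have j1: "manifold_smooth_on vec_atlas (charts G) (\<Omega> \<times> (UNIV :: real set)) (\<lambda>y. \<iota> (fst y))"
    by (rule manifold_smooth_on_compose[OF manifold_smooth_on_vecI[OF o smooth_on_linear[OF o bounded_linear_fst]]
        smooth_pt _ smooth_atlas_vec smooth_atlas_vec fdp fd]) auto
  have j: "manifold_smooth_on vec_atlas ?A (\<Omega> \<times> UNIV) j"
    unfolding j_def
    by (rule manifold_smooth_on_Pair[OF smooth_mult_vec[OF fdp smooth_const_vec[OF g] j1]
        manifold_smooth_on_vecI[OF o smooth_on_linear[OF o bounded_linear_snd]] smooth_atlas_vec smooth_atlas_vec fdp findim_euclidean])
  have p: "(e0, t) \<in> \<Omega> \<times> UNIV" "j (e0, t) \<in> W" using e0_\<Omega> W(2) g by (auto simp: j_def pt_e0)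
  obtain M where M: "open M" "(e0, t) \<in> M" "\<And>y. y \<in> M \<Longrightarrow> y \<in> \<Omega> \<times> UNIV \<Longrightarrow> j y \<in> W"
    by (rule manifold_smooth_on_preimage[OF j smooth_atlas_vec at W(1) p, unfolded manifold_topology_vec open_openin[symmetric]])
      (rule that)
  \<comment> \<open>Time is cut to \<open>{0..1}\<close>, where the evolution lives; the derivative
    obtained is accordingly one within \<open>UNIV \<times> {0..1}\<close>.\<close>
  define S' where "S' = M \<inter> (\<Omega> \<times> {0..1})"
  have S': "S' \<subseteq> \<Omega> \<times> UNIV" by (auto simp: S'_def)
  have jW: "j y \<in> W \<inter> ?S" if "y \<in> S'" for y
    using that M(3)[of y] pt_carrier g by (auto simp: S'_def j_def)
  have j': "manifold_smooth_on vec_atlas ?A S' j" by (rule manifold_smooth_on_subset[OF j S'])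
  have Fj: "manifold_smooth_on vec_atlas ?L S' (\<lambda>y. F (j y))"
    by (rule manifold_smooth_on_compose[OF j' F _ smooth_atlas_vec at fdp fdp])
      (rule image_subsetI, erule jW)
  have Fcar: "fst (F (j y)) \<in> carrier G" if "y \<in> S'" for y
    using manifold_smooth_on_mem[OF Fj atL that] by auto
  have F1: "manifold_smooth_on vec_atlas (charts G) S' (\<lambda>y. fst (F (j y)))"
    by (rule manifold_smooth_on_compose[OF Fj manifold_smooth_on_fst[OF atl smooth_atlas_vec subset_refl] _ smooth_atlas_vec atL fdp fdL])
      (rule image_subsetI, erule manifold_smooth_on_mem[OF Fj atL])
  have F2: "manifold_smooth_on vec_atlas vec_atlas S' (\<lambda>y. snd (F (j y)))"
    by (rule manifold_smooth_on_compose[OF Fj manifold_smooth_on_snd[OF atl smooth_atlas_vec subset_refl] _ smooth_atlas_vec atL fdp fdL])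
      (rule image_subsetI, erule manifold_smooth_on_mem[OF Fj atL])
  have J: "manifold_smooth_on vec_atlas (charts G) S' (\<lambda>y. fst (j y))"
    by (rule manifold_smooth_on_compose[OF j' manifold_smooth_on_fst[OF atl smooth_atlas_vec subset_refl] _ smooth_atlas_vec at fdp fdp])
      (rule image_subsetI, erule manifold_smooth_on_mem[OF j' at])
  have P: "manifold_smooth_on vec_atlas (charts G) S' (\<lambda>y. inv (fst (F (j y))) \<otimes> fst (j y))"
    by (rule smooth_mult_vec[OF fdp smooth_inv_vec[OF fdp F1] J])
  have Q: "manifold_smooth_on vec_atlas vec_atlas S' (\<lambda>y. wfun (inv (fst (F (j y))) \<otimes> fst (j y)))"
    by (rule manifold_smooth_on_compose[OF P wfun_smooth _ smooth_atlas_vec atl fdp fd]) (use smooth_on_carrier[OF P] in auto)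
  have QF: "manifold_smooth_on vec_atlas vec_atlas S' (\<lambda>y. (wfun (inv (fst (F (j y))) \<otimes> fst (j y)), snd (F (j y))))"
    using manifold_smooth_on_Pair[OF Q F2 smooth_atlas_vec smooth_atlas_vec fdp findim_euclidean]
    by (simp add: prod_atlas_vec)
  have mult: "smooth_on UNIV (\<lambda>z :: complex \<times> complex. fst z * snd z / v $ i)"
    by (rule smooth_on_linear_compose[OF open_UNIV bounded_linear_divide smooth_on_bilinear[OF open_UNIV bounded_bilinear_mult
          smooth_on_linear[OF open_UNIV bounded_linear_fst] smooth_on_linear[OF open_UNIV bounded_linear_snd]]])
  have R: "manifold_smooth_on vec_atlas vec_atlas S' (\<lambda>y. wfun (inv (fst (F (j y))) \<otimes> fst (j y)) * snd (F (j y)) / v $ i)"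
    using manifold_smooth_on_compose[OF QF manifold_smooth_on_vecI[OF open_UNIV mult] subset_UNIV smooth_atlas_vec
        smooth_atlas_vec fdp findim_euclidean] by simp
  have val: "coordf (snd y) (g \<otimes> \<iota> (fst y)) = wfun (inv (fst (F (j y))) \<otimes> fst (j y)) * snd (F (j y)) / v $ i" if y: "y \<in> S'" for y
  proof -
    let ?k = "fst (j y)" and ?l = "fst (F (j y))" and ?z = "snd (F (j y))"
    have k: "?k \<in> carrier G" and s: "snd y \<in> {0..1}" using jW[OF y] by (auto simp: j_def)
    have "sec (coordf (snd y)) (coad G ?k \<eta>) = cls G \<eta> \<Lambda> ?l ?z"
      using eq[of ?k "snd y"] jW[OF y] coordf(2)[OF s] by (simp add: j_def)
    then have "cls G \<eta> \<Lambda> ?k (coordf (snd y) ?k) = cls G \<eta> \<Lambda> ?l ?z" using sec_apply[OF coordf(1)[OF s] k] by simp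
    then have "(?k, coordf (snd y) ?k) \<in> cls G \<eta> \<Lambda> ?l ?z" using mem_cls_same[OF k] by blast
    then obtain b where b: "b \<in> T" "?k = ?l \<otimes> inv b" "coordf (snd y) ?k = \<Lambda> b * ?z" using mem_cls[OF Fcar[OF y]] by auto
    have "inv ?l \<otimes> ?k = inv b" using Fcar[OF y] T_carrier[OF b(1)] by (simp add: b(2) inv_mult_cancel')
    \<comment> \<open>Here the matrix coefficient yields the character: \<open>wfun\<close> is
      smooth on all of \<open>G\<close> and takes the value \<open>\<Lambda> b * v $ i\<close> at
      the inverse of \<open>b\<close>.\<close>
    then have "wfun (inv ?l \<otimes> ?k) = \<Lambda> b * v $ i" by (simp add: wfun_def rep_T[OF T_inv[OF b(1)]] \<Lambda>_inv[OF b(1)])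
    then show ?thesis using b(3) vi by (simp add: j_def)
  qed
  have mem: "(e0, t) \<in> S'" using M(2) e0_\<Omega> t by (simp add: S'_def)
  have u: "(UNIV, id) \<in> (vec_atlas :: (complex, complex) atlas)" by (simp add: vec_atlas_def)
  obtain N E where N: "open N" "(e0, t) \<in> N" "smooth_on N E"
    "\<And>y. y \<in> S' \<Longrightarrow> y \<in> N \<Longrightarrow> wfun (inv (fst (F (j y))) \<otimes> fst (j y)) * snd (F (j y)) / v $ i \<in> UNIV \<and>
      id (wfun (inv (fst (F (j y))) \<otimes> fst (j y)) * snd (F (j y)) / v $ i) = E y"
    by (rule manifold_smooth_on_vec_domainE[OF R smooth_atlas_vec fdp findim_euclidean mem u UNIV_I]) (rule that)
  have "((\<lambda>y. coordf (snd y) (g \<otimes> \<iota> (fst y))) has_derivative frechet_derivative E (at (e0, t))) (at (e0, t) within UNIV \<times> {0..1})"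
  proof (rule has_derivative_transform_eventually)
    show "(E has_derivative frechet_derivative E (at (e0, t))) (at (e0, t) within UNIV \<times> {0..1})"
      by (rule has_derivative_at_withinI[OF smooth_on_has_derivative[OF N(3,2)]])
    have EN: "E y = coordf (snd y) (g \<otimes> \<iota> (fst y))" if "y \<in> N" "y \<in> S'" for y
      using N(4)[OF that(2,1)] val[OF that(2)] by simp
    show "E (e0, t) = coordf (snd (e0, t)) (g \<otimes> \<iota> (fst (e0, t)))" by (rule EN[OF N(2) mem])
    have "open (N \<inter> M \<inter> \<Omega> \<times> UNIV)" using N(1) M(1) o by blast
    then show "\<forall>\<^sub>F y in at (e0, t) within UNIV \<times> {0..1}. E y = coordf (snd y) (g \<otimes> \<iota> (fst y))"
      unfolding eventually_at_topological
      using N(2) M(2) e0_\<Omega> EN by (intro exI[of _ "N \<inter> M \<inter> \<Omega> \<times> UNIV"]) (auto simp: S'_def)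
    show "(e0, t) \<in> UNIV \<times> {0..1}" using t by simp
  qed
  then show thesis by (rule that)
qed

lemma coordf_gderiv:
  assumes t: "t \<in> {0..1}"
    and D: "((\<lambda>y. coordf (snd y) (g \<otimes> \<iota> (fst y))) has_derivative D) (at (e0, t) within UNIV \<times> {0..1})"
  shows "gderiv (coordf t) g (\<lambda>X. D (X, 0))"
proof -
  have 1: "((\<lambda>x. (x, t)) has_derivative (\<lambda>X. (X, 0))) (at e0 within UNIV)" by (auto intro!: derivative_eq_intros)
  have "((\<lambda>y. coordf (snd y) (g \<otimes> \<iota> (fst y))) has_derivative D) (at (e0, t) within (\<lambda>x. (x, t)) ` UNIV)"
    by (rule has_derivative_subset[OF D]) (use t in auto)
  from has_derivative_in_compose[OF 1 this] show ?thesis by (simp add: gderiv_def)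
qed

text \<open>Along \<open>s \<mapsto> h s \<otimes> g\<close> the time derivative, which the
  evolution equation makes \<open>- rderiv\<close>, cancels the space derivative
  \<open>rderiv\<close>.\<close>

lemma coordf_transport:
  assumes g: "g \<in> carrier G"
  shows "coordf 1 (h 1 \<otimes> g) = coordf 0 g"
proof -
  have "((\<lambda>s. coordf s (h s \<otimes> g)) has_vector_derivative 0) (at t within {0..1})" if t: "t \<in> {0..1}" for t
  proof -
    define k where "k = h t \<otimes> g"
    have ht: "h t \<in> carrier G" by (rule h_carrier[OF t])
    have k: "k \<in> carrier G" using ht g by (simp add: k_def)
    define a where "a = Ad G (inv k) (A t)"
    have lv: "lvel (\<lambda>s. h s \<otimes> g) a t {0..1}"
      using lvel_mult[OF group_evolution_lvel[OF h t] lvel_const[OF g] t] ht g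
      by (simp add: a_def k_def inv_mult_group Ad_mult)
    obtain D where D: "((\<lambda>y. coordf (snd y) (k \<otimes> \<iota> (fst y))) has_derivative D) (at (e0, t) within UNIV \<times> {0..1})"
      by (rule coordf_differentiable[OF k t]) (rule that)
    interpret D: bounded_linear D using D by (rule has_derivative_bounded_linear)
    \<comment> \<open>One joint derivative \<open>D\<close> serves two curves: the resting one gives
      the time part \<open>D (0, 1)\<close>, the moving one gives \<open>D (a, 1)\<close>.\<close>
    have chain: "((\<lambda>s. coordf s (k \<otimes> \<iota> (y s))) has_vector_derivative D (b, 1)) (at t within {0..1})"
      if y: "(y has_vector_derivative b) (at t within {0..1})" and y0: "y t = e0" for y b
    proof -
      have 1: "((\<lambda>s. (y s, s)) has_derivative (\<lambda>r. (r *\<^sub>R b, r))) (at t within {0..1})"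
        using has_vector_derivative_Pair[OF y has_vector_derivative_id] by (simp add: has_vector_derivative_def)
      have "((\<lambda>y. coordf (snd y) (k \<otimes> \<iota> (fst y))) has_derivative D) (at (y t, t) within (\<lambda>s. (y s, s)) ` {0..1})"
        unfolding y0 by (rule has_derivative_subset[OF D]) auto
      from has_derivative_in_compose[OF 1 this]
      show ?thesis
        by (simp add: has_vector_derivative_def D.scaleR[symmetric])
    qed
    have e: "((\<lambda>s. coordf s k) has_vector_derivative D (0, 1)) (at t within {0..1})"
      using chain[of "\<lambda>_. e0" 0] k by (simp add: pt_e0)
    have gd: "gdiff (coordf t)"
      unfolding gdiff_def
    proof
      fix g assume "g \<in> carrier G"
      then obtain D' where "((\<lambda>y. coordf (snd y) (g \<otimes> \<iota> (fst y))) has_derivative D') (at (e0, t) within UNIV \<times> {0..1})"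
        by (rule coordf_differentiable[OF _ t]) (rule that)
      from coordf_gderiv[OF t this] show "\<exists>L. gderiv (coordf t) g L" by (intro exI[of _ "\<lambda>X. D' (X, 0)"])
    qed
    have "((\<lambda>s. coordf s k) has_vector_derivative fibre_coord k (quantum_op G \<eta> \<Lambda> (A t) (\<sigma> t) (coad G k \<eta>))) (at t within {0..1})"
      using ev t k by (simp add: quantum_evolution_def coordf_def)
    then have "((\<lambda>s. coordf s k) has_vector_derivative - rderiv (A t) (coordf t) k) (at t within {0..1})"
      by (simp only: coordf(2)[OF t] quantum_op_sec[OF coordf(1)[OF t] gd k])
    \<comment> \<open>Both are derivatives within the nondegenerate interval \<open>{0..1}\<close>,
      where derivatives are unique.\<close>
    then have "D (0, 1) = - rderiv (A t) (coordf t) k"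
      using vector_derivative_unique_within_closed_interval[where f = "\<lambda>s. coordf s k" and a = 0 and b = 1
        and x = t and f' = "D (0, 1)"] e t by (simp add: cbox_interval)
    moreover have "rderiv (A t) (coordf t) k = D (a, 0)"
      using rderiv_gderiv(2)[OF coordf_gderiv[OF t D] k] by (simp add: a_def)
    moreover have "D (a, 1) = D (a, 0) + D (0, 1)" using D.add[of "(a, 0)" "(0, 1)"] by simp
    ultimately have "D (a, 1) = 0" by simp
    moreover have "\<phi> (inv k \<otimes> (h t \<otimes> g)) = e0" using k by (simp add: k_def[symmetric])
    ultimately have "((\<lambda>s. coordf s (k \<otimes> \<iota> (\<phi> (inv k \<otimes> (h s \<otimes> g))))) has_vector_derivative 0) (at t within {0..1})"
      using chain[of "\<lambda>s. \<phi> (inv k \<otimes> (h s \<otimes> g))" a] lvel_deriv[OF lv] by (simp add: k_def)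
    then show ?thesis
    proof (rule has_vector_derivative_transform_eventually[OF _ _ _ t])
      show "\<forall>\<^sub>F s in at t within {0..1}. coordf s (k \<otimes> \<iota> (\<phi> (inv k \<otimes> (h s \<otimes> g)))) = coordf s (h s \<otimes> g)"
        using lvel_eventually[OF lv] by eventually_elim (use k in \<open>simp add: k_def[symmetric] pt_coord inv_mult_cancel\<close>)
      show "coordf t (k \<otimes> \<iota> (\<phi> (inv k \<otimes> (h t \<otimes> g)))) = coordf t (h t \<otimes> g)"
        using k by (simp add: k_def[symmetric] pt_e0)
    qed
  qed
  then obtain c where "\<And>t. t \<in> {0..1} \<Longrightarrow> coordf t (h t \<otimes> g) = c"
    by (rule has_vector_derivative_zero_constant[OF convex_real_interval(5)]) (auto intro: that)
  from this[of 0] this[of 1] show ?thesis using g by (simp add: h_zero)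
qed

end

section \<open>Evaluation of \<open>kappa\<close> and of the character\<close>

lemma kappa_eq:
  assumes hT: "h 1 \<in> T" and cen: "\<And>g. g \<in> carrier G \<Longrightarrow> g \<otimes> h 1 = h 1 \<otimes> g"
  shows "kappa G \<eta> \<Lambda> A = \<Lambda> (h 1)"
  unfolding kappa_def
proof (rule the_equality)
  have hc: "h 1 \<in> carrier G" by (rule T_carrier[OF hT])
  have all: "\<sigma> 1 \<nu> = fscale (\<Lambda> (h 1)) (\<sigma> 0 \<nu>)"
    if ev: "quantum_evolution G \<eta> \<Lambda> A \<sigma>" and \<nu>: "\<nu> \<in> orbit G \<eta>" for \<sigma> \<nu>
  proof -
    obtain g where g: "g \<in> carrier G" "\<nu> = coad G g \<eta>" using \<nu> by (rule orbitE)
    have z: "(0::real) \<in> {0..1}" "(1::real) \<in> {0..1}" by auto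
    have e: "equivariant (coordf \<sigma> 0)" "equivariant (coordf \<sigma> 1)" and s: "\<sigma> 0 = sec (coordf \<sigma> 0)" "\<sigma> 1 = sec (coordf \<sigma> 1)"
      using coordf[OF ev z(1)] coordf[OF ev z(2)] by auto
    \<comment> \<open>Centrality writes \<open>g\<close> as \<open>h 1\<close> times
      \<open>g (h 1)^-1\<close>, so that transport applies; equivariance then produces the factor
      \<open>\<Lambda> (h 1)\<close>.\<close>
    have "coordf \<sigma> 1 g = coordf \<sigma> 1 (h 1 \<otimes> (g \<otimes> inv (h 1)))"
      using cen[of "g \<otimes> inv (h 1)"] g(1) hc by (simp add: m_assoc)
    also have "\<dots> = coordf \<sigma> 0 (g \<otimes> inv (h 1))" by (rule coordf_transport[OF ev]) (use g hc in simp)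
    also have "\<dots> = \<Lambda> (h 1) * coordf \<sigma> 0 g" using e(1) g(1) hT by (simp add: equivariant_def)
    finally show ?thesis
      using sec_apply[OF e(1) g(1)] sec_apply[OF e(2) g(1)] s by (simp add: g(2) fscale_cls[OF g(1)])
  qed
  show "cmod (\<Lambda> (h 1)) = 1 \<and> (\<forall>\<sigma> \<sigma>t. smooth_section G \<eta> \<Lambda> \<sigma> \<and> quantum_evolution G \<eta> \<Lambda> A \<sigma>t \<and> \<sigma>t 0 = \<sigma> \<longrightarrow>
        (\<forall>\<nu>\<in>orbit G \<eta>. \<sigma>t 1 \<nu> = fscale (\<Lambda> (h 1)) (\<sigma> \<nu>)))"
    using all \<Lambda>_norm[OF hT] by auto
  fix k assume k: "cmod k = 1 \<and> (\<forall>\<sigma> \<sigma>t. smooth_section G \<eta> \<Lambda> \<sigma> \<and> quantum_evolution G \<eta> \<Lambda> A \<sigma>t \<and> \<sigma>t 0 = \<sigma> \<longrightarrow>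
        (\<forall>\<nu>\<in>orbit G \<eta>. \<sigma>t 1 \<nu> = fscale k (\<sigma> \<nu>)))"
  \<comment> \<open>Uniqueness is tested on the evolution of \<open>sec wfun\<close> over the base
    point \<open>\<eta>\<close>, where its fibre coordinate \<open>wfun \<one>\<close> is
    nonzero.\<close>
  have "fscale k (sec wfun (coad G \<one> \<eta>)) = fscale (\<Lambda> (h 1)) (sec wfun (coad G \<one> \<eta>))"
    using k sec_wfun_smooth sec_wflow_evolution sec_wflow_zero all[OF sec_wflow_evolution] orbitI[OF one_closed] by metis
  then have "k * wfun \<one> = \<Lambda> (h 1) * wfun \<one>"
    unfolding sec_apply[OF wfun_equivariant one_closed] fscale_cls[OF one_closed] cls_inject[OF one_closed] .
  then show "k = \<Lambda> (h 1)" using wfun_one by simp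
qed

end

text \<open>The eigenspace of \<open>\<pi> z\<close> for the eigenvalue
  \<open>inverse (\<Lambda> z)\<close> contains \<open>v\<close>, and it is invariant because
  \<open>z\<close> is central.\<close>

lemma rep_central:
  assumes irr: "irreducible_rep G \<pi>" and z: "z \<in> T" and cen: "\<And>g. g \<in> carrier G \<Longrightarrow> g \<otimes> z = z \<otimes> g"
  shows "\<pi> z *v w = inverse (\<Lambda> z) *s w"
proof -
  let ?W = "{w. \<pi> z *v w = inverse (\<Lambda> z) *s w}"
  have zc: "z \<in> carrier G" by (rule T_carrier[OF z])
  have "vec.subspace ?W"
    by (auto simp: vec.subspace_def matrix_vector_right_distrib vector_add_ldistrib vector_scalar_commute vector_smult_assoc mult.commute)
  moreover have "\<forall>g\<in>carrier G. \<forall>w\<in>?W. \<pi> g *v w \<in> ?W"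
  proof (intro ballI CollectI)
    fix g w assume g: "g \<in> carrier G" and w: "w \<in> ?W"
    have "\<pi> z *v (\<pi> g *v w) = \<pi> g *v (\<pi> z *v w)"
      using cen[OF g] g zc by (simp add: matrix_vector_mul_assoc rep_mult[OF rep, symmetric])
    then show "\<pi> z *v (\<pi> g *v w) = inverse (\<Lambda> z) *s (\<pi> g *v w)" using w by (simp add: vector_scalar_commute)
  qed
  ultimately have "?W = {0} \<or> ?W = UNIV" using irr by (simp add: irreducible_rep_def)
  moreover have "v \<in> ?W" "v \<noteq> 0" using rep_T[OF z] vi by auto
  ultimately show ?thesis by auto
qed

text \<open>The dual representation evaluates \<open>\<pi>\<close> at the inverse of
  \<open>z\<close>, which turns the scalar into \<open>\<Lambda> z\<close>; transposition leaves the
  diagonal alone.\<close>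

lemma character_central:
  assumes irr: "irreducible_rep G \<pi>" and z: "z \<in> T" and cen: "\<And>g. g \<in> carrier G \<Longrightarrow> g \<otimes> z = z \<otimes> g"
  shows "rep_character (dual_rep G \<pi>) z = \<Lambda> z * of_nat CARD('n)"
proof -
  have zc: "z \<in> carrier G" by (rule T_carrier[OF z])
  have cen': "g \<otimes> inv z = inv z \<otimes> g" if g: "g \<in> carrier G" for g
  proof -
    have "inv z \<otimes> (g \<otimes> z) \<otimes> inv z = inv z \<otimes> (z \<otimes> g) \<otimes> inv z" by (simp only: cen[OF g])
    then show ?thesis using g zc by (simp add: m_assoc inv_mult_cancel')
  qed
  have "\<pi> (inv z) $ j $ j = \<Lambda> z" for j
  proof -
    have "\<pi> (inv z) $ j $ j = (\<pi> (inv z) *v axis j 1) $ j" by (simp add: matrix_vector_mult_def axis_def if_distrib cong: if_cong)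
    also have "\<dots> = \<Lambda> z" using rep_central[OF irr T_inv[OF z] cen'] by (simp add: \<Lambda>_inv[OF z])
    finally show ?thesis .
  qed
  then show ?thesis by (simp add: rep_character_def dual_rep_def trace_def transpose_def)
qed

end

theorem theorem11:
  fixes G :: "('g, 'e::banach) lie_group_data"
    and \<eta> :: "'e \<Rightarrow>\<^sub>L real"
    and \<Lambda> :: "'g \<Rightarrow> complex"
    and P :: "('e \<times> 'e \<Rightarrow> complex) set"
    and A :: "real \<Rightarrow> 'e"
    and \<psi> :: "real \<Rightarrow> ('e \<Rightarrow>\<^sub>L real) \<Rightarrow> ('e \<Rightarrow>\<^sub>L real)"
    and h :: "real \<Rightarrow> 'g"
    and \<pi> :: "'g \<Rightarrow> complex^'n^'n"
  assumes "lie_group G"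
    and "compact_space (lie_topology G)"
    and "connected_space (lie_topology G)"
    and "semisimple G"
    and "maximal_torus G (isotropy G \<eta>)"
    and "quantizing_character G \<eta> \<Lambda>"
    and "positive_system G (isotropy G \<eta>) P"
    and "dominant G (isotropy G \<eta>) P (\<lambda>H. - lambda_ext \<eta> H)"
    and "manifold_smooth_on vec_atlas vec_atlas {0..1} A"
    and "closed_isotopy G \<eta> A \<psi>"
    and "group_evolution G A h"
    and "irreducible_rep G \<pi>"
    and "highest_weight G (isotropy G \<eta>) P \<pi> (\<lambda>H. - lambda_ext \<eta> H)"
  shows "kappa G \<eta> \<Lambda> A = rep_character (dual_rep G \<pi>) (h 1) / of_nat CARD('n)"
proof -
  interpret prequantum G \<eta> \<Lambda>
    using assms(1,6) by (simp add: prequantum_def prequantum_axioms_def lie_grp_def lie_grp_axioms_def lie_group_def)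
  have T: "torus G (isotropy G \<eta>)" using assms(5) by (simp add: maximal_torus_def)
  have rep: "representation G \<pi>" using assms(12) by (simp add: irreducible_rep_def)
  obtain v where v: "v \<noteq> 0" "\<And>H. H \<in> cartan G (isotropy G \<eta>) \<Longrightarrow> rep_action G \<pi> H v = - lambda_ext \<eta> H *s v"
    using assms(13) by (auto simp: highest_weight_def rep_weight_def)
  obtain i where i: "v $ i \<noteq> 0" using v(1) by (auto simp: vec_eq_iff)
  have weight: "rep_deriv G \<pi> C *v v = - (2 * of_real pi * \<i> * of_real (blinfun_apply \<eta> C)) *s v"
    if C: "C \<in> lie_subalgebra G (isotropy G \<eta>)" for C
  proof -
    \<comment> \<open>The complexified Cartan subalgebra consists of pairs, so a real
      \<open>C\<close> enters as \<open>(C, 0)\<close>; linearity of \<open>rep_deriv\<close> then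
      removes the imaginary part of the action.\<close>
    have "(C, 0) \<in> cartan G (isotropy G \<eta>)"
      using C T_one by (simp add: cartan_def lie_subalgebra_def lexp_zero)
    moreover have "rep_deriv G \<pi> 0 = 0"
      by (rule linear_0[OF bounded_linear.linear[OF rep_deriv_linear[OF rep]]])
    ultimately show ?thesis using v(2)[of "(C, 0)"] by (simp add: rep_action_def lambda_ext_def)
  qed
  interpret weighted_rep G \<eta> \<Lambda> \<pi> v i
    by unfold_locales (use rep i T weight in auto)
  have fixes_orbit: "blinfun_apply q (Ad G (h 1) B) = blinfun_apply q B" if "q \<in> orbit G \<eta>" for q B
    by (rule closed_isotopy_fixes_orbit[OF assms(11,10) that])
  have hc: "h 1 \<in> carrier G" by (rule h_carrier[OF assms(11)]) simp
  have Ad: "Ad G (h 1) B = B" for B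
    by (rule Ad_eq_ident_of_semisimple[OF assms(4) torus_commute[OF T] hc fixes_orbit])
  have cen: "g \<otimes>\<^bsub>G\<^esub> h 1 = h 1 \<otimes>\<^bsub>G\<^esub> g" if "g \<in> carrier G" for g
    by (rule central_of_Ad_ident[OF assms(3) hc Ad that])
  have "coad G (h 1) \<eta> = \<eta>"
  proof (rule blinfun_eqI)
    fix B
    have "Ad G (inv\<^bsub>G\<^esub> h 1) B = B" using Ad_inv(1)[OF hc, of B] Ad by simp
    then show "blinfun_apply (coad G (h 1) \<eta>) B = blinfun_apply \<eta> B" by (simp add: coad_apply hc)
  qed
  then have hT: "h 1 \<in> isotropy G \<eta>" using hc by (simp add: isotropy_def)
  show ?thesis
    using kappa_eq[OF assms(11) hT cen] character_central[OF assms(12) hT cen] by simp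
qed

end
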